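(* Let $S$ be a scheme such that $\mathrm{WeakAss}(S)=\mathrm{Max}(S)$ and this set is locally finite in $S$. Then $\mathcal{M}_S$ is a quasi-coherent sheaf of $\mathcal{O}_S$-algebras; put $\eta=\mathrm{Spec}(\mathcal{M}_S)$ (relative spectrum over $S$). One has $\mathbb{G}_{m,S}^{lft}\times_S\eta=\mathbb{G}_{m,\eta}^{lft}=\mathbb{G}_{m,\eta}$, and for every flat and convex morphism $T\to S$, with $T_\eta=T\times_S\eta$, the base change morphism $$\mathbb{G}_{m,S}^{lft}(T)=\mathrm{Hom}_S(T,\mathbb{G}_{m,S}^{lft})\longrightarrow \mathrm{Hom}_\eta(T_\eta,\mathbb{G}_{m,\eta})=\mathbb{G}_{m,\eta}(T_\eta)$$ is an isomorphism.
   Context: $\mathrm{Max}(S)$ is the set of generic points of the irreducible components of $S$; $\mathrm{WeakAss}(S)$ is the set of weakly associated points of $S$ (points $s$ such that the maximal ideal of $\mathcal{O}_{S,s}$ is minimal over the annihilator of some element of $\mathcal{O}_{S,s}$). A subset is locally finite if every point of $S$ has an open neighborhood meeting it in a finite set. Cartier divisors. For an open $U\subset S$, $\mathcal{O}_S^{reg}(U)$ is the set of $x\in\mathcal{O}_S(U)$ whose germ $x_s$ is a nonzerodivisor in $\mathcal{O}_{S,s}$ for every $s\in U$; this is a sheaf of monoids $\mathcal{O}_S^{reg}$. $\mathcal{M}_S$ is the sheaf of $\mathcal{O}_S$-algebras associated with $U\mapsto\mathcal{O}_S(U)[\mathcal{O}_S^{reg}(U)^{-1}]$, with stalks $\mathcal{M}_{S,s}=\mathcal{O}_{S,s}[(\mathcal{O}_{S,s}^{reg})^{-1}]$.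 $\mathcal{D}_S=\mathcal{M}_S^\times/\mathcal{O}_S^\times$ is the Zariski sheaf of Cartier divisors, written additively; it is a sheaf of partially ordered groups, with non-negative elements the image of $\mathcal{O}_S^{reg}$. For $d\in\mathcal{D}_S(U)$, $\mathcal{L}(d)\subset\mathcal{M}_S|_U$ is the invertible $\mathcal{O}_U$-submodule locally spanned by any local lift of $d$ to $\mathcal{M}_S^\times$. The group schemes. $\pi:\Pi_S\to S$ is the espace étalé of $\mathcal{D}_S$, with $|\Pi_S|=\coprod_{s}\mathcal{D}_{S,s}$ and structure sheaf $\pi^{-1}\mathcal{O}_S$; it is covered by the opens $U_d=\{d_s:s\in U\}\simeq U$ for $U\subset S$ open and $d\in\mathcal{D}_S(U)$, and is an étale commutative group scheme over $S$. $\mathcal{L}$ is the unique invertible subsheaf of $\pi^*\mathcal{M}_S=\pi^{-1}\mathcal{M}_S$ with $\mathcal{L}|_{U_d}=(\pi^*\mathcal{L}(d))|_{U_d}$ for all such $U,d$; multiplication in $\mathcal{M}_S$ induces isomorphisms $a^*\mathcal{L}\otimes b^*\mathcal{L}\simeq(a+b)^*\mathcal{L}$ for $a,b\in\Pi_S(T)$. $\mathbb{G}_{m,S}^{lft}$ is the smooth commutative group scheme over $S$ whose $T$-points are the pairs $(a,\alpha)$ with $a\in\Pi_S(T)$ and $\alpha$ an invertible (i.e. generating) section of $a^*\mathcal{L}$ over $T$, with product $(a,\alpha)(b,\beta)=(a+b,\alpha\otimes\beta)$. The same constructions apply to the scheme $\eta$, giving $\mathbb{G}_{m,\eta}^{lft}$.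 Convexity. If $f:T\to S$ is flat and $t\in T$ lies above $s\in S$, then $\mathcal{O}_{S,s}\to\mathcal{O}_{T,t}$ induces an injective morphism of partially ordered groups $\mathcal{D}_{S,s}\hookrightarrow\mathcal{D}_{T,t}$. A subgroup $H$ of a partially ordered commutative group $D$ is convex if $\alpha\le\beta\le\gamma$ with $\alpha,\gamma\in H$ and $\beta\in D$ implies $\beta\in H$. A flat $f$ is convex if for all $t\in T$ above $s\in S$ the image of $\mathcal{D}_{S,s}\hookrightarrow\mathcal{D}_{T,t}$ is convex. *)

theory Defs
  imports
    "HOL-Analysis.Product_Topology"
    "HOL-Algebra.QuotRing"
    "HOL-Algebra.Module"
    "HOL-Algebra.Coset"
    "HOL-Algebra.Free_Abelian_Groups"
begin

section \<open>Commutative algebra\<close>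

definition local_ring :: "('r, 'x) ring_scheme \<Rightarrow> bool" where
  "local_ring R \<longleftrightarrow> cring R \<and> (\<exists>!I. maximalideal I R)"

definition max_ideal :: "('r, 'x) ring_scheme \<Rightarrow> 'r set" where
  "max_ideal R = (THE I. maximalideal I R)"

definition nonzerodivisor :: "('r, 'x) ring_scheme \<Rightarrow> 'r \<Rightarrow> bool" where
  "nonzerodivisor R x \<longleftrightarrow> x \<in> carrier R \<and>
     (\<forall>y\<in>carrier R. x \<otimes>\<^bsub>R\<^esub> y = \<zero>\<^bsub>R\<^esub> \<longrightarrow> y = \<zero>\<^bsub>R\<^esub>)"

definition annihilator :: "('r, 'x) ring_scheme \<Rightarrow> 'r \<Rightarrow> 'r set" where
  "annihilator R a = {x \<in> carrier R. x \<otimes>\<^bsub>R\<^esub> a = \<zero>\<^bsub>R\<^esub>}"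

definition minimal_prime_over :: "('r, 'x) ring_scheme \<Rightarrow> 'r set \<Rightarrow> 'r set \<Rightarrow> bool" where
  "minimal_prime_over R I P \<longleftrightarrow> primeideal P R \<and> I \<subseteq> P \<and>
     (\<forall>Q. primeideal Q R \<and> I \<subseteq> Q \<and> Q \<subseteq> P \<longrightarrow> Q = P)"

subsection \<open>Localization at a multiplicative subset\<close>

definition fraction :: "('r, 'x) ring_scheme \<Rightarrow> 'r set \<Rightarrow> 'r \<Rightarrow> 'r \<Rightarrow> ('r \<times> 'r) set" where
  "fraction R S a b = {(a', b'). a' \<in> carrier R \<and> b' \<in> S \<and>
     (\<exists>u\<in>S. u \<otimes>\<^bsub>R\<^esub> (a \<otimes>\<^bsub>R\<^esub> b') = u \<otimes>\<^bsub>R\<^esub> (a' \<otimes>\<^bsub>R\<^esub> b))}"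

definition localization :: "('r, 'x) ring_scheme \<Rightarrow> 'r set \<Rightarrow> ('r \<times> 'r) set ring" where
  "localization R S = \<lparr>
     carrier = {fraction R S a b |a b. a \<in> carrier R \<and> b \<in> S},
     Group.monoid.mult = (\<lambda>X Y. \<Union>(a, b)\<in>X. \<Union>(c, d)\<in>Y. fraction R S (a \<otimes>\<^bsub>R\<^esub> c) (b \<otimes>\<^bsub>R\<^esub> d)),
     one = fraction R S \<one>\<^bsub>R\<^esub> \<one>\<^bsub>R\<^esub>,
     ring.zero = fraction R S \<zero>\<^bsub>R\<^esub> \<one>\<^bsub>R\<^esub>,
     ring.add = (\<lambda>X Y. \<Union>(a, b)\<in>X. \<Union>(c, d)\<in>Y.
              fraction R S (a \<otimes>\<^bsub>R\<^esub> d \<oplus>\<^bsub>R\<^esub> c \<otimes>\<^bsub>R\<^esub> b) (b \<otimes>\<^bsub>R\<^esub> d))\<rparr>"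

text \<open>The map of localizations induced by a ring map \<open>\<phi>\<close> into \<open>R'\<close> that sends the
  denominators into \<open>S'\<close>.\<close>

definition loc_map ::
    "('k, 'x) ring_scheme \<Rightarrow> 'k set \<Rightarrow> ('r \<Rightarrow> 'k) \<Rightarrow> ('r \<times> 'r) set \<Rightarrow> ('k \<times> 'k) set" where
  "loc_map R' S' \<phi> X = (\<Union>(a, b)\<in>X. fraction R' S' (\<phi> a) (\<phi> b))"

subsection \<open>Tensor products and flatness\<close>

text \<open>The ring \<open>B\<close> as a module along a ring map \<open>\<phi>\<close>; it keeps its ring operations.\<close>

definition alg_module :: "('r \<Rightarrow> 'm) \<Rightarrow> 'm ring \<Rightarrow> ('r, 'm) module" where
  "alg_module \<phi> B = \<lparr>
     carrier = carrier B,
     Group.monoid.mult = Group.monoid.mult B,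
     one = one B,
     ring.zero = ring.zero B,
     ring.add = ring.add B,
     smult = (\<lambda>r x. \<phi> r \<otimes>\<^bsub>B\<^esub> x)\<rparr>"

definition tensor_rels ::
    "'r ring \<Rightarrow> ('r, 'm) module \<Rightarrow> ('r, 'n) module \<Rightarrow> ('m \<times> 'n \<Rightarrow>\<^sub>0 int) set" where
  "tensor_rels A M N =
     {frag_of (m \<oplus>\<^bsub>M\<^esub> m', n) - frag_of (m, n) - frag_of (m', n) |m m' n.
        m \<in> carrier M \<and> m' \<in> carrier M \<and> n \<in> carrier N} \<union>
     {frag_of (m, n \<oplus>\<^bsub>N\<^esub> n') - frag_of (m, n) - frag_of (m, n') |m n n'.
        m \<in> carrier M \<and> n \<in> carrier N \<and> n' \<in> carrier N} \<union>
     {frag_of (r \<odot>\<^bsub>M\<^esub> m, n) - frag_of (m, r \<odot>\<^bsub>N\<^esub> n) |r m n.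
        r \<in> carrier A \<and> m \<in> carrier M \<and> n \<in> carrier N}"

definition tensor_kernel ::
    "'r ring \<Rightarrow> ('r, 'm) module \<Rightarrow> ('r, 'n) module \<Rightarrow> ('m \<times> 'n \<Rightarrow>\<^sub>0 int) set" where
  "tensor_kernel A M N =
     generate (free_Abelian_group (carrier M \<times> carrier N)) (tensor_rels A M N)"

definition tensor_class ::
    "'r ring \<Rightarrow> ('r, 'm) module \<Rightarrow> ('r, 'n) module \<Rightarrow>
      ('m \<times> 'n \<Rightarrow>\<^sub>0 int) \<Rightarrow> ('m \<times> 'n \<Rightarrow>\<^sub>0 int) set" where
  "tensor_class A M N x =
     tensor_kernel A M N #>\<^bsub>free_Abelian_group (carrier M \<times> carrier N)\<^esub> x"

definition tensor_carrier ::
    "'r ring \<Rightarrow> ('r, 'm) module \<Rightarrow> ('r, 'n) module \<Rightarrow> ('m \<times> 'n \<Rightarrow>\<^sub>0 int) set set" where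
  "tensor_carrier A M N =
     carrier (free_Abelian_group (carrier M \<times> carrier N) Mod tensor_kernel A M N)"

text \<open>\<open>tensor_map A M N f g\<close> is the map \<open>f \<otimes> g\<close> with target \<open>M \<otimes>\<^sub>A N\<close>.\<close>

definition tensor_map ::
    "'r ring \<Rightarrow> ('r, 'm) module \<Rightarrow> ('r, 'n) module \<Rightarrow> ('k \<Rightarrow> 'm) \<Rightarrow> ('l \<Rightarrow> 'n) \<Rightarrow>
      ('k \<times> 'l \<Rightarrow>\<^sub>0 int) set \<Rightarrow> ('m \<times> 'n \<Rightarrow>\<^sub>0 int) set" where
  "tensor_map A M N f g X =
     (\<Union>x\<in>X. tensor_class A M N (frag_extend (\<lambda>(m, n). frag_of (f m, g n)) x))"

text \<open>The product \<open>(m \<otimes> n) (m' \<otimes> n') = m m' \<otimes> n n'\<close>, with values in \<open>M \<otimes>\<^sub>A N\<close>.\<close>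

definition tensor_mult ::
    "'r ring \<Rightarrow> ('r, 'm) module \<Rightarrow> ('r, 'n) module \<Rightarrow>
      ('m \<times> 'n \<Rightarrow>\<^sub>0 int) set \<Rightarrow> ('m \<times> 'n \<Rightarrow>\<^sub>0 int) set \<Rightarrow> ('m \<times> 'n \<Rightarrow>\<^sub>0 int) set" where
  "tensor_mult A M N X Y = (\<Union>x\<in>X. \<Union>y\<in>Y. tensor_class A M N
     (frag_extend (\<lambda>(m, n). frag_extend (\<lambda>(m', n'). frag_of (m \<otimes>\<^bsub>M\<^esub> m', n \<otimes>\<^bsub>N\<^esub> n')) y) x))"

definition tensor_ring ::
    "'r ring \<Rightarrow> ('r, 'm) module \<Rightarrow> ('r, 'n) module \<Rightarrow> ('m \<times> 'n \<Rightarrow>\<^sub>0 int) set ring" where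
  "tensor_ring A M N = \<lparr>
     carrier = tensor_carrier A M N,
     Group.monoid.mult = tensor_mult A M N,
     one = tensor_class A M N (frag_of (\<one>\<^bsub>M\<^esub>, \<one>\<^bsub>N\<^esub>)),
     ring.zero = tensor_class A M N 0,
     ring.add = (\<lambda>X Y. \<Union>x\<in>X. \<Union>y\<in>Y. tensor_class A M N (x + y))\<rparr>"

text \<open>Exactness of \<open>- \<otimes>\<^sub>A M\<close> is tested on modules whose carrier lies in the type of \<open>A\<close>.
  This universe contains \<open>A\<close> and all its ideals, so that by the ideal criterion nothing is lost.\<close>

definition flat_module :: "'r ring \<Rightarrow> ('r, 'm) module \<Rightarrow> bool" where
  "flat_module A M \<longleftrightarrow> module A M \<and>
     (\<forall>(N' :: ('r, 'r) module) (N :: ('r, 'r) module) j.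
        module A N' \<and> module A N \<and>
        j \<in> carrier N' \<rightarrow> carrier N \<and>
        (\<forall>x\<in>carrier N'. \<forall>y\<in>carrier N'. j (x \<oplus>\<^bsub>N'\<^esub> y) = j x \<oplus>\<^bsub>N\<^esub> j y) \<and>
        (\<forall>r\<in>carrier A. \<forall>x\<in>carrier N'. j (r \<odot>\<^bsub>N'\<^esub> x) = r \<odot>\<^bsub>N\<^esub> j x) \<and>
        inj_on j (carrier N') \<longrightarrow>
        inj_on (tensor_map A N M j id) (tensor_carrier A N' M))"

section \<open>Sheaves and ringed spaces\<close>

text \<open>A sheaf is given by its stalks and, for each open set, its sections; a section \<open>s\<close> over \<open>U\<close>
  is identified with the family of its germs, so that \<open>s x\<close> is the germ of \<open>s\<close> at \<open>x\<close> and
  restriction of sections is restriction of functions (the sheaf of sections of an espace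
  etale). The last two conditions say that every element of a stalk is the germ of a section
  and that sections with the same germ at a point agree near that point.\<close>

definition sheaf_on ::
    "'a topology \<Rightarrow> ('a \<Rightarrow> 'e set) \<Rightarrow> ('a set \<Rightarrow> ('a \<Rightarrow> 'e) set) \<Rightarrow> bool" where
  "sheaf_on X E \<Gamma> \<longleftrightarrow>
     (\<forall>U. openin X U \<longrightarrow> \<Gamma> U \<subseteq> (\<Pi>\<^sub>E x\<in>U. E x)) \<and>
     (\<forall>U V s. openin X U \<and> openin X V \<and> V \<subseteq> U \<and> s \<in> \<Gamma> U \<longrightarrow> restrict s V \<in> \<Gamma> V) \<and>
     (\<forall>U s. openin X U \<and> s \<in> (\<Pi>\<^sub>E x\<in>U. E x) \<and>
        (\<forall>x\<in>U. \<exists>V. openin X V \<and> x \<in> V \<and> V \<subseteq> U \<and> restrict s V \<in> \<Gamma> V) \<longrightarrow> s \<in> \<Gamma> U) \<and>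
     (\<forall>x\<in>topspace X. \<forall>e\<in>E x. \<exists>U s. openin X U \<and> x \<in> U \<and> s \<in> \<Gamma> U \<and> s x = e) \<and>
     (\<forall>U s t x. openin X U \<and> s \<in> \<Gamma> U \<and> t \<in> \<Gamma> U \<and> x \<in> U \<and> s x = t x \<longrightarrow>
        (\<exists>V. openin X V \<and> x \<in> V \<and> V \<subseteq> U \<and> (\<forall>y\<in>V. s y = t y)))"

text \<open>The sheaf with stalks \<open>E\<close> whose sections are locally of the form given by \<open>B\<close>. Every
  sheaf associated with a presheaf below is obtained in this way from its stalks.\<close>

definition locally_given ::
    "'a topology \<Rightarrow> ('a \<Rightarrow> 'e set) \<Rightarrow> ('a set \<Rightarrow> ('a \<Rightarrow> 'e) set) \<Rightarrow> 'a set \<Rightarrow> ('a \<Rightarrow> 'e) set" where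
  "locally_given X E B W = {\<sigma> \<in> (\<Pi>\<^sub>E x\<in>W. E x).
     \<forall>x\<in>W. \<exists>V \<tau>. openin X V \<and> x \<in> V \<and> V \<subseteq> W \<and> \<tau> \<in> B V \<and> (\<forall>y\<in>V. \<sigma> y = \<tau> y)}"

record ('a, 'r) ringed_space =
  spc :: "'a topology"
  stalk :: "'a \<Rightarrow> 'r ring"
  sections :: "'a set \<Rightarrow> ('a \<Rightarrow> 'r) set"

abbreviation points :: "('a, 'r) ringed_space \<Rightarrow> 'a set" where
  "points X \<equiv> topspace (spc X)"

definition is_ringed_space :: "('a, 'r) ringed_space \<Rightarrow> bool" where
  "is_ringed_space X \<longleftrightarrow>
     (\<forall>x\<in>points X. cring (stalk X x)) \<and>
     sheaf_on (spc X) (\<lambda>x. carrier (stalk X x)) (sections X) \<and>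
     (\<forall>U. openin (spc X) U \<longrightarrow>
        (\<lambda>x\<in>U. \<one>\<^bsub>stalk X x\<^esub>) \<in> sections X U \<and>
        (\<forall>s\<in>sections X U. (\<lambda>x\<in>U. \<ominus>\<^bsub>stalk X x\<^esub> s x) \<in> sections X U) \<and>
        (\<forall>s\<in>sections X U. \<forall>t\<in>sections X U.
           (\<lambda>x\<in>U. s x \<oplus>\<^bsub>stalk X x\<^esub> t x) \<in> sections X U \<and>
           (\<lambda>x\<in>U. s x \<otimes>\<^bsub>stalk X x\<^esub> t x) \<in> sections X U))"

definition locally_ringed :: "('a, 'r) ringed_space \<Rightarrow> bool" where
  "locally_ringed X \<longleftrightarrow> is_ringed_space X \<and> (\<forall>x\<in>points X. local_ring (stalk X x))"

definition section_ring :: "('a, 'r) ringed_space \<Rightarrow> 'a set \<Rightarrow> ('a \<Rightarrow> 'r) ring" where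
  "section_ring X U = \<lparr>
     carrier = sections X U,
     Group.monoid.mult = (\<lambda>s t. \<lambda>x\<in>U. s x \<otimes>\<^bsub>stalk X x\<^esub> t x),
     one = (\<lambda>x\<in>U. \<one>\<^bsub>stalk X x\<^esub>),
     ring.zero = (\<lambda>x\<in>U. \<zero>\<^bsub>stalk X x\<^esub>),
     ring.add = (\<lambda>s t. \<lambda>x\<in>U. s x \<oplus>\<^bsub>stalk X x\<^esub> t x)\<rparr>"

definition open_subspace :: "('a, 'r) ringed_space \<Rightarrow> 'a set \<Rightarrow> ('a, 'r) ringed_space" where
  "open_subspace X U = X\<lparr>spc := subtopology (spc X) U\<rparr>"

text \<open>The inverse image sheaf \<open>h\<^sup>-\<^sup>1 F\<close>, as a sheaf of rings on \<open>Y\<close>.\<close>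

definition inverse_image ::
    "'b topology \<Rightarrow> ('b \<Rightarrow> 'a) \<Rightarrow> ('a, 'r) ringed_space \<Rightarrow> ('b, 'r) ringed_space" where
  "inverse_image Y h F = \<lparr>
     spc = Y,
     stalk = (\<lambda>y. stalk F (h y)),
     sections = locally_given Y (\<lambda>y. carrier (stalk F (h y)))
       (\<lambda>V. {(\<lambda>y. s (h y)) |s U. openin (spc F) U \<and> h ` V \<subseteq> U \<and> s \<in> sections F U})\<rparr>"

subsection \<open>Morphisms\<close>

text \<open>\<open>cm f x\<close> is the map of stalks from the local ring at \<open>f x\<close> to the local ring at \<open>x\<close>.
  Both components are made extensional, so that equal morphisms are equal records.\<close>

record ('a, 'r, 'b, 'k) morphism =
  pt :: "'a \<Rightarrow> 'b"
  cm :: "'a \<Rightarrow> 'k \<Rightarrow> 'r"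

definition lrs_hom ::
    "('a, 'r) ringed_space \<Rightarrow> ('b, 'k) ringed_space \<Rightarrow> ('a, 'r, 'b, 'k) morphism \<Rightarrow> bool" where
  "lrs_hom X Y f \<longleftrightarrow>
     continuous_map (spc X) (spc Y) (pt f) \<and>
     pt f \<in> extensional (points X) \<and> cm f \<in> extensional (points X) \<and>
     (\<forall>x\<in>points X.
        cm f x \<in> ring_hom (stalk Y (pt f x)) (stalk X x) \<and>
        cm f x \<in> extensional (carrier (stalk Y (pt f x))) \<and>
        cm f x ` max_ideal (stalk Y (pt f x)) \<subseteq> max_ideal (stalk X x)) \<and>
     (\<forall>V s. openin (spc Y) V \<and> s \<in> sections Y V \<longrightarrow>
        (\<lambda>x\<in>{x \<in> points X. pt f x \<in> V}. cm f x (s (pt f x)))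
          \<in> sections X {x \<in> points X. pt f x \<in> V})"

text \<open>\<open>mor_comp X Z g f\<close> is the composite of \<open>f\<close>, with source \<open>X\<close>, and \<open>g\<close>, with target \<open>Z\<close>.\<close>

definition mor_comp ::
    "('a, 'r) ringed_space \<Rightarrow> ('c, 'l) ringed_space \<Rightarrow>
     ('b, 'k, 'c, 'l) morphism \<Rightarrow> ('a, 'r, 'b, 'k) morphism \<Rightarrow> ('a, 'r, 'c, 'l) morphism" where
  "mor_comp X Z g f = \<lparr>
     pt = (\<lambda>x\<in>points X. pt g (pt f x)),
     cm = (\<lambda>x\<in>points X. \<lambda>r\<in>carrier (stalk Z (pt g (pt f x))). cm f x (cm g (pt f x) r))\<rparr>"

definition lrs_isomorphic :: "('a, 'r) ringed_space \<Rightarrow> ('b, 'k) ringed_space \<Rightarrow> bool" where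
  "lrs_isomorphic X Y \<longleftrightarrow> (\<exists>f. lrs_hom X Y f \<and> homeomorphic_map (spc X) (spc Y) (pt f) \<and>
     (\<forall>x\<in>points X. cm f x \<in> ring_iso (stalk Y (pt f x)) (stalk X x)))"

subsection \<open>Localization of a ringed space at a system of primes\<close>

text \<open>For each \<open>x\<close> let \<open>Q x\<close> be a set of prime ideals of the stalk at \<open>x\<close>. The points of the
  localized space are the pairs \<open>(x, q)\<close> with \<open>q \<in> Q x\<close>, the stalk at \<open>(x, q)\<close> is the stalk at
  \<open>x\<close> localized at \<open>q\<close>, a basis of the topology is given by the sets where a local section \<open>g\<close>
  does not lie in \<open>q\<close>, and sections are locally fractions of sections (W. D. Gillam,
  Localization of ringed spaces). Spectra of rings, relative spectra and fibre products of
  locally ringed spaces are all of this form.\<close>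

definition basic_open ::
    "('a, 'r) ringed_space \<Rightarrow> ('a \<Rightarrow> 'r set set) \<Rightarrow> 'a set \<Rightarrow> ('a \<Rightarrow> 'r) \<Rightarrow> ('a \<times> 'r set) set" where
  "basic_open X Q U g = {(x, q). x \<in> U \<and> q \<in> Q x \<and> g x \<notin> q}"

definition prime_topology ::
    "('a, 'r) ringed_space \<Rightarrow> ('a \<Rightarrow> 'r set set) \<Rightarrow> ('a \<times> 'r set) topology" where
  "prime_topology X Q =
     topology_generated_by {basic_open X Q U g |U g. openin (spc X) U \<and> g \<in> sections X U}"

definition prime_stalk ::
    "('a, 'r) ringed_space \<Rightarrow> 'a \<times> 'r set \<Rightarrow> ('r \<times> 'r) set ring" where
  "prime_stalk X = (\<lambda>(x, q). localization (stalk X x) (carrier (stalk X x) - q))"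

definition localize_at ::
    "('a, 'r) ringed_space \<Rightarrow> ('a \<Rightarrow> 'r set set) \<Rightarrow>
     ('a \<times> 'r set, ('r \<times> 'r) set) ringed_space" where
  "localize_at X Q = \<lparr>
     spc = prime_topology X Q,
     stalk = prime_stalk X,
     sections = locally_given (prime_topology X Q) (\<lambda>z. carrier (prime_stalk X z))
       (\<lambda>V. {(\<lambda>(x, q). fraction (stalk X x) (carrier (stalk X x) - q) (a x) (g x)) |a g U.
          openin (spc X) U \<and> a \<in> sections X U \<and> g \<in> sections X U \<and> V \<subseteq> basic_open X Q U g})\<rparr>"

subsection \<open>Schemes\<close>

definition one_point_space :: "'r ring \<Rightarrow> (unit, 'r) ringed_space" where
  "one_point_space R = \<lparr>spc = discrete_topology UNIV, stalk = (\<lambda>_. R),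
     sections = (\<lambda>U. \<Pi>\<^sub>E x\<in>U. carrier R)\<rparr>"

text \<open>The usual spectrum, a prime \<open>q\<close> being recorded as the pair \<open>((), q)\<close>.\<close>

definition Spec :: "'r ring \<Rightarrow> (unit \<times> 'r set, ('r \<times> 'r) set) ringed_space" where
  "Spec R = localize_at (one_point_space R) (\<lambda>_. {q. primeideal q R})"

text \<open>A locally ringed space that is isomorphic to the spectrum of some ring is isomorphic to
  the spectrum of its ring of global sections.\<close>

definition affine_scheme :: "('a, 'r) ringed_space \<Rightarrow> bool" where
  "affine_scheme X \<longleftrightarrow> locally_ringed X \<and> lrs_isomorphic X (Spec (section_ring X (points X)))"

definition scheme :: "('a, 'r) ringed_space \<Rightarrow> bool" where
  "scheme X \<longleftrightarrow> locally_ringed X \<and>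
     (\<forall>x\<in>points X. \<exists>U. openin (spc X) U \<and> x \<in> U \<and> affine_scheme (open_subspace X U))"

definition flat_morphism ::
    "('a, 'r) ringed_space \<Rightarrow> ('b, 'k) ringed_space \<Rightarrow> ('a, 'r, 'b, 'k) morphism \<Rightarrow> bool" where
  "flat_morphism X Y f \<longleftrightarrow>
     (\<forall>x\<in>points X. flat_module (stalk Y (pt f x)) (alg_module (cm f x) (stalk X x)))"

subsection \<open>Fibre products\<close>

text \<open>The fibre product of \<open>f : X \<rightarrow> S\<close> and \<open>g : Y \<rightarrow> S\<close> as ringed spaces: the fibre product of
  the underlying spaces, with the sheaf of rings \<open>O\<^sub>X \<otimes> O\<^sub>Y\<close> over \<open>O\<^sub>S\<close> (inverse images
  understood).\<close>

definition fibre_topology ::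
    "('a, 'r) ringed_space \<Rightarrow> ('b, 'k) ringed_space \<Rightarrow>
     ('a, 'r, 'c, 'l) morphism \<Rightarrow> ('b, 'k, 'c, 'l) morphism \<Rightarrow> ('a \<times> 'b) topology" where
  "fibre_topology X Y f g = subtopology (prod_topology (spc X) (spc Y)) {(x, y). pt f x = pt g y}"

definition fibre_tensor_class ::
    "('a, 'r) ringed_space \<Rightarrow> ('b, 'k) ringed_space \<Rightarrow> ('c, 'l) ringed_space \<Rightarrow>
     ('a, 'r, 'c, 'l) morphism \<Rightarrow> ('b, 'k, 'c, 'l) morphism \<Rightarrow>
     'a \<times> 'b \<Rightarrow> ('r \<times> 'k \<Rightarrow>\<^sub>0 int) \<Rightarrow> ('r \<times> 'k \<Rightarrow>\<^sub>0 int) set" where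
  "fibre_tensor_class X Y S f g = (\<lambda>(x, y). tensor_class (stalk S (pt f x))
     (alg_module (cm f x) (stalk X x)) (alg_module (cm g y) (stalk Y y)))"

definition fibre_stalk ::
    "('a, 'r) ringed_space \<Rightarrow> ('b, 'k) ringed_space \<Rightarrow> ('c, 'l) ringed_space \<Rightarrow>
     ('a, 'r, 'c, 'l) morphism \<Rightarrow> ('b, 'k, 'c, 'l) morphism \<Rightarrow>
     'a \<times> 'b \<Rightarrow> ('r \<times> 'k \<Rightarrow>\<^sub>0 int) set ring" where
  "fibre_stalk X Y S f g = (\<lambda>(x, y). tensor_ring (stalk S (pt f x))
     (alg_module (cm f x) (stalk X x)) (alg_module (cm g y) (stalk Y y)))"

definition ringed_fibre_product ::
    "('a, 'r) ringed_space \<Rightarrow> ('b, 'k) ringed_space \<Rightarrow> ('c, 'l) ringed_space \<Rightarrow>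
     ('a, 'r, 'c, 'l) morphism \<Rightarrow> ('b, 'k, 'c, 'l) morphism \<Rightarrow>
     ('a \<times> 'b, ('r \<times> 'k \<Rightarrow>\<^sub>0 int) set) ringed_space" where
  "ringed_fibre_product X Y S f g = \<lparr>
     spc = fibre_topology X Y f g,
     stalk = fibre_stalk X Y S f g,
     sections = locally_given (fibre_topology X Y f g) (\<lambda>z. carrier (fibre_stalk X Y S f g z))
       (\<lambda>V. {(\<lambda>z. fibre_tensor_class X Y S f g z
                (\<Sum>i<n. frag_of (b i (fst z), c i (snd z)))) |(n :: nat) b c U U'.
          openin (spc X) U \<and> openin (spc Y) U' \<and> V \<subseteq> U \<times> U' \<and>
          (\<forall>i<n. b i \<in> sections X U \<and> c i \<in> sections Y U')})\<rparr>"

text \<open>The fibre product of (locally ringed spaces, hence of) schemes is the localization of the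
  above at the primes lying over the maximal ideals of both factors.\<close>

definition fibre_primes ::
    "('a, 'r) ringed_space \<Rightarrow> ('b, 'k) ringed_space \<Rightarrow> ('c, 'l) ringed_space \<Rightarrow>
     ('a, 'r, 'c, 'l) morphism \<Rightarrow> ('b, 'k, 'c, 'l) morphism \<Rightarrow>
     'a \<times> 'b \<Rightarrow> ('r \<times> 'k \<Rightarrow>\<^sub>0 int) set set set" where
  "fibre_primes X Y S f g = (\<lambda>(x, y). {q. primeideal q (fibre_stalk X Y S f g (x, y)) \<and>
     {r \<in> carrier (stalk X x).
        fibre_tensor_class X Y S f g (x, y) (frag_of (r, \<one>\<^bsub>stalk Y y\<^esub>)) \<in> q}
       = max_ideal (stalk X x) \<and>
     {r \<in> carrier (stalk Y y).
        fibre_tensor_class X Y S f g (x, y) (frag_of (\<one>\<^bsub>stalk X x\<^esub>, r)) \<in> q}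
       = max_ideal (stalk Y y)})"

definition fibre_product ::
    "('a, 'r) ringed_space \<Rightarrow> ('b, 'k) ringed_space \<Rightarrow> ('c, 'l) ringed_space \<Rightarrow>
     ('a, 'r, 'c, 'l) morphism \<Rightarrow> ('b, 'k, 'c, 'l) morphism \<Rightarrow>
     (('a \<times> 'b) \<times> ('r \<times> 'k \<Rightarrow>\<^sub>0 int) set set,
      (('r \<times> 'k \<Rightarrow>\<^sub>0 int) set \<times> ('r \<times> 'k \<Rightarrow>\<^sub>0 int) set) set) ringed_space" where
  "fibre_product X Y S f g =
     localize_at (ringed_fibre_product X Y S f g) (fibre_primes X Y S f g)"

definition fibre_frac ::
    "('a, 'r) ringed_space \<Rightarrow> ('b, 'k) ringed_space \<Rightarrow> ('c, 'l) ringed_space \<Rightarrow>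
     ('a, 'r, 'c, 'l) morphism \<Rightarrow> ('b, 'k, 'c, 'l) morphism \<Rightarrow>
     ('a \<times> 'b) \<times> ('r \<times> 'k \<Rightarrow>\<^sub>0 int) set set \<Rightarrow> 'r \<times> 'k \<Rightarrow>
     (('r \<times> 'k \<Rightarrow>\<^sub>0 int) set \<times> ('r \<times> 'k \<Rightarrow>\<^sub>0 int) set) set" where
  "fibre_frac X Y S f g = (\<lambda>(z, q) e. fraction (fibre_stalk X Y S f g z)
     (carrier (fibre_stalk X Y S f g z) - q)
     (fibre_tensor_class X Y S f g z (frag_of e)) \<one>\<^bsub>fibre_stalk X Y S f g z\<^esub>)"

definition fibre_proj1 ::
    "('a, 'r) ringed_space \<Rightarrow> ('b, 'k) ringed_space \<Rightarrow> ('c, 'l) ringed_space \<Rightarrow>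
     ('a, 'r, 'c, 'l) morphism \<Rightarrow> ('b, 'k, 'c, 'l) morphism \<Rightarrow>
     (('a \<times> 'b) \<times> ('r \<times> 'k \<Rightarrow>\<^sub>0 int) set set,
      (('r \<times> 'k \<Rightarrow>\<^sub>0 int) set \<times> ('r \<times> 'k \<Rightarrow>\<^sub>0 int) set) set, 'a, 'r) morphism" where
  "fibre_proj1 X Y S f g = \<lparr>
     pt = (\<lambda>w\<in>points (fibre_product X Y S f g). fst (fst w)),
     cm = (\<lambda>w\<in>points (fibre_product X Y S f g). \<lambda>r\<in>carrier (stalk X (fst (fst w))).
            fibre_frac X Y S f g w (r, \<one>\<^bsub>stalk Y (snd (fst w))\<^esub>))\<rparr>"

definition fibre_proj2 ::
    "('a, 'r) ringed_space \<Rightarrow> ('b, 'k) ringed_space \<Rightarrow> ('c, 'l) ringed_space \<Rightarrow>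
     ('a, 'r, 'c, 'l) morphism \<Rightarrow> ('b, 'k, 'c, 'l) morphism \<Rightarrow>
     (('a \<times> 'b) \<times> ('r \<times> 'k \<Rightarrow>\<^sub>0 int) set set,
      (('r \<times> 'k \<Rightarrow>\<^sub>0 int) set \<times> ('r \<times> 'k \<Rightarrow>\<^sub>0 int) set) set, 'b, 'k) morphism" where
  "fibre_proj2 X Y S f g = \<lparr>
     pt = (\<lambda>w\<in>points (fibre_product X Y S f g). snd (fst w)),
     cm = (\<lambda>w\<in>points (fibre_product X Y S f g). \<lambda>r\<in>carrier (stalk Y (snd (fst w))).
            fibre_frac X Y S f g w (\<one>\<^bsub>stalk X (fst (fst w))\<^esub>, r))\<rparr>"

subsection \<open>Quasi-coherence\<close>

definition fin_coeffs :: "'r ring \<Rightarrow> 'i set \<Rightarrow> ('i \<Rightarrow> 'r) set" where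
  "fin_coeffs A G = {c \<in> (\<Pi>\<^sub>E e\<in>G. carrier A). finite {e \<in> G. c e \<noteq> \<zero>\<^bsub>A\<^esub>}}"

definition lin_comb ::
    "'r ring \<Rightarrow> ('r, 'm) module \<Rightarrow> 'i set \<Rightarrow> ('i \<Rightarrow> 'm) \<Rightarrow> ('i \<Rightarrow> 'r) \<Rightarrow> 'm" where
  "lin_comb A M G v c = (\<Oplus>\<^bsub>M\<^esub>e\<in>{e \<in> G. c e \<noteq> \<zero>\<^bsub>A\<^esub>}. c e \<odot>\<^bsub>M\<^esub> v e)"

text \<open>Locally there is an exact sequence \<open>O\<^sup>(\<^sup>J\<^sup>) \<rightarrow> O\<^sup>(\<^sup>I\<^sup>) \<rightarrow> F \<rightarrow> 0\<close>: a set \<open>G\<close> of sections of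
  \<open>F\<close> generates, and a set \<open>R\<close> of sections of the free module on \<open>G\<close> (families of functions,
  locally with finite support) generates the relations. Indexing generators and relations by
  themselves is no restriction, as repetitions may be discarded.\<close>

definition quasi_coherent ::
    "('a, 'r) ringed_space \<Rightarrow> ('a \<Rightarrow> ('r, 'm) module) \<Rightarrow> ('a set \<Rightarrow> ('a \<Rightarrow> 'm) set) \<Rightarrow> bool" where
  "quasi_coherent X F \<Gamma> \<longleftrightarrow>
     (\<forall>x\<in>points X. module (stalk X x) (F x)) \<and>
     sheaf_on (spc X) (\<lambda>x. carrier (F x)) \<Gamma> \<and>
     (\<forall>x\<in>points X. \<exists>U G R. openin (spc X) U \<and> x \<in> U \<and> G \<subseteq> \<Gamma> U \<and>
        (\<forall>r\<in>R. r \<in> (\<Pi>\<^sub>E e\<in>G. sections X U) \<and>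
          (\<forall>y\<in>U. \<exists>V. openin (spc X) V \<and> y \<in> V \<and> V \<subseteq> U \<and>
             finite {e \<in> G. \<exists>z\<in>V. r e z \<noteq> \<zero>\<^bsub>stalk X z\<^esub>})) \<and>
        (\<forall>y\<in>U.
          (\<forall>m\<in>carrier (F y). \<exists>c\<in>fin_coeffs (stalk X y) G.
             lin_comb (stalk X y) (F y) G (\<lambda>e. e y) c = m) \<and>
          (\<forall>c\<in>fin_coeffs (stalk X y) G.
             lin_comb (stalk X y) (F y) G (\<lambda>e. e y) c = \<zero>\<^bsub>F y\<^esub> \<longleftrightarrow>
             (\<exists>d\<in>fin_coeffs (stalk X y) R. \<forall>e\<in>G.
                c e = (\<Oplus>\<^bsub>stalk X y\<^esub>r\<in>{r \<in> R. d r \<noteq> \<zero>\<^bsub>stalk X y\<^esub>}.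
                         d r \<otimes>\<^bsub>stalk X y\<^esub> r e y)))))"

subsection \<open>Relative spectra\<close>

text \<open>\<open>A\<close> is a sheaf of algebras on the space of \<open>S\<close>, with structure maps \<open>\<iota> s\<close>. The points over
  \<open>s\<close> are the primes of the stalk of \<open>A\<close> lying over the maximal ideal at \<open>s\<close>. If \<open>A\<close> is
  quasi-coherent, this is \<open>Spec A(U)\<close> over an affine open \<open>U\<close>.\<close>

definition spec_primes ::
    "('a, 'r) ringed_space \<Rightarrow> ('a, 'm) ringed_space \<Rightarrow> ('a \<Rightarrow> 'r \<Rightarrow> 'm) \<Rightarrow> 'a \<Rightarrow> 'm set set" where
  "spec_primes S A \<iota> s = {q. primeideal q (stalk A s) \<and>
     {r \<in> carrier (stalk S s). \<iota> s r \<in> q} = max_ideal (stalk S s)}"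

definition rel_Spec ::
    "('a, 'r) ringed_space \<Rightarrow> ('a, 'm) ringed_space \<Rightarrow> ('a \<Rightarrow> 'r \<Rightarrow> 'm) \<Rightarrow>
     ('a \<times> 'm set, ('m \<times> 'm) set) ringed_space" where
  "rel_Spec S A \<iota> = localize_at A (spec_primes S A \<iota>)"

definition rel_Spec_proj ::
    "('a, 'r) ringed_space \<Rightarrow> ('a, 'm) ringed_space \<Rightarrow> ('a \<Rightarrow> 'r \<Rightarrow> 'm) \<Rightarrow>
     ('a \<times> 'm set, ('m \<times> 'm) set, 'a, 'r) morphism" where
  "rel_Spec_proj S A \<iota> = \<lparr>
     pt = (\<lambda>z\<in>points (rel_Spec S A \<iota>). fst z),
     cm = (\<lambda>z\<in>points (rel_Spec S A \<iota>). \<lambda>r\<in>carrier (stalk S (fst z)).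
            fraction (stalk A (fst z)) (carrier (stalk A (fst z)) - snd z)
              (\<iota> (fst z) r) \<one>\<^bsub>stalk A (fst z)\<^esub>)\<rparr>"

section \<open>Generic points and weakly associated points\<close>

definition irreducible_in :: "'a topology \<Rightarrow> 'a set \<Rightarrow> bool" where
  "irreducible_in X Z \<longleftrightarrow> Z \<subseteq> topspace X \<and> Z \<noteq> {} \<and>
     (\<forall>A B. closedin X A \<and> closedin X B \<and> Z \<subseteq> A \<union> B \<longrightarrow> Z \<subseteq> A \<or> Z \<subseteq> B)"

definition irreducible_component :: "'a topology \<Rightarrow> 'a set \<Rightarrow> bool" where
  "irreducible_component X Z \<longleftrightarrow> irreducible_in X Z \<and>
     (\<forall>Z'. irreducible_in X Z' \<and> Z \<subseteq> Z' \<longrightarrow> Z' = Z)"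

definition Max_points :: "('a, 'r) ringed_space \<Rightarrow> 'a set" where
  "Max_points S = {s \<in> points S. irreducible_component (spc S) (spc S closure_of {s})}"

definition WeakAss :: "('a, 'r) ringed_space \<Rightarrow> 'a set" where
  "WeakAss S = {s \<in> points S. \<exists>a\<in>carrier (stalk S s).
     minimal_prime_over (stalk S s) (annihilator (stalk S s) a) (max_ideal (stalk S s))}"

text \<open>For a subset; the library notion \<open>locally_finite_in\<close> is for families of subsets.\<close>

definition locally_finite_subset :: "'a topology \<Rightarrow> 'a set \<Rightarrow> bool" where
  "locally_finite_subset X E \<longleftrightarrow>
     (\<forall>x\<in>topspace X. \<exists>U. openin X U \<and> x \<in> U \<and> finite (U \<inter> E))"

section \<open>Cartier divisors\<close>

definition reg_sections :: "('a, 'r) ringed_space \<Rightarrow> 'a set \<Rightarrow> ('a \<Rightarrow> 'r) set" where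
  "reg_sections S U = {x \<in> sections S U. \<forall>s\<in>U. nonzerodivisor (stalk S s) (x s)}"

text \<open>Germs of regular sections; a germ that is a nonzerodivisor need not be one.\<close>

definition reg_stalk :: "('a, 'r) ringed_space \<Rightarrow> 'a \<Rightarrow> 'r set" where
  "reg_stalk S s = {x s |x U. openin (spc S) U \<and> s \<in> U \<and> x \<in> reg_sections S U}"

definition merom_stalk :: "('a, 'r) ringed_space \<Rightarrow> 'a \<Rightarrow> ('r \<times> 'r) set ring" where
  "merom_stalk S s = localization (stalk S s) (reg_stalk S s)"

definition merom :: "('a, 'r) ringed_space \<Rightarrow> ('a, ('r \<times> 'r) set) ringed_space" where
  "merom S = \<lparr>
     spc = spc S,
     stalk = merom_stalk S,
     sections = locally_given (spc S) (\<lambda>s. carrier (merom_stalk S s))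
       (\<lambda>V. {(\<lambda>s. fraction (stalk S s) (reg_stalk S s) (a s) (b s)) |a b.
          a \<in> sections S V \<and> b \<in> reg_sections S V})\<rparr>"

definition merom_of :: "('a, 'r) ringed_space \<Rightarrow> 'a \<Rightarrow> 'r \<Rightarrow> ('r \<times> 'r) set" where
  "merom_of S s r = fraction (stalk S s) (reg_stalk S s) r \<one>\<^bsub>stalk S s\<^esub>"

definition merom_module :: "('a, 'r) ringed_space \<Rightarrow> 'a \<Rightarrow> ('r, ('r \<times> 'r) set) module" where
  "merom_module S s = alg_module (merom_of S s) (merom_stalk S s)"

text \<open>The groups of divisors are written multiplicatively, as quotients of groups of units. An
  element of \<open>div_stalk S s\<close> is a coset, that is, the set of its lifts to units of \<open>M\<^sub>S\<^sub>,\<^sub>s\<close>.\<close>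

definition const_units :: "('a, 'r) ringed_space \<Rightarrow> 'a \<Rightarrow> ('r \<times> 'r) set set" where
  "const_units S s = merom_of S s ` Units (stalk S s)"

definition div_stalk :: "('a, 'r) ringed_space \<Rightarrow> 'a \<Rightarrow> ('r \<times> 'r) set set monoid" where
  "div_stalk S s = units_of (merom_stalk S s) Mod const_units S s"

definition div_class :: "('a, 'r) ringed_space \<Rightarrow> 'a \<Rightarrow> ('r \<times> 'r) set \<Rightarrow> ('r \<times> 'r) set set" where
  "div_class S s m = const_units S s #>\<^bsub>units_of (merom_stalk S s)\<^esub> m"

definition div_sections ::
    "('a, 'r) ringed_space \<Rightarrow> 'a set \<Rightarrow> ('a \<Rightarrow> ('r \<times> 'r) set set) set" where
  "div_sections S = locally_given (spc S) (\<lambda>s. carrier (div_stalk S s))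
     (\<lambda>V. {(\<lambda>s. div_class S s (m s)) |m. m \<in> sections (merom S) V \<and>
        (\<forall>s\<in>V. m s \<in> Units (merom_stalk S s))})"

definition div_le ::
    "('a, 'r) ringed_space \<Rightarrow> 'a \<Rightarrow> ('r \<times> 'r) set set \<Rightarrow> ('r \<times> 'r) set set \<Rightarrow> bool" where
  "div_le S s \<alpha> \<beta> \<longleftrightarrow>
     \<beta> \<otimes>\<^bsub>div_stalk S s\<^esub> inv\<^bsub>div_stalk S s\<^esub> \<alpha> \<in> (\<lambda>x. div_class S s (merom_of S s x)) ` reg_stalk S s"

text \<open>The maps on stalks of \<open>M\<close> and of divisors induced by a flat morphism \<open>f : T \<rightarrow> S\<close>.\<close>

definition merom_map ::
    "('b, 'k) ringed_space \<Rightarrow> ('b, 'k, 'a, 'r) morphism \<Rightarrow> 'b \<Rightarrow>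
     ('r \<times> 'r) set \<Rightarrow> ('k \<times> 'k) set" where
  "merom_map T f t = loc_map (stalk T t) (reg_stalk T t) (cm f t)"

definition div_map ::
    "('b, 'k) ringed_space \<Rightarrow> ('b, 'k, 'a, 'r) morphism \<Rightarrow> 'b \<Rightarrow>
     ('r \<times> 'r) set set \<Rightarrow> ('k \<times> 'k) set set" where
  "div_map T f t \<delta> = (\<Union>m\<in>\<delta>. div_class T t (merom_map T f t m))"

definition convex_subgroup :: "'g monoid \<Rightarrow> ('g \<Rightarrow> 'g \<Rightarrow> bool) \<Rightarrow> 'g set \<Rightarrow> bool" where
  "convex_subgroup D leq H \<longleftrightarrow> subgroup H D \<and>
     (\<forall>\<alpha>\<in>H. \<forall>\<gamma>\<in>H. \<forall>\<beta>\<in>carrier D. leq \<alpha> \<beta> \<and> leq \<beta> \<gamma> \<longrightarrow> \<beta> \<in> H)"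

definition convex_morphism ::
    "('b, 'k) ringed_space \<Rightarrow> ('a, 'r) ringed_space \<Rightarrow> ('b, 'k, 'a, 'r) morphism \<Rightarrow> bool" where
  "convex_morphism T S f \<longleftrightarrow> flat_morphism T S f \<and>
     (\<forall>t\<in>points T. convex_subgroup (div_stalk T t) (div_le T t)
        (div_map T f t ` carrier (div_stalk S (pt f t))))"

section \<open>The group schemes\<close>

subsection \<open>The espace etale of the sheaf of divisors\<close>

definition Pi_topology :: "('a, 'r) ringed_space \<Rightarrow> ('a \<times> ('r \<times> 'r) set set) topology" where
  "Pi_topology S =
     topology_generated_by {(\<lambda>s. (s, d s)) ` U |U d. openin (spc S) U \<and> d \<in> div_sections S U}"

definition Pi_space ::
    "('a, 'r) ringed_space \<Rightarrow> ('a \<times> ('r \<times> 'r) set set, 'r) ringed_space" where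
  "Pi_space S = inverse_image (Pi_topology S) fst S"

definition Pi_proj ::
    "('a, 'r) ringed_space \<Rightarrow> ('a \<times> ('r \<times> 'r) set set, 'r, 'a, 'r) morphism" where
  "Pi_proj S = \<lparr>
     pt = (\<lambda>z\<in>points (Pi_space S). fst z),
     cm = (\<lambda>z\<in>points (Pi_space S). \<lambda>r\<in>carrier (stalk S (fst z)). r)\<rparr>"

text \<open>The \<open>T\<close>-points of \<open>\<Pi>\<^sub>S\<close>, where \<open>T\<close> is an \<open>S\<close>-scheme through \<open>f\<close>.\<close>

definition Pi_points ::
    "('a, 'r) ringed_space \<Rightarrow> ('b, 'k) ringed_space \<Rightarrow> ('b, 'k, 'a, 'r) morphism \<Rightarrow>
     ('b, 'k, 'a \<times> ('r \<times> 'r) set set, 'r) morphism set" where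
  "Pi_points S T f = {a. lrs_hom T (Pi_space S) a \<and> mor_comp T S (Pi_proj S) a = f}"

definition Pi_add ::
    "('a, 'r) ringed_space \<Rightarrow> ('b, 'k) ringed_space \<Rightarrow> ('b, 'k, 'a, 'r) morphism \<Rightarrow>
     ('b, 'k, 'a \<times> ('r \<times> 'r) set set, 'r) morphism \<Rightarrow>
     ('b, 'k, 'a \<times> ('r \<times> 'r) set set, 'r) morphism \<Rightarrow>
     ('b, 'k, 'a \<times> ('r \<times> 'r) set set, 'r) morphism" where
  "Pi_add S T f a b = \<lparr>
     pt = (\<lambda>t\<in>points T. (pt f t, snd (pt a t) \<otimes>\<^bsub>div_stalk S (pt f t)\<^esub> snd (pt b t))),
     cm = cm f\<rparr>"

definition Pi_zero ::
    "('a, 'r) ringed_space \<Rightarrow> ('b, 'k) ringed_space \<Rightarrow> ('b, 'k, 'a, 'r) morphism \<Rightarrow>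
     ('b, 'k, 'a \<times> ('r \<times> 'r) set set, 'r) morphism" where
  "Pi_zero S T f = \<lparr>
     pt = (\<lambda>t\<in>points T. (pt f t, \<one>\<^bsub>div_stalk S (pt f t)\<^esub>)),
     cm = cm f\<rparr>"

subsection \<open>The invertible sheaf on it\<close>

text \<open>The stalk at \<open>(s, \<delta>)\<close> of the sheaf \<open>L\<close> is the submodule of \<open>M\<^sub>S\<^sub>,\<^sub>s\<close> spanned by any
  lift \<open>m \<in> \<delta>\<close>; the multiplication of \<open>M\<^sub>S\<^sub>,\<^sub>s\<close> is kept in the record.\<close>

definition L_stalk ::
    "('a, 'r) ringed_space \<Rightarrow> 'a \<times> ('r \<times> 'r) set set \<Rightarrow> ('r, ('r \<times> 'r) set) module" where
  "L_stalk S = (\<lambda>(s, \<delta>). (merom_module S s)\<lparr>carrier :=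
     {r \<odot>\<^bsub>merom_module S s\<^esub> m |r m. r \<in> carrier (stalk S s) \<and> m \<in> \<delta>}\<rparr>)"

definition L_sections ::
    "('a, 'r) ringed_space \<Rightarrow> ('a \<times> ('r \<times> 'r) set set) set \<Rightarrow>
     ('a \<times> ('r \<times> 'r) set set \<Rightarrow> ('r \<times> 'r) set) set" where
  "L_sections S W = {l \<in> sections (inverse_image (Pi_topology S) fst (merom S)) W.
     \<forall>z\<in>W. l z \<in> carrier (L_stalk S z)}"

text \<open>The pullback \<open>a\<^sup>*L\<close> along \<open>a : T \<rightarrow> \<Pi>\<^sub>S\<close>, with stalk \<open>O\<^sub>T\<^sub>,\<^sub>t \<otimes> L\<^sub>a\<^sub>(\<^sub>t\<^sub>)\<close> at \<open>t\<close>. Its classes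
  and maps into it are taken with the following three arguments of the tensor operations.\<close>

abbreviation base_at ::
    "('a, 'r) ringed_space \<Rightarrow> ('b, 'k, 'a \<times> ('r \<times> 'r) set set, 'r) morphism \<Rightarrow> 'b \<Rightarrow> 'r ring" where
  "base_at S a t \<equiv> stalk (Pi_space S) (pt a t)"

abbreviation struct_at ::
    "('b, 'k) ringed_space \<Rightarrow> ('b, 'k, 'a \<times> ('r \<times> 'r) set set, 'r) morphism \<Rightarrow> 'b \<Rightarrow>
     ('r, 'k) module" where
  "struct_at T a t \<equiv> alg_module (cm a t) (stalk T t)"

abbreviation L_at ::
    "('a, 'r) ringed_space \<Rightarrow> ('b, 'k, 'a \<times> ('r \<times> 'r) set set, 'r) morphism \<Rightarrow> 'b \<Rightarrow>
     ('r, ('r \<times> 'r) set) module" where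
  "L_at S a t \<equiv> L_stalk S (pt a t)"

definition pullL_stalk ::
    "('a, 'r) ringed_space \<Rightarrow> ('b, 'k) ringed_space \<Rightarrow>
     ('b, 'k, 'a \<times> ('r \<times> 'r) set set, 'r) morphism \<Rightarrow> 'b \<Rightarrow>
     ('k \<times> ('r \<times> 'r) set \<Rightarrow>\<^sub>0 int) set set" where
  "pullL_stalk S T a t = tensor_carrier (base_at S a t) (struct_at T a t) (L_at S a t)"

definition pullL_sections ::
    "('a, 'r) ringed_space \<Rightarrow> ('b, 'k) ringed_space \<Rightarrow>
     ('b, 'k, 'a \<times> ('r \<times> 'r) set set, 'r) morphism \<Rightarrow> 'b set \<Rightarrow>
     ('b \<Rightarrow> ('k \<times> ('r \<times> 'r) set \<Rightarrow>\<^sub>0 int) set) set" where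
  "pullL_sections S T a = locally_given (spc T) (pullL_stalk S T a)
     (\<lambda>V. {(\<lambda>t. tensor_class (base_at S a t) (struct_at T a t) (L_at S a t)
              (\<Sum>i<n. frag_of (b i t, l i (pt a t)))) |(n :: nat) b l W.
        openin (Pi_topology S) W \<and> pt a ` V \<subseteq> W \<and>
        (\<forall>i<n. b i \<in> sections T V \<and> l i \<in> L_sections S W)})"

text \<open>A section is invertible if it generates all stalks over the local rings of \<open>T\<close>.\<close>

definition pullL_generators ::
    "('a, 'r) ringed_space \<Rightarrow> ('b, 'k) ringed_space \<Rightarrow>
     ('b, 'k, 'a \<times> ('r \<times> 'r) set set, 'r) morphism \<Rightarrow>
     ('b \<Rightarrow> ('k \<times> ('r \<times> 'r) set \<Rightarrow>\<^sub>0 int) set) set" where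
  "pullL_generators S T a = {\<alpha> \<in> pullL_sections S T a (points T).
     \<forall>t\<in>points T. \<forall>z\<in>pullL_stalk S T a t. \<exists>c\<in>carrier (stalk T t).
       z = tensor_map (base_at S a t) (struct_at T a t) (L_at S a t)
             (\<lambda>x. c \<otimes>\<^bsub>stalk T t\<^esub> x) id (\<alpha> t)}"

subsection \<open>The functors of points\<close>

text \<open>\<open>G\<^sub>m\<^sub>,\<^sub>S\<^sup>l\<^sup>f\<^sup>t\<close> is given by its functor of points; \<open>Gm_lft S T f\<close> is the group of points with
  values in the \<open>S\<close>-scheme \<open>f : T \<rightarrow> S\<close>.\<close>

definition Gm_lft ::
    "('a, 'r) ringed_space \<Rightarrow> ('b, 'k) ringed_space \<Rightarrow> ('b, 'k, 'a, 'r) morphism \<Rightarrow>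
     (('b, 'k, 'a \<times> ('r \<times> 'r) set set, 'r) morphism \<times>
      ('b \<Rightarrow> ('k \<times> ('r \<times> 'r) set \<Rightarrow>\<^sub>0 int) set)) monoid" where
  "Gm_lft S T f = \<lparr>
     carrier = {(a, \<alpha>). a \<in> Pi_points S T f \<and> \<alpha> \<in> pullL_generators S T a},
     Group.monoid.mult = (\<lambda>(a, \<alpha>) (b, \<beta>). let c = Pi_add S T f a b in
       (c, \<lambda>t\<in>points T. tensor_mult (base_at S c t) (struct_at T c t) (L_at S c t) (\<alpha> t) (\<beta> t))),
     one = (let z = Pi_zero S T f in
       (z, \<lambda>t\<in>points T. tensor_class (base_at S z t) (struct_at T z t) (L_at S z t)
             (frag_of (\<one>\<^bsub>stalk T t\<^esub>, \<one>\<^bsub>merom_stalk S (pt f t)\<^esub>))))\<rparr>"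

text \<open>Functoriality in \<open>T\<close>, for an \<open>S\<close>-morphism \<open>h : T' \<rightarrow> T\<close>.\<close>

definition Gm_lft_pull ::
    "('a, 'r) ringed_space \<Rightarrow> ('c, 'l) ringed_space \<Rightarrow> ('c, 'l, 'b, 'k) morphism \<Rightarrow>
     ('b, 'k, 'a \<times> ('r \<times> 'r) set set, 'r) morphism \<times>
      ('b \<Rightarrow> ('k \<times> ('r \<times> 'r) set \<Rightarrow>\<^sub>0 int) set) \<Rightarrow>
     ('c, 'l, 'a \<times> ('r \<times> 'r) set set, 'r) morphism \<times>
      ('c \<Rightarrow> ('l \<times> ('r \<times> 'r) set \<Rightarrow>\<^sub>0 int) set)" where
  "Gm_lft_pull S T' h = (\<lambda>(a, \<alpha>). let a' = mor_comp T' (Pi_space S) a h in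
     (a', \<lambda>t\<in>points T'. tensor_map (base_at S a' t) (struct_at T' a' t) (L_at S a' t)
            (cm h t) id (\<alpha> (pt h t))))"

definition Gm :: "('b, 'k) ringed_space \<Rightarrow> ('b \<Rightarrow> 'k) monoid" where
  "Gm T = units_of (section_ring T (points T))"

definition Gm_pull ::
    "('c, 'l) ringed_space \<Rightarrow> ('c, 'l, 'b, 'k) morphism \<Rightarrow> ('b \<Rightarrow> 'k) \<Rightarrow> 'c \<Rightarrow> 'l" where
  "Gm_pull T' h u = (\<lambda>t\<in>points T'. cm h t (u (pt h t)))"

text \<open>The canonical inclusion \<open>u \<mapsto> (0, u)\<close> of the multiplicative group.\<close>

definition Gm_incl ::
    "('a, 'r) ringed_space \<Rightarrow> ('b, 'k) ringed_space \<Rightarrow> ('b, 'k, 'a, 'r) morphism \<Rightarrow> ('b \<Rightarrow> 'k) \<Rightarrow>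
     ('b, 'k, 'a \<times> ('r \<times> 'r) set set, 'r) morphism \<times>
      ('b \<Rightarrow> ('k \<times> ('r \<times> 'r) set \<Rightarrow>\<^sub>0 int) set)" where
  "Gm_incl S T f u = (let z = Pi_zero S T f in
     (z, \<lambda>t\<in>points T. tensor_class (base_at S z t) (struct_at T z t) (L_at S z t)
           (frag_of (u t, \<one>\<^bsub>merom_stalk S (pt f t)\<^esub>))))"

text \<open>For a flat \<open>p : E \<rightarrow> S\<close>, the canonical map from the base change along \<open>p\<close> of the group
  attached to \<open>S\<close> to the group attached to \<open>E\<close>, on points with values in an \<open>E\<close>-scheme \<open>X\<close>
  with structure morphism \<open>g\<close>. The \<open>X\<close>-points of the base change are the \<open>X\<close>-points over \<open>S\<close>.\<close>

definition Gm_lft_compare ::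
    "('e, 'w) ringed_space \<Rightarrow> ('e, 'w, 'a, 'r) morphism \<Rightarrow>
     ('b, 'k) ringed_space \<Rightarrow> ('b, 'k, 'e, 'w) morphism \<Rightarrow>
     ('b, 'k, 'a \<times> ('r \<times> 'r) set set, 'r) morphism \<times>
      ('b \<Rightarrow> ('k \<times> ('r \<times> 'r) set \<Rightarrow>\<^sub>0 int) set) \<Rightarrow>
     ('b, 'k, 'e \<times> ('w \<times> 'w) set set, 'w) morphism \<times>
      ('b \<Rightarrow> ('k \<times> ('w \<times> 'w) set \<Rightarrow>\<^sub>0 int) set)" where
  "Gm_lft_compare E p X g = (\<lambda>(a, \<alpha>).
     let a' = \<lparr>pt = (\<lambda>x\<in>points X. (pt g x, div_map E p (pt g x) (snd (pt a x)))), cm = cm g\<rparr> in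
     (a', \<lambda>x\<in>points X. tensor_map (base_at E a' x) (struct_at X a' x) (L_at E a' x)
            id (merom_map E p (pt g x)) (\<alpha> x)))"

subsection \<open>The total spectrum of meromorphic functions\<close>

abbreviation eta ::
    "('a, 'r) ringed_space \<Rightarrow>
     ('a \<times> ('r \<times> 'r) set set, (('r \<times> 'r) set \<times> ('r \<times> 'r) set) set) ringed_space" where
  "eta S \<equiv> rel_Spec S (merom S) (merom_of S)"

abbreviation eta_proj ::
    "('a, 'r) ringed_space \<Rightarrow>
     ('a \<times> ('r \<times> 'r) set set, (('r \<times> 'r) set \<times> ('r \<times> 'r) set) set, 'a, 'r) morphism" where
  "eta_proj S \<equiv> rel_Spec_proj S (merom S) (merom_of S)"

text \<open>The base change morphism from \<open>T\<close>-points over \<open>S\<close> to units on \<open>T\<^sub>\<eta>\<close>: restrict to \<open>T\<^sub>\<eta>\<close>,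
  pass to the group attached to \<open>\<eta>\<close>, and identify the latter with the multiplicative group.\<close>

definition eta_base_change where
  "eta_base_change S T f u =
     (let T\<eta> = fibre_product T (eta S) S f (eta_proj S);
          q1 = fibre_proj1 T (eta S) S f (eta_proj S);
          q2 = fibre_proj2 T (eta S) S f (eta_proj S)
      in inv_into (carrier (Gm T\<eta>)) (Gm_incl (eta S) T\<eta> q2)
           (Gm_lft_compare (eta S) (eta_proj S) T\<eta> q2 (Gm_lft_pull S T\<eta> q1 u)))"

end

theory Submission
 imports Defs "HOL-Algebra.Ring_Divisibility"
begin

text \<open>At a generic point every regular germ is a unit, because \<open>WeakAss(S) = Max(S)\<close>. Together with
  local finiteness this makes \<open>\<eta>\<close> the discrete union of the spectra of the local rings at
  \<open>Max(S)\<close>; it has no nontrivial divisors, so \<open>G\<^sub>m\<^sup>l\<^sup>f\<^sup>t\<close> and \<open>G\<^sub>m\<close> agree over it.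

  A section of \<open>G\<^sub>m\<^sup>l\<^sup>f\<^sup>t\<close> over \<open>T\<close> is locally \<open>([c/e], v \<otimes> c/e)\<close> with \<open>c\<close>, \<open>e\<close> regular on \<open>S\<close> and
  \<open>v\<close> a unit of \<open>T\<close>; base change sends it to the unit \<open>v c/e\<close> on the fibre over \<open>Max(S)\<close>, which is
  schematically dense in \<open>T\<close>. Two such triples with the same image agree by density and because flat
  local maps reflect divisibility. Every unit on the generic fibre comes from such a triple because
  it and its inverse are fractions with denominators from \<open>S\<close>, so that convexity puts their divisors
  into those of \<open>S\<close>.

  For quasi-coherence one takes a small affine neighbourhood \<open>W\<close>, on which every meromorphic germ is
  the germ of a global fraction; all sections over \<open>W\<close> and all their relations present the sheaf.\<close>

section \<open>Notation\<close>

text \<open>The generic fibre is not open in \<open>T\<close>, so units on it do not extend by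
  restriction arguments. Inside an affine chart, near a given point, it is the locus where a
  multiplicative set is invertible, whose members are, up to units, pullbacks of regular sections of
  \<open>S\<close>; flatness keeps these regular. Hence a function on the locus is a single fraction
  with such a denominator, and a function vanishing on it is killed by a nonzerodivisor. Regular
  denominators are plentiful because \<open>WeakAss(S) = Max(S)\<close> lets regularity be tested at
  generic points, and local finiteness reduces this to prime avoidance for finitely many minimal
  primes. The tensor products in the group schemes and in the fibre product with \<eta> involve
  modules free of rank one, so a class has one coordinate in the local ring of \<open>T\<close>. It
  depends on the chosen lift \<open>c/e\<close>; the real content is that different choices match.
  An affine open set enters only through the germs of ring elements at its points, which keeps the
  nested localizations of a spectrum out of later arguments.\<close>

abbreviation (input) ixstalk ("_@@_" [1000, 1000] 1000) where "X@@x \<equiv> stalk X x"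
abbreviation (input) ixpt ("_$_" [1000, 1000] 1000) where "f$t \<equiv> pt f t"
abbreviation (input) "opn X \<equiv> openin (spc X)"
abbreviation (input) "RS \<equiv> reg_stalk"
abbreviation (input) "MS \<equiv> merom_stalk"
abbreviation (input) "nzd \<equiv> nonzerodivisor"
abbreviation (input) "locfrac Y a g \<equiv> %(x, q). fraction Y@@x (carrier Y@@x - q) (a x) (g x)"
abbreviation (input) "locfracs Y Q V \<equiv> {locfrac Y a g |a g U. opn Y U & a : sections Y U & g : sections Y U & V <= basic_open Y Q U g}"
abbreviation (input) ixiff (infixr "<->" 25) where "P <-> Q \<equiv> P \<longleftrightarrow> Q"
abbreviation (input) ixmult ("(_ *[_] _)" [70, 0, 71] 70) where "x *[R] y \<equiv> x \<otimes>\<^bsub>R\<^esub> y"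
abbreviation (input) ixadd ("(_ +[_] _)" [65, 0, 66] 65) where "x +[R] y \<equiv> x \<oplus>\<^bsub>R\<^esub> y"
abbreviation (input) ixminus ("(_ -[_] _)" [65, 0, 66] 65) where "x -[R] y \<equiv> x \<ominus>\<^bsub>R\<^esub> y"
abbreviation (input) ixneg ("(-[_] _)" [0, 81] 80) where "-[R] x \<equiv> \<ominus>\<^bsub>R\<^esub> x"
abbreviation (input) ixone ("1[_]") where "1[R] \<equiv> \<one>\<^bsub>R\<^esub>"
abbreviation (input) ixzero ("0[_]") where "0[R] \<equiv> \<zero>\<^bsub>R\<^esub>"
abbreviation (input) ixinv ("(inv[_] _)" [0, 81] 80) where "inv[R] x \<equiv> inv\<^bsub>R\<^esub> x"
abbreviation (input) ixpow ("(_ ^[_] _)" [75, 0, 75] 75) where "x ^[R] n \<equiv> x [^]\<^bsub>R\<^esub> n"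
abbreviation (input) ixsmult ("(_ .[_] _)" [70, 0, 71] 70) where "r .[M] x \<equiv> r \<odot>\<^bsub>M\<^esub> x"

section \<open>Prime ideals\<close>

definition mult_subset :: "('r, 'x) ring_scheme => 'r set => bool" where
 "mult_subset R M <-> M <= carrier R & 1[R] : M & (ALL x:M. ALL y:M. x *[R] y : M)"

lemma mult_subsetD:
 assumes "mult_subset R M"
 shows "M <= carrier R" "1[R] : M" "!!x y. x : M ==> y : M ==> x *[R] y : M"
  "!!x. x : M ==> x : carrier R"
 using assms unfolding mult_subset_def by auto

context cring
begin

lemma ideal_add_elem:
 assumes "ideal P R" "a : carrier R"
 obtains J where "ideal J R" "P <= J" "a : J" "!!x. x : J ==> EX p:P. EX r:carrier R. x = p +[R] r *[R] a"
proof -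
 interpret P: ideal P R by fact
 let ?J = "set_add R P (PIdl a)"
 have J: "ideal ?J R" by(rule add_ideals[OF assms(1) cgenideal_ideal[OF assms(2)]])
 have 1: "x : ?J" if "x : P" for x
 proof -
  have "x +[R] 0[R] : ?J"
   using that additive_subgroup.zero_closed[OF ideal.axioms(1)[OF cgenideal_ideal[OF assms(2)]]]
   unfolding set_add_def' by blast
  thus ?thesis using that P.Icarr by simp
 qed
 have 2: "a : ?J"
 proof -
  have "0[R] +[R] a : ?J"
   using cgenideal_self[OF assms(2)] P.zero_closed unfolding set_add_def' by blast
  thus ?thesis using assms(2) by simp
 qed
 have 3: "EX p:P. EX r:carrier R. x = p +[R] r *[R] a" if "x : ?J" for x
  using that unfolding set_add_def' cgenideal_def by blast
 show thesis by(rule that[OF J _ 2 3]) (use 1 in auto)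
qed

text \<open>Zorn's lemma. \<open>M\<close> is an arbitrary set: for \<open>M = {1}\<close> the
  result is a maximal ideal, which yields the structure of local rings, and for multiplicative
  \<open>M\<close> it is prime.\<close>

lemma exists_ideal_maximal_disjoint:
 assumes I: "ideal I R" and dis: "I Int M = {}"
 obtains P where "ideal P R" "I <= P" "P Int M = {}"
  "!!J. ideal J R ==> P <= J ==> J Int M = {} ==> J = P"
proof -
 let ?A = "{J. ideal J R & I <= J & J Int M = {}}"
 have "EX P:?A. ALL X:?A. P <= X --> X = P"
 proof (rule subset_Zorn_nonempty)
  show "?A ~= {}" using I dis by blast
  fix C assume C: "C ~= {}" "subset.chain ?A C"
  have "subset.chain {J. ideal J R} C" using C(2) unfolding subset.chain_def by auto
  hence "ideal (\<Union>C) R" using chain_Union_is_ideal[of C] C(1) by simp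
  thus "\<Union>C \<in> ?A" using C unfolding subset.chain_def by auto
 qed
 thus thesis using that by(smt (verit) mem_Collect_eq order_trans)
qed

text \<open>An ideal \<open>P\<close> maximal among those missing \<open>M\<close> is prime: if
  neither \<open>a\<close> nor \<open>b\<close> lies in it, then \<open>P + (a)\<close> and
  \<open>P + (b)\<close> both meet \<open>M\<close>, and if \<open>ab\<close> were in
  \<open>P\<close> the product of the two elements found would lie in \<open>P\<close> as well as in
  \<open>M\<close>.\<close>

lemma exists_prime_disjoint:
 assumes I: "ideal I R" and dis: "I Int M = {}" and M: "mult_subset R M"
 obtains P where "primeideal P R" "I <= P" "P Int M = {}"
proof -
 obtain P where P: "ideal P R" "I <= P" "P Int M = {}"
  and max: "!!J. ideal J R ==> P <= J ==> J Int M = {} ==> J = P"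
  using exists_ideal_maximal_disjoint[OF I dis] by blast
 interpret P: ideal P R by fact
 have "primeideal P R"
 proof (rule primeidealI[OF P(1) is_cring])
  show "carrier R ~= P" using P(3) mult_subsetD[OF M] by blast
  fix a b assume ab: "a : carrier R" "b : carrier R" "a *[R] b : P"
  show "a : P | b : P"
  proof (rule ccontr)
   assume n: "~ (a : P | b : P)"
   have meet: "EX p:P. EX r:carrier R. p +[R] r *[R] c : M" if c: "c : carrier R" "c ~: P" for c
   proof -
    obtain J where J: "ideal J R" "P <= J" "c : J"
     "!!x. x : J ==> EX p:P. EX r:carrier R. x = p +[R] r *[R] c"
     using ideal_add_elem[OF P(1) c(1)] by blast
    hence "J Int M ~= {}" using max[of J] c by blast
    thus ?thesis using J(4) by blast
   qed
   obtain p r where 1: "p : P" "r : carrier R" "p +[R] r *[R] a : M" using meet ab n by blast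
   obtain p' r' where 2: "p' : P" "r' : carrier R" "p' +[R] r' *[R] b : M" using meet ab n by blast
   have [simp]: "p : carrier R" "p' : carrier R" using 1 2 P.Icarr by auto
   have e: "(p +[R] r *[R] a) *[R] (p' +[R] r' *[R] b) =
    (p' +[R] r' *[R] b) *[R] p +[R] (r *[R] a *[R] p' +[R] (r *[R] r') *[R] (a *[R] b))"
    using ab(1,2) 1(2) 2(2) \<open>p : carrier R\<close> \<open>p' : carrier R\<close> by algebra
   have "(p' +[R] r' *[R] b) *[R] p : P" "r *[R] a *[R] p' : P" "(r *[R] r') *[R] (a *[R] b) : P"
    using ab 1 2 by(auto intro!: P.I_l_closed)
   hence "(p +[R] r *[R] a) *[R] (p' +[R] r' *[R] b) : P" unfolding e by(intro P.a_closed)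
   thus False using mult_subsetD(3)[OF M 1(3) 2(3)] P(3) by auto
  qed
 qed
 thus thesis using that P by blast
qed

lemma exists_minimal_prime_between:
 assumes Q: "primeideal Q R" "I <= Q"
 obtains P where "minimal_prime_over R I P" "P <= Q"
proof -
 define Ps where "Ps = {P. primeideal P R & I <= P & P <= Q}"
 have PsD: "primeideal P R" "I <= P" "P <= Q" "ideal P R" "P <= carrier R" if "P : Ps" for P
  using that primeideal.axioms(1)[of P R] ideal.Icarr[of P R] unfolding Ps_def by auto
 \<comment> \<open>Zorn's lemma is available for unions of increasing chains, so it is applied to
   complements; the intersection of a chain of primes is again prime.\<close>
 let ?co = "%P. carrier R - P"
 have "EX M:?co ` Ps. ALL X:?co ` Ps. M <= X --> X = M"
 proof (rule subset_Zorn_nonempty)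
  have "Q : Ps" using Q unfolding Ps_def by simp
  thus "?co ` Ps ~= {}" by blast
  fix C assume C: "C ~= {}" "subset.chain (?co ` Ps) C"
  define D where "D = {P : Ps. ?co P : C}"
  have DP: "P : Ps" if "P : D" for P using that unfolding D_def by blast
  have CP: "C <= ?co ` Ps" and Cc: "!!X Y. X : C ==> Y : C ==> X <= Y | Y <= X"
   using C(2) unfolding subset.chain_def by blast+
  have CD: "C = ?co ` D" using CP unfolding D_def by blast
  have Dne: "D ~= {}" using C(1) CD by blast
  have chain: "P <= P' | P' <= P" if "P : D" "P' : D" for P P'
   using Cc[of "?co P" "?co P'"] that PsD(5)[OF DP] unfolding D_def by blast
  have "primeideal (\<Inter>D) R"
  proof (rule primeidealI)
   show "ideal (\<Inter>D) R" using i_Intersect[of D] PsD(4)[OF DP] Dne by blast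
   show "cring R" by(rule is_cring)
   obtain P where P: "P : D" using Dne by blast
   have "1[R] ~: P"
    using primeideal.I_notcarr[OF PsD(1)[OF DP[OF P]]] ideal.one_imp_carrier[OF PsD(4)[OF DP[OF P]]] by metis
   thus "carrier R ~= \<Inter>D" using P by blast
   fix a b assume ab: "a : carrier R" "b : carrier R" "a *[R] b : \<Inter>D"
   show "a : \<Inter>D | b : \<Inter>D"
   proof (rule ccontr)
    assume "~ ?thesis"
    then obtain P P' where P: "P : D" "P' : D" "a ~: P" "b ~: P'" by blast
    obtain P'' where P'': "P'' : D" "a ~: P''" "b ~: P''" using chain[OF P(1,2)] P by blast
    hence "a *[R] b : P''" using ab by blast
    thus False using primeideal.I_prime[OF PsD(1)[OF DP[OF P''(1)]] ab(1,2)] P'' by blast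
   qed
  qed
  moreover have "I <= \<Inter>D" using PsD(2)[OF DP] by blast
  moreover have "\<Inter>D <= Q" using Dne PsD(3)[OF DP] by blast
  ultimately have "\<Inter>D : Ps" unfolding Ps_def by simp
  moreover have "\<Union>C = ?co (\<Inter>D)" unfolding CD by blast
  ultimately show "\<Union>C \<in> ?co ` Ps" by simp
 qed
 then obtain P where P: "P : Ps" and m: "!!X. X : Ps ==> ?co P <= ?co X ==> ?co X = ?co P" by auto
 have "P' = P" if "primeideal P' R" "I <= P'" "P' <= P" for P'
 proof -
  have P': "P' : Ps" using that PsD(3)[OF P] unfolding Ps_def by auto
  have "?co P' = ?co P" by(rule m[OF P']) (use that in blast)
  thus ?thesis using PsD(5)[OF P] PsD(5)[OF P'] by blast
 qed
 thus thesis using that[of P] PsD[OF P] unfolding minimal_prime_over_def by blast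
qed

text \<open>Supplies the correction term of prime avoidance: a product of an element of
  \<open>J\<close> outside \<open>P\<close> with one such element from each ideal of
  \<open>F\<close>.\<close>

lemma prod_notin_prime_in_family:
 assumes "finite F" and J: "ideal J R" and P: "primeideal P R" and nJ: "~ J <= P"
  and F: "!!Q. Q : F ==> ideal Q R & ~ Q <= P"
 shows "EX y:J. y ~: P & (ALL Q:F. y : Q)"
 using assms(1) F
proof (induction F rule: finite_induct)
 case empty thus ?case using nJ by blast
next
 case (insert Q F)
 obtain y where y: "y : J" "y ~: P" "ALL Q:F. y : Q" using insert by blast
 obtain z where z: "z : Q" "z ~: P" "ideal Q R" using insert.prems[of Q] by blast
 have c: "y : carrier R" "z : carrier R" using ideal.Icarr[OF J] ideal.Icarr[OF z(3)] y z by auto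
 have "y *[R] z : J" using ideal.I_r_closed[OF J y(1) c(2)] .
 moreover have "y *[R] z ~: P" using primeideal.I_prime[OF P c] y z by blast
 moreover have "y *[R] z : Q" using ideal.I_l_closed[OF z(3,1) c(1)] .
 moreover have "y *[R] z : Q'" if "Q' : F" for Q'
  using ideal.I_r_closed[of Q' R y z] y insert.prems[of Q'] that c by auto
 ultimately show ?case by blast
qed

text \<open>Induction on \<open>F\<close>: if an element of \<open>J\<close> that is good for
  \<open>F\<close> happens to lie in the new prime \<open>P\<close>, add an element of
  \<open>J\<close> that lies in every prime of \<open>F\<close> but not in \<open>P\<close>. It
  exists because the primes are pairwise incomparable, as minimal primes are.\<close>

lemma prime_avoidance:
 assumes "finite F" and J: "ideal J R"
  and F: "!!P. P : F ==> primeideal P R & ~ J <= P"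
  and anti: "!!P Q. P : F ==> Q : F ==> P <= Q ==> P = Q"
 shows "EX x:J. ALL P:F. x ~: P"
 using assms(1) F anti
proof (induction F rule: finite_induct)
 case empty thus ?case
  using additive_subgroup.zero_closed[OF ideal.axioms(1)[OF J]] by blast
next
 case (insert P F)
 obtain x where x: "x : J" "ALL Q:F. x ~: Q" using insert by blast
 show ?case
 proof (cases "x : P")
  case False thus ?thesis using x by blast
 next
  case True
  have P: "primeideal P R" "~ J <= P" using insert.prems by auto
  obtain y where y: "y : J" "y ~: P" "ALL Q:F. y : Q"
  proof -
   have "ideal Q R & ~ Q <= P" if "Q : F" for Q
    using insert.prems(1)[of Q] insert.prems(2)[of Q P] insert.hyps that primeideal.axioms(1) by blast
   thus thesis using prod_notin_prime_in_family[OF insert.hyps(1) J P] that by blast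
  qed
  have c: "x : carrier R" "y : carrier R" using ideal.Icarr[OF J] x y by auto
  have ad: "a +[R] b ~: Q" if "ideal Q R" "a : Q" "b ~: Q" "b : carrier R" for a b Q
  proof
   interpret Q: ideal Q R by fact
   assume "a +[R] b : Q"
   hence "\<ominus> a +[R] (a +[R] b) : Q" by(intro Q.a_closed[OF Q.a_inv_closed[OF that(2)]])
   hence "b : Q" using that Q.Icarr[of a] by(simp add: r_neg1)
   thus False using that by blast
  qed
  have "x +[R] y : J" using x y J additive_subgroup.a_closed ideal.axioms(1) by metis
  moreover have "x +[R] y ~: P" using ad[OF primeideal.axioms(1)[OF P(1)] True y(2) c(2)] .
  moreover have "x +[R] y ~: Q" if "Q : F" for Q
  proof -
   have "ideal Q R" using insert.prems(1)[of Q] that primeideal.axioms(1) by blast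
   hence "y +[R] x ~: Q" using ad[of Q y x] x y that c by blast
   thus ?thesis using c a_comm by simp
  qed
  ultimately show ?thesis by blast
 qed
qed

text \<open>Inverting this multiplicative set cuts the locus where \<open>M\<close> is invertible
  down to the basic open set of \<open>h\<close>.\<close>

definition denoms :: "'a set => 'a => 'a set" where
 "denoms M h = {w *[R] h ^[R] n |w (n::nat). w : M}"

lemma denoms_mult_subset:
 assumes M: "mult_subset R M" and h: "h : carrier R"
 shows "mult_subset R (denoms M h)"
 unfolding mult_subset_def denoms_def
proof (intro conjI ballI)
 note MD = mult_subsetD[OF M]
 show "{w *[R] h ^[R] n |w (n::nat). w : M} <= carrier R" using MD h by auto
 have "1[R] = 1[R] *[R] h ^[R] (0::nat)" by simp
 thus "1[R] : {w *[R] h ^[R] n |w (n::nat). w : M}" using MD(2) by blast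
 fix a b assume "a : {w *[R] h ^[R] n |w (n::nat). w : M}" "b : {w *[R] h ^[R] n |w (n::nat). w : M}"
 then obtain w n w' n' where e: "a = w *[R] h ^[R] (n::nat)" "b = w' *[R] h ^[R] (n'::nat)" and w: "w : M" "w' : M" by blast
 have "a *[R] b = (w *[R] w') *[R] h ^[R] (n + n')"
  unfolding e using MD(4)[OF w(1)] MD(4)[OF w(2)] h by(simp add: nat_pow_mult[symmetric] m_ac)
 thus "a *[R] b : {w *[R] h ^[R] n |w (n::nat). w : M}" using MD(3)[OF w] by blast
qed

end

section \<open>Local rings\<close>

text \<open>A nonunit generates an ideal without \<open>1\<close>, which lies in an ideal maximal
  for this property; that is a maximal ideal, hence the only one.\<close>

lemma local_ring_nonunits:
 fixes R (structure)
 assumes "local_ring R"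
 shows "max_ideal R = carrier R - Units R" "maximalideal (max_ideal R) R"
proof -
 interpret cring R using assms local_ring_def by blast
 show mx: "maximalideal (max_ideal R) R"
  using assms theI'[of "%I. maximalideal I R"] unfolding local_ring_def max_ideal_def by blast
 interpret m: maximalideal "max_ideal R" R by fact
 show "max_ideal R = carrier R - Units R"
 proof (intro equalityI subsetI)
  fix x assume x: "x : max_ideal R"
  have "x ~: Units R"
  proof
   assume "x : Units R"
   have "inv x *[R] x : max_ideal R" by(rule m.I_l_closed[OF x]) (use \<open>x : Units R\<close> in simp)
   hence "1[R] : max_ideal R" using \<open>x : Units R\<close> by simp
   thus False using m.one_imp_carrier m.I_notcarr by blast
  qed
  thus "x : carrier R - Units R" using x m.Icarr by blast
 next
  fix x assume x: "x : carrier R - Units R"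
  hence id: "ideal (PIdl x) R" using cgenideal_ideal by blast
  have "PIdl x Int {1[R]} = {}"
  proof -
   have "1[R] ~: PIdl x"
   proof
    assume "1[R] : PIdl x"
    then obtain r where "r : carrier R" "1[R] = r *[R] x" unfolding cgenideal_def by blast
    thus False using x m_comm[of r x] unfolding Units_def by auto
   qed
   thus ?thesis by blast
  qed
  then obtain P where P: "ideal P R" "PIdl x <= P" "P Int {1[R]} = {}"
   "!!J. ideal J R ==> P <= J ==> J Int {1[R]} = {} ==> J = P"
   using exists_ideal_maximal_disjoint[OF id] by blast
  have "maximalideal P R"
  proof (rule maximalidealI[OF P(1)])
   show "carrier R ~= P" using P(3) by blast
   fix J assume J: "ideal J R" "P <= J" "J <= carrier R"
   show "J = P | J = carrier R"
    using P(4)[OF J(1,2)] ideal.one_imp_carrier[OF J(1)] by blast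
  qed
  hence "P = max_ideal R" using mx assms unfolding local_ring_def by blast
  thus "x : max_ideal R" using P(2) cgenideal_self[of x] x by blast
 qed
qed

lemma local_ringD:
 fixes R (structure)
 assumes "local_ring R"
 shows "cring R" "0[R] ~= 1[R]" "primeideal (carrier R - Units R) R" 
  "!!x y. x : carrier R ==> y : carrier R ==> x +[R] y : Units R ==> x : Units R | y : Units R"
proof -
 show cr: "cring R" using assms local_ring_def by blast
 interpret cring R by fact
 have e: "max_ideal R = carrier R - Units R" and m: "maximalideal (max_ideal R) R"
  using local_ring_nonunits[OF assms] by auto
 show "primeideal (carrier R - Units R) R" using maximalideal_prime[OF m] e by simp
 have id: "ideal (carrier R - Units R) R" using m e maximalideal.axioms(1) by metis
 show "0[R] ~= 1[R]"
 proof
  assume "0[R] = 1[R]"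
  hence "1[R] : carrier R - Units R" using additive_subgroup.zero_closed[OF ideal.axioms(1)[OF id]] by metis
  thus False by auto
 qed
 show "!!x y. x : carrier R ==> y : carrier R ==> x +[R] y : Units R ==> x : Units R | y : Units R"
  using additive_subgroup.a_closed[OF ideal.axioms(1)[OF id]] by blast
qed

lemma local_ringI:
 fixes R (structure)
 assumes "cring R" "0[R] ~= 1[R]"
  and add: "!!x y. x : carrier R ==> y : carrier R ==> x +[R] y : Units R ==> x : Units R | y : Units R"
 shows "local_ring R"
proof -
 interpret cring R by fact
 let ?N = "carrier R - Units R"
 have prod: "a *[R] x : ?N" if "a : carrier R" "x : ?N" for a x
  using that unit_factor[of x a] m_comm[of a x] by auto
 have zN: "0[R] : ?N" using assms(2) by(auto simp: Units_def)
 have id: "ideal ?N R"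
 proof (rule idealI[OF ring_axioms])
  show "subgroup ?N (add_monoid R)"
  proof (rule add.subgroupI)
   show "?N <= carrier R" by blast
   show "?N ~= {}" using zN by blast
   fix a assume a: "a : ?N"
   have "\<ominus> a = (\<ominus> 1[R]) *[R] a" using a by(simp add: l_minus)
   thus "\<ominus> a : ?N" using prod[OF _ a, of "\<ominus> 1[R]"] by simp
  next
   fix a b assume "a : ?N" "b : ?N"
   thus "a +[R] b : ?N" using add[of a b] by auto
  qed
 next
  fix a x assume *: "a : ?N" "x : carrier R"
  show "x *[R] a : ?N" using prod * by blast
  thus "a *[R] x : ?N" using * m_comm[of a x] by auto
 qed
 have sub: "J <= ?N | J = carrier R" if "ideal J R" for J
 proof -
  interpret J: ideal J R by fact
  { fix u assume u: "u : J" "u : Units R"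
   have "inv u *[R] u : J" by(rule J.I_l_closed[OF u(1)]) (use u in simp)
   hence "J = carrier R" using u J.one_imp_carrier by auto }
  thus ?thesis using J.Icarr by blast
 qed
 have "maximalideal ?N R"
 proof (rule maximalidealI[OF id])
  show "carrier R ~= ?N" by auto
  fix J assume "ideal J R" "?N <= J"
  thus "J = ?N | J = carrier R" using sub[of J] by blast
 qed
 moreover have "I = ?N" if "maximalideal I R" for I
 proof -
  interpret I: maximalideal I R by fact
  have "I <= ?N" using sub[OF I.is_ideal] I.I_notcarr by blast
  thus ?thesis using I.I_maximal[OF id] by auto
 qed
 ultimately show ?thesis unfolding local_ring_def using is_cring by blast
qed

text \<open>Membership in \<open>ring_iso\<close> says nothing about the field \<open>zero\<close>
  of the target record, so its value has to be required; the ring axioms are transported.\<close>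

lemma cring_of_ring_iso:
 assumes "cring R" "h : ring_iso R R'" "0[R'] = h 0[R]"
 shows "cring R'"
proof -
 have "R'(|zero := h 0[R]|) = R'" unfolding assms(3)[symmetric] by simp
 thus ?thesis using cring.ring_iso_imp_img_cring[OF assms(1,2)] by metis
qed

lemma ring_hom_Units:
 assumes "h : ring_hom R R'" "cring R" "cring R'" "x : Units R"
 shows "h x : Units R'"
proof -
 interpret R: cring R by fact
 interpret R': cring R' by fact
 have *: "inv[R] x : carrier R" "x : carrier R" "inv[R] x *[R] x = 1[R]" "x *[R] inv[R] x = 1[R]" using assms by auto
 have "h (inv[R] x) *[R'] h x = 1[R']" "h x *[R'] h (inv[R] x) = 1[R']"
  using ring_hom_mult[OF assms(1)] ring_hom_one[OF assms(1)] * by metis+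
 thus ?thesis using ring_hom_closed[OF assms(1)] * unfolding Units_def by blast
qed

lemma ring_hom_zero': 
 assumes "h : ring_hom R R'" "cring R" "cring R'"
 shows "h 0[R] = 0[R']"
 by(rule ring_hom_zero[OF assms(1) cring.axioms(1)[OF assms(2)] cring.axioms(1)[OF assms(3)]])

lemma ring_iso_Units:
 assumes "h : ring_iso R R'" "cring R" "cring R'" "x : carrier R" "h x : Units R'"
 shows "x : Units R"
proof -
 interpret R: cring R by fact
 interpret R': cring R' by fact
 have h: "h : ring_hom R R'" "bij_betw h (carrier R) (carrier R')" using assms(1) unfolding ring_iso_def by auto
 obtain y where y: "y : carrier R" "h y = inv[R'] (h x)"
  using h(2) assms(5) unfolding bij_betw_def by(metis R'.Units_inv_closed imageE)
 have "h (x *[R] y) = h 1[R]"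
  using y assms ring_hom_mult[OF h(1)] ring_hom_one[OF h(1)] by simp
 hence "x *[R] y = 1[R]" using h(2) y assms(4) unfolding bij_betw_def inj_on_def by simp
 thus ?thesis using y(1) assms(4) R.m_comm[OF assms(4) y(1)] unfolding Units_def by auto
qed

lemma local_ring_of_ring_iso:
 assumes "local_ring R" "h : ring_iso R R'" "0[R'] = h 0[R]"
 shows "local_ring R'"
proof -
 note R = local_ringD[OF assms(1)]
 have R': "cring R'" by(rule cring_of_ring_iso[OF R(1) assms(2,3)])
 interpret R: cring R by fact
 have h: "h : ring_hom R R'" "inj_on h (carrier R)" "h ` carrier R = carrier R'"
  using assms(2) unfolding ring_iso_def bij_betw_def by auto
 show ?thesis
 proof (rule local_ringI[OF R'])
  show "0[R'] ~= 1[R']"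
   using R(2) h(2) assms(3) ring_hom_one[OF h(1)] unfolding inj_on_def by(metis R.one_closed R.zero_closed)
  fix x y assume xy: "x : carrier R'" "y : carrier R'" "x +[R'] y : Units R'"
  obtain a b where ab: "a : carrier R" "x = h a" "b : carrier R" "y = h b" using xy h(3) by blast
  hence "h (a +[R] b) : Units R'" using xy ring_hom_add[OF h(1)] by simp
  hence "a +[R] b : Units R" using ring_iso_Units[OF assms(2) R(1) R'] ab by simp
  thus "x : Units R' | y : Units R'"
   using R(4)[of a b] ab ring_hom_Units[OF h(1) R(1) R'] by blast
 qed
qed

section \<open>Localization\<close>

locale localized = cring R for R (structure) +
 fixes S
 assumes mult: "mult_subset R S"
begin

lemma S_closed [simp, intro]: "x : S ==> x : carrier R"
 and one_S [simp, intro]: "1[R] : S"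
 and mult_S [intro]: "x : S ==> y : S ==> x *[R] y : S"
 using mult_subsetD[OF mult] by auto

abbreviation fr where "fr == fraction R S"
abbreviation L where "L == localization R S"

text \<open>Half of the transitivity of equality of fractions. The witness is \<open>u v b\<close>:
  besides \<open>u\<close> and \<open>v\<close> it contains the denominator \<open>b\<close> of the
  middle fraction, which cannot be cancelled in a ring with zero divisors.\<close>

lemma fr_subset: 
 assumes "a : carrier R" "b : S" "a' : carrier R" "b' : S" "u : S" 
  and e: "u *[R] (a *[R] b') = u *[R] (a' *[R] b)"
 shows "fr a b <= fr a' b'"
proof
 fix p assume "p : fr a b"
 then obtain c d v where p: "p = (c, d)" "c : carrier R" "d : S" "v : S"
  and e': "v *[R] (a *[R] d) = v *[R] (c *[R] b)" unfolding fraction_def by auto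
 have "(u *[R] v *[R] b) *[R] (a' *[R] d) = v *[R] d *[R] (u *[R] (a' *[R] b))"
  using assms p by(simp add: m_ac)
 also have "... = u *[R] b' *[R] (v *[R] (a *[R] d))" using assms(1-5) p(2-4) unfolding e[symmetric] by(simp add: m_ac)
 also have "... = (u *[R] v *[R] b) *[R] (c *[R] b')" using assms(1-5) p(2-4) unfolding e' by(simp add: m_ac)
 finally have "(u *[R] v *[R] b) *[R] (a' *[R] d) = (u *[R] v *[R] b) *[R] (c *[R] b')" .
 moreover have "u *[R] v *[R] b : S" using assms p by blast
 ultimately show "p : fr a' b'" using p unfolding fraction_def by blast
qed

lemma fr_self: "a : carrier R ==> b : S ==> (a, b) : fr a b"
 unfolding fraction_def by blast

lemma fr_eq_iff:
 assumes "a : carrier R" "b : S" "a' : carrier R" "b' : S"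
 shows "fr a b = fr a' b' <-> (EX u:S. u *[R] (a *[R] b') = u *[R] (a' *[R] b))"
proof
 assume "fr a b = fr a' b'"
 hence "(a', b') : fr a b" using fr_self[OF assms(3,4)] by simp
 thus "EX u:S. u *[R] (a *[R] b') = u *[R] (a' *[R] b)" unfolding fraction_def by auto
next
 assume "EX u:S. u *[R] (a *[R] b') = u *[R] (a' *[R] b)"
 thus "fr a b = fr a' b'" using fr_subset assms by(metis equalityI)
qed

lemma fr_eqI:
 assumes "a : carrier R" "b : S" "a' : carrier R" "b' : S" "a *[R] b' = a' *[R] b"
 shows "fr a b = fr a' b'"
 by(intro fr_eq_iff[THEN iffD2] bexI[of _ \<one>]) (use assms in auto)

lemma in_frD:
 assumes "a : carrier R" "b : S" "(c, d) : fr a b"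
 shows "c : carrier R" "d : S" "fr c d = fr a b"
proof -
 show 1: "c : carrier R" "d : S" using assms unfolding fraction_def by auto
 show "fr c d = fr a b" using fr_eq_iff[OF assms(1,2) 1] assms(3) unfolding fraction_def by blast
qed

lemma fr_carrier [simp, intro]: "a : carrier R ==> b : S ==> fr a b : carrier L"
 unfolding localization_def by auto

lemma carrierE:
 assumes "x : carrier L"
 obtains a b where "a : carrier R" "b : S" "x = fr a b"
 using assms unfolding localization_def by auto

lemma one_fr: "1[L] = fr 1[R] 1[R]" and zero_fr: "0[L] = fr 0[R] 1[R]"
 unfolding localization_def by simp_all

text \<open>Operations on classes of fractions are unions over representatives; they collapse once
  the member is shown not to depend on the representatives.\<close>

lemma UN2_const:
 assumes "p : X" "q : Y" "!!a b c d. (a, b) : X ==> (c, d) : Y ==> h a b c d = C"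
 shows "(\<Union>(a, b)\<in>X. \<Union>(c, d)\<in>Y. h a b c d) = C"
 by(intro UN_constant_eq[OF assms(1)] UN_constant_eq[OF assms(2)])
  (auto simp: assms(3) intro!: UN_constant_eq[OF assms(2)])

lemma mult_fr:
 assumes "a : carrier R" "b : S" "c : carrier R" "d : S"
 shows "fr a b *[L] fr c d = fr (a *[R] c) (b *[R] d)"
proof -
 have "(\<Union>(a, b)\<in>fr a b. \<Union>(c, d)\<in>fr c d. fr (a *[R] c) (b *[R] d)) = fr (a *[R] c) (b *[R] d)"
 proof (rule UN2_const[OF fr_self[OF assms(1,2)] fr_self[OF assms(3,4)]])
  fix a' b' c' d' assume *: "(a', b') : fr a b" "(c', d') : fr c d"
  note A = in_frD[OF assms(1,2) *(1)] and C = in_frD[OF assms(3,4) *(2)]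
  obtain u where u: "u : S" "u *[R] (a' *[R] b) = u *[R] (a *[R] b')" using fr_eq_iff[OF A(1,2) assms(1,2)] A(3) by blast
  obtain v where v: "v : S" "v *[R] (c' *[R] d) = v *[R] (c *[R] d')" using fr_eq_iff[OF C(1,2) assms(3,4)] C(3) by blast
  have "u *[R] v *[R] ((a' *[R] c') *[R] (b *[R] d)) = (u *[R] (a' *[R] b)) *[R] (v *[R] (c' *[R] d))"
   using assms A C u(1) v(1) by(simp add: m_ac)
  also have "... = u *[R] v *[R] ((a *[R] c) *[R] (b' *[R] d'))"
   unfolding u v using assms A C u(1) v(1) by(simp add: m_ac)
  finally show "fr (a' *[R] c') (b' *[R] d') = fr (a *[R] c) (b *[R] d)"
   by(intro fr_eq_iff[THEN iffD2] bexI[of _ "u *[R] v"]) (use assms A C u(1) v(1) in auto)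
 qed
 thus ?thesis unfolding localization_def by simp
qed

lemma add_fr:
 assumes "a : carrier R" "b : S" "c : carrier R" "d : S"
 shows "fr a b +[L] fr c d = fr (a *[R] d +[R] c *[R] b) (b *[R] d)"
proof -
 have "(\<Union>(a, b)\<in>fr a b. \<Union>(c, d)\<in>fr c d. fr (a *[R] d +[R] c *[R] b) (b *[R] d)) = fr (a *[R] d +[R] c *[R] b) (b *[R] d)"
 proof (rule UN2_const[OF fr_self[OF assms(1,2)] fr_self[OF assms(3,4)]])
  fix a' b' c' d' assume *: "(a', b') : fr a b" "(c', d') : fr c d"
  note A = in_frD[OF assms(1,2) *(1)] and C = in_frD[OF assms(3,4) *(2)]
  obtain u where u: "u : S" "u *[R] (a' *[R] b) = u *[R] (a *[R] b')" using fr_eq_iff[OF A(1,2) assms(1,2)] A(3) by blast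
  obtain v where v: "v : S" "v *[R] (c' *[R] d) = v *[R] (c *[R] d')" using fr_eq_iff[OF C(1,2) assms(3,4)] C(3) by blast
  have "u *[R] v *[R] ((a' *[R] d' +[R] c' *[R] b') *[R] (b *[R] d))
    = (u *[R] (a' *[R] b)) *[R] (v *[R] d' *[R] d) +[R] (v *[R] (c' *[R] d)) *[R] (u *[R] b' *[R] b)"
   using assms A C u(1) v(1) by(simp add: l_distr r_distr m_ac)
  also have "... = u *[R] v *[R] ((a *[R] d +[R] c *[R] b) *[R] (b' *[R] d'))"
   unfolding u v using assms A C u(1) v(1) by(simp add: l_distr r_distr m_ac)
  finally show "fr (a' *[R] d' +[R] c' *[R] b') (b' *[R] d') = fr (a *[R] d +[R] c *[R] b) (b *[R] d)"
   by(intro fr_eq_iff[THEN iffD2] bexI[of _ "u *[R] v"]) (use assms A C u(1) v(1) in auto)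
 qed
 thus ?thesis unfolding localization_def by simp
qed

lemma cring_L: "cring L"
proof (rule cringI)
 show "abelian_group L"
 proof (rule abelian_groupI)
  fix x y assume "x : carrier L" "y : carrier L"
  then obtain a b c d where x: "a : carrier R" "b : S" "x = fr a b" and y: "c : carrier R" "d : S" "y = fr c d"
   by(metis carrierE)
  show "x +[L] y : carrier L" using x y by(simp add: add_fr mult_S)
  show "x +[L] y = y +[L] x" using x y by(simp add: add_fr a_comm m_comm)
  fix z assume "z : carrier L"
  then obtain e f where z: "e : carrier R" "f : S" "z = fr e f" by(metis carrierE)
  show "x +[L] y +[L] z = x +[L] (y +[L] z)"
  proof -
   have "(a *[R] d +[R] c *[R] b) *[R] f +[R] e *[R] (b *[R] d) = a *[R] (d *[R] f) +[R] (c *[R] f +[R] e *[R] d) *[R] b"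
    using x(1,2) y(1,2) z(1,2) by(simp add: l_distr r_distr m_ac a_assoc)
   thus ?thesis unfolding x(3) y(3) z(3)
    using x(1,2) y(1,2) z(1,2) by(simp add: add_fr mult_S m_assoc)
  qed
 next
  show "0[L] : carrier L" by(simp add: zero_fr)
  fix x assume "x : carrier L"
  then obtain a b where x: "a : carrier R" "b : S" "x = fr a b" by(metis carrierE)
  show "0[L] +[L] x = x" using x by(simp add: zero_fr add_fr)
  have "fr (\<ominus> a *[R] b +[R] a *[R] b) (b *[R] b) = fr 0[R] 1[R]"
   by(rule fr_eqI) (use x in \<open>auto simp: l_minus l_neg\<close>)
  hence "fr (\<ominus> a) b +[L] x = 0[L]" using x by(simp add: zero_fr add_fr)
  thus "EX y:carrier L. y +[L] x = 0[L]" using x by blast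
 qed
 show "comm_monoid L"
 proof (rule comm_monoidI)
  fix x y assume "x : carrier L" "y : carrier L"
  then obtain a b c d where x: "a : carrier R" "b : S" "x = fr a b" and y: "c : carrier R" "d : S" "y = fr c d"
   by(metis carrierE)
  show "x *[L] y : carrier L" using x y by(simp add: mult_fr mult_S)
  show "x *[L] y = y *[L] x" using x y by(simp add: mult_fr m_comm)
  fix z assume "z : carrier L"
  then obtain e f where z: "e : carrier R" "f : S" "z = fr e f" by(metis carrierE)
  show "x *[L] y *[L] z = x *[L] (y *[L] z)" using x y z by(simp add: mult_fr mult_S m_assoc)
 next
  show "1[L] : carrier L" by(simp add: one_fr)
  fix x assume "x : carrier L"
  then obtain a b where x: "a : carrier R" "b : S" "x = fr a b" by(metis carrierE)
  show "1[L] *[L] x = x" using x by(simp add: one_fr mult_fr)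
 qed
 fix x y z assume "x : carrier L" "y : carrier L" "z : carrier L"
 then obtain a b c d e f where x: "a : carrier R" "b : S" "x = fr a b" and y: "c : carrier R" "d : S" "y = fr c d"
  and z: "e : carrier R" "f : S" "z = fr e f" by(metis carrierE)
 have "((a *[R] d +[R] c *[R] b) *[R] e) *[R] (b *[R] f *[R] (d *[R] f))
   = (a *[R] e *[R] (d *[R] f) +[R] c *[R] e *[R] (b *[R] f)) *[R] (b *[R] d *[R] f)"
  using x(1,2) y(1,2) z(1,2) by(simp add: l_distr r_distr m_ac)
 hence "fr ((a *[R] d +[R] c *[R] b) *[R] e) (b *[R] d *[R] f)
   = fr (a *[R] e *[R] (d *[R] f) +[R] c *[R] e *[R] (b *[R] f)) (b *[R] f *[R] (d *[R] f))"
  using x(1,2) y(1,2) z(1,2) by(intro fr_eqI mult_S) auto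
 thus "(x +[L] y) *[L] z = x *[L] z +[L] y *[L] z"
  unfolding x(3) y(3) z(3) using x(1,2) y(1,2) z(1,2) by(simp add: add_fr mult_fr mult_S)
qed

lemma fr_one_hom: "(%r. fr r 1[R]) : ring_hom R L"
 by(rule ring_hom_memI) (auto simp: mult_fr add_fr one_fr)

text \<open>If \<open>ac\<close> lies in \<open>S\<close>, the inverse of \<open>a/b\<close> is
  \<open>bc/ac\<close>. For regular germs, which form a saturated set, the condition becomes
  regularity of \<open>a\<close>.\<close>

lemma fr_Units_iff:
 assumes "a : carrier R" "b : S"
 shows "fr a b : Units L <-> (EX c:carrier R. a *[R] c : S)"
proof
 assume "fr a b : Units L"
 then obtain y where "y : carrier L" "fr a b *[L] y = 1[L]" unfolding Units_def by blast
 then obtain c d where y: "c : carrier R" "d : S" "fr a b *[L] fr c d = 1[L]" by(metis carrierE)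
 hence "fr (a *[R] c) (b *[R] d) = fr 1[R] 1[R]" using assms by(simp add: mult_fr one_fr)
 then obtain u where u: "u : S" "u *[R] (a *[R] c *[R] 1[R]) = u *[R] (1[R] *[R] (b *[R] d))"
  using fr_eq_iff[of "a *[R] c" "b *[R] d" \<one> \<one>] y assms by blast
 hence "a *[R] (u *[R] c) = u *[R] (b *[R] d)" using y assms by(simp add: m_ac)
 hence "a *[R] (u *[R] c) : S" using u y assms by auto
 thus "EX c:carrier R. a *[R] c : S" using u(1) y(1) by blast
next
 assume "EX c:carrier R. a *[R] c : S"
 then obtain c where c: "c : carrier R" "a *[R] c : S" by blast
 interpret L: cring L by(rule cring_L)
 have e: "a *[R] (b *[R] c) = b *[R] (a *[R] c)" using assms c by(simp add: m_ac)
 have bS: "b *[R] (a *[R] c) : S" using assms c by blast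
 have bc: "fr (b *[R] c) (a *[R] c) : carrier L" using assms c by auto
 have "fr a b *[L] fr (b *[R] c) (a *[R] c) = fr (b *[R] (a *[R] c)) (b *[R] (a *[R] c))"
  using assms c e by(simp add: mult_fr)
 also have "... = 1[L]" unfolding one_fr by(rule fr_eqI) (use bS in auto)
 finally have 1: "fr a b *[L] fr (b *[R] c) (a *[R] c) = 1[L]" .
 hence "fr (b *[R] c) (a *[R] c) *[L] fr a b = 1[L]"
  using L.m_comm[OF bc, of "fr a b"] assms by auto
 thus "fr a b : Units L" using 1 bc assms unfolding Units_def by auto
qed

lemma fr_mult_one: "a : carrier R ==> b : S ==> fr a b *[L] fr b 1[R] = fr a 1[R]"
 using fr_eqI[of "a *[R] b" "b *[R] 1[R]" a \<one>] by(simp add: mult_fr)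

lemma fr_one_iso:
 assumes "S <= Units R"
 shows "(%r. fr r 1[R]) : ring_iso R L"
proof -
 have "inj_on (%r. fr r 1[R]) (carrier R)"
 proof (rule inj_onI)
  fix x y assume *: "x : carrier R" "y : carrier R" "fr x 1[R] = fr y 1[R]"
  then obtain u where "u : S" "u *[R] (x *[R] 1[R]) = u *[R] (y *[R] 1[R])" using fr_eq_iff[of x \<one> y \<one>] by blast
  thus "x = y" using assms * Units_l_cancel[of u x y] by auto
 qed
 moreover have "carrier L <= (%r. fr r 1[R]) ` carrier R"
 proof
  fix z assume "z : carrier L"
  then obtain a b where z: "a : carrier R" "b : S" "z = fr a b" by(metis carrierE)
  hence b: "b : Units R" using assms by blast
  hence "fr a b = fr (a *[R] inv b) 1[R]"
   using z by(intro fr_eqI) (auto simp: m_assoc)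
  thus "z : (%r. fr r 1[R]) ` carrier R" using z b by auto
 qed
 ultimately show ?thesis using fr_one_hom unfolding ring_iso_def bij_betw_def by auto
qed

lemma loc_map_fr:
 assumes fi: "fi : ring_hom R R'" and loc': "localized R' S'" and sub: "fi ` S <= S'"
  and ab: "a : carrier R" "b : S"
 shows "loc_map R' S' fi (fr a b) = fraction R' S' (fi a) (fi b)"
proof -
 interpret R': localized R' S' by fact
 have "fraction R' S' (fi c) (fi d) = fraction R' S' (fi a) (fi b)" if cd: "(c, d) : fr a b" for c d
 proof -
  note C = in_frD[OF ab cd]
  obtain u where u: "u : S" "u *[R] (c *[R] b) = u *[R] (a *[R] d)" using fr_eq_iff[OF C(1,2) ab] C(3) by blast
  have cl: "c *[R] b : carrier R" "a *[R] d : carrier R" "u : carrier R" using C ab u by auto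
  have "fi (u *[R] (c *[R] b)) = fi u *[R'] (fi c *[R'] fi b)"
   using ring_hom_mult[OF fi] C ab u cl by(metis S_closed)
  moreover have "fi (u *[R] (a *[R] d)) = fi u *[R'] (fi a *[R'] fi d)"
   using ring_hom_mult[OF fi] C ab u cl by(metis S_closed)
  ultimately have "fi u *[R'] (fi c *[R'] fi b) = fi u *[R'] (fi a *[R'] fi d)" using u(2) by simp
  moreover have "fi u : S'" "fi d : S'" "fi b : S'" using sub u C ab by auto
  ultimately show ?thesis
   using R'.fr_eq_iff[of "fi c" "fi d" "fi a" "fi b"] ring_hom_closed[OF fi] C ab by blast
 qed
 thus ?thesis unfolding loc_map_def by(intro UN_constant_eq[OF fr_self[OF ab]]) auto
qed

end

section \<open>Tensor products\<close>

text \<open>Only closure of the carriers is required, which is exactly what puts the defining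
  relations into the free group. The stalks of \<open>L\<close> thus enter without first being shown
  to be modules.\<close>

locale tensor_pair =
 fixes A :: "'r ring" and M :: "('r, 'm) module" and N :: "('r, 'n) module"
 assumes add_M: "!!m m'. m : carrier M ==> m' : carrier M ==> m +[M] m' : carrier M"
  and add_N: "!!n n'. n : carrier N ==> n' : carrier N ==> n +[N] n' : carrier N"
  and smult_M: "!!r m. r : carrier A ==> m : carrier M ==> r .[M] m : carrier M"
  and smult_N: "!!r n. r : carrier A ==> n : carrier N ==> r .[N] n : carrier N"
begin

abbreviation F where "F == free_Abelian_group (carrier M \<times> carrier N)"
abbreviation K where "K == tensor_kernel A M N"
abbreviation cl where "cl == tensor_class A M N"

lemma F_diff: "x : carrier F ==> y : carrier F ==> x - y : carrier F"
 unfolding carrier_free_Abelian_group_iff by(rule order_trans[OF keys_diff]) simp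

lemma F_add: "x : carrier F ==> y : carrier F ==> x + y : carrier F"
 unfolding carrier_free_Abelian_group_iff by(rule order_trans[OF Poly_Mapping.keys_add]) simp

lemma pair_F: "m : carrier M ==> n : carrier N ==> frag_of (m, n) : carrier F" by simp

lemma rels_carrier: "tensor_rels A M N <= carrier F"
 unfolding tensor_rels_def
 by(safe; intro F_diff pair_F add_M add_N smult_M smult_N)

lemma F_group: "group F" by simp

lemma K_subgroup: "subgroup K F"
 unfolding tensor_kernel_def by(rule group.generate_is_subgroup[OF F_group rels_carrier])

lemma K_F: "x : K ==> x : carrier F"
 using subgroup.mem_carrier[OF K_subgroup] .

lemma K_zero: "0 : K" using subgroup.one_closed[OF K_subgroup] by simp
lemma K_add: "x : K ==> y : K ==> x + y : K" using subgroup.m_closed[OF K_subgroup] by simp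
lemma K_minus: "x : K ==> - x : K"
 using subgroup.m_inv_closed[OF K_subgroup, of x] K_F[of x] by simp
lemma K_diff: "x : K ==> y : K ==> x - y : K"
 using K_add[of x "- y"] K_minus by simp
lemma K_rel: "x : tensor_rels A M N ==> x : K"
 unfolding tensor_kernel_def by(rule generate.incl)

lemma K_rel_M:
 assumes "m : carrier M" "m' : carrier M" "n : carrier N"
 shows "frag_of (m +[M] m', n) - frag_of (m, n) - frag_of (m', n) : K"
 by(rule K_rel) (use assms in \<open>unfold tensor_rels_def, blast\<close>)
lemma K_rel_N:
 assumes "m : carrier M" "n : carrier N" "n' : carrier N"
 shows "frag_of (m, n +[N] n') - frag_of (m, n) - frag_of (m, n') : K"
 by(rule K_rel) (use assms in \<open>unfold tensor_rels_def, blast\<close>)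
lemma K_rel_A:
 assumes "r : carrier A" "m : carrier M" "n : carrier N"
 shows "frag_of (r .[M] m, n) - frag_of (m, r .[N] n) : K"
 by(rule K_rel) (use assms in \<open>unfold tensor_rels_def, blast\<close>)

lemma in_cl_iff: "z : cl x <-> z - x : K"
 unfolding tensor_class_def r_coset_def by(auto intro: bexI[of _ "z - x"])

lemma cl_self: "x : cl x" using K_zero in_cl_iff[of x x] by simp

lemma cl_eq_iff: "cl x = cl y <-> x - y : K"
proof
 assume "cl x = cl y" hence "x : cl y" using cl_self by blast
 thus "x - y : K" using in_cl_iff by blast
next
 assume k: "x - y : K"
 have "z - x : K <-> z - y : K" for z
  using K_add[OF _ k, of "z - x"] K_diff[OF _ k, of "z - y"] by auto
 thus "cl x = cl y" using in_cl_iff by blast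
qed

lemma cl_eqI: "x - y : K ==> cl x = cl y" using cl_eq_iff by blast

lemma tensor_carrier_eq: "tensor_carrier A M N = cl ` carrier F"
 unfolding tensor_carrier_def tensor_class_def FactGroup_def RCOSETS_def by auto

lemma pair_carrier: "m : carrier M ==> n : carrier N ==> cl (frag_of (m, n)) : tensor_carrier A M N"
 unfolding tensor_carrier_eq using pair_F by blast

lemma K_hom:
 assumes G: "group G" and h: "h : hom F G" and rels: "!!x. x : tensor_rels A M N ==> h x = 1[G]"
  and x: "x : K"
 shows "h x = 1[G]"
proof -
 interpret h: group_hom F G h using G h by(simp add: group_hom_def group_hom_axioms_def)
 have s: "subgroup (kernel F G h) F" by(rule h.subgroup_kernel)
 have "tensor_rels A M N <= kernel F G h" using rels rels_carrier unfolding kernel_def by blast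
 hence "K <= kernel F G h"
  unfolding tensor_kernel_def by(rule group.generate_subgroup_incl[OF F_group _ s])
 thus ?thesis using x unfolding kernel_def by auto
qed

text \<open>The universal property of the tensor product: a homomorphism that is balanced on
  generators kills every relation. Tensors are told apart by such maps.\<close>

lemma K_balanced:
 assumes G: "comm_group G" and h: "h : hom F G"
  and p: "!!m n. m : carrier M ==> n : carrier N ==> h (frag_of (m, n)) = p m n"
  and M: "!!m m' n. m : carrier M ==> m' : carrier M ==> n : carrier N ==> p (m +[M] m') n = p m n *[G] p m' n"
  and N: "!!m n n'. m : carrier M ==> n : carrier N ==> n' : carrier N ==> p m (n +[N] n') = p m n *[G] p m n'"
  and A: "!!r m n. r : carrier A ==> m : carrier M ==> n : carrier N ==> p (r .[M] m) n = p m (r .[N] n)"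
  and x: "x : K"
 shows "h x = 1[G]"
proof (rule K_hom[OF _ h _ x])
 interpret G: comm_group G by fact
 show "group G" by(rule G.is_group)
 interpret h: group_hom F G h using G.is_group h by(simp add: group_hom_def group_hom_axioms_def)
 have hd: "h (a - b) = h a *[G] inv[G] (h b)" if "a : carrier F" "b : carrier F" for a b
 proof -
  have e: "a - b = a *[F] inv[F] b" using that by simp
  show ?thesis unfolding e using that h.hom_mult[of a "inv[F] b"] h.hom_inv[of b] h.G.inv_closed[of b] by metis
 qed
 have pc: "p m n : carrier G" if "m : carrier M" "n : carrier N" for m n
  using h.hom_closed[OF pair_F[OF that]] p[OF that] by simp
 fix x assume "x : tensor_rels A M N"
 then consider (1) m m' n where "m : carrier M" "m' : carrier M" "n : carrier N"
   "x = frag_of (m +[M] m', n) - frag_of (m, n) - frag_of (m', n)"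
  | (2) m n n' where "m : carrier M" "n : carrier N" "n' : carrier N"
   "x = frag_of (m, n +[N] n') - frag_of (m, n) - frag_of (m, n')"
  | (3) r m n where "r : carrier A" "m : carrier M" "n : carrier N"
   "x = frag_of (r .[M] m, n) - frag_of (m, r .[N] n)"
  unfolding tensor_rels_def by blast
 thus "h x = 1[G]"
 proof cases
  case 1
  have "h x = p (m +[M] m') n *[G] inv[G] p m n *[G] inv[G] p m' n"
   unfolding 1 by(subst hd hd, intro F_diff pair_F add_M 1, intro pair_F 1)+ (use 1 add_M p hd[OF pair_F pair_F] in simp)
  thus ?thesis using M[OF 1(1,2,3)] pc 1 G.m_comm by(simp add: G.m_ac)
 next
  case 2
  have "h x = p m (n +[N] n') *[G] inv[G] p m n *[G] inv[G] p m n'"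
   unfolding 2 by(subst hd hd, intro F_diff pair_F add_N 2, intro pair_F 2)+ (use 2 add_N p hd[OF pair_F pair_F] in simp)
  thus ?thesis using N[OF 2(1,2,3)] pc 2 by(simp add: G.m_ac)
 next
  case 3
  have "h x = p (r .[M] m) n *[G] inv[G] p m (r .[N] n)"
   unfolding 3 using hd[OF pair_F pair_F] p 3 smult_M smult_N by simp
  thus ?thesis using A[OF 3(1,2,3)] pc 3 smult_N by simp
 qed
qed

text \<open>Maps on tensors are unions over representatives; additivity, together with kernel going
  into kernel, makes the union constant.\<close>

lemma class_map:
 assumes T: "tensor_pair A' M' N'"
  and diff: "!!x y. ps (x - y) = ps x - ps y" and K': "!!x. x : K ==> ps x : tensor_kernel A' M' N'"
 shows "(\<Union>z\<in>cl x. tensor_class A' M' N' (ps z)) = tensor_class A' M' N' (ps x)"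
proof (rule UN_constant_eq[OF cl_self], rule ballI)
 fix z assume "z : cl x"
 thus "tensor_class A' M' N' (ps z) = tensor_class A' M' N' (ps x)"
  using tensor_pair.cl_eqI[OF T] K' diff in_cl_iff by metis
qed

lemma K_frag_extend:
 assumes T: "tensor_pair A' M' N'"
  and p: "!!m n. m : carrier M ==> n : carrier N ==> p (m, n) : carrier (free_Abelian_group (carrier M' \<times> carrier N'))"
  and rM: "!!m m' n. m : carrier M ==> m' : carrier M ==> n : carrier N ==> p (m +[M] m', n) - p (m, n) - p (m', n) : tensor_kernel A' M' N'"
  and rN: "!!m n n'. m : carrier M ==> n : carrier N ==> n' : carrier N ==> p (m, n +[N] n') - p (m, n) - p (m, n') : tensor_kernel A' M' N'"
  and rA: "!!r m n. r : carrier A ==> m : carrier M ==> n : carrier N ==> p (r .[M] m, n) - p (m, r .[N] n) : tensor_kernel A' M' N'"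
  and x: "x : K"
 shows "frag_extend p x : tensor_kernel A' M' N'"
proof -
 interpret T: tensor_pair A' M' N' by fact
 have r: "frag_extend p x : tensor_kernel A' M' N'" if "x : tensor_rels A M N" for x
  using that rM rN rA unfolding tensor_rels_def by(auto simp: frag_extend_diff)
 have "x : generate F (tensor_rels A M N)" using x unfolding tensor_kernel_def .
 thus ?thesis
 proof (induction rule: generate.induct)
  case one thus ?case using T.K_zero by simp
 next
  case (incl h) thus ?case by(rule r)
 next
  case (inv h)
  hence "inv[F] h = - h" using rels_carrier by auto
  thus ?case using T.K_minus[OF r[OF inv]] by(simp add: frag_extend_minus)
 next
  case (eng h1 h2)
  thus ?case using T.K_add by(simp add: frag_extend_add)
 qed
qed

text \<open>The base rings may differ: \<open>f\<close> and \<open>g\<close> are semilinear along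
  \<open>rh\<close>. The comparison of the groups over \<open>S\<close> and over \<eta> takes
  \<open>rh\<close> to be a map of local rings; elsewhere it is the identity.\<close>

lemma tensor_map_pair:
 assumes T: "tensor_pair A' M' N'"
  and f: "!!m. m : carrier M ==> f m : carrier M'" "!!m m'. m : carrier M ==> m' : carrier M ==> f (m +[M] m') = f m +[M'] f m'"
  and g: "!!n. n : carrier N ==> g n : carrier N'" "!!n n'. n : carrier N ==> n' : carrier N ==> g (n +[N] n') = g n +[N'] g n'"
  and rh: "!!r. r : carrier A ==> rh r : carrier A'"
   "!!r m. r : carrier A ==> m : carrier M ==> f (r .[M] m) = rh r .[M'] f m"
   "!!r n. r : carrier A ==> n : carrier N ==> g (r .[N] n) = rh r .[N'] g n"
 shows "tensor_map A' M' N' f g (cl (frag_of (m, n))) = tensor_class A' M' N' (frag_of (f m, g n))"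
proof -
 interpret T: tensor_pair A' M' N' by fact
 let ?p = "%(m, n). frag_of (f m, g n)"
 have "(\<Union>z\<in>cl (frag_of (m, n)). tensor_class A' M' N' (frag_extend ?p z)) = tensor_class A' M' N' (frag_extend ?p (frag_of (m, n)))"
 proof (rule class_map[OF T frag_extend_diff])
  fix x assume "x : K"
  thus "frag_extend ?p x : tensor_kernel A' M' N'"
   by(rule K_frag_extend[OF T, rotated -1])
    (use f g rh T.K_rel_M T.K_rel_N T.K_rel_A in auto)
 qed
 thus ?thesis unfolding tensor_map_def by simp
qed

end

text \<open>Three modules occur because a section of \<open>a^*L\<close> times one of
  \<open>b^*L\<close> is a section of the pullback of \<open>L\<close> along \<open>a + b\<close>;
  the product is the one stored in the record of the last module.\<close>

lemma tensor_mult_pair: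
 fixes A :: "'r ring"
 assumes T1: "tensor_pair A M N1" and T2: "tensor_pair A M N2" and T3: "tensor_pair A M N3"
  and M: "!!m m'. m : carrier M ==> m' : carrier M ==> m *[M] m' : carrier M"
   "!!a b c. a : carrier M ==> b : carrier M ==> c : carrier M ==> (a +[M] b) *[M] c = a *[M] c +[M] b *[M] c"
   "!!a b c. a : carrier M ==> b : carrier M ==> c : carrier M ==> c *[M] (a +[M] b) = c *[M] a +[M] c *[M] b"
   "!!r a c. r : carrier A ==> a : carrier M ==> c : carrier M ==> (r .[M] a) *[M] c = r .[M] (a *[M] c)"
   "!!r a c. r : carrier A ==> a : carrier M ==> c : carrier M ==> c *[M] (r .[M] a) = r .[M] (c *[M] a)"
  and N: "!!m m'. m : carrier N1 ==> m' : carrier N2 ==> m *[N3] m' : carrier N3"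
   "!!a b c. a : carrier N1 ==> b : carrier N1 ==> c : carrier N2 ==> (a +[N1] b) *[N3] c = a *[N3] c +[N3] b *[N3] c"
   "!!a b c. a : carrier N2 ==> b : carrier N2 ==> c : carrier N1 ==> c *[N3] (a +[N2] b) = c *[N3] a +[N3] c *[N3] b"
   "!!r a c. r : carrier A ==> a : carrier N1 ==> c : carrier N2 ==> (r .[N1] a) *[N3] c = r .[N3] (a *[N3] c)"
   "!!r a c. r : carrier A ==> a : carrier N2 ==> c : carrier N1 ==> c *[N3] (r .[N2] a) = r .[N3] (c *[N3] a)"
  and mn: "m : carrier M" "n : carrier N1" "m' : carrier M" "n' : carrier N2"
 shows "tensor_mult A M N3 (tensor_class A M N1 (frag_of (m, n))) (tensor_class A M N2 (frag_of (m', n')))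
  = tensor_class A M N3 (frag_of (m *[M] m', n *[N3] n'))"
proof -
 interpret T1: tensor_pair A M N1 by fact
 interpret T2: tensor_pair A M N2 by fact
 interpret T3: tensor_pair A M N3 by fact
 let ?q = "%m n (m', n'). frag_of (m *[M] m', n *[N3] n')"
 let ?p = "%y (m, n). frag_extend (?q m n) y"
 let ?ps = "%x y. frag_extend (?p y) x"
 have Kdiff: "frag_extend g y - frag_extend g' y - frag_extend g'' y : T3.K"
  if y: "y : carrier T2.F" and r: "!!m' n'. m' : carrier M ==> n' : carrier N2 ==> g (m', n') - g' (m', n') - g'' (m', n') : T3.K"
  for g g' g'' y
 proof -
  have "Poly_Mapping.keys y <= carrier M \<times> carrier N2" using y by simp
  thus ?thesis
  proof (induction y rule: frag_induction)
   case (diff a b)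
   hence "frag_extend g a - frag_extend g' a - frag_extend g'' a - (frag_extend g b - frag_extend g' b - frag_extend g'' b) : T3.K"
    using T3.K_diff by blast
   thus ?case by(simp add: frag_extend_diff algebra_simps)
  qed (use r T3.K_zero in auto)
 qed
 have Kdiff2: "frag_extend g y - frag_extend g' y : T3.K"
  if y: "y : carrier T2.F" and r: "!!m' n'. m' : carrier M ==> n' : carrier N2 ==> g (m', n') - g' (m', n') : T3.K"
  for g g' y
 proof -
  have "Poly_Mapping.keys y <= carrier M \<times> carrier N2" using y by simp
  thus ?thesis
  proof (induction y rule: frag_induction)
   case (diff a b)
   hence "frag_extend g a - frag_extend g' a - (frag_extend g b - frag_extend g' b) : T3.K"
    using T3.K_diff by blast
   thus ?case by(simp add: frag_extend_diff algebra_simps)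
  qed (use r T3.K_zero in auto)
 qed
 have qF: "?q m n z : carrier T3.F" if "m : carrier M" "n : carrier N1" "z : carrier M \<times> carrier N2" for m n z
  using that M(1) N(1) by auto
 have pF: "?p y (m, n) : carrier T3.F" if "y : carrier T2.F" "m : carrier M" "n : carrier N1" for y m n
 proof -
  have "Poly_Mapping.keys (?q m n z) <= carrier M \<times> carrier N3" if "z : Poly_Mapping.keys y" for z
   using qF[OF \<open>m : carrier M\<close> \<open>n : carrier N1\<close>, of z] that \<open>y : carrier T2.F\<close>
   unfolding carrier_free_Abelian_group_iff by blast
  thus ?thesis unfolding carrier_free_Abelian_group_iff prod.case
   by(intro order_trans[OF keys_frag_extend] UN_least)
 qed
 have left: "?ps x y : T3.K" if "x : T1.K" and y: "y : carrier T2.F" for x y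
  using that(1)
  by(rule T1.K_frag_extend[OF T3, rotated -1])
   (use pF[OF y] M N in \<open>auto intro!: Kdiff[OF y] Kdiff2[OF y] simp: T3.K_rel_M T3.K_rel_N T3.K_rel_A\<close>)
 have right: "?ps (frag_of (m, n)) y : T3.K" if "y : T2.K" for y
 proof -
  have "frag_extend (?q m n) y : T3.K"
   using that by(rule T2.K_frag_extend[OF T3, rotated -1])
   (use qF mn M N T3.K_rel_M T3.K_rel_N T3.K_rel_A in auto)
  thus ?thesis by simp
 qed
 have "(\<Union>x\<in>T1.cl (frag_of (m, n)). \<Union>y\<in>T2.cl (frag_of (m', n')). T3.cl (?ps x y)) = T3.cl (?q m n (m', n'))"
 proof (rule UN_constant_eq[OF T1.cl_self], rule ballI, rule UN_constant_eq[OF T2.cl_self], rule ballI)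
  fix x y assume x: "x : T1.cl (frag_of (m, n))" and y: "y : T2.cl (frag_of (m', n'))"
  have kx: "x - frag_of (m, n) : T1.K" and ky: "y - frag_of (m', n') : T2.K"
   using x y T1.in_cl_iff T2.in_cl_iff by auto
  have "y - frag_of (m', n') + frag_of (m', n') : carrier T2.F"
   by(rule T2.F_add[OF T2.K_F[OF ky] T2.pair_F[OF mn(3,4)]])
  hence yF: "y : carrier T2.F" by simp
  \<comment> \<open>The error of changing both representatives is split by additivity in each slot:
    \<open>x\<close> is changed against \<open>y\<close>, then \<open>y\<close> against the pure
    tensor.\<close>
  have "?ps (x - frag_of (m, n)) y + ?ps (frag_of (m, n)) (y - frag_of (m', n')) : T3.K"
   by(rule T3.K_add[OF left[OF kx yF] right[OF ky]])
  hence "?ps x y - ?q m n (m', n') : T3.K" by(simp add: frag_extend_diff)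
  thus "T3.cl (?ps x y) = T3.cl (?q m n (m', n'))" by(rule T3.cl_eqI)
 qed
 thus ?thesis unfolding tensor_mult_def by(simp add: case_prod_beta')
qed

subsection \<open>Tensor products with a free module of rank one\<close>

lemma alg_module_simps [simp]:
 "carrier (alg_module fi B) = carrier B" "x *[alg_module fi B] y = x *[B] y"
 "x +[alg_module fi B] y = x +[B] y" "r .[alg_module fi B] x = fi r *[B] x"
 "1[alg_module fi B] = 1[B]" "0[alg_module fi B] = 0[B]"
 unfolding alg_module_def by simp_all

text \<open>\<open>N\<close> is free on \<open>e\<close> over \<open>A\<close>, expressed through
  the operations of the record only. Then \<open>v \<mapsto> v \<otimes> e\<close> identifies
  \<open>B\<close> with \<open>B \<otimes> N\<close>. The stalks of pullbacks of \<open>L\<close>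
  have this shape, and so do those of the fibre product over generic points.\<close>

locale rank_one = A: cring A + B: cring B for A :: "'r ring" and B :: "'m ring" +
 fixes fi :: "'r => 'm" and N :: "('r, 'n) module" and e :: 'n
 assumes fi: "fi : ring_hom A B"
  and closed: "!!r. r : carrier A ==> r .[N] e : carrier N"
  and gen: "!!n. n : carrier N ==> EX r:carrier A. n = r .[N] e"
  and free: "!!r r'. r : carrier A ==> r' : carrier A ==> r .[N] e = r' .[N] e ==> r = r'"
  and add: "!!r r'. r : carrier A ==> r' : carrier A ==> r .[N] e +[N] r' .[N] e = (r +[A] r') .[N] e"
  and smult: "!!r r'. r : carrier A ==> r' : carrier A ==> r .[N] (r' .[N] e) = (r *[A] r') .[N] e"
  and one: "1[A] .[N] e = e"
begin

lemma e_N: "e : carrier N" using closed[of "1[A]"] one by simp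

abbreviation M where "M == alg_module fi B"

lemma fi_closed [simp]: "r : carrier A ==> fi r : carrier B" by(rule ring_hom_closed[OF fi])

sublocale tensor_pair A "alg_module fi B" N
proof
 show "n +[N] n' : carrier N" if "n : carrier N" "n' : carrier N" for n n'
  using gen[OF that(1)] gen[OF that(2)] add closed A.a_closed by metis
 show "r .[N] n : carrier N" if "r : carrier A" "n : carrier N" for r n
  using gen[OF that(2)] that(1) smult closed A.m_closed by metis
qed auto

lemma cl_smult:
 assumes "v : carrier B" "r : carrier A"
 shows "cl (frag_of (v, r .[N] e)) = cl (frag_of (v *[B] fi r, e))"
proof -
 have "frag_of (r .[M] v, e) - frag_of (v, r .[N] e) : K"
  by(rule K_rel_A) (use assms e_N in auto)
 hence "cl (frag_of (fi r *[B] v, e)) = cl (frag_of (v, r .[N] e))" using cl_eqI by auto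
 thus ?thesis using assms B.m_comm by simp
qed

lemma cl_add:
 assumes "cl x = cl (frag_of (v, e))" "v : carrier B" "b : carrier B" "r : carrier A"
 shows "cl (x + frag_of (b, r .[N] e)) = cl (frag_of (v +[B] b *[B] fi r, e))"
proof (rule cl_eqI)
 have 1: "x - frag_of (v, e) : K" using assms(1) cl_eq_iff by blast
 have 2: "frag_of (b, r .[N] e) - frag_of (b *[B] fi r, e) : K"
  using cl_smult[OF assms(3,4)] cl_eq_iff by blast
 have 3: "frag_of (v +[B] b *[B] fi r, e) - frag_of (v, e) - frag_of (b *[B] fi r, e) : K"
  using K_rel_M[of v "b *[B] fi r" e] assms e_N by simp
 have "(x - frag_of (v, e)) + (frag_of (b, r .[N] e) - frag_of (b *[B] fi r, e))
   - (frag_of (v +[B] b *[B] fi r, e) - frag_of (v, e) - frag_of (b *[B] fi r, e)) : K"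
  by(intro K_add K_diff 1 2 3)
 thus "x + frag_of (b, r .[N] e) - frag_of (v +[B] b *[B] fi r, e) : K"
  by(simp add: algebra_simps)
qed

lemma cl_zero: "cl 0 = cl (frag_of (0[B], e))"
proof (rule cl_eqI)
 have "frag_of (0[B], e) - frag_of (0[B], e) - frag_of (0[B], e) : K"
  using K_rel_M[of "0[B]" "0[B]" e] e_N by simp
 thus "0 - frag_of (0[B], e) : K" by simp
qed

lemma cl_minus:
 assumes "cl x = cl (frag_of (v, e))" "cl y = cl (frag_of (w, e))" "v : carrier B" "w : carrier B"
 shows "cl (x - y) = cl (frag_of (v -[B] w, e))"
proof (rule cl_eqI)
 have 1: "x - frag_of (v, e) : K" "y - frag_of (w, e) : K" using assms cl_eq_iff by blast+
 have "v -[B] w +[B] w = v" using assms by algebra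
 hence 3: "frag_of (v, e) - frag_of (v -[B] w, e) - frag_of (w, e) : K"
  using K_rel_M[of "v -[B] w" w e] assms e_N by simp
 have "(x - frag_of (v, e)) - (y - frag_of (w, e)) + (frag_of (v, e) - frag_of (v -[B] w, e) - frag_of (w, e)) : K"
  by(intro K_add K_diff 1 3)
 thus "x - y - frag_of (v -[B] w, e) : K" by(simp add: algebra_simps)
qed

text \<open>The balanced map \<open>m \<otimes> n \<mapsto> m fi(c n)\<close>, with
  \<open>c n\<close> the coordinate of \<open>n\<close> along \<open>e\<close>, recovers
  \<open>v\<close> from \<open>v \<otimes> e\<close>.\<close>

lemma cl_inj:
 assumes "cl (frag_of (v, e)) = cl (frag_of (w, e))" "v : carrier B" "w : carrier B"
 shows "v = w"
proof -
 define c where "c n = (SOME r. r : carrier A & n = r .[N] e)" for n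
 have c: "c n : carrier A & n = c n .[N] e" if "n : carrier N" for n
  unfolding c_def by(rule someI_ex) (use gen[OF that] in blast)
 have ce: "c (r .[N] e) = r" if "r : carrier A" for r
  using c[OF closed[OF that]] free[OF _ that, of "c (r .[N] e)"] by metis
 define p where "p m n = m *[B] fi (c n)" for m n
 interpret G: comm_group "add_monoid B" by(rule B.a_comm_group)
 have "(%(m, n). p m n) ` (carrier M \<times> carrier N) <= carrier (add_monoid B)"
  using c unfolding p_def by auto
 then obtain h where h: "h : hom F (add_monoid B)" "!!z. z : carrier M \<times> carrier N ==> h (frag_of z) = (%(m, n). p m n) z"
  using comm_group.free_Abelian_group_universal[OF B.a_comm_group] by blast
 interpret h: group_hom F "add_monoid B" h
  by(intro group_hom.intro group_hom_axioms.intro F_group h(1) comm_group.axioms(2)[OF B.a_comm_group])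
 have "frag_of (v, e) - frag_of (w, e) : K" using assms(1) cl_eq_iff by blast
 hence "h (frag_of (v, e) - frag_of (w, e)) = 1[add_monoid B]"
 proof (rule K_balanced[OF B.a_comm_group h(1), rotated -1])
  show "h (frag_of (m, n)) = p m n" if "m : carrier M" "n : carrier N" for m n using h(2) that by simp
  show "p (m +[M] m') n = p m n *[add_monoid B] p m' n" if "m : carrier M" "m' : carrier M" "n : carrier N" for m m' n
   using that c[OF that(3)] unfolding p_def by(simp add: B.l_distr)
  show "p m (n +[N] n') = p m n *[add_monoid B] p m n'" if "m : carrier M" "n : carrier N" "n' : carrier N" for m n n'
  proof -
   have "c (n +[N] n') = c n +[A] c n'" using c[OF that(2)] c[OF that(3)] add ce by(metis A.a_closed)
   thus ?thesis using that c[OF that(2)] c[OF that(3)] unfolding p_def by(simp add: ring_hom_add[OF fi] B.r_distr)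
  qed
  show "p (r .[M] m) n = p m (r .[N] n)" if "r : carrier A" "m : carrier M" "n : carrier N" for r m n
  proof -
   have "c (r .[N] n) = r *[A] c n" using c[OF that(3)] smult ce that(1) by(metis A.m_closed)
   thus ?thesis using that c[OF that(3)] unfolding p_def by(simp add: ring_hom_mult[OF fi] B.m_ac)
  qed
 qed
 moreover have "h (frag_of (v, e) - frag_of (w, e)) = h (frag_of (v, e)) *[add_monoid B] inv[add_monoid B] h (frag_of (w, e))"
 proof -
  have F: "frag_of (v, e) : carrier F" "frag_of (w, e) : carrier F" using assms e_N by auto
  have "frag_of (v, e) - frag_of (w, e) = frag_of (v, e) *[F] inv[F] frag_of (w, e)" using F by simp
  thus ?thesis using h.hom_mult[OF F(1) h.G.inv_closed[OF F(2)]] h.hom_inv[OF F(2)] by metis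
 qed
 moreover have "h (frag_of (v, e)) = v" "h (frag_of (w, e)) = w"
  using h(2)[of "(v, e)"] h(2)[of "(w, e)"] ce[of "1[A]"] one assms e_N ring_hom_one[OF fi] unfolding p_def by auto
 ultimately have "v +[B] (-[B] w) = 0[B]" by(simp add: a_inv_def)
 thus "v = w" using assms(2,3) B.minus_eq B.r_right_minus_eq by metis
qed

lemma carrier_cl:
 assumes "X : tensor_carrier A M N"
 obtains v where "v : carrier B" "X = cl (frag_of (v, e))"
proof -
 obtain x where x: "Poly_Mapping.keys x <= carrier M \<times> carrier N" "X = cl x"
  using assms unfolding tensor_carrier_eq by auto
 have "EX v:carrier B. cl x = cl (frag_of (v, e))" using x(1)
 proof (induction x rule: frag_induction)
  case zero thus ?case using cl_zero by blast
 next
  case (one z)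
  then obtain m n where z: "z = (m, n)" "m : carrier B" "n : carrier N" by auto
  obtain r where "r : carrier A" "n = r .[N] e" using gen z by blast
  thus ?case using cl_smult[of m r] z by(metis B.m_closed fi_closed)
 next
  case (diff a b) thus ?case using cl_minus B.minus_closed by metis
 qed
 thus thesis using that x by blast
qed

end

section \<open>Germs of sections\<close>

abbreviation near :: "('a, 'r) ringed_space => 'a => 'a filter" where
 "near X x == nhdsin (spc X) x"

abbreviation (input) "evn X x P \<equiv> eventually P (near X x)"

text \<open>\<open>s\<close> is a section in some neighbourhood of \<open>x\<close>; its values elsewhere are arbitrary.\<close>

definition lsec :: "('a, 'r) ringed_space => 'a => ('a => 'r) => bool" where
 "lsec X x s <-> (EX V. opn X V & x : V & restrict s V : sections X V)"

lemma nearI: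
 assumes "opn X V" "x : V" "!!y. y : V ==> P y"
 shows "evn X x P"
 using assms unfolding eventually_nhdsin by blast

lemma nearE:
 assumes "evn X x P" "x : points X"
 obtains V where "opn X V" "x : V" "ALL y:V. P y"
 using assms unfolding eventually_nhdsin by blast

lemma near_self: "evn X x P ==> x : points X ==> P x"
 by(auto elim: nearE)

lemma near_near: "evn X x P ==> evn X x (%y. evn X y P)"
 unfolding eventually_nhdsin by blast

lemma near_points: "evn X x (%y. y : points X)"
 unfolding eventually_nhdsin using openin_topspace by blast

lemma near_open: "opn X V ==> x : V ==> evn X x (%y. y : V)"
 by(rule nearI)

lemma open_of_near:
 assumes "!!x. x : U ==> x : points X & evn X x (%y. y : U)"
 shows "opn X U"
 unfolding openin_subopen[of _ U]
proof
 fix x assume "x : U"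
 then obtain V where "opn X V" "x : V" "ALL y:V. y : U"
  using assms nearE by metis
 thus "EX T. opn X T & x : T & T <= U" by blast
qed

lemma lsecI: "opn X V ==> x : V ==> restrict s V : sections X V ==> lsec X x s"
 unfolding lsec_def by blast

lemma lsecE:
 assumes "lsec X x s"
 obtains V where "opn X V" "x : V" "restrict s V : sections X V"
 using assms unfolding lsec_def by blast

lemma lsec_points: "lsec X x s ==> x : points X"
 using openin_subset unfolding lsec_def by blast

lemma lsec_near: "lsec X x s ==> evn X x (%y. lsec X y s)"
 unfolding eventually_nhdsin lsec_def by blast

locale sheaf =
 fixes X :: "('a, 'r) ringed_space" and E
 assumes sheaf: "sheaf_on (spc X) E (sections X)"
begin

lemma sections_sub: "opn X U ==> sections X U <= (\<Pi>\<^sub>E x\<in>U. E x)"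
 and sections_restrict: "opn X U ==> opn X V ==> V <= U ==> s : sections X U ==> restrict s V : sections X V"
 and sections_glue: "opn X U ==> s : (\<Pi>\<^sub>E x\<in>U. E x) ==>
  (!!x. x : U ==> EX V. opn X V & x : V & V <= U & restrict s V : sections X V) ==> s : sections X U"
 and sections_ex: "x : points X ==> e : E x ==> EX U s. opn X U & x : U & s : sections X U & s x = e"
 and sections_eq: "opn X U ==> s : sections X U ==> t : sections X U ==> x : U ==> s x = t x ==>
  EX V. opn X V & x : V & V <= U & (ALL y:V. s y = t y)"
proof -
 note s1 = sheaf[unfolded sheaf_on_def, THEN conjunct1]
  and s2 = sheaf[unfolded sheaf_on_def, THEN conjunct2, THEN conjunct1]
  and s3 = sheaf[unfolded sheaf_on_def, THEN conjunct2, THEN conjunct2, THEN conjunct1]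
  and s4 = sheaf[unfolded sheaf_on_def, THEN conjunct2, THEN conjunct2, THEN conjunct2, THEN conjunct1]
  and s5 = sheaf[unfolded sheaf_on_def, THEN conjunct2, THEN conjunct2, THEN conjunct2, THEN conjunct2]
 show "opn X U ==> sections X U <= (\<Pi>\<^sub>E x\<in>U. E x)" using s1 by blast
 show "opn X U ==> opn X V ==> V <= U ==> s : sections X U ==> restrict s V : sections X V"
  using s2[rule_format, of U V s] by simp
 show "opn X U ==> s : (\<Pi>\<^sub>E x\<in>U. E x) ==>
  (!!x. x : U ==> EX V. opn X V & x : V & V <= U & restrict s V : sections X V) ==> s : sections X U"
  using s3[rule_format, of U s] by blast
 show "x : points X ==> e : E x ==> EX U s. opn X U & x : U & s : sections X U & s x = e"
  using s4[rule_format, of x e] by simp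
 show "opn X U ==> s : sections X U ==> t : sections X U ==> x : U ==> s x = t x ==>
  EX V. opn X V & x : V & V <= U & (ALL y:V. s y = t y)"
  using s5[rule_format, of U s t x] by simp
qed

lemma lsec_carrier: "lsec X x s ==> s x : E x"
proof (erule lsecE)
 fix V assume "opn X V" "x : V" "restrict s V : sections X V"
 hence "restrict s V x : E x" using sections_sub[of V] PiE_mem by blast
 thus "s x : E x" using \<open>x : V\<close> by simp
qed

lemma lsec_restrict:
 assumes "opn X V" "restrict s V : sections X V" "opn X W" "W <= V"
 shows "restrict s W : sections X W"
 using sections_restrict[OF assms(1,3,4,2)] assms(4) by(simp add: restrict_restrict Int_absorb1)

lemma lsec_cong:
 assumes "lsec X x s" "evn X x (%y. s y = t y)"
 shows "lsec X x t"
proof -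
 obtain V where V: "opn X V" "x : V" "restrict s V : sections X V" using assms(1) by(rule lsecE)
 obtain W where W: "opn X W" "x : W" "ALL y:W. s y = t y"
  using assms(2) lsec_points[OF assms(1)] by(rule nearE)
 have "restrict s (V Int W) : sections X (V Int W)" by(rule lsec_restrict[OF V(1,3)]) (use V W in auto)
 moreover have "restrict s (V Int W) = restrict t (V Int W)" using W(3) by(auto simp: restrict_def)
 ultimately show ?thesis using V W by(intro lsecI[of X "V Int W"]) auto
qed

lemma lsec_eq:
 assumes "lsec X x s" "lsec X x t" "s x = t x"
 shows "evn X x (%y. s y = t y)"
proof -
 obtain V where V: "opn X V" "x : V" "restrict s V : sections X V" using assms(1) by(rule lsecE)
 obtain W where W: "opn X W" "x : W" "restrict t W : sections X W" using assms(2) by(rule lsecE)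
 have o: "opn X (V Int W)" using V W by blast
 have "restrict s (V Int W) : sections X (V Int W)" by(rule lsec_restrict[OF V(1,3) o]) auto
 moreover have "restrict t (V Int W) : sections X (V Int W)" by(rule lsec_restrict[OF W(1,3) o]) auto
 ultimately obtain V' where V': "opn X V'" "x : V'" "V' <= V Int W"
  "ALL y:V'. restrict s (V Int W) y = restrict t (V Int W) y"
  using sections_eq[OF o, of "restrict s (V Int W)" "restrict t (V Int W)" x] V W assms(3) by auto
 show ?thesis
 proof (rule nearI[OF V'(1,2)])
  fix y assume "y : V'" thus "s y = t y" using V'(3,4) by(metis restrict_apply' subsetD)
 qed
qed

lemma lsec_exists:
 assumes "x : points X" "e : E x"
 obtains s where "lsec X x s" "s x = e"
proof -
 obtain U s where U: "opn X U" "x : U" "s : sections X U" "s x = e" using sections_ex[OF assms] by blast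
 have "restrict s U = s" using subsetD[OF sections_sub[OF U(1)] U(3)] by(simp add: PiE_def extensional_restrict)
 hence "lsec X x s" using U by(intro lsecI[OF U(1,2)]) simp
 thus thesis using that U(4) by blast
qed

text \<open>Allows sheaf arguments to be made germ by germ: membership in the sections over an open
  set becomes a condition at each point.\<close>

lemma sections_iff:
 assumes V: "opn X V"
 shows "s : sections X V <-> s : extensional V & (ALL x:V. lsec X x s)"
proof (intro iffI conjI ballI)
 assume s: "s : sections X V"
 thus "s : extensional V" using sections_sub[OF V] by(auto simp: PiE_def)
 hence "restrict s V = s" by(rule extensional_restrict)
 thus "lsec X x s" if "x : V" for x using that V s by(intro lsecI[OF V]) auto
next
 assume *: "s : extensional V & (ALL x:V. lsec X x s)"
 show "s : sections X V"
 proof (rule sections_glue[OF V])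
  show "s : (\<Pi>\<^sub>E x\<in>V. E x)" using * lsec_carrier by(auto simp: PiE_def)
  fix x assume x: "x : V"
  then obtain W where W: "opn X W" "x : W" "restrict s W : sections X W" using * by(metis lsecE)
  have "restrict s (V Int W) : sections X (V Int W)" by(rule lsec_restrict[OF W(1,3)]) (use V W in auto)
  thus "EX W. opn X W & x : W & W <= V & restrict s W : sections X W"
   using V W x by(intro exI[of _ "V Int W"]) auto
 qed
qed

lemma restrict_sections:
 assumes V: "opn X V" and s: "!!x. x : V ==> lsec X x s"
 shows "restrict s V : sections X V"
 unfolding sections_iff[OF V]
proof (intro conjI ballI)
 fix x assume x: "x : V"
 show "lsec X x (restrict s V)"
  by(rule lsec_cong[OF s[OF x]]) (rule nearI[OF V x], simp)
qed simp

lemma sections_lsec: "opn X V ==> s : sections X V ==> x : V ==> lsec X x s"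
 using sections_iff by blast

end

locale ringed = sheaf X "%x. carrier X@@x" for X :: "('a, 'r) ringed_space" +
 assumes stalk_cring: "x : points X ==> cring X@@x"
  and ringed: "is_ringed_space X"

lemma ringedI: "is_ringed_space X ==> ringed X"
 unfolding ringed_def ringed_axioms_def sheaf_def is_ringed_space_def by blast

context ringed
begin

lemma sections_one: "opn X U ==> (\<lambda>x\<in>U. 1[X@@x]) : sections X U"
 and sections_neg: "opn X U ==> s : sections X U ==> (\<lambda>x\<in>U. -[X@@x] s x) : sections X U"
 and sections_add: "opn X U ==> s : sections X U ==> t : sections X U ==> (\<lambda>x\<in>U. s x +[X@@x] t x) : sections X U"
 and sections_mult: "opn X U ==> s : sections X U ==> t : sections X U ==> (\<lambda>x\<in>U. s x *[X@@x] t x) : sections X U"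
 using ringed unfolding is_ringed_space_def by blast+

lemma lsec_one: "x : points X ==> lsec X x (%y. 1[X@@y])"
 using sections_one[OF openin_topspace] by(intro lsecI[OF openin_topspace])

lemma lsec_neg:
 assumes "lsec X x s" shows "lsec X x (%y. -[X@@y] s y)"
proof -
 obtain V where V: "opn X V" "x : V" "restrict s V : sections X V" using assms by(rule lsecE)
 have "(\<lambda>y\<in>V. -[X@@y] restrict s V y) = (\<lambda>y\<in>V. -[X@@y] s y)" by auto
 thus ?thesis using sections_neg[OF V(1,3)] V by(intro lsecI[OF V(1,2)]) simp
qed

lemma lsec_common:
 assumes "lsec X x s" "lsec X x t"
 obtains V where "opn X V" "x : V" "restrict s V : sections X V" "restrict t V : sections X V"
proof -
 obtain V where V: "opn X V" "x : V" "restrict s V : sections X V" using assms(1) by(rule lsecE)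
 obtain W where W: "opn X W" "x : W" "restrict t W : sections X W" using assms(2) by(rule lsecE)
 have o: "opn X (V Int W)" using V W by blast
 show thesis
  by(rule that[OF o _ lsec_restrict[OF V(1,3) o] lsec_restrict[OF W(1,3) o]]) (use V W in auto)
qed

lemma lsec_add:
 assumes "lsec X x s" "lsec X x t" shows "lsec X x (%y. s y +[X@@y] t y)"
proof -
 obtain V where V: "opn X V" "x : V" "restrict s V : sections X V" "restrict t V : sections X V"
  using assms by(rule lsec_common)
 have "(\<lambda>y\<in>V. restrict s V y +[X@@y] restrict t V y) = (\<lambda>y\<in>V. s y +[X@@y] t y)" by auto
 thus ?thesis using sections_add[OF V(1,3,4)] V by(intro lsecI[OF V(1,2)]) simp
qed

lemma lsec_mult:
 assumes "lsec X x s" "lsec X x t" shows "lsec X x (%y. s y *[X@@y] t y)"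
proof -
 obtain V where V: "opn X V" "x : V" "restrict s V : sections X V" "restrict t V : sections X V"
  using assms by(rule lsec_common)
 have "(\<lambda>y\<in>V. restrict s V y *[X@@y] restrict t V y) = (\<lambda>y\<in>V. s y *[X@@y] t y)" by auto
 thus ?thesis using sections_mult[OF V(1,3,4)] V by(intro lsecI[OF V(1,2)]) simp
qed

lemma lsec_zero: assumes "x : points X" shows "lsec X x (%y. 0[X@@y])"
proof (rule lsec_cong)
 show "lsec X x (%y. 1[X@@y] +[X@@y] (-[X@@y] 1[X@@y]))"
  using lsec_add lsec_neg lsec_one assms by blast
 show "evn X x (%y. 1[X@@y] +[X@@y] (-[X@@y] 1[X@@y]) = 0[X@@y])"
 proof (rule eventually_mono[OF near_points])
  fix y assume "y : points X"
  then interpret cring "X@@y" by(rule stalk_cring)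
  show "1[X@@y] +[X@@y] (-[X@@y] 1[X@@y]) = 0[X@@y]" by(simp add: r_neg)
 qed
qed

lemma lsec_pow:
 assumes "lsec X x s" shows "lsec X x (%y. s y ^[X@@y] (n::nat))"
proof (induction n)
 case 0
 have "(%y. s y ^[X@@y] (0::nat)) = (%y. 1[X@@y])" by(auto simp: nat_pow_def)
 thus ?case using lsec_one[OF lsec_points[OF assms]] by simp
next
 case (Suc n)
 have "(%y. s y ^[X@@y] Suc n) = (%y. s y ^[X@@y] n *[X@@y] s y)" by(auto simp: nat_pow_def)
 thus ?case using lsec_mult[OF Suc assms] by simp
qed

text \<open>A section with the inverse germ is an inverse wherever the product equals
  \<open>1\<close>, that is, near \<open>x\<close>.\<close>

lemma lsec_unit_near:
 assumes s: "lsec X x s" and u: "s x : Units X@@x"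
 shows "evn X x (%y. s y : Units X@@y)"
  and "lsec X x (%y. inv[X@@y] s y)"
proof -
 have x: "x : points X" by(rule lsec_points[OF s])
 interpret Rx: cring "X@@x" by(rule stalk_cring[OF x])
 obtain t where t: "lsec X x t" "t x = inv[X@@x] s x" using lsec_exists[OF x Rx.Units_inv_closed[OF u]] by blast
 have "evn X x (%y. s y *[X@@y] t y = 1[X@@y])"
  by(rule lsec_eq[OF lsec_mult[OF s t(1)] lsec_one[OF x]]) (use t u in simp)
 with lsec_near[OF s] lsec_near[OF t(1)] near_points[of X x]
 have ev: "evn X x (%y. s y : Units X@@y & t y = inv[X@@y] s y)"
 proof eventually_elim
  case (elim y)
  interpret cring "X@@y" by(rule stalk_cring) fact
  have c: "s y : carrier X@@y" "t y : carrier X@@y" using elim lsec_carrier by auto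
  hence "t y *[X@@y] s y = 1[X@@y]" using elim m_comm by metis
  thus ?case using elim c inv_char[of "s y" "t y"] unfolding Units_def by auto
 qed
 thus "evn X x (%y. s y : Units X@@y)" by(rule eventually_mono) blast
 show "lsec X x (%y. inv[X@@y] s y)" by(rule lsec_cong[OF t(1)]) (use ev in \<open>auto elim: eventually_mono\<close>)
qed

end

subsection \<open>Pullback of sections\<close>

lemma lrs_homD:
 assumes "lrs_hom X Y f"
 shows "continuous_map (spc X) (spc Y) (pt f)" "pt f : extensional (points X)" "cm f : extensional (points X)"
  and "!!x. x : points X ==> cm f x : ring_hom Y@@(f$x) X@@x"
  and "!!x. x : points X ==> cm f x : extensional (carrier Y@@(f$x))"
  and "!!x. x : points X ==> cm f x ` max_ideal Y@@(f$x) <= max_ideal X@@x"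
  and "!!V s. opn Y V ==> s : sections Y V ==> 
   (\<lambda>x\<in>{x : points X. f$x : V}. cm f x (s f$x)) : sections X {x : points X. f$x : V}"
  and "!!x. x : points X ==> f$x : points Y"
proof -
 show c: "continuous_map (spc X) (spc Y) (pt f)" using assms unfolding lrs_hom_def by blast
 show "!!x. x : points X ==> f$x : points Y" using c unfolding continuous_map_def by blast
qed (use assms in \<open>unfold lrs_hom_def, blast\<close>)+

lemma near_pullback:
 assumes f: "continuous_map (spc X) (spc Y) f" and x: "x : points X" and P: "evn Y (f x) P"
 shows "evn X x (%x. P (f x))"
proof -
 have fx: "f x : points Y" using f x unfolding continuous_map_def by blast
 obtain V where V: "opn Y V" "f x : V" "ALL y:V. P y" using P fx by(rule nearE)
 show ?thesis
  by(rule nearI[of X "{x : points X. f x : V}"]) (use V x openin_continuous_map_preimage[OF f V(1)] in auto)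
qed

lemma lsec_pullback:
 assumes f: "lrs_hom X Y f" and x: "x : points X" and s: "lsec Y f$x s"
 shows "lsec X x (%x. cm f x (s f$x))"
proof -
 obtain V where V: "opn Y V" "f$x : V" "restrict s V : sections Y V" using s by(rule lsecE)
 let ?W = "{x : points X. f$x : V}"
 have "opn X ?W" using openin_continuous_map_preimage[OF lrs_homD(1)[OF f] V(1)] .
 moreover have "(\<lambda>x\<in>?W. cm f x (restrict s V f$x)) = (\<lambda>x\<in>?W. cm f x (s f$x))" by auto
 hence "(\<lambda>x\<in>?W. cm f x (s f$x)) : sections X ?W" using lrs_homD(7)[OF f V(1,3)] by simp
 ultimately show ?thesis using V x by(intro lsecI[of X ?W]) auto
qed

lemma lrs_hom_units:
 assumes f: "lrs_hom X Y f" and x: "x : points X"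
  and l: "local_ring X@@x" "local_ring Y@@(f$x)" and r: "r : carrier Y@@(f$x)"
 shows "cm f x r : Units X@@x <-> r : Units Y@@(f$x)"
proof
 assume "cm f x r : Units X@@x"
 thus "r : Units Y@@(f$x)"
  using lrs_homD(6)[OF f x] local_ring_nonunits(1)[OF l(1)] local_ring_nonunits(1)[OF l(2)] r by blast
next
 assume "r : Units Y@@(f$x)"
 thus "cm f x r : Units X@@x"
  using ring_hom_Units[OF lrs_homD(4)[OF f x]] local_ringD(1)[OF l(1)] local_ringD(1)[OF l(2)] by blast
qed

subsection \<open>Sheaves given locally\<close>

lemma locally_given_PiE: "s : locally_given X E B W ==> s : (\<Pi>\<^sub>E x\<in>W. E x)"
 unfolding locally_given_def by simp

lemma locally_givenD:
 "s : locally_given X E B W ==> x : W ==>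
  EX V ta. openin X V & x : V & V <= W & ta : B V & (ALL y:V. s y = ta y)"
 unfolding locally_given_def by simp

lemma lsec_locally_givenD:
 assumes "sections X = locally_given (spc X) E B" "lsec X x s"
 obtains V ta where "opn X V" "x : V" "ta : B V" "!!y. y : V ==> s y = ta y" "!!y. y : V ==> s y : E y"
proof -
 obtain W where W: "opn X W" "x : W" "restrict s W : locally_given (spc X) E B W"
  using assms unfolding lsec_def by auto
 then obtain V ta where V: "opn X V" "x : V" "V <= W" "ta : B V" "ALL y:V. restrict s W y = ta y"
  using locally_givenD[OF W(3,2)] by blast
 have "restrict s W y : E y" if "y : V" for y using PiE_mem[OF locally_given_PiE[OF W(3)]] V(3) that by blast
 hence E: "s y : E y" if "y : V" for y using V(3) that by(metis restrict_apply' subsetD)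
 have "s y = ta y" if "y : V" for y using V(3,5) that by(metis restrict_apply' subsetD)
 thus thesis using that[OF V(1,2,4)] E by blast
qed

lemma locally_givenI:
 assumes "s : extensional W" 
  "!!x. x : W ==> EX V ta. openin X V & x : V & V <= W & ta : B V & (ALL y:V. s y = ta y & s y : E y)"
 shows "s : locally_given X E B W"
proof -
 have "s x : E x" if "x : W" for x using assms(2)[OF that] by auto
 hence "s : (\<Pi>\<^sub>E x\<in>W. E x)" using assms(1) by(simp add: PiE_def)
 moreover have "EX V ta. openin X V & x : V & V <= W & ta : B V & (ALL y:V. s y = ta y)" if "x : W" for x
  using assms(2)[OF that] by meson
 ultimately show ?thesis unfolding locally_given_def by simp
qed

lemma lsec_locally_givenI:
 assumes "sections X = locally_given (spc X) E B"
  "opn X V" "x : V" "ta : B V" "!!y. y : V ==> s y = ta y" "!!y. y : V ==> s y : E y"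
 shows "lsec X x s"
proof (rule lsecI[OF assms(2,3)])
 show "restrict s V : sections X V" unfolding assms(1)
  by(rule locally_givenI) (use assms(2-6) in auto)
qed

text \<open>Gluing comes for free for families given locally. What has to be supplied is stability
  of the local shapes under shrinking, enough germs, and that equality at a point spreads to a
  neighbourhood.\<close>

lemma sheaf_locally_given:
 assumes sec: "sections X = locally_given (spc X) E B"
  and mono: "!!V W ta. opn X V ==> opn X W ==> W <= V ==> ta : B V ==> EX ta':B W. ALL y:W. ta' y = ta y"
  and ex: "!!x e. x : points X ==> e : E x ==> EX s. lsec X x s & s x = e"
  and eq: "!!x s t. lsec X x s ==> lsec X x t ==> s x = t x ==> evn X x (%y. s y = t y)"
 shows "sheaf X E"
proof
 have sub: "sections X U <= (\<Pi>\<^sub>E x\<in>U. E x)" for U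
  unfolding sec using locally_given_PiE by(rule subsetI)
 have res: "restrict s V : sections X V" if VU: "opn X V" "V <= U" "s : sections X U" for U V s
  unfolding sec
 proof (rule locally_givenI)
  fix x assume x: "x : V"
  then obtain W ta where W: "opn X W" "x : W" "W <= U" "ta : B W" "ALL y:W. s y = ta y"
   using locally_givenD[OF VU(3)[unfolded sec], of x] VU(2) by blast
  obtain ta' where "ta' : B (V Int W)" "ALL y:V Int W. ta' y = ta y"
   using mono[OF W(1) _ _ W(4), of "V Int W"] VU(1) W(1) by blast
  moreover have "ALL y:V. s y : E y" using PiE_mem[OF subsetD[OF sub VU(3)]] VU(2) by blast
  ultimately show "EX W ta. opn X W & x : W & W <= V & ta : B W & (ALL y:W. restrict s V y = ta y & restrict s V y : E y)"
   using W x VU(1) by(intro exI[of _ "V Int W"] exI[of _ ta']) auto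
 qed simp
 show "sheaf_on (spc X) E (sections X)"
  unfolding sheaf_on_def
 proof (intro conjI allI impI ballI; (elim conjE)?)
  show "sections X U <= (\<Pi>\<^sub>E x\<in>U. E x)" for U by(rule sub)
  show "restrict s V : sections X V" if "opn X V" "V <= U" "s : sections X U" for U V s
   by(rule res[OF that])
  fix U s assume U: "opn X U" "s : (\<Pi>\<^sub>E x\<in>U. E x)"
   "ALL x:U. EX V. opn X V & x : V & V <= U & restrict s V : sections X V"
  show "s : sections X U" unfolding sec
  proof (rule locally_givenI)
   show "s : extensional U" using U(2) by(simp add: PiE_def)
   fix x assume x: "x : U"
   then obtain V where V: "opn X V" "x : V" "V <= U" "restrict s V : sections X V" using U(3) by blast
   then obtain W ta where W: "opn X W" "x : W" "W <= V" "ta : B W" "ALL y:W. restrict s V y = ta y"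
    using locally_givenD[OF V(4)[unfolded sec] V(2)] by blast
   hence "ALL y:W. s y = ta y" by(metis restrict_apply' subsetD)
   moreover have "ALL y:W. s y : E y" using PiE_mem[OF U(2)] V(3) W(3) by blast
   ultimately show "EX V ta. opn X V & x : V & V <= U & ta : B V & (ALL y:V. s y = ta y & s y : E y)"
    using V(3) W(1-4) by(intro exI[of _ W] exI[of _ ta]) auto
  qed
 next
  fix x e assume "x : points X" "e : E x"
  then obtain s where s: "lsec X x s" "s x = e" using ex by blast
  obtain V where "opn X V" "x : V" "restrict s V : sections X V" using s(1) by(rule lsecE)
  thus "EX U s. opn X U & x : U & s : sections X U & s x = e"
   using s(2) by(intro exI[of _ V] exI[of _ "restrict s V"]) auto
 next
  fix U s t x assume U: "opn X U" "s : sections X U" "t : sections X U" "x : U" "s x = t x"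
  have l: "lsec X x s'" if "s' : sections X U" for s'
  proof -
   have "restrict s' U = s'" using sub[of U] that by(auto simp: PiE_def extensional_restrict)
   thus ?thesis using that by(intro lsecI[OF U(1,4)]) simp
  qed
  obtain V where V: "opn X V" "x : V" "ALL y:V. s y = t y"
   by(rule nearE[OF eq[OF l[OF U(2)] l[OF U(3)] U(5)] lsec_points[OF l[OF U(2)]]])
  thus "EX V. opn X V & x : V & V <= U & (ALL y:V. s y = t y)"
   using U(1,4) by(intro exI[of _ "U Int V"]) auto
 qed
qed

section \<open>Affine charts\<close>

lemma mult_subset_compl_prime:
 assumes "primeideal q R" shows "mult_subset R (carrier R - q)"
proof -
 interpret primeideal q R by fact
 show ?thesis unfolding mult_subset_def
  using I_prime I_notcarr one_imp_carrier by auto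
qed

lemma localized_compl_prime: "primeideal q R ==> localized R (carrier R - q)"
 using mult_subset_compl_prime[of q R] primeideal.axioms(2)[of q R]
 unfolding localized_def localized_axioms_def by blast

lemma (in localized) fr_compl_prime_Units:
 assumes q: "primeideal q R" "S = carrier R - q" and r: "r : carrier R"
 shows "fr r 1[R] : Units L <-> r ~: q"
proof
 assume "fr r 1[R] : Units L"
 then obtain c where "c : carrier R" "r *[R] c : S" using fr_Units_iff[OF r one_S] by blast
 thus "r ~: q" using ideal.I_r_closed[OF primeideal.axioms(1)[OF q(1)]] q(2) by blast
next
 assume "r ~: q"
 hence "r *[R] 1[R] : S" using r q(2) by simp
 thus "fr r 1[R] : Units L" using fr_Units_iff[OF r one_S] by blast
qed

text \<open>An affine open set \<open>V\<close> seen through germs: \<open>rh x r\<close> is the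
  germ at \<open>x\<close> of the ring element \<open>r\<close>, and the prime belonging to
  \<open>x\<close> consists of those \<open>r\<close> whose germ is not a unit.
  \<open>prime_point\<close> and \<open>points_distinct\<close> make this a bijection with the
  primes, \<open>frac\<close> and \<open>zero\<close> say that stalks are localizations, and
  \<open>basis\<close> that basic open sets form a basis.\<close>

locale affine_chart = ringed X + R: cring R
 for X :: "('a, 'r) ringed_space" and R :: "'c ring" +
 fixes V :: "'a set" and rh :: "'a => 'c => 'r"
 assumes V: "opn X V"
  and local_stalk: "!!x. x : V ==> local_ring X@@x"
  and rh: "!!x. x : V ==> rh x : ring_hom R X@@x"
  and rh_lsec: "!!r x. r : carrier R ==> x : V ==> lsec X x (%y. rh y r)"
  and prime_point: "!!p. primeideal p R ==> EX x:V. p = {r : carrier R. rh x r ~: Units X@@x}"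
  and frac: "!!x z. x : V ==> z : carrier X@@x ==>
   EX a:carrier R. EX b:carrier R. rh x b : Units X@@x & rh x b *[X@@x] z = rh x a"
  and zero: "!!x r. x : V ==> r : carrier R ==> rh x r = 0[X@@x] ==>
   EX b:carrier R. rh x b : Units X@@x & b *[R] r = 0[R]"
  and basis: "!!U x. opn X U ==> x : U ==> x : V ==>
   EX g:carrier R. rh x g : Units X@@x & (ALL y:V. rh y g : Units X@@y --> y : U)"
  and points_distinct: "!!x y. x : V ==> y : V ==>
   (!!r. r : carrier R ==> rh x r : Units X@@x <-> rh y r : Units X@@y) ==> x = y"

lemma section_ring_simps [simp]:
 "carrier (section_ring X U) = sections X U"
 "s *[section_ring X U] t = (\<lambda>x\<in>U. s x *[X@@x] t x)"
 "s +[section_ring X U] t = (\<lambda>x\<in>U. s x +[X@@x] t x)"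
 "1[section_ring X U] = (\<lambda>x\<in>U. 1[X@@x])"
 "0[section_ring X U] = (\<lambda>x\<in>U. 0[X@@x])"
 unfolding section_ring_def by simp_all

lemma (in ringed) section_ring_cring:
 assumes U: "opn X U"
 shows "cring (section_ring X U)"
proof -
 let ?R = "section_ring X U"
 have c: "cring X@@x" if "x : U" for x using that openin_subset[OF U] stalk_cring by blast
 note cs = cring.cring_simprules[OF c]
 have el [simp]: "s x : carrier X@@x" if "s : sections X U" "x : U" for s x
  using PiE_mem[OF subsetD[OF sections_sub[OF U] that(1)] that(2)] .
 have eqI: "s = t" if "s : extensional U" "t : sections X U" "!!x. x : U ==> s x = t x" for s t :: "'a => 'r"
  using that(1) _ that(3) by(rule extensionalityI) (use subsetD[OF sections_sub[OF U] that(2)] in \<open>simp add: PiE_def\<close>)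
 show ?thesis
 proof (rule cringI)
  show "abelian_group ?R"
  proof (rule abelian_groupI; (unfold section_ring_simps)?)
   fix s t u assume [simp]: "s : sections X U" "t : sections X U"
   show "(\<lambda>x\<in>U. s x +[X@@x] t x) : sections X U" by(rule sections_add[OF U]) simp_all
   show "(\<lambda>x\<in>U. s x +[X@@x] t x) = (\<lambda>x\<in>U. t x +[X@@x] s x)" by(rule restrict_ext) (simp add: cs(10))
   assume [simp]: "u : sections X U"
   show "(\<lambda>x\<in>U. (\<lambda>x\<in>U. s x +[X@@x] t x) x +[X@@x] u x) = (\<lambda>x\<in>U. s x +[X@@x] (\<lambda>x\<in>U. t x +[X@@x] u x) x)"
    by(rule restrict_ext) (simp add: cs(7))
  next
   show "(\<lambda>x\<in>U. 0[X@@x]) : sections X U"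
    by(rule restrict_sections[OF U lsec_zero]) (use openin_subset[OF U] in blast)
   fix s assume s [simp]: "s : sections X U"
   show "(\<lambda>x\<in>U. (\<lambda>x\<in>U. 0[X@@x]) x +[X@@x] s x) = s" by(rule eqI) (simp_all add: cs(8))
   have "(\<lambda>x\<in>U. (\<lambda>x\<in>U. -[X@@x] s x) x +[X@@x] s x) = (\<lambda>x\<in>U. 0[X@@x])" by(rule restrict_ext) (simp add: cs(9))
   thus "EX y:sections X U. (\<lambda>x\<in>U. y x +[X@@x] s x) = (\<lambda>x\<in>U. 0[X@@x])" using sections_neg[OF U s] by blast
  qed
  show "comm_monoid ?R"
  proof (rule comm_monoidI; (unfold section_ring_simps)?)
   fix s t u assume [simp]: "s : sections X U" "t : sections X U"
   show "(\<lambda>x\<in>U. s x *[X@@x] t x) : sections X U" by(rule sections_mult[OF U]) simp_all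
   show "(\<lambda>x\<in>U. s x *[X@@x] t x) = (\<lambda>x\<in>U. t x *[X@@x] s x)" by(rule restrict_ext) (simp add: cs(14))
   assume [simp]: "u : sections X U"
   show "(\<lambda>x\<in>U. (\<lambda>x\<in>U. s x *[X@@x] t x) x *[X@@x] u x) = (\<lambda>x\<in>U. s x *[X@@x] (\<lambda>x\<in>U. t x *[X@@x] u x) x)"
    by(rule restrict_ext) (simp add: cs(11))
  next
   show "(\<lambda>x\<in>U. 1[X@@x]) : sections X U" by(rule sections_one[OF U])
   show "(\<lambda>x\<in>U. (\<lambda>x\<in>U. 1[X@@x]) x *[X@@x] s x) = s" if "s : sections X U" for s
    by(rule eqI) (simp_all add: cs(12) that)
  qed
  show "(s +[?R] t) *[?R] u = s *[?R] u +[?R] t *[?R] u" if "s : carrier ?R" "t : carrier ?R" "u : carrier ?R" for s t u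
   using that unfolding section_ring_simps by(intro restrict_ext) (simp add: cs(13))
 qed
qed

subsection \<open>Spectra\<close>

lemma Spec_openin_D:
 assumes "g : carrier R"
 shows "opn (Spec R) {((), q) |q. primeideal q R & g ~: q}"
proof -
 have "basic_open (one_point_space R) (%_. {q. primeideal q R}) UNIV (%_. g) = {((), q) |q. primeideal q R & g ~: q}"
  unfolding basic_open_def by auto
 moreover have "(%_. g) : sections (one_point_space R) UNIV" using assms unfolding one_point_space_def by(auto simp: PiE_def extensional_def)
 moreover have "opn (one_point_space R) UNIV" unfolding one_point_space_def by simp
 ultimately show ?thesis unfolding Spec_def localize_at_def prime_topology_def ringed_space.select_convs
  by(intro topology_generated_by_Basis) (metis (mono_tags, lifting) mem_Collect_eq)
qed

lemma points_Spec:
 fixes R :: "'r ring" (structure)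
 assumes "cring R"
 shows "points (Spec R) = {((), q) |q. primeideal q R}"
proof -
 interpret cring R by fact
 have "1[R] ~: q" if "primeideal q R" for q
  using primeideal.I_notcarr[OF that] ideal.one_imp_carrier[OF primeideal.axioms(1)[OF that]] by metis
 hence "{((), q) |q. primeideal q R} = {((), q) |q. primeideal q R & 1[R] ~: q}" by auto
 hence "opn (Spec R) {((), q) |q. primeideal q R}" using Spec_openin_D[of \<one> R] by simp
 hence "{((), q) |q. primeideal q R} <= points (Spec R)" by(rule openin_subset)
 moreover have "points (Spec R) <= {((), q) |q. primeideal q R}"
  unfolding Spec_def localize_at_def prime_topology_def ringed_space.select_convs topology_generated_by_topspace basic_open_def by auto
 ultimately show ?thesis by blast
qed

text \<open>Induction over the generation of the topology; an intersection of basic neighbourhoods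
  is handled by the product of their functions.\<close>

lemma Spec_basis:
 fixes R :: "'r ring" (structure)
 assumes R: "cring R" and W: "opn (Spec R) W" "((), q) : W"
 shows "EX g:carrier R. g ~: q & (ALL q'. primeideal q' R --> g ~: q' --> ((), q') : W)"
proof -
 interpret cring R by fact
 have q: "primeideal q R" using W openin_subset points_Spec[OF R] by blast
 let ?B = "{basic_open (one_point_space R) (%_. {q. primeideal q R}) U g |U g.
   opn (one_point_space R) U & g : sections (one_point_space R) U}"
 have "generate_topology_on ?B W"
  using W(1) unfolding Spec_def localize_at_def prime_topology_def ringed_space.select_convs
  by(rule openin_topology_generated_by)
 thus ?thesis using W(2)
 proof (induction rule: generate_topology_on.induct)
  case Empty thus ?case by simp
 next
  case (Int a b)
  obtain g where g: "g : carrier R" "g ~: q" "ALL q'. primeideal q' R --> g ~: q' --> ((), q') : a" using Int by blast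
  obtain h where h: "h : carrier R" "h ~: q" "ALL q'. primeideal q' R --> h ~: q' --> ((), q') : b" using Int by blast
  have "g *[R] h ~: q" using primeideal.I_prime[OF q g(1) h(1)] g h by blast
  moreover have "((), q') : a Int b" if "primeideal q' R" "g *[R] h ~: q'" for q'
  proof -
   note i = primeideal.axioms(1)[OF that(1)]
   have "g ~: q'" using ideal.I_r_closed[OF i _ h(1), of g] that(2) by blast
   moreover have "h ~: q'" using ideal.I_l_closed[OF i _ g(1), of h] that(2) by blast
   ultimately show ?thesis using g(3) h(3) that(1) by blast
  qed
  ultimately show ?case using g(1) h(1) by blast
 next
  case (UN K) thus ?case by blast
 next
  case (Basis s)
  then obtain U g where s: "s = basic_open (one_point_space R) (%_. {q. primeideal q R}) U g"
   "g : sections (one_point_space R) U" by blast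
  hence U: "() : U" "g () ~: q" using Basis(2) unfolding basic_open_def by auto
  have "g () : carrier R" using s(2) U(1) unfolding one_point_space_def by auto
  thus ?case using U unfolding s(1) basic_open_def by auto
 qed
qed

lemma stalk_Spec: "(Spec R)@@((), q) = localization R (carrier R - q)"
 unfolding Spec_def localize_at_def prime_stalk_def one_point_space_def by simp

lemma Spec_section:
 fixes R :: "'r ring" (structure)
 assumes R: "cring R" and r: "r : carrier R"
 shows "(\<lambda>z\<in>points (Spec R). fraction R (carrier R - snd z) r 1[R]) : sections (Spec R) (points (Spec R))"
proof -
 interpret cring R by fact
 let ?O = "one_point_space R" and ?Q = "%_. {q. primeideal q R}"
 let ?s = "\<lambda>z\<in>points (Spec R). fraction R (carrier R - snd z) r 1[R]"
 have n1: "1[R] ~: q" if "primeideal q R" for q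
  using primeideal.I_notcarr[OF that] ideal.one_imp_carrier[OF primeideal.axioms(1)[OF that]] by metis
 have sec: "sections (Spec R) (points (Spec R)) = locally_given (spc (Spec R)) (%z. carrier (prime_stalk ?O z))
    (%V. locfracs ?O ?Q V) (points (Spec R))"
  unfolding Spec_def localize_at_def by simp
 show ?thesis unfolding sec
 proof (rule locally_givenI)
  fix z assume z: "z : points (Spec R)"
  let ?ta = "(%(x, q). fraction ?O@@x (carrier ?O@@x - q) ((%_. r) x) ((%_. 1[R]) x))"
  have 1: "opn ?O UNIV" "(%_. r) : sections ?O UNIV" "(%_. 1[R]) : sections ?O UNIV"
   using r unfolding one_point_space_def by(auto simp: PiE_def extensional_def)
  have 2: "points (Spec R) <= basic_open ?O ?Q UNIV (%_. 1[R])"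
   unfolding points_Spec[OF R] basic_open_def using n1 by auto
  have 3: "?s y = ?ta y" if "y : points (Spec R)" for y
   using that unfolding one_point_space_def by(cases y) simp
  have 4: "?s y : carrier (prime_stalk ?O y)" if y: "y : points (Spec R)" for y
  proof -
   obtain q where q: "y = ((), q)" "primeideal q R" using y points_Spec[OF R] by blast
   interpret l: localized R "carrier R - q" by(rule localized_compl_prime[OF q(2)])
   have "l.fr r 1[R] : carrier l.L" by(rule l.fr_carrier[OF r l.one_S])
   thus ?thesis using y q unfolding prime_stalk_def one_point_space_def by simp
  qed
  show "EX V ta. opn (Spec R) V & z : V & V <= points (Spec R) &
    ta : locfracs ?O ?Q V &
    (ALL y:V. ?s y = ta y & ?s y : carrier (prime_stalk ?O y))"
   by(intro exI[of _ "points (Spec R)"] exI[of _ ?ta] conjI CollectI exI[of _ "%_. r"] exI[of _ "%_. 1[R]"] exI[of _ UNIV] ballI)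
    (use 1 2 3 4 z in auto)
 qed simp
qed

lemma scheme_affine_chart:
 fixes X :: "('a, 'r) ringed_space"
 assumes X: "scheme X" and x0: "x0 : points X"
 obtains V and R :: "('a => 'r) ring" and rh where "x0 : V" "affine_chart X R V rh"
proof -
 obtain V where V: "opn X V" "x0 : V" and aff: "affine_scheme (open_subspace X V)"
  using X x0 unfolding scheme_def by blast
 let ?Y = "open_subspace X V"
 have ptY: "points ?Y = V" using openin_subset[OF V(1)] unfolding open_subspace_def by auto
 have stY: "stalk ?Y = stalk X" and secY: "sections ?Y = sections X" and spY: "spc ?Y = subtopology (spc X) V"
  unfolding open_subspace_def by simp_all
 have rX: "is_ringed_space X" using X unfolding scheme_def locally_ringed_def by blast
 interpret X: ringed X by(rule ringedI[OF rX])
 have lX: "local_ring X@@x" if "x : points X" for x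
  using X that unfolding scheme_def locally_ringed_def by blast
 have rY: "is_ringed_space ?Y" using aff unfolding affine_scheme_def locally_ringed_def by blast
 interpret Y: ringed ?Y by(rule ringedI[OF rY])
 define R where "R = section_ring ?Y (points ?Y)"
 have R: "cring R" unfolding R_def by(rule Y.section_ring_cring[OF openin_topspace])
 interpret R: cring R by(rule R)
 obtain f where f: "lrs_hom ?Y (Spec R) f" "homeomorphic_map (spc ?Y) (spc (Spec R)) (pt f)"
  and iso: "!!x. x : V ==> cm f x : ring_iso (Spec R)@@(f$x) X@@x"
  using aff unfolding affine_scheme_def lrs_isomorphic_def R_def ptY stY by blast
 define q where "q x = snd f$x" for x
 have q: "f$x = ((), q x)" "primeideal (q x) R" if "x : V" for x
  using lrs_homD(8)[OF f(1), of x] that unfolding ptY points_Spec[OF R] q_def by auto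
 have iso': "cm f x : ring_iso (localization R (carrier R - q x)) X@@x" if "x : V" for x
  using iso[OF that] unfolding q(1)[OF that] stalk_Spec .
 have VX: "x : points X" if "x : V" for x using openin_subset[OF V(1)] that by blast
 \<comment> \<open>The given isomorphism with the spectrum need not be the canonical one, so the
   germ of \<open>r\<close> is obtained by transport along \<open>f\<close> and may differ from the
   value \<open>r x\<close>.\<close>
 define rh where "rh x r = cm f x (fraction R (carrier R - q x) r 1[R])" for x r
 have loc: "localized R (carrier R - q x)" if "x : V" for x by(rule localized_compl_prime[OF q(2)[OF that]])
 have unit: "rh x r : Units X@@x <-> r ~: q x" if x: "x : V" and r: "r : carrier R" for x r
 proof -
  interpret l: localized R "carrier R - q x" by(rule loc[OF x])
  have c: "l.fr r 1[R] : carrier l.L" by(rule l.fr_carrier[OF r l.one_S])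
  have "rh x r : Units X@@x <-> l.fr r 1[R] : Units l.L"
   using ring_iso_Units[OF iso'[OF x] l.cring_L X.stalk_cring[OF VX[OF x]] c]
    ring_hom_Units[OF _ l.cring_L X.stalk_cring[OF VX[OF x]], of "cm f x"] iso'[OF x]
   unfolding rh_def ring_iso_def by blast
  thus ?thesis using l.fr_compl_prime_Units[OF q(2)[OF x] refl r] by simp
 qed
 have qR: "r : carrier R" if "r : q x" "x : V" for x r
  using ideal.Icarr[OF primeideal.axioms(1)[OF q(2)[OF that(2)]] that(1)] .
 have q_eq: "q x = {r : carrier R. rh x r ~: Units X@@x}" if "x : V" for x
  using unit[OF that] qR[OF _ that] by blast
 have surj: "EX x:V. q x = p" if "primeideal p R" for p
 proof -
  have "((), p) : pt f ` V"
   using homeomorphic_imp_surjective_map[OF f(2)] that unfolding ptY points_Spec[OF R] by auto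
  thus ?thesis using q(1) by auto
 qed
 have "affine_chart X R V rh"
 proof (unfold_locales)
  show "opn X V" by(rule V)
  fix x assume x: "x : V"
  show "local_ring X@@x" by(rule lX[OF VX[OF x]])
  interpret l: localized R "carrier R - q x" by(rule loc[OF x])
  have isox: "cm f x : ring_hom l.L X@@x" "bij_betw (cm f x) (carrier l.L) (carrier X@@x)"
   using iso'[OF x] unfolding ring_iso_def by auto
  have "cm f x \<circ> (%r. l.fr r 1[R]) : ring_hom R X@@x"
   by(rule ring_hom_trans[OF l.fr_one_hom isox(1)])
  moreover have "cm f x \<circ> (%r. l.fr r 1[R]) = rh x" unfolding rh_def by auto
  ultimately show "rh x : ring_hom R X@@x" by simp
  show "lsec X x (%y. rh y r)" if r: "r : carrier R" for r
  proof -
   let ?P = "{x : points ?Y. f$x : points (Spec R)}"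
   have P: "?P = V" using lrs_homD(8)[OF f(1)] unfolding ptY by blast
   have "(\<lambda>x\<in>?P. cm f x ((\<lambda>z\<in>points (Spec R). fraction R (carrier R - snd z) r 1[R]) f$x)) : sections ?Y ?P"
    by(rule lrs_homD(7)[OF f(1) openin_topspace Spec_section[OF R r]])
   moreover have "(\<lambda>x\<in>V. cm f x ((\<lambda>z\<in>points (Spec R). fraction R (carrier R - snd z) r 1[R]) f$x)) = (\<lambda>y\<in>V. rh y r)"
    using lrs_homD(8)[OF f(1)] unfolding ptY rh_def q_def by auto
   ultimately have "(\<lambda>y\<in>V. rh y r) : sections X V" unfolding P secY by simp
   thus ?thesis by(rule lsecI[OF V(1) x])
  qed
  show "EX a:carrier R. EX b:carrier R. rh x b : Units X@@x & rh x b *[X@@x] z = rh x a"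
   if z: "z : carrier X@@x" for z
  proof -
   obtain w where w: "w : carrier l.L" "z = cm f x w" using isox(2) z unfolding bij_betw_def by blast
   obtain a b where ab: "a : carrier R" "b : carrier R - q x" "w = l.fr a b" using w(1) by(rule l.carrierE)
   have "rh x b *[X@@x] z = cm f x (l.fr b 1[R] *[l.L] l.fr a b)"
    unfolding rh_def w(2) ab(3) using ring_hom_mult[OF isox(1) l.fr_carrier[OF _ l.one_S] l.fr_carrier[OF ab(1,2)], of b] ab by auto
   also have "l.fr b 1[R] *[l.L] l.fr a b = l.fr a 1[R]"
   proof -
    interpret L: cring l.L by(rule l.cring_L)
    have "l.fr b 1[R] : carrier l.L" by(rule l.fr_carrier[OF _ l.one_S]) (use ab in blast)
    thus ?thesis using l.fr_mult_one[OF ab(1,2)] L.m_comm[OF _ l.fr_carrier[OF ab(1,2)]] by metis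
   qed
   finally have "rh x b *[X@@x] z = rh x a" unfolding rh_def .
   moreover have "rh x b : Units X@@x" using unit[OF x, of b] ab(2) by simp
   ultimately show ?thesis using ab by blast
  qed
  show "EX b:carrier R. rh x b : Units X@@x & b *[R] r = 0[R]"
   if r: "r : carrier R" "rh x r = 0[X@@x]" for r
  proof -
   have z: "cm f x (l.fr 0[R] 1[R]) = 0[X@@x]"
    using ring_hom_zero'[OF isox(1) l.cring_L X.stalk_cring[OF VX[OF x]]] unfolding l.zero_fr .
   have "l.fr r 1[R] = l.fr 0[R] 1[R]"
    by(rule inj_onD[OF bij_betw_imp_inj_on[OF isox(2)]]) (use r z l.fr_carrier[OF _ l.one_S] in \<open>auto simp: rh_def\<close>)
   then obtain u where u: "u : carrier R - q x" "u *[R] (r *[R] 1[R]) = u *[R] (0[R] *[R] 1[R])"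
    using l.fr_eq_iff[OF r(1) l.one_S R.zero_closed l.one_S] by blast
   hence "u *[R] r = 0[R]" using r by simp
   moreover have "u : carrier R" "rh x u : Units X@@x" using unit[OF x, of u] u(1) by auto
   ultimately show ?thesis by blast
  qed
  show "EX g:carrier R. rh x g : Units X@@x & (ALL y:V. rh y g : Units X@@y --> y : U)"
   if U: "opn X U" "x : U" for U
  proof -
   have "opn ?Y (U Int V)" unfolding spY by(rule openin_subtopology_Int[OF U(1)])
   hence o: "opn (Spec R) (pt f ` (U Int V))"
    using homeomorphic_imp_open_map[OF f(2)] unfolding open_map_def by blast
   have "((), q x) : pt f ` (U Int V)" using q(1)[OF x] U x by(metis IntI imageI)
   then obtain g where g: "g : carrier R" "g ~: q x" "!!q'. primeideal q' R ==> g ~: q' ==> ((), q') : pt f ` (U Int V)"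
    using Spec_basis[OF R o] by blast
   have "y : U" if y: "y : V" "rh y g : Units X@@y" for y
   proof -
    have "f$y : pt f ` (U Int V)" using g(3)[OF q(2)[OF y(1)]] unit[OF y(1) g(1)] y(2) q(1)[OF y(1)] by simp
    then obtain y' where y': "y' : U" "y' : V" "f$y = f$y'" by auto
    have "y = y'" by(rule inj_onD[OF homeomorphic_imp_injective_map[OF f(2)] y'(3)]) (use y y' ptY in auto)
    thus ?thesis using y' by simp
   qed
   thus ?thesis using g unit[OF x g(1)] by blast
  qed
  show "x = y" if y: "y : V" "!!r. r : carrier R ==> rh x r : Units X@@x <-> rh y r : Units X@@y" for y
  proof -
   have "q x = q y" unfolding q_eq[OF x] q_eq[OF y(1)] using y(2) by blast
   hence e: "f$x = f$y" using q(1)[OF x] q(1)[OF y(1)] by simp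
   show ?thesis by(rule inj_onD[OF homeomorphic_imp_injective_map[OF f(2)] e]) (use x y ptY in auto)
  qed
 next
  show "EX x:V. p = {r : carrier R. rh x r ~: Units X@@x}" if "primeideal p R" for p
   using surj[OF that] q_eq by metis
 qed
 thus thesis using that V(2) by blast
qed

section \<open>Units, denominators and fractions on an affine chart\<close>

context affine_chart
begin

lemma V_points: "x : V ==> x : points X" using openin_subset[OF V] by blast
lemma stalk_V: "x : V ==> cring X@@x" using stalk_cring V_points by blast

lemma rh_closed [simp]: "x : V ==> r : carrier R ==> rh x r : carrier X@@x"
 by(rule ring_hom_closed[OF rh])
lemma rh_mult: "x : V ==> r : carrier R ==> s : carrier R ==> rh x (r *[R] s) = rh x r *[X@@x] rh x s"
 by(rule ring_hom_mult[OF rh])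
lemma rh_add: "x : V ==> r : carrier R ==> s : carrier R ==> rh x (r +[R] s) = rh x r +[X@@x] rh x s"
 by(rule ring_hom_add[OF rh])
lemma rh_one: "x : V ==> rh x 1[R] = 1[X@@x]" by(rule ring_hom_one[OF rh])
lemma rh_zero: "x : V ==> rh x 0[R] = 0[X@@x]"
 by(rule ring_hom_zero'[OF rh R.is_cring stalk_V])
lemma rh_pow: "x : V ==> r : carrier R ==> rh x (r ^[R] (n::nat)) = rh x r ^[X@@x] n"
proof (induction n)
 case (Suc n)
 interpret S: cring "X@@x" by(rule stalk_V) fact
 show ?case using Suc by(simp add: rh_mult)
next
 case 0
 interpret S: cring "X@@x" by(rule stalk_V) fact
 show ?case using 0 by(simp add: rh_one)
qed

definition pr :: "'a => 'c set" where "pr x = {r : carrier R. rh x r ~: Units X@@x}"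

lemma pr_sub: "pr x <= carrier R" unfolding pr_def by blast

lemma pr_prime: assumes x: "x : V" shows "primeideal (pr x) R"
proof -
 interpret S: cring "X@@x" by(rule stalk_V[OF x])
 interpret h: ring_hom_ring R "X@@x" "rh x"
  by(rule ring_hom_ringI2[OF R.ring_axioms S.ring_axioms rh[OF x]])
 have "pr x = {r : carrier R. rh x r : carrier X@@x - Units X@@x}" unfolding pr_def using x by auto
 thus ?thesis using h.primeideal_vimage[OF R.is_cring local_ringD(3)[OF local_stalk[OF x]]] by simp
qed

lemma pr_ideal: "x : V ==> ideal (pr x) R" by(rule primeideal.axioms(1)[OF pr_prime])

lemma prime_pr: "primeideal p R ==> EX x:V. p = pr x" using prime_point unfolding pr_def by blast

lemma pr_inj: "x : V ==> y : V ==> pr x = pr y ==> x = y"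
 by(rule points_distinct) (auto simp: pr_def)

lemma unit_iff: "x : V ==> r : carrier R ==> rh x r : Units X@@x <-> r ~: pr x"
 unfolding pr_def by blast

lemma unit_mult_iff:
 assumes "x : V" "r : carrier R" "s : carrier R"
 shows "rh x (r *[R] s) : Units X@@x <-> rh x r : Units X@@x & rh x s : Units X@@x"
 using primeideal.I_prime[OF pr_prime[OF assms(1)] assms(2,3)] ideal.I_r_closed[OF pr_ideal[OF assms(1)] _ assms(3)]
  ideal.I_l_closed[OF pr_ideal[OF assms(1)] _ assms(2)] unit_iff assms by auto

lemma unit_pow: "x : V ==> r : carrier R ==> rh x r : Units X@@x ==> rh x (r ^[R] (n::nat)) : Units X@@x"
proof (induction n)
 case 0
 interpret cring "X@@x" using 0 by(simp add: stalk_V)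
 show ?case using 0 by(simp add: rh_one)
next
 case (Suc n) thus ?case by(simp add: unit_mult_iff)
qed

lemma unit_near: "x : V ==> r : carrier R ==> rh x r : Units X@@x ==>
  evn X x (%y. rh y r : Units X@@y)"
 by(rule lsec_unit_near(1)[OF rh_lsec])

lemma basisE:
 assumes "evn X x P" "x : V"
 obtains g where "g : carrier R" "rh x g : Units X@@x" "!!y. y : V ==> rh y g : Units X@@y ==> P y"
proof -
 obtain U where U: "opn X U" "x : U" "ALL y:U. P y" using assms(1) V_points[OF assms(2)] by(rule nearE)
 show thesis using basis[OF U(1,2) assms(2)] U(3) that by blast
qed

lemma near_V: "x : V ==> evn X x (%y. y : V)"
 by(rule near_open[OF V])

text \<open>The fraction is valid on the whole basic open set of its denominator, not just near
  \<open>x\<close>: numerator and denominator are multiplied by a \<open>g\<close> whose basic open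
  set lies in the neighbourhood where the identity holds.\<close>

lemma lsec_frac:
 assumes s: "lsec X x s" and x: "x : V"
 obtains a b where "a : carrier R" "b : carrier R" "rh x b : Units X@@x"
  "!!y. y : V ==> rh y b : Units X@@y ==> rh y b *[X@@y] s y = rh y a"
proof -
 obtain a b where ab: "a : carrier R" "b : carrier R" "rh x b : Units X@@x" "rh x b *[X@@x] s x = rh x a"
  using frac[OF x lsec_carrier[OF s]] by blast
 have "evn X x (%y. rh y b *[X@@y] s y = rh y a)"
  by(rule lsec_eq[OF lsec_mult[OF rh_lsec s] rh_lsec]) (use ab x in auto)
 hence "evn X x (%y. lsec X y s & rh y b *[X@@y] s y = rh y a)"
  using lsec_near[OF s] by eventually_elim blast
 then obtain g where g: "g : carrier R" "rh x g : Units X@@x"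
  "!!y. y : V ==> rh y g : Units X@@y ==> lsec X y s & rh y b *[X@@y] s y = rh y a"
  using basisE[OF _ x] by blast
 show thesis
 proof (rule that[of "g *[R] a" "g *[R] b"])
  show "rh x (g *[R] b) : Units X@@x" using unit_mult_iff x g ab by blast
  fix y assume y: "y : V" "rh y (g *[R] b) : Units X@@y"
  hence gy: "rh y g : Units X@@y" using unit_mult_iff g ab by blast
  interpret S: cring "X@@y" by(rule stalk_V[OF y(1)])
  have "s y : carrier X@@y" using g(3)[OF y(1) gy] lsec_carrier by blast
  thus "rh y (g *[R] b) *[X@@y] s y = rh y (g *[R] a)"
   using g(3)[OF y(1) gy] y(1) g(1) ab(1,2) by(simp add: rh_mult S.m_assoc)
 qed (use g ab in auto)
qed

lemma ann_ideal:
 assumes "x : carrier R" shows "ideal {r : carrier R. r *[R] x = 0[R]} R"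
proof (rule idealI[OF R.ring_axioms])
 show "subgroup {r : carrier R. r *[R] x = 0[R]} (add_monoid R)"
  by(rule R.add.subgroupI) (use assms in \<open>auto simp: R.l_minus R.l_distr\<close>)
next
 fix a y assume *: "a : {r : carrier R. r *[R] x = 0[R]}" "y : carrier R"
 show "y *[R] a : {r : carrier R. r *[R] x = 0[R]}" using * assms by(simp add: R.m_assoc)
 thus "a *[R] y : {r : carrier R. r *[R] x = 0[R]}" using * assms by(simp add: R.m_comm)
qed

lemma denoms_unit_iff:
 assumes Sg: "mult_subset R Sg" and h: "h : carrier R" and y: "y : V"
 shows "(ALL w:R.denoms Sg h. rh y w : Units X@@y) <-> (ALL w:Sg. rh y w : Units X@@y) & rh y h : Units X@@y"
proof -
 note SgD = mult_subsetD[OF Sg]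
 have "w : R.denoms Sg h" if "w : Sg" for w
  unfolding R.denoms_def using that SgD(4)[OF that] by(intro CollectI exI[of _ w] exI[of _ 0]) simp
 moreover have "h : R.denoms Sg h"
  unfolding R.denoms_def using h SgD(2) by(intro CollectI exI[of _ "1[R]"] exI[of _ 1]) simp
 moreover have "rh y w : Units X@@y" if "w : R.denoms Sg h" "ALL w:Sg. rh y w : Units X@@y" "rh y h : Units X@@y" for w
  using that SgD(4) h y unfolding R.denoms_def by(auto simp: unit_mult_iff unit_pow)
 ultimately show ?thesis by blast
qed

text \<open>Quasi-compactness in algebraic form. If \<open>J\<close> missed \<open>Sg\<close>, a
  prime containing \<open>J\<close> and disjoint from \<open>Sg\<close> would be a point of the
  locus at which no element of \<open>J\<close> is a unit.\<close>

lemma ideal_meets: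
 assumes J: "ideal J R" and Sg: "mult_subset R Sg"
  and u: "!!y. y : V ==> (ALL w:Sg. rh y w : Units X@@y) ==> EX r:J. rh y r : Units X@@y"
 shows "EX w:Sg. w : J"
proof (rule ccontr)
 assume "~ ?thesis"
 hence "J Int Sg = {}" by blast
 then obtain P where P: "primeideal P R" "J <= P" "P Int Sg = {}" using R.exists_prime_disjoint[OF J _ Sg] by blast
 obtain y where y: "y : V" "P = pr y" using prime_pr[OF P(1)] by blast
 have "ALL w:Sg. rh y w : Units X@@y" using y P(3) unit_iff[OF y(1)] mult_subsetD(4)[OF Sg] by blast
 thus False using u[OF y(1)] P(2) y(2) unfolding pr_def by blast
qed

text \<open>If \<open>a\<close> and \<open>b\<close> have no common zero on the locus of
  \<open>Sg\<close>, the ideal \<open>(a, b)\<close> meets \<open>Sg\<close>. With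
  \<open>a = b\<close> this shows that an element invertible on the locus has a multiple in
  \<open>Sg\<close>.\<close>

lemma unit_combination:
 assumes Sg: "mult_subset R Sg" and ab: "a : carrier R" "b : carrier R"
  and u: "!!y. y : V ==> (ALL w:Sg. rh y w : Units X@@y) ==> rh y a : Units X@@y | rh y b : Units X@@y"
 obtains c d where "c : carrier R" "d : carrier R" "c *[R] a +[R] d *[R] b : Sg"
proof -
 obtain J where J: "ideal J R" "PIdl\<^bsub>R\<^esub> a <= J" "b : J"
  "!!x. x : J ==> EX p:PIdl\<^bsub>R\<^esub> a. EX r:carrier R. x = p +[R] r *[R] b"
  by(rule R.ideal_add_elem[OF R.cgenideal_ideal[OF ab(1)] ab(2)]) blast
 have "EX w:Sg. w : J" by(rule ideal_meets[OF J(1) Sg]) (use u J(2,3) R.cgenideal_self[OF ab(1)] in blast)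
 thus thesis using J(4) that unfolding cgenideal_def by blast
qed

text \<open>The annihilator of \<open>x\<close> contains a unit at each point of the locus of
  \<open>Sg\<close> where \<open>h\<close> is invertible, hence meets the multiplicative set
  generated by \<open>Sg\<close> and \<open>h\<close>.\<close>

lemma killed_of_vanishing:
 assumes Sg: "mult_subset R Sg" and xh: "x : carrier R" "h : carrier R"
  and van: "!!y. y : V ==> (!!w. w : Sg ==> rh y w : Units X@@y) ==> rh y h : Units X@@y ==> rh y x = 0[X@@y]"
 obtains w and n :: nat where "w : Sg" "w *[R] h ^[R] n *[R] x = 0[R]"
proof -
 have "EX w:R.denoms Sg h. w : {r : carrier R. r *[R] x = 0[R]}"
 proof (rule ideal_meets[OF ann_ideal[OF xh(1)] R.denoms_mult_subset[OF Sg xh(2)]])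
  fix y assume y: "y : V" "ALL w:R.denoms Sg h. rh y w : Units X@@y"
  hence "rh y x = 0[X@@y]" using van[OF y(1)] denoms_unit_iff[OF Sg xh(2) y(1)] by blast
  thus "EX r:{r : carrier R. r *[R] x = 0[R]}. rh y r : Units X@@y" using zero[OF y(1) xh(1)] by blast
 qed
 thus thesis unfolding R.denoms_def using that by blast
qed

text \<open>Those \<open>r\<close> for which \<open>si\<close> is a fraction on the locus of \<open>Z\<close> where \<open>r\<close> is invertible form
  an ideal. It is contained in no prime disjoint from \<open>Sg\<close>, hence meets \<open>Sg\<close>. This replaces a
  finite partition of unity.\<close>

lemma section_is_fraction:
 assumes Sg: "mult_subset R Sg" and Z: "Z = {y : V. ALL w:Sg. rh y w : Units X@@y}"
  and si: "!!y. y : Z ==> EX ta. lsec X y ta & evn X y (%y'. y' : Z --> si y' = ta y')"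
 obtains b w where "b : carrier R" "w : Sg" "!!y. y : Z ==> rh y w *[X@@y] si y = rh y b"
proof -
 note SgD = mult_subsetD[OF Sg]
 have ZV: "y : V" if "y : Z" for y using that Z by blast
 have Zu: "rh y w : Units X@@y" if "y : Z" "w : Sg" for y w using that Z by blast
 have sic: "si y : carrier X@@y" if y: "y : Z" for y
 proof -
  obtain ta where t: "lsec X y ta" "evn X y (%y'. y' : Z --> si y' = ta y')" using si[OF y] by blast
  have "si y = ta y" using near_self[OF t(2) V_points[OF ZV[OF y]]] y by blast
  thus ?thesis using lsec_carrier[OF t(1)] by simp
 qed
 define frac where "frac y u b <-> rh y u *[X@@y] si y = rh y b" for y u b
 \<comment> \<open>A single fraction \<open>b/u\<close> is to represent \<open>si\<close> wherever
   \<open>r\<close> is invertible on \<open>Z\<close>; the hypothesis gives representations near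
   single points only.\<close>
 define good where "good r <-> (EX b:carrier R. EX u:carrier R. ALL y:Z. rh y r : Units X@@y --> rh y u : Units X@@y & frac y u b)" for r
 have goodI: "good r" if "b : carrier R" "u : carrier R" "!!y. y : Z ==> rh y r : Units X@@y ==> rh y u : Units X@@y & frac y u b" for r b u
  using that unfolding good_def by blast
 have comb: "frac y (c *[R] u +[R] d *[R] u') (c *[R] b +[R] d *[R] b')"
  if y: "y : Z" and f: "frac y u b" "frac y u' b'" and c: "c : carrier R" "d : carrier R" "u : carrier R" "u' : carrier R" "b : carrier R" "b' : carrier R"
  for y c d u u' b b'
 proof -
  interpret S: cring "X@@y" by(rule stalk_V[OF ZV[OF y]])
  show ?thesis using f c ZV[OF y] sic[OF y] unfolding frac_def by(simp add: rh_mult rh_add S.l_distr S.m_assoc)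
 qed
 have mult: "frac y (c *[R] u) (c *[R] b)" if y: "y : Z" and f: "frac y u b" and c: "c : carrier R" "u : carrier R" "b : carrier R" for y c u b
  using comb[OF y f f c(1) R.zero_closed c(2,2,3,3)] c by simp
 \<comment> \<open>Where \<open>r\<close> and \<open>u\<close> are invertible, \<open>w\<close>, the
   power of \<open>r\<close> and \<open>u\<close> can be cancelled from the relation
   \<open>e\<close>. What remains says that \<open>s^N b'\<close> over \<open>s^N u'\<close>
   satisfies the identity for \<open>si\<close>, although \<open>u'\<close> itself need not be
   invertible there.\<close>
 have swap: "frac y (s ^[R] N *[R] u') (s ^[R] N *[R] b')"
  if y: "y : Z" "rh y r : Units X@@y" "rh y u : Units X@@y" "frac y u b"
   and c: "r : carrier R" "s : carrier R" "u : carrier R" "b : carrier R" "u' : carrier R" "b' : carrier R" and w: "w : Sg"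
   and e: "w *[R] (r *[R] s) ^[R] N *[R] (u *[R] b') = w *[R] (r *[R] s) ^[R] N *[R] (u' *[R] b)" for y r s u b u' b' w and N :: nat
 proof -
  interpret S: cring "X@@y" by(rule stalk_V[OF ZV[OF y(1)]])
  note yV = ZV[OF y(1)] and wc = SgD(4)[OF w]
  let ?q = "w *[R] r ^[R] N *[R] u"
  have q: "rh y ?q : Units X@@y" using unit_mult_iff[OF yV] unit_pow[OF yV c(1) y(2)] Zu[OF y(1) w] y(3) c wc by simp
  have "?q *[R] (s ^[R] N *[R] b') = w *[R] (r *[R] s) ^[R] N *[R] (u' *[R] b)"
   unfolding e[symmetric] using c wc by(simp add: R.nat_pow_distrib R.m_ac)
  also have "... = (w *[R] r ^[R] N) *[R] (s ^[R] N *[R] u') *[R] b" using c wc by(simp add: R.nat_pow_distrib R.m_ac)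
  finally have "rh y ?q *[X@@y] rh y (s ^[R] N *[R] b') = rh y (w *[R] r ^[R] N) *[X@@y] rh y (s ^[R] N *[R] u') *[X@@y] rh y b"
   using c wc yV by(metis rh_mult R.m_closed R.nat_pow_closed)
  also have "... = rh y ?q *[X@@y] (rh y (s ^[R] N *[R] u') *[X@@y] si y)"
   using y(4)[unfolded frac_def, symmetric] c wc yV sic[OF y(1)] rh_mult[OF yV, of "w *[R] r ^[R] N" u] by(simp add: S.m_ac)
  finally show ?thesis using S.Units_l_cancel[OF q, of "rh y (s ^[R] N *[R] b')"] c yV sic[OF y(1)] unfolding frac_def by simp
 qed
 let ?J = "{r : carrier R. good r}"
 have J: "ideal ?J R"
 proof (rule idealI[OF R.ring_axioms])
  show l: "c *[R] r : ?J" if "r : ?J" "c : carrier R" for r c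
   using that ZV unit_mult_iff unfolding good_def by simp blast
  show "r *[R] c : ?J" if "r : ?J" "c : carrier R" for r c
   using l[OF that] R.m_comm[of c r] that by auto
  show "subgroup ?J (add_monoid R)"
  proof (rule R.add.subgroupI)
   have "rh y 0[R] ~: Units X@@y" if "y : Z" for y
    using additive_subgroup.zero_closed[OF ideal.axioms(1)[OF pr_ideal[OF ZV[OF that]]]] unit_iff[OF ZV[OF that]] by simp
   hence "good 0[R]" by(intro goodI[OF R.zero_closed R.zero_closed]) blast
   thus "?J ~= {}" by blast
   show "?J <= carrier R" by blast
   show "-[R] r : ?J" if "r : ?J" for r
    using l[OF that, of "-[R] 1[R]"] that by(simp add: R.l_minus)
   fix r s assume "r : ?J" "s : ?J"
   then obtain b u b' u' where rs: "r : carrier R" "s : carrier R" and c: "b : carrier R" "u : carrier R" "b' : carrier R" "u' : carrier R"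
    and F: "ALL y:Z. rh y r : Units X@@y --> rh y u : Units X@@y & frac y u b"
     "ALL y:Z. rh y s : Units X@@y --> rh y u' : Units X@@y & frac y u' b'" unfolding good_def by blast
   let ?x = "u *[R] b' -[R] u' *[R] b"
   obtain w and N :: nat where w: "w : Sg" "w *[R] (r *[R] s) ^[R] N *[R] ?x = 0[R]"
   proof (rule killed_of_vanishing[OF Sg _ R.m_closed[OF rs]])
    fix y assume y: "y : V" "!!w. w : Sg ==> rh y w : Units X@@y" "rh y (r *[R] s) : Units X@@y"
    interpret S: cring "X@@y" by(rule stalk_V[OF y(1)])
    have yZ: "y : Z" using y Z by blast
    have "frac y u b" "frac y u' b'" using F yZ y(3) unit_mult_iff[OF y(1) rs] by auto
    note f = this[unfolded frac_def, symmetric]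
    have "rh y (u *[R] b') = rh y (u' *[R] b)" using c y(1) sic[OF yZ] by(simp add: rh_mult f S.m_ac)
    moreover have "?x +[R] u' *[R] b = u *[R] b'" using c by(simp add: R.minus_eq R.a_assoc R.l_neg)
    hence "rh y ?x +[X@@y] rh y (u' *[R] b) = rh y (u *[R] b')" using rh_add[OF y(1), of ?x "u' *[R] b"] c by simp
    ultimately show "rh y ?x = 0[X@@y]" using S.add.l_cancel_one[of "rh y (u' *[R] b)" "rh y ?x"] y(1) c by(simp add: S.a_comm)
   qed (use c in auto)
   let ?P = "w *[R] (r *[R] s) ^[R] N"
   have "?P *[R] (u *[R] b') -[R] ?P *[R] (u' *[R] b) = 0[R]"
    using w(2) SgD(4)[OF w(1)] c rs by(simp add: R.minus_eq R.r_distr R.r_minus)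
   hence e: "?P *[R] (u *[R] b') = ?P *[R] (u' *[R] b)" using SgD(4)[OF w(1)] c rs by(simp add: R.r_right_minus_eq)
   have e': "w *[R] (s *[R] r) ^[R] N *[R] (u' *[R] b) = w *[R] (s *[R] r) ^[R] N *[R] (u *[R] b')" using e R.m_comm[OF rs] by simp
   \<comment> \<open>After this rescaling both fractions satisfy the identity wherever
     \<open>r\<close> or \<open>s\<close> is invertible, in particular where \<open>r + s\<close>
     is, and so do their linear combinations.\<close>
   let ?u = "r ^[R] N *[R] u" and ?b = "r ^[R] N *[R] b" and ?u' = "s ^[R] N *[R] u'" and ?b' = "s ^[R] N *[R] b'"
   have both: "frac y ?u ?b & frac y ?u' ?b' & (rh y ?u : Units X@@y | rh y ?u' : Units X@@y)" if y: "y : Z" "rh y (r +[R] s) : Units X@@y" for y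
   proof -
    note yV = ZV[OF y(1)]
    have "rh y r : Units X@@y | rh y s : Units X@@y"
     using local_ringD(4)[OF local_stalk[OF yV], of "rh y r" "rh y s"] y yV rs by(simp add: rh_add)
    thus ?thesis
    proof
     assume r: "rh y r : Units X@@y"
     hence "rh y u : Units X@@y" "frac y u b" using F y by auto
     thus ?thesis using swap[OF y(1) r _ _ rs c(2,1,4,3) w(1) e] mult[OF y(1) _ _ c(2,1)] unit_mult_iff[OF yV] unit_pow[OF yV rs(1) r] rs c by simp
    next
     assume r: "rh y s : Units X@@y"
     hence "rh y u' : Units X@@y" "frac y u' b'" using F y by auto
     thus ?thesis using swap[OF y(1) r _ _ rs(2,1) c(4,3,2,1) w(1) e'] mult[OF y(1) _ _ c(4,3)] unit_mult_iff[OF yV] unit_pow[OF yV rs(2) r] rs c by simp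
    qed
   qed
   note rsc = R.a_closed[OF rs]
   have uc: "?u : carrier R" "?u' : carrier R" "?b : carrier R" "?b' : carrier R" using rs c by auto
   \<comment> \<open>At each point of \<open>Z\<close> with \<open>r + s\<close> invertible one of
     the two denominators is a unit, so some combination of them is a unit on this whole
     locus.\<close>
   obtain x z where xz: "x : carrier R" "z : carrier R" "x *[R] ?u +[R] z *[R] ?u' : R.denoms Sg (r +[R] s)"
    by(rule unit_combination[OF R.denoms_mult_subset[OF Sg rsc] uc(1,2)]) (use denoms_unit_iff[OF Sg rsc] both Z in blast)+
   have "good (r +[R] s)"
   proof (rule goodI[of "x *[R] ?b +[R] z *[R] ?b'" "x *[R] ?u +[R] z *[R] ?u'"])
    fix y assume y: "y : Z" "rh y (r +[R] s) : Units X@@y"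
    thus "rh y (x *[R] ?u +[R] z *[R] ?u') : Units X@@y & frac y (x *[R] ?u +[R] z *[R] ?u') (x *[R] ?b +[R] z *[R] ?b')"
     using comb[OF y(1) _ _ xz(1,2) uc] both[OF y] denoms_unit_iff[OF Sg rsc ZV[OF y(1)]] Zu[OF y(1)] xz(3) by blast
   qed (use xz uc in auto)
   thus "r +[R] s : ?J" using rs by blast
  qed
 qed
 have "EX w:Sg. w : ?J"
 proof (rule ideal_meets[OF J Sg])
  fix y assume y: "y : V" "ALL w:Sg. rh y w : Units X@@y"
  hence "y : Z" unfolding Z by blast
  then obtain ta where t: "lsec X y ta" "evn X y (%y'. y' : Z --> si y' = ta y')" using si by blast
  obtain a b where ab: "a : carrier R" "b : carrier R" "rh y b : Units X@@y"
   "!!y'. y' : V ==> rh y' b : Units X@@y' ==> rh y' b *[X@@y'] ta y' = rh y' a"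
   by(rule lsec_frac[OF t(1) y(1)]) blast
  obtain g where g: "g : carrier R" "rh y g : Units X@@y"
   "!!y'. y' : V ==> rh y' g : Units X@@y' ==> y' : Z --> si y' = ta y'"
   by(rule basisE[OF t(2) y(1)]) blast
  have "good (g *[R] b)"
   by(rule goodI[OF ab(1,2)]) (use ab g ZV unit_mult_iff in \<open>auto simp: frac_def\<close>)
  thus "EX r:?J. rh y r : Units X@@y" using g ab unit_mult_iff[OF y(1)] by(intro bexI[of _ "g *[R] b"]) auto
 qed
 then obtain w b u where w: "w : Sg" and bu: "b : carrier R" "u : carrier R" and f: "ALL y:Z. rh y u : Units X@@y & frac y u b"
  unfolding good_def using Zu by blast
 \<comment> \<open>\<open>u\<close> is a unit on all of \<open>Z\<close>; a multiple of it, written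
   as \<open>c u + d u\<close>, lies in \<open>Sg\<close>.\<close>
 obtain c d where cd: "c : carrier R" "d : carrier R" "c *[R] u +[R] d *[R] u : Sg"
  by(rule unit_combination[OF Sg bu(2,2)]) (use f Z in blast)+
 show thesis
  by(rule that[of "c *[R] b +[R] d *[R] b", OF _ cd(3)]) (use bu cd comb f in \<open>auto simp: frac_def\<close>)
qed

end

section \<open>Regular sections\<close>

lemma nzd_mult:
 assumes "cring R" "nzd R a" "nzd R b"
 shows "nzd R (a *[R] b)"
proof -
 interpret cring R by fact
 have c: "a : carrier R" "b : carrier R" using assms(2,3) unfolding nonzerodivisor_def by auto
 have "y = 0[R]" if y: "y : carrier R" "a *[R] b *[R] y = 0[R]" for y
 proof -
  have "a *[R] (b *[R] y) = 0[R]" using y c by(simp add: m_assoc)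
  hence "b *[R] y = 0[R]" using assms(2) c y unfolding nonzerodivisor_def by blast
  thus ?thesis using assms(3) y unfolding nonzerodivisor_def by blast
 qed
 thus ?thesis using c unfolding nonzerodivisor_def by blast
qed

lemma nzd_factor:
 assumes "cring R" "nzd R (a *[R] b)" "a : carrier R" "b : carrier R"
 shows "nzd R a"
proof -
 interpret cring R by fact
 have "y = 0[R]" if y: "y : carrier R" "a *[R] y = 0[R]" for y
 proof -
  have "a *[R] b *[R] y = b *[R] (a *[R] y)" using assms(3,4) y(1) by(simp add: m_ac)
  thus ?thesis using assms y unfolding nonzerodivisor_def by simp
 qed
 thus ?thesis using assms(3) unfolding nonzerodivisor_def by blast
qed

lemma nzd_unit:
 assumes "cring R" "u : Units R"
 shows "nzd R u"
proof -
 interpret cring R by fact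
 show ?thesis unfolding nonzerodivisor_def
 proof (intro conjI ballI impI)
  fix y assume "y : carrier R" "u *[R] y = 0[R]"
  thus "y = 0[R]"
   using Units_l_cancel[OF assms(2), of y "0[R]"] r_null[OF Units_closed[OF assms(2)]] by simp
 qed (use assms(2) in auto)
qed

lemma nzd_cancel:
 assumes "cring R" "nzd R a" "x : carrier R" "y : carrier R" "a *[R] x = a *[R] y"
 shows "x = y"
proof -
 interpret cring R by fact
 have a: "a : carrier R" using assms(2) unfolding nonzerodivisor_def by blast
 have "a *[R] (x -[R] y) = 0[R]" using assms a by(simp add: minus_eq r_distr r_minus r_neg)
 hence "x -[R] y = 0[R]" using assms unfolding nonzerodivisor_def by simp
 thus ?thesis using assms by(simp add: r_right_minus_eq)
qed

lemma (in cring) unit_of_unit_mult: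
 assumes "u : Units R" "x : carrier R" "u *[R] x : Units R" shows "x : Units R"
proof -
 have "inv u *[R] (u *[R] x) = inv u *[R] u *[R] x"
  by(rule m_assoc[symmetric]) (use assms in auto)
 hence "inv u *[R] (u *[R] x) = x" using assms by simp
 thus ?thesis using Units_m_closed[OF Units_inv_Units[OF assms(1)] assms(3)] by simp
qed

text \<open>Regularity is demanded in a whole neighbourhood, so that \<open>regs\<close> describes
  exactly the germs in \<open>reg_stalk\<close>; on a general ringed space a nonzerodivisor germ
  need not spread.\<close>

definition regs :: "('a, 'r) ringed_space => 'a => ('a => 'r) => bool" where
 "regs X x b <-> lsec X x b & evn X x (%y. nzd X@@y (b y))"

context ringed
begin

lemma regs_lsec: "regs X x b ==> lsec X x b" unfolding regs_def by blast

lemma regs_near: "regs X x b ==> evn X x (%y. regs X y b)"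
 unfolding regs_def by(auto intro!: eventually_conj lsec_near near_near)

lemma regs_nzd: "regs X x b ==> nzd X@@x (b x)"
 unfolding regs_def by(auto dest!: near_self[of "%y. nzd X@@y (b y)"] intro: lsec_points)

lemma regs_carrier: "regs X x b ==> b x : carrier X@@x"
 by(rule lsec_carrier[OF regs_lsec])

lemma regs_RS:
 assumes "regs X x b" shows "b x : RS X x"
proof -
 have l: "lsec X x b" by(rule regs_lsec[OF assms])
 obtain V where V: "opn X V" "x : V" "restrict b V : sections X V" using l by(rule lsecE)
 obtain W where W: "opn X W" "x : W" "ALL y:W. nzd X@@y (b y)"
  by(rule nearE[OF conjunct2[OF assms[unfolded regs_def]] lsec_points[OF l]])
 have "restrict b (V Int W) : sections X (V Int W)" by(rule lsec_restrict[OF V(1,3)]) (use V W in auto)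
 hence "restrict b (V Int W) : reg_sections X (V Int W)" unfolding reg_sections_def using W by auto
 moreover have "opn X (V Int W)" "x : V Int W" "b x = restrict b (V Int W) x" using V W by auto
 ultimately show ?thesis unfolding reg_stalk_def by blast
qed

lemma reg_stalkE:
 assumes "r : RS X x"
 obtains b where "regs X x b" "b x = r"
proof -
 obtain b U where b: "r = b x" "opn X U" "x : U" "b : reg_sections X U"
  using assms unfolding reg_stalk_def by blast
 have *: "b : sections X U" "!!y. y : U ==> nzd X@@y (b y)"
  using b(4) unfolding reg_sections_def by auto
 have "regs X x b" unfolding regs_def
  by(intro conjI sections_lsec[OF b(2) *(1) b(3)] nearI[OF b(2,3)] *(2))
 thus thesis using that b(1) by blast
qed

lemma regs_unit:
 assumes "lsec X x b" "b x : Units X@@x" shows "regs X x b"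
proof -
 have "evn X x (%y. nzd X@@y (b y))"
  using lsec_unit_near(1)[OF assms] near_points[of X x] by eventually_elim (rule nzd_unit[OF stalk_cring])
 thus ?thesis using assms(1) unfolding regs_def by simp
qed

lemma regs_one: "x : points X ==> regs X x (%y. 1[X@@y])"
proof (rule regs_unit)
 assume x: "x : points X"
 show "lsec X x (%y. 1[X@@y])" by(rule lsec_one[OF x])
 interpret cring "X@@x" by(rule stalk_cring[OF x])
 show "1[X@@x] : Units X@@x" by simp
qed

lemma regs_mult:
 assumes "regs X x a" "regs X x b" shows "regs X x (%y. a y *[X@@y] b y)"
proof -
 have "evn X x (%y. nzd X@@y (a y))"
  "evn X x (%y. nzd X@@y (b y))" using assms unfolding regs_def by simp_all
 hence "evn X x (%y. nzd X@@y (a y *[X@@y] b y))"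
  using near_points[of X x] by eventually_elim (rule nzd_mult[OF stalk_cring])
 thus ?thesis using lsec_mult[of x a b] assms unfolding regs_def by simp
qed

lemma regs_factor:
 assumes "regs X x (%y. a y *[X@@y] b y)" "lsec X x a" "lsec X x b" shows "regs X x a"
proof -
 have "evn X x (%y. nzd X@@y (a y *[X@@y] b y))"
  using assms(1) unfolding regs_def by simp
 hence "evn X x (%y. nzd X@@y (a y))"
  using near_points[of X x] lsec_near[OF assms(2)] lsec_near[OF assms(3)]
  by eventually_elim (rule nzd_factor[OF stalk_cring], auto intro: lsec_carrier)
 thus ?thesis using assms unfolding regs_def by simp
qed

lemma regs_cong:
 assumes "regs X x a" "evn X x (%y. a y = b y)" shows "regs X x b"
proof -
 have "evn X x (%y. nzd X@@y (b y))"
  using assms(2) conjunct2[OF assms(1)[unfolded regs_def]] by eventually_elim simp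
 thus ?thesis using lsec_cong[OF regs_lsec[OF assms(1)] assms(2)] unfolding regs_def by simp
qed

lemma RS_nzd: "r : RS X x ==> nzd X@@x r"
 by(erule reg_stalkE) (auto dest: regs_nzd)

lemma RS_unit:
 assumes "x : points X" "u : Units X@@x" shows "u : RS X x"
proof -
 interpret cring "X@@x" by(rule stalk_cring[OF assms(1)])
 obtain s where "lsec X x s" "s x = u" using lsec_exists[OF assms(1), of u] assms(2) by auto
 thus ?thesis using regs_RS[OF regs_unit, of x s] assms(2) by simp
qed

lemma reg_localized: assumes x: "x : points X" shows "localized X@@x (RS X x)"
proof -
 have "mult_subset X@@x (RS X x)" unfolding mult_subset_def
 proof (intro conjI ballI subsetI)
  show "1[X@@x] : RS X x" using regs_RS[OF regs_one[OF x]] .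
  show "r : carrier X@@x" if "r : RS X x" for r
   using RS_nzd[OF that] unfolding nonzerodivisor_def by blast
  fix a b assume "a : RS X x" "b : RS X x"
  then obtain a' b' where "regs X x a'" "a' x = a" "regs X x b'" "b' x = b" by(metis reg_stalkE)
  thus "a *[X@@x] b : RS X x" using regs_RS[OF regs_mult[of x a' b']] by simp
 qed
 thus ?thesis using stalk_cring[OF x] unfolding localized_def localized_axioms_def by blast
qed

end

section \<open>Generic and weakly associated points\<close>

lemma irreducible_in_closure:
 assumes "y : topspace X" shows "irreducible_in X (X closure_of {y})"
 unfolding irreducible_in_def
proof (intro conjI allI impI)
 have y: "y : X closure_of {y}" using closure_of_subset[of "{y}" X] assms by blast
 thus "X closure_of {y} ~= {}" by blast
 show "X closure_of {y} <= topspace X" by(rule closure_of_subset_topspace)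
 fix A B assume *: "closedin X A & closedin X B & X closure_of {y} <= A Un B"
 hence "y : A | y : B" using y by blast
 thus "X closure_of {y} <= A | X closure_of {y} <= B"
  using * closure_of_minimal[of "{y}" A X] closure_of_minimal[of "{y}" B X] by blast
qed

context affine_chart
begin

text \<open>\<open>pr y' <= pr y\<close> says that \<open>y'\<close> is a generization of
  \<open>y\<close>, and a generization lies in every neighbourhood of \<open>y\<close>.\<close>

lemma near_generization:
 assumes "evn X y P" "y : V" "y' : V" "pr y' <= pr y"
 shows "P y'"
proof -
 obtain g where "g : carrier R" "rh y g : Units X@@y" "!!y. y : V ==> rh y g : Units X@@y ==> P y"
  using basisE[OF assms(1,2)] by blast
 thus ?thesis using assms unit_iff by blast
qed

text \<open>Generic points of components are minimal primes of the chart: if \<open>y'\<close> is a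
  generization of \<open>y\<close>, the closure of \<open>y'\<close> is irreducible and contains the
  component of \<open>y\<close>, so the two closures are equal.\<close>

lemma Max_points_minimal:
 assumes y: "y : V" "y : Max_points X" and y': "y' : V" "pr y' <= pr y"
 shows "y' = y"
proof -
 have p: "y : points X" "y' : points X" using V_points y y' by auto
 have "y : spc X closure_of {y'}" unfolding in_closure_of
 proof (intro conjI allI impI)
  fix T assume T: "y : T & opn X T"
  have "y' : T" by(rule near_generization[OF near_open y(1) y']) (use T in auto)
  thus "EX z. z : {y'} & z : T" by blast
 qed (rule p)
 hence sub: "spc X closure_of {y} <= spc X closure_of {y'}"
  by(intro closure_of_minimal) auto
 have "irreducible_component (spc X) (spc X closure_of {y})" using y(2) unfolding Max_points_def by blast
 hence "spc X closure_of {y'} = spc X closure_of {y}"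
  using irreducible_in_closure[OF p(2)] sub unfolding irreducible_component_def by blast
 hence cl: "y' : spc X closure_of {y}" using closure_of_subset[of "{y'}" "spc X"] p by blast
 have "pr y <= pr y'"
 proof
  fix r assume r: "r : pr y"
  hence rR: "r : carrier R" using pr_sub by blast
  show "r : pr y'"
  proof (rule ccontr)
   assume "r ~: pr y'"
   hence "evn X y' (%z. rh z r : Units X@@z)" using unit_near[OF y'(1) rR] unit_iff[OF y'(1) rR] by blast
   then obtain U where U: "opn X U" "y' : U" "ALL z:U. rh z r : Units X@@z" using p(2) by(rule nearE)
   hence "y : U" using cl unfolding in_closure_of by blast
   thus False using U(3) unit_iff[OF y(1) rR] r by blast
  qed
 qed
 thus ?thesis using pr_inj[OF y'(1) y(1)] y'(2) by blast
qed

text \<open>By minimality of \<open>pr y\<close> there is no point at all where \<open>r\<close> and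
  everything outside \<open>pr y\<close> are invertible. So \<open>1\<close> vanishes on this empty
  locus and is killed by some \<open>w r^n\<close>.\<close>

lemma Max_points_nilpotent:
 assumes y: "y : V" "y : Max_points X" and r: "r : carrier R" "r : pr y"
 obtains n :: nat where "rh y (r ^[R] n) = 0[X@@y]"
proof -
 interpret S: cring "X@@y" by(rule stalk_V[OF y(1)])
 note Sg = mult_subset_compl_prime[OF pr_prime[OF y(1)]]
 obtain w n where w: "w : carrier R - pr y" "w *[R] r ^[R] (n::nat) *[R] 1[R] = 0[R]"
 proof (rule killed_of_vanishing[OF Sg R.one_closed r(1)])
  fix y' assume y': "y' : V" "!!w. w : carrier R - pr y ==> rh y' w : Units X@@y'" "rh y' r : Units X@@y'"
  have "pr y' <= pr y" using y'(1,2) unit_iff pr_sub by blast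
  hence "y' = y" using Max_points_minimal[OF y y'(1)] by blast
  thus "rh y' 1[R] = 0[X@@y']" using y'(3) r unit_iff y by blast
 qed
 have wc: "w : carrier R" "rh y w : Units X@@y" using w(1) unit_iff[OF y(1)] by auto
 have "rh y w *[X@@y] rh y (r ^[R] n) = rh y w *[X@@y] 0[X@@y]"
  using arg_cong[OF w(2), of "rh y"] wc(1) r y by(simp add: rh_mult rh_zero)
 thus thesis using that[of n] S.Units_l_cancel[OF wc(2), of "rh y (r ^[R] n)" "0[X@@y]"] y r by simp
qed

text \<open>A nonzerodivisor in the maximal ideal would be nilpotent while all its powers are
  nonzerodivisors, forcing \<open>1 = 0\<close>.\<close>

lemma Max_points_nzd:
 assumes y: "y : V" "y : Max_points X" and nz: "nzd X@@y r"
 shows "r : Units X@@y"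
proof -
 interpret S: cring "X@@y" by(rule stalk_V[OF y(1)])
 have rc: "r : carrier X@@y" using nz unfolding nonzerodivisor_def by blast
 obtain a b where ab: "a : carrier R" "b : carrier R" "rh y b : Units X@@y" "rh y b *[X@@y] r = rh y a"
  using frac[OF y(1) rc] by blast
 have nza: "nzd X@@y (rh y a)"
  using nzd_mult[OF stalk_V[OF y(1)] nzd_unit[OF stalk_V[OF y(1)] ab(3)] nz] ab(4) by simp
 have "a ~: pr y"
 proof
  assume "a : pr y"
  then obtain n :: nat where n: "rh y (a ^[R] n) = 0[X@@y]" using Max_points_nilpotent[OF y ab(1)] by blast
  have "nzd X@@y (rh y (a ^[R] m))" for m :: nat
  proof (induction m)
   case 0 show ?case using nzd_unit[OF stalk_V[OF y(1)], of "1[X@@y]"] y by(simp add: rh_one)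
  next
   case (Suc m) thus ?case using nzd_mult[OF stalk_V[OF y(1)] _ nza] y ab(1) by(simp add: rh_mult)
  qed
  from this[of n] have "1[X@@y] = 0[X@@y]" unfolding n nonzerodivisor_def by simp
  thus False using local_ringD(2)[OF local_stalk[OF y(1)]] by simp
 qed
 hence "rh y b *[X@@y] r : Units X@@y" using unit_iff[OF y(1) ab(1)] ab(4) by simp
 thus "r : Units X@@y" by(rule S.unit_of_unit_mult[OF ab(3) rc])
qed

text \<open>Take a minimal prime over the annihilator of \<open>z\<close>.\<close>

lemma nonzero_at_WeakAss:
 assumes y: "y : V" and z: "z : carrier R" "rh y z ~= 0[X@@y]"
 obtains y' where "y' : V" "pr y' <= pr y" "y' : WeakAss X" "rh y' z ~= 0[X@@y']"
proof -
 interpret S: cring "X@@y" by(rule stalk_V[OF y])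
 let ?I = "{r : carrier R. rh y r *[X@@y] rh y z = 0[X@@y]}"
 have Ipr: "?I <= pr y"
 proof
  fix r assume r: "r : ?I"
  show "r : pr y"
  proof (rule ccontr)
   assume "r ~: pr y"
   hence "rh y r : Units X@@y" using r unit_iff[OF y] by blast
   hence "nzd X@@y (rh y r)" by(rule nzd_unit[OF S.is_cring])
   thus False using r z y unfolding nonzerodivisor_def by auto
  qed
 qed
 obtain P where P: "minimal_prime_over R ?I P" "P <= pr y"
  using R.exists_minimal_prime_between[OF pr_prime[OF y] Ipr] by blast
 hence Pp: "primeideal P R" "?I <= P" unfolding minimal_prime_over_def by auto
 obtain y' where y': "y' : V" "P = pr y'" using prime_pr[OF Pp(1)] by blast
 interpret S': cring "X@@y'" by(rule stalk_V[OF y'(1)])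
 let ?z = "rh y' z"
 have kill: "b : ?I" if b: "b : carrier R" "b *[R] z = 0[R]" for b
  using rh_mult[OF y b(1) z(1)] b rh_zero[OF y] by simp
 have z': "?z ~= 0[X@@y']"
 proof
  assume "?z = 0[X@@y']"
  then obtain b where b: "b : carrier R" "rh y' b : Units X@@y'" "b *[R] z = 0[R]" using zero[OF y'(1) z(1)] by blast
  thus False using kill Pp(2) y' unit_iff[OF y'(1) b(1)] by blast
 qed
 let ?A = "annihilator X@@y' ?z"
 note mx = local_ring_nonunits(1)[OF local_stalk[OF y'(1)]]
 have "minimal_prime_over X@@y' ?A (max_ideal X@@y')"
  unfolding minimal_prime_over_def mx
 proof (intro conjI allI impI)
  show "primeideal (carrier X@@y' - Units X@@y') X@@y'" by(rule local_ringD(3)[OF local_stalk[OF y'(1)]])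
  show A: "?A <= carrier X@@y' - Units X@@y'"
  proof
   fix u assume u: "u : ?A"
   have "u ~: Units X@@y'"
   proof
    assume "u : Units X@@y'"
    hence "nzd X@@y' u" by(rule nzd_unit[OF S'.is_cring])
    thus False using u z' z(1) y'(1) unfolding annihilator_def nonzerodivisor_def by auto
   qed
   thus "u : carrier X@@y' - Units X@@y'" using u unfolding annihilator_def by blast
  qed
  fix Q assume Q: "primeideal Q X@@y' & ?A <= Q & Q <= carrier X@@y' - Units X@@y'"
  interpret h: ring_hom_ring R "X@@y'" "rh y'"
   by(rule ring_hom_ringI2[OF R.ring_axioms S'.ring_axioms rh[OF y'(1)]])
  have Q': "primeideal {r : carrier R. rh y' r : Q} R" using h.primeideal_vimage[OF R.is_cring] Q by blast
  \<comment> \<open>An element killing \<open>z\<close> at \<open>y\<close> also kills it at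
    \<open>y'\<close>, since the denominator needed at \<open>y\<close> stays a unit at a
    generization. So a prime between the annihilator at \<open>y'\<close> and the maximal ideal
    pulls back to a prime over \<open>?I\<close>, where \<open>P\<close> is minimal.\<close>
  have "?I <= {r : carrier R. rh y' r : Q}"
  proof
   fix r assume r: "r : ?I"
   hence "rh y (r *[R] z) = 0[X@@y]" using rh_mult[OF y _ z(1)] by simp
   then obtain b where b: "b : carrier R" "rh y b : Units X@@y" "b *[R] (r *[R] z) = 0[R]"
    using zero[OF y, of "r *[R] z"] r z(1) by auto
   have "rh y' b : Units X@@y'" using b(1,2) P(2) y' unit_iff[OF y b(1)] unit_iff[OF y'(1) b(1)] by blast
   hence n: "nzd X@@y' (rh y' b)" by(rule nzd_unit[OF S'.is_cring])
   have "rh y' b *[X@@y'] (rh y' r *[X@@y'] ?z) = 0[X@@y']"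
    using arg_cong[OF b(3), of "rh y'"] b(1) r z(1) y'(1) by(simp add: rh_mult rh_zero)
   hence "rh y' r *[X@@y'] ?z = 0[X@@y']" using n r z(1) y'(1) unfolding nonzerodivisor_def by simp
   hence "rh y' r : ?A" using r y'(1) unfolding annihilator_def by simp
   thus "r : {r : carrier R. rh y' r : Q}" using Q r by blast
  qed
  moreover have "{r : carrier R. rh y' r : Q} <= P" unfolding y'(2) pr_def using Q by blast
  ultimately have QP: "{r : carrier R. rh y' r : Q} = P" using P(1) Q' unfolding minimal_prime_over_def by blast
  show "Q = carrier X@@y' - Units X@@y'"
  proof
   show "carrier X@@y' - Units X@@y' <= Q"
   proof
    fix n assume n: "n : carrier X@@y' - Units X@@y'"
    obtain a b where ab: "a : carrier R" "b : carrier R" "rh y' b : Units X@@y'" "rh y' b *[X@@y'] n = rh y' a"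
     using frac[OF y'(1), of n] n by blast
    have "rh y' a ~: Units X@@y'"
    proof
     assume "rh y' a : Units X@@y'"
     hence "rh y' b *[X@@y'] n : Units X@@y'" using ab by simp
     thus False using S'.unit_of_unit_mult[OF ab(3)] n by blast
    qed
    hence "a : P" using ab(1) y'(2) unfolding pr_def by blast
    hence "rh y' b *[X@@y'] n : Q" using QP ab(4) by auto
    moreover have "rh y' b ~: Q" using Q ab(3) by blast
    ultimately show "n : Q" using primeideal.I_prime[of Q "X@@y'" "rh y' b" n] Q n ab(2) y'(1) by auto
   qed
  qed (use Q in blast)
 qed
 hence "y' : WeakAss X" unfolding WeakAss_def using V_points[OF y'(1)] z(1) y'(1) by auto
 thus thesis using that y' P z' by blast
qed

text \<open>The local ring at \<open>y\<close> embeds into the product of the local rings at the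
  generic points specializing to \<open>y\<close>: a nonzero germ stays nonzero at some weakly
  associated generization, and those are the generic points by assumption.\<close>

lemma lsec_eq_zero:
 assumes W: "WeakAss X = Max_points X" and y: "y : V" and s: "lsec X y s"
  and van: "!!y'. y' : V ==> pr y' <= pr y ==> y' : Max_points X ==> s y' = 0[X@@y']"
 shows "s y = 0[X@@y]"
proof (rule ccontr)
 assume nz: "s y ~= 0[X@@y]"
 obtain a b where ab: "a : carrier R" "b : carrier R" "rh y b : Units X@@y"
  "!!y'. y' : V ==> rh y' b : Units X@@y' ==> rh y' b *[X@@y'] s y' = rh y' a"
  using lsec_frac[OF s y] by blast
 have "rh y a ~= 0[X@@y]"
 proof
  assume "rh y a = 0[X@@y]"
  hence "rh y b *[X@@y] s y = 0[X@@y]" using ab(4)[OF y ab(3)] by simp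
  thus False using nzd_unit[OF stalk_V[OF y] ab(3)] nz lsec_carrier[OF s] unfolding nonzerodivisor_def by blast
 qed
 then obtain y' where y': "y' : V" "pr y' <= pr y" "y' : WeakAss X" "rh y' a ~= 0[X@@y']"
  using nonzero_at_WeakAss[OF y ab(1)] by blast
 interpret S': cring "X@@y'" by(rule stalk_V[OF y'(1)])
 have "rh y' b : Units X@@y'" using ab(2,3) y' y unit_iff by blast
 thus False using ab(4)[OF y'(1)] van[OF y'(1,2)] y'(3,4) W ab(2) y'(1) by simp
qed

text \<open>If \<open>s x = 0\<close>, then \<open>x\<close> vanishes at the nearby generic points
  because \<open>s\<close> is a unit there, and hence is zero. This is the source of regular
  sections in the construction of denominators.\<close>

lemma regs_criterion:
 assumes W: "WeakAss X = Max_points X" and y: "y : V" and s: "lsec X y s"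
  and u: "evn X y (%y'. y' : Max_points X --> s y' : Units X@@y')"
 shows "regs X y s"
 unfolding regs_def
proof
 show "evn X y (%y. nzd X@@y (s y))"
  using lsec_near[OF s] near_near[OF u] near_V[OF y]
 proof eventually_elim
  case (elim y1)
  interpret S: cring "X@@y1" by(rule stalk_V[OF elim(3)])
  show ?case unfolding nonzerodivisor_def
  proof (intro conjI ballI impI)
   show sc: "s y1 : carrier X@@y1" by(rule lsec_carrier[OF elim(1)])
   fix x assume x: "x : carrier X@@y1" "s y1 *[X@@y1] x = 0[X@@y1]"
   obtain t where t: "lsec X y1 t" "t y1 = x" using lsec_exists[OF V_points[OF elim(3)] x(1)] by blast
   have ev: "evn X y1 (%y'. s y' *[X@@y'] t y' = 0[X@@y'])"
    by(rule lsec_eq[OF lsec_mult[OF elim(1) t(1)] lsec_zero[OF V_points[OF elim(3)]]]) (use x t in simp)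
   have "t y1 = 0[X@@y1]"
   proof (rule lsec_eq_zero[OF W elim(3) t(1)])
    fix y' assume y': "y' : V" "pr y' <= pr y1" "y' : Max_points X"
    have "s y' : Units X@@y'" using near_generization[OF elim(2) elim(3) y'(1,2)] y'(3) by blast
    moreover have "s y' *[X@@y'] t y' = 0[X@@y']" by(rule near_generization[OF ev elim(3) y'(1,2)])
    moreover have "t y' : carrier X@@y'" using near_generization[OF lsec_near[OF t(1)] elim(3) y'(1,2)] lsec_carrier by blast
    ultimately show "t y' = 0[X@@y']" using nzd_unit[OF stalk_V[OF y'(1)]] unfolding nonzerodivisor_def by blast
   qed
   thus "x = 0[X@@y1]" using t by simp
  qed
 qed
qed (rule s)

subsection \<open>Separating generic points\<close>

lemma Max_points_avoidance:
 assumes F: "finite F" "F <= V Int Max_points X" and J: "ideal J R" and nJ: "!!i. i : F ==> ~ J <= pr i"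
 obtains a where "a : J" "a : carrier R" "!!i. i : F ==> rh i a : Units X@@i"
proof -
 have "EX x:J. ALL P:pr ` F. x ~: P"
 proof (rule R.prime_avoidance[OF _ J])
  show "finite (pr ` F)" using F by simp
  show "primeideal P R & ~ J <= P" if "P : pr ` F" for P using that nJ pr_prime F by auto
  fix P Q assume "P : pr ` F" "Q : pr ` F" and sub: "P <= Q"
  then obtain i j where ij: "i : F" "j : F" "P = pr i" "Q = pr j" by blast
  have "i = j" using Max_points_minimal[of j i] ij F(2) sub by blast
  thus "P = Q" using ij by simp
 qed
 then obtain a where a: "a : J" "ALL P:pr ` F. a ~: P" by blast
 have "a : carrier R" using ideal.Icarr[OF J a(1)] .
 thus thesis using that a unit_iff F(2) by blast
qed

text \<open>The semilocalization of the chart at \<open>F\<close> has no points outside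
  \<open>F\<close>: otherwise \<open>pr y\<close> is contained in none of the minimal primes of
  \<open>F\<close>, and prime avoidance gives an element of \<open>pr y\<close> invertible at all of
  them.\<close>

lemma in_Max_points_of_units:
 assumes F: "finite F" "F <= V Int Max_points X" and y: "y : V"
  and u: "!!a. a : carrier R ==> (!!i. i : F ==> rh i a : Units X@@i) ==> rh y a : Units X@@y"
 shows "y : F"
proof (rule ccontr)
 assume yF: "y ~: F"
 have "~ pr y <= pr i" if "i : F" for i using Max_points_minimal[of i y] that F(2) y yF by blast
 then obtain a where "a : pr y" "a : carrier R" "!!i. i : F ==> rh i a : Units X@@i"
  using Max_points_avoidance[OF F pr_ideal[OF y]] by blast
 thus False using u unit_iff[OF y] by blast
qed

text \<open>A product with one factor for each \<open>j\<close>: an element of \<open>pr j\<close>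
  outside \<open>pr y\<close>, raised to a power that vanishes in the local ring at
  \<open>j\<close>.\<close>

lemma unit_vanishing_at:
 assumes F: "finite F" "F <= V Int Max_points X" and y: "y : V" and n: "!!j. j : F ==> ~ pr j <= pr y"
 shows "EX h:carrier R. rh y h : Units X@@y & (ALL j:F. rh j h = 0[X@@j])"
 using F n
proof (induction F rule: finite_induct)
 case empty
 interpret S: cring "X@@y" by(rule stalk_V[OF y])
 show ?case by(rule bexI[of _ "1[R]"]) (use y in \<open>auto simp: rh_one\<close>)
next
 case (insert j F)
 obtain h where h: "h : carrier R" "rh y h : Units X@@y" "ALL j:F. rh j h = 0[X@@j]"
  using insert by auto
 obtain r where r: "r : pr j" "r ~: pr y" "r : carrier R" using insert.prems(2)[of j] pr_sub by blast
 have j: "j : V" "j : Max_points X" using insert.prems by auto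
 obtain n :: nat where n: "rh j (r ^[R] n) = 0[X@@j]" using Max_points_nilpotent[OF j r(3,1)] by blast
 have "rh y (r ^[R] n) : Units X@@y" using unit_pow[OF y r(3)] unit_iff[OF y r(3)] r(2) by blast
 hence "rh y (h *[R] r ^[R] n) : Units X@@y" using unit_mult_iff[OF y h(1)] h(2) r(3) by simp
 moreover have "rh i (h *[R] r ^[R] n) = 0[X@@i]" if i: "i : insert j F" for i
 proof -
  have iV: "i : V" using i insert.prems by auto
  interpret S: cring "X@@i" by(rule stalk_V[OF iV])
  have e: "rh i (h *[R] r ^[R] n) = rh i h *[X@@i] rh i (r ^[R] n)"
   by(rule rh_mult[OF iV h(1)]) (use r in simp)
  show ?thesis
  proof (cases "i = j")
   case True thus ?thesis unfolding e using n S.r_null[OF rh_closed[OF iV h(1)]] by simp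
  next
   case False
   hence "rh i h = 0[X@@i]" using i h(3) by blast
   thus ?thesis unfolding e using iV r(3) by simp
  qed
 qed
 ultimately show ?case using h(1) r(3) by blast
qed

text \<open>Prime avoidance for the ideal of elements vanishing at \<open>F1\<close>: by
  \<open>unit_vanishing_at\<close> it is contained in the prime of no point of
  \<open>F2\<close>.\<close>

lemma separate_Max_points:
 assumes F: "finite F1" "F1 <= V Int Max_points X" "finite F2" "F2 <= V Int Max_points X" "F1 Int F2 = {}"
 obtains k where "k : carrier R" "!!i. i : F1 ==> rh i k = 0[X@@i]" "!!i. i : F2 ==> rh i k : Units X@@i"
proof -
 let ?J = "{r : carrier R. ALL i:F1. rh i r = 0[X@@i]}"
 have smul: "c *[R] r : ?J" if "r : ?J" "c : carrier R" for r c
 proof -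
  have "rh i (c *[R] r) = 0[X@@i]" if i: "i : F1" for i
  proof -
   have iV: "i : V" using i F by blast
   interpret S: cring "X@@i" by(rule stalk_V[OF iV])
   show ?thesis using \<open>r : ?J\<close> \<open>c : carrier R\<close> i iV by(simp add: rh_mult)
  qed
  thus ?thesis using that by auto
 qed
 have J: "ideal ?J R"
 proof (rule idealI[OF R.ring_axioms])
  show "c *[R] r : ?J" if "r : ?J" "c : carrier R" for r c by(rule smul[OF that])
  show "r *[R] c : ?J" if "r : ?J" "c : carrier R" for r c
   using smul[OF that] R.m_comm[of c r] that by auto
  show "subgroup ?J (add_monoid R)"
  proof (rule R.add.subgroupI)
   have "0[R] : ?J" using rh_zero F by auto
   thus "?J ~= {}" by blast
   show "-[R] r : ?J" if "r : ?J" for r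
    using smul[OF that, of "-[R] 1[R]"] that by(simp add: R.l_minus)
   fix a b assume ab: "a : ?J" "b : ?J"
   have "rh i (a +[R] b) = 0[X@@i]" if i: "i : F1" for i
   proof -
    have iV: "i : V" using i F by blast
    interpret S: cring "X@@i" by(rule stalk_V[OF iV])
    show ?thesis using ab i iV by(simp add: rh_add)
   qed
   thus "a +[R] b : ?J" using ab by auto
  qed blast
 qed
 have "~ ?J <= pr j" if j: "j : F2" for j
 proof -
  have jV: "j : V" "j : Max_points X" using j F by auto
  have "~ pr i <= pr j" if "i : F1" for i
   using Max_points_minimal[OF jV, of i] that F(2,5) j by blast
  then obtain h where "h : carrier R" "rh j h : Units X@@j" "ALL i:F1. rh i h = 0[X@@i]"
   using unit_vanishing_at[OF F(1,2) jV(1)] by blast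
  thus ?thesis using unit_iff[OF jV(1)] by blast
 qed
 then obtain a where "a : ?J" "a : carrier R" "!!i. i : F2 ==> rh i a : Units X@@i"
  using Max_points_avoidance[OF F(3,4) J] by blast
 thus thesis using that by blast
qed

lemma locally_finite_Max:
 assumes lf: "locally_finite_subset (spc X) (Max_points X)" and U: "evn X y P" and y: "y : V"
 obtains W where "opn X W" "y : W" "W <= V" "finite (W Int Max_points X)" "ALL z:W. P z"
proof -
 obtain U1 where U1: "opn X U1" "y : U1" "finite (U1 Int Max_points X)"
  using lf V_points[OF y] unfolding locally_finite_subset_def by blast
 obtain U2 where U2: "opn X U2" "y : U2" "ALL z:U2. P z" using U V_points[OF y] by(rule nearE)
 show thesis
 proof (rule that[of "U1 Int U2 Int V"])
  show "finite (U1 Int U2 Int V Int Max_points X)" by(rule finite_subset[OF _ U1(3)]) blast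
 qed (use U1 U2 V y in auto)
qed

end

section \<open>Meromorphic functions and divisors\<close>

abbreviation mfrac :: "('a, 'r) ringed_space => 'a => 'r => 'r => ('r \<times> 'r) set" where
 "mfrac X x == fraction X@@x (RS X x)"

abbreviation dcls :: "('a, 'r) ringed_space => 'a => 'r => 'r => ('r \<times> 'r) set set" where
 "dcls X x c e == div_class X x (mfrac X x c e)"

abbreviation (input) "dc X x c e \<equiv> dcls X x (c x) (e x)"
abbreviation (input) "mq X x c e \<equiv> mfrac X x (c x) (e x)"

abbreviation (input) "mfracs X V \<equiv> {(%s. fraction X@@s (RS X s) (a s) (b s)) |a b. a : sections X V & b : reg_sections X V}"

lemma merom_simps [simp]: "spc (merom X) = spc X" "stalk (merom X) = MS X"
 unfolding merom_def by simp_all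

context ringed
begin

lemma sections_merom: "sections (merom X) = locally_given (spc (merom X)) (%s. carrier (MS X s))
    (%V. mfracs X V)" unfolding merom_def by simp

lemma lsec_meromI:
 assumes a: "lsec X x a" and b: "regs X x b" and m: "evn X x (%y. m y = mq X y a b)"
 shows "lsec (merom X) x m"
proof -
 have x: "x : points X" by(rule lsec_points[OF a])
 have "evn X x (%y. m y = mq X y a b & lsec X y a & regs X y b)"
  by(intro eventually_conj m lsec_near[OF a] regs_near[OF b])
 then obtain V where V: "opn X V" "x : V" "ALL y:V. m y = mq X y a b & lsec X y a & regs X y b"
  using x by(rule nearE)
 have a': "restrict a V : sections X V" using V by(intro restrict_sections) auto
 have b': "restrict b V : reg_sections X V"
  unfolding reg_sections_def using V regs_lsec regs_nzd by(auto intro!: restrict_sections)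
 show ?thesis
 proof (rule lsec_locally_givenI[OF sections_merom])
  show "opn (merom X) V" "x : V" using V by auto
  show "(%s. mfrac X s (restrict a V s) (restrict b V s)) : mfracs X V" using a' b' by blast
  fix y assume y: "y : V"
  thus "m y = mfrac X y (restrict a V y) (restrict b V y)" using V by simp
  interpret l: localized "X@@y" "RS X y" by(rule reg_localized) (use y V openin_subset in blast)
  show "m y : carrier (MS X y)"
   using V(3) y lsec_carrier[of y a] regs_RS[of y b] unfolding merom_stalk_def by auto
 qed
qed

lemma lsec_meromE:
 assumes "lsec (merom X) x m"
 obtains a b where "lsec X x a" "regs X x b" "evn X x (%y. m y = mq X y a b)"
proof -
 show thesis
 proof (rule lsec_locally_givenD[OF sections_merom assms])
  fix V ta assume "opn (merom X) V" and xV: "x : V"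
   and ta: "ta : mfracs X V"
   and m: "!!y. y : V ==> m y = ta y"
  hence V: "opn X V" by simp
  from ta obtain a b where a: "ta = (%s. mq X s a b)" "a : sections X V" "b : reg_sections X V"
   by blast
  hence b: "b : sections X V" "!!y. y : V ==> nzd X@@y (b y)"
   by(simp_all add: reg_sections_def)
  have "regs X x b" unfolding regs_def
   by(intro conjI sections_lsec[OF V b(1) xV] nearI[OF V xV] b(2))
  moreover have "evn X x (%y. m y = mq X y a b)"
   by(rule nearI[OF V xV]) (use m a in simp)
  ultimately show thesis by(rule that[OF sections_lsec[OF V a(2) xV]])
 qed
qed

text \<open>Regular denominators cancel, so cross-multiplication decides equality without an
  auxiliary factor.\<close>

lemma mfrac_eq_iff:
 assumes x: "x : points X" and "a : carrier X@@x" "b : RS X x" "a' : carrier X@@x" "b' : RS X x"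
 shows "mfrac X x a b = mfrac X x a' b' <-> a *[X@@x] b' = a' *[X@@x] b"
proof -
 interpret l: localized "X@@x" "RS X x" by(rule reg_localized[OF x])
 have "(EX u:RS X x. u *[X@@x] (a *[X@@x] b') = u *[X@@x] (a' *[X@@x] b))
  <-> a *[X@@x] b' = a' *[X@@x] b"
 proof
  assume "EX u:RS X x. u *[X@@x] (a *[X@@x] b') = u *[X@@x] (a' *[X@@x] b)"
  then obtain u where u: "u : RS X x" "u *[X@@x] (a *[X@@x] b') = u *[X@@x] (a' *[X@@x] b)" by blast
  show "a *[X@@x] b' = a' *[X@@x] b"
   by(rule nzd_cancel[OF stalk_cring[OF x] RS_nzd[OF u(1)] _ _ u(2)]) (use assms in auto)
 next
  assume "a *[X@@x] b' = a' *[X@@x] b"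
  thus "EX u:RS X x. u *[X@@x] (a *[X@@x] b') = u *[X@@x] (a' *[X@@x] b)"
   by(intro bexI[OF _ l.one_S]) simp
 qed
 thus ?thesis using l.fr_eq_iff[OF assms(2-5)] by simp
qed

lemma merom_near_eq:
 assumes "lsec (merom X) x s" "lsec (merom X) x t" "s x = t x"
 shows "evn X x (%y. s y = t y)"
proof -
 obtain a b where s: "lsec X x a" "regs X x b" "evn X x (%y. s y = mq X y a b)"
  using assms(1) by(rule lsec_meromE)
 obtain a' b' where t: "lsec X x a'" "regs X x b'" "evn X x (%y. t y = mq X y a' b')"
  using assms(2) by(rule lsec_meromE)
 have x: "x : points X" by(rule lsec_points[OF s(1)])
 have eq: "(a y *[X@@y] b' y = a' y *[X@@y] b y) = (mq X y a b = mq X y a' b')"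
  if "lsec X y a" "lsec X y a'" "regs X y b" "regs X y b'" for y
  using mfrac_eq_iff[OF lsec_points[OF that(1)] lsec_carrier[OF that(1)] regs_RS[OF that(3)] lsec_carrier[OF that(2)] regs_RS[OF that(4)]] by simp
 have "evn X x (%y. a y *[X@@y] b' y = a' y *[X@@y] b y)"
  by(rule lsec_eq[OF lsec_mult[OF s(1) regs_lsec[OF t(2)]] lsec_mult[OF t(1) regs_lsec[OF s(2)]]])
   (use near_self[OF s(3) x] near_self[OF t(3) x] assms(3) eq[OF s(1) t(1) s(2) t(2)] in simp)
 thus ?thesis using s(3) t(3) lsec_near[OF s(1)] lsec_near[OF t(1)] regs_near[OF s(2)] regs_near[OF t(2)]
  by eventually_elim (simp add: eq)
qed

lemma merom_carrierE:
 assumes x: "x : points X" and e: "e : carrier (MS X x)"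
 obtains a b where "lsec X x a" "regs X x b" "e = mq X x a b"
proof -
 interpret l: localized "X@@x" "RS X x" by(rule reg_localized[OF x])
 obtain a b where ab: "a : carrier X@@x" "b : RS X x" "e = mfrac X x a b"
  by(rule l.carrierE[OF e[unfolded merom_stalk_def]])
 obtain a' where "lsec X x a'" "a' x = a" using lsec_exists[OF x ab(1)] by blast
 moreover obtain b' where "regs X x b'" "b' x = b" using ab(2) by(rule reg_stalkE)
 ultimately show thesis using that ab(3) by blast
qed

lemma merom_sheaf: "sheaf (merom X) (%x. carrier (MS X x))"
proof (rule sheaf_locally_given)
 show "sections (merom X) = locally_given (spc (merom X)) (%s. carrier (MS X s))
    (%V. mfracs X V)" unfolding merom_def by simp
 show "EX ta':mfracs X W.
   ALL y:W. ta' y = ta y"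
  if VW: "opn (merom X) V" "opn (merom X) W" "W <= V" "ta : mfracs X V" for V W ta
 proof -
  obtain a b where ab: "ta = (%s. mq X s a b)" "a : sections X V" "b : reg_sections X V" using VW(4) by blast
  have 1: "restrict a W : sections X W" using sections_restrict[of V W a] VW ab(2) by simp
  have "restrict b W : sections X W" using sections_restrict[of V W b] VW ab(3) unfolding reg_sections_def by simp
  hence 2: "restrict b W : reg_sections X W" using ab(3) VW(3) unfolding reg_sections_def by auto
  have 3: "ALL y:W. mfrac X y (restrict a W y) (restrict b W y) = ta y" unfolding ab by simp
  show ?thesis by(rule bexI[of _ "%s. mfrac X s (restrict a W s) (restrict b W s)"]) (use 1 2 3 in blast)+
 qed
 show "EX s. lsec (merom X) x s & s x = e" if xe: "x : points (merom X)" "e : carrier (MS X x)" for x e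
 proof -
  have x: "x : points X" using xe(1) by simp
  obtain a b where ab: "lsec X x a" "regs X x b" "e = mq X x a b" using x xe(2) by(rule merom_carrierE)
  have "lsec (merom X) x (%y. mq X y a b)" by(rule lsec_meromI[OF ab(1,2)]) simp
  thus ?thesis using ab(3) by blast
 qed
 show "evn (merom X) x (%y. s y = t y)" if "lsec (merom X) x s" "lsec (merom X) x t" "s x = t x" for x s t
  using merom_near_eq[OF that] by simp
qed

lemma cring_merom: "x : points X ==> cring (MS X x)"
 unfolding merom_stalk_def by(rule localized.cring_L[OF reg_localized])

lemma mfrac_carrier: "x : points X ==> a : carrier X@@x ==> b : RS X x ==> mfrac X x a b : carrier (MS X x)"
 unfolding merom_stalk_def by(rule localized.fr_carrier[OF reg_localized])

lemma mfrac_mult: 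
 "x : points X ==> a : carrier X@@x ==> b : RS X x ==> c : carrier X@@x ==> d : RS X x ==>
 mfrac X x a b *[MS X x] mfrac X x c d = mfrac X x (a *[X@@x] c) (b *[X@@x] d)"
 unfolding merom_stalk_def by(rule localized.mult_fr[OF reg_localized])

lemma RS_carrier: "x : points X ==> r : RS X x ==> r : carrier X@@x"
 by(rule localized.S_closed[OF reg_localized])

lemma RS_one: "x : points X ==> 1[X@@x] : RS X x"
 by(rule localized.one_S[OF reg_localized])

lemma RS_mult: "x : points X ==> r : RS X x ==> s : RS X x ==> r *[X@@x] s : RS X x"
 by(rule localized.mult_S[OF reg_localized])

text \<open>Regular germs form a saturated multiplicative set, because a factor of a nonzerodivisor
  is one, at each nearby point. The units of \<open>M\<close> are therefore the fractions with
  regular numerator.\<close>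

lemma RS_factor:
 assumes x: "x : points X" and "a : carrier X@@x" "c : carrier X@@x" "a *[X@@x] c : RS X x"
 shows "a : RS X x"
proof -
 obtain a' where a: "lsec X x a'" "a' x = a" using lsec_exists[OF x assms(2)] by blast
 obtain c' where c: "lsec X x c'" "c' x = c" using lsec_exists[OF x assms(3)] by blast
 obtain d where d: "regs X x d" "d x = a *[X@@x] c" using assms(4) by(rule reg_stalkE)
 have "evn X x (%y. d y = a' y *[X@@y] c' y)"
  by(rule lsec_eq[OF regs_lsec[OF d(1)] lsec_mult[OF a(1) c(1)]]) (use a c d in simp)
 thus ?thesis using regs_RS[OF regs_factor[OF regs_cong[OF d(1)] a(1) c(1)]] a(2) by simp
qed

lemma mfrac_Units_iff:
 assumes x: "x : points X" and a: "a : carrier X@@x" and b: "b : RS X x"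
 shows "mfrac X x a b : Units (MS X x) <-> a : RS X x"
proof -
 interpret l: localized "X@@x" "RS X x" by(rule reg_localized[OF x])
 have "mfrac X x a b : Units (MS X x) <-> (EX c:carrier X@@x. a *[X@@x] c : RS X x)"
  unfolding merom_stalk_def by(rule l.fr_Units_iff[OF a b])
 also have "... <-> a : RS X x"
  using RS_factor[OF x a] a by(metis l.one_closed l.r_one)
 finally show ?thesis .
qed

lemma merom_of_hom: "x : points X ==> merom_of X x : ring_hom X@@x (MS X x)"
 unfolding merom_stalk_def merom_of_def by(rule localized.fr_one_hom[OF reg_localized])

lemma merom_of_mult:
 assumes "x : points X" "r : carrier X@@x" "a : carrier X@@x" "b : RS X x"
 shows "merom_of X x r *[MS X x] mfrac X x a b = mfrac X x (r *[X@@x] a) b"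
proof -
 interpret l: localized "X@@x" "RS X x" by(rule reg_localized[OF assms(1)])
 show ?thesis using l.mult_fr[OF assms(2) l.one_S assms(3,4)] assms unfolding merom_of_def merom_stalk_def by simp
qed

subsection \<open>Stalks of the sheaf of divisors\<close>

lemma div_normal:
 assumes x: "x : points X"
 shows "comm_group (units_of (MS X x))" "const_units X x \<lhd> units_of (MS X x)"
  "const_units X x <= Units (MS X x)"
proof -
 interpret O: cring "X@@x" by(rule stalk_cring[OF x])
 interpret M: cring "MS X x" by(rule cring_merom[OF x])
 note h = merom_of_hom[OF x]
 show G: "comm_group (units_of (MS X x))" by(rule M.units_comm_group)
 interpret G: comm_group "units_of (MS X x)" by(rule G)
 show sub: "const_units X x <= Units (MS X x)"
  unfolding const_units_def using ring_hom_Units[OF h O.is_cring M.is_cring] by blast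
 have "subgroup (const_units X x) (units_of (MS X x))"
 proof (rule G.subgroupI)
  show "const_units X x <= carrier (units_of (MS X x))" using sub by(simp add: units_of_carrier)
  show "const_units X x ~= {}" unfolding const_units_def using O.Units_one_closed by blast
  fix a assume "a : const_units X x"
  then obtain u where u: "u : Units X@@x" "a = merom_of X x u" unfolding const_units_def by blast
  have iu: "inv[X@@x] u : Units X@@x" using u by simp
  have "merom_of X x (inv[X@@x] u) *[MS X x] a = merom_of X x (inv[X@@x] u *[X@@x] u)"
   using u iu ring_hom_mult[OF h, of "inv[X@@x] u" u] by(simp add: O.Units_closed)
  also have "... = 1[MS X x]" using u ring_hom_one[OF h] by simp
  finally have "inv[units_of (MS X x)] a = merom_of X x (inv[X@@x] u)"
   using u iu ring_hom_Units[OF h O.is_cring M.is_cring]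
   by(intro G.inv_equality) (auto simp: units_of_carrier units_of_mult units_of_one)
  thus "inv[units_of (MS X x)] a : const_units X x" unfolding const_units_def using iu by simp
  fix b assume "b : const_units X x"
  then obtain v where v: "v : Units X@@x" "b = merom_of X x v" unfolding const_units_def by blast
  hence "a *[units_of (MS X x)] b = merom_of X x (u *[X@@x] v)"
   using u ring_hom_mult[OF h, of u v] by(simp add: units_of_mult O.Units_closed)
  thus "a *[units_of (MS X x)] b : const_units X x" unfolding const_units_def using u v by simp
 qed
 thus "const_units X x \<lhd> units_of (MS X x)" by(rule G.subgroup_imp_normal)
qed

lemma in_div_class_iff:
 "m' : div_class X x m <-> (EX w:Units X@@x. m' = merom_of X x w *[MS X x] m)"
 unfolding div_class_def r_coset_def const_units_def by(auto simp: units_of_mult)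

lemma div_class_eq_iff:
 assumes x: "x : points X" and m: "m : Units (MS X x)" "m' : Units (MS X x)"
 shows "div_class X x m' = div_class X x m <-> (EX w:Units X@@x. m' = merom_of X x w *[MS X x] m)"
proof -
 interpret N: normal "const_units X x" "units_of (MS X x)" by(rule div_normal[OF x])
 have "div_class X x m' = div_class X x m <-> m' : div_class X x m"
  unfolding div_class_def using N.repr_independence[of m' "const_units X x" m] N.subgroup_axioms
   N.repr_independenceD[of "const_units X x" m' m] m by(auto simp: units_of_carrier)
 thus ?thesis unfolding in_div_class_iff .
qed

lemma div_class_self: "x : points X ==> m : Units (MS X x) ==> m : div_class X x m"
proof -
 assume x: "x : points X" and m: "m : Units (MS X x)"
 interpret N: normal "const_units X x" "units_of (MS X x)" by(rule div_normal[OF x])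
 show ?thesis unfolding div_class_def by(rule N.rcos_self) (use m N.subgroup_axioms in \<open>auto simp: units_of_carrier\<close>)
qed

lemma div_carrier: "x : points X ==> carrier (div_stalk X x) = div_class X x ` Units (MS X x)"
 unfolding div_stalk_def carrier_FactGroup div_class_def by(auto simp: units_of_carrier)

lemma div_mult:
 assumes x: "x : points X" and m: "m : Units (MS X x)" "m' : Units (MS X x)"
 shows "div_class X x m *[div_stalk X x] div_class X x m' = div_class X x (m *[MS X x] m')"
proof -
 interpret N: normal "const_units X x" "units_of (MS X x)" by(rule div_normal[OF x])
 show ?thesis unfolding div_stalk_def div_class_def
  using N.rcos_sum[of m m'] m by(simp add: units_of_carrier units_of_mult)
qed

lemma div_group: "x : points X ==> group (div_stalk X x)"
 unfolding div_stalk_def by(rule normal.factorgroup_is_group[OF div_normal(2)])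

lemma div_one: assumes x: "x : points X" shows "1[div_stalk X x] = div_class X x 1[MS X x]"
proof -
 interpret N: normal "const_units X x" "units_of (MS X x)" by(rule div_normal[OF x])
 show ?thesis unfolding div_stalk_def div_class_def
  using N.coset_mult_one[OF N.subset] by(simp add: units_of_one)
qed

lemma mfrac_one: "x : points X ==> mfrac X x 1[X@@x] 1[X@@x] = 1[MS X x]"
 unfolding merom_stalk_def by(simp add: localized.one_fr[OF reg_localized])

lemma dcls_eq_iff:
 assumes x: "x : points X" and r: "c : RS X x" "e : RS X x" "c' : RS X x" "e' : RS X x"
 shows "dcls X x c e = dcls X x c' e' <->
  (EX w:Units X@@x. c *[X@@x] e' = w *[X@@x] (c' *[X@@x] e))"
proof -
 interpret O: cring "X@@x" by(rule stalk_cring[OF x])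
 have c: "c : carrier X@@x" "e : carrier X@@x" "c' : carrier X@@x" "e' : carrier X@@x"
  using RS_carrier[OF x] r by auto
 have u: "mfrac X x c e : Units (MS X x)" "mfrac X x c' e' : Units (MS X x)"
  using mfrac_Units_iff[OF x] c r by auto
 have "mfrac X x c e = merom_of X x w *[MS X x] mfrac X x c' e' <-> c *[X@@x] e' = w *[X@@x] (c' *[X@@x] e)"
  if w: "w : Units X@@x" for w
 proof -
  have wc: "w : carrier X@@x" using w by(rule O.Units_closed)
  show ?thesis unfolding merom_of_mult[OF x wc c(3) r(4)]
   using mfrac_eq_iff[OF x c(1) r(2) _ r(4), of "w *[X@@x] c'"] wc c O.m_assoc[of w c' e] by simp
 qed
 thus ?thesis using div_class_eq_iff[OF x u(2,1)] by blast
qed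

text \<open>The unit comparing the two divisors at \<open>x\<close> extends to a unit near
  \<open>x\<close>, and the cross-multiplied identity spreads with it. Continuity of maps into the
  espace etale rests on this.\<close>

lemma dcls_near:
 assumes r: "regs X x c" "regs X x e" "regs X x c'" "regs X x e'" and eq: "dc X x c e = dc X x c' e'"
 shows "evn X x (%y. dc X y c e = dc X y c' e')"
proof -
 have x: "x : points X" by(rule lsec_points[OF regs_lsec[OF r(1)]])
 interpret O: cring "X@@x" by(rule stalk_cring[OF x])
 obtain w where w: "w : Units X@@x" "c x *[X@@x] e' x = w *[X@@x] (c' x *[X@@x] e x)"
  using eq dcls_eq_iff[OF x] regs_RS r by blast
 obtain w' where w': "lsec X x w'" "w' x = w" using lsec_exists[OF x] w(1) by blast
 have "evn X x (%y. c y *[X@@y] e' y = w' y *[X@@y] (c' y *[X@@y] e y))"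
  by(intro lsec_eq lsec_mult regs_lsec r w') (use w w' in simp)
 moreover have "evn X x (%y. w' y : Units X@@y)" by(rule lsec_unit_near) (use w w' in auto)
 ultimately show ?thesis using regs_near[OF r(1)] regs_near[OF r(2)] regs_near[OF r(3)] regs_near[OF r(4)] near_points[of X x]
 proof eventually_elim
  case (elim y) thus ?case using dcls_eq_iff[OF elim(7)] regs_RS by blast
 qed
qed

lemma div_carrierE:
 assumes x: "x : points X" and d: "de : carrier (div_stalk X x)"
 obtains c e where "regs X x c" "regs X x e" "de = dc X x c e"
proof -
 interpret M: cring "MS X x" by(rule cring_merom[OF x])
 obtain m where m: "m : Units (MS X x)" "de = div_class X x m" using d div_carrier[OF x] by blast
 hence "m : carrier (MS X x)" by(simp add: M.Units_closed)
 then obtain a e where ae: "lsec X x a" "regs X x e" "m = mq X x a e" using merom_carrierE[OF x] by blast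
 have "a x : RS X x"
  using mfrac_Units_iff[OF x lsec_carrier[OF ae(1)] regs_RS[OF ae(2)]] m ae(3) by blast
 then obtain c where c: "regs X x c" "c x = a x" by(rule reg_stalkE)
 thus thesis using that[OF c(1) ae(2)] m ae(3) by simp
qed

lemma dcls_carrier: "x : points X ==> c : RS X x ==> e : RS X x ==> dcls X x c e : carrier (div_stalk X x)"
 unfolding div_carrier using mfrac_Units_iff RS_carrier by blast

lemma dcls_mult:
 assumes "x : points X" "c : RS X x" "e : RS X x" "c' : RS X x" "e' : RS X x"
 shows "dcls X x c e *[div_stalk X x] dcls X x c' e' = dcls X x (c *[X@@x] c') (e *[X@@x] e')"
 using div_mult[OF assms(1), of "mfrac X x c e" "mfrac X x c' e'"] mfrac_mult[OF assms(1)] mfrac_Units_iff[OF assms(1)]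
  RS_carrier[OF assms(1)] assms by simp

lemma dcls_one: "x : points X ==> 1[div_stalk X x] = dcls X x 1[X@@x] 1[X@@x]"
 by(simp add: div_one mfrac_one)

lemma dcls_trivial:
 assumes x: "x : points X" and t: "RS X x <= Units X@@x" and d: "de : carrier (div_stalk X x)"
 shows "de = 1[div_stalk X x]"
proof -
 interpret O: cring "X@@x" by(rule stalk_cring[OF x])
 obtain c e where ce: "regs X x c" "regs X x e" "de = dc X x c e" using div_carrierE[OF x d] by blast
 have u: "c x : Units X@@x" "e x : Units X@@x" using regs_RS ce(1,2) t by auto
 have "c x *[X@@x] inv[X@@x] e x *[X@@x] (1[X@@x] *[X@@x] e x) = c x *[X@@x] 1[X@@x]"
  using u by(simp add: O.m_assoc O.Units_closed)
 moreover have "c x *[X@@x] inv[X@@x] e x : Units X@@x" using u by simp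
 ultimately show ?thesis unfolding ce(3) dcls_one[OF x]
  using dcls_eq_iff[OF x regs_RS[OF ce(1)] regs_RS[OF ce(2)] RS_one[OF x] RS_one[OF x]] by metis
qed

subsection \<open>Stalks of the invertible sheaf\<close>

lemma L_stalk_simps:
 "x' +[L_stalk X (x, de)] y' = x' +[MS X x] y'"
 "x' *[L_stalk X (x, de)] y' = x' *[MS X x] y'"
 "r .[L_stalk X (x, de)] y' = merom_of X x r *[MS X x] y'"
 "carrier (L_stalk X (x, de)) = {merom_of X x r *[MS X x] m |r m. r : carrier X@@x & m : de}"
 unfolding L_stalk_def merom_module_def by(simp_all add: alg_module_def)

text \<open>Both \<open>c\<close> and \<open>e\<close> are nonzerodivisors, so a multiple of
  \<open>c/e\<close> determines its coefficient: the lift is a free generator of the stalk of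
  \<open>L\<close>.\<close>

lemma L_rank_one:
 assumes x: "x : points X" and r: "c : RS X x" "e : RS X x"
  and B: "cring B" "fi : ring_hom X@@x B"
 shows "rank_one X@@x B fi (L_stalk X (x, dcls X x c e)) (mfrac X x c e)"
proof -
 interpret O: cring "X@@x" by(rule stalk_cring[OF x])
 interpret B: cring B by(rule B)
 interpret M: cring "MS X x" by(rule cring_merom[OF x])
 let ?m = "mfrac X x c e"
 have cc: "c : carrier X@@x" "e : carrier X@@x" using RS_carrier[OF x] r by auto
 have u: "?m : Units (MS X x)" using mfrac_Units_iff[OF x] cc r by auto
 have mc: "?m : carrier (MS X x)" using u by(rule M.Units_closed)
 have h: "merom_of X x s : carrier (MS X x)" if "s : carrier X@@x" for s
  by(rule ring_hom_closed[OF merom_of_hom[OF x] that])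
 have mem: "?m : dcls X x c e" by(rule div_class_self[OF x u])
 show ?thesis
 proof (unfold_locales, unfold L_stalk_simps)
  show "fi : ring_hom X@@x B" by(rule B)
  show "merom_of X x s *[MS X x] ?m : {merom_of X x r *[MS X x] m |r m. r : carrier X@@x & m : dcls X x c e}"
   if "s : carrier X@@x" for s using that mem by blast
  show "EX s:carrier X@@x. n = merom_of X x s *[MS X x] ?m"
   if n: "n : {merom_of X x r *[MS X x] m |r m. r : carrier X@@x & m : dcls X x c e}" for n
  proof -
   obtain s w where s: "s : carrier X@@x" "w : Units X@@x" "n = merom_of X x s *[MS X x] (merom_of X x w *[MS X x] ?m)"
    using n unfolding in_div_class_iff by blast
   have "n = merom_of X x (s *[X@@x] w) *[MS X x] ?m"
    unfolding s(3) using s(1,2) mc h ring_hom_mult[OF merom_of_hom[OF x], of s w] by(simp add: M.m_assoc O.Units_closed)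
   thus ?thesis using s(1,2) by(intro bexI[of _ "s *[X@@x] w"]) (auto simp: O.Units_closed)
  qed
  show "s = s'" if s: "s : carrier X@@x" "s' : carrier X@@x"
   "merom_of X x s *[MS X x] ?m = merom_of X x s' *[MS X x] ?m" for s s'
  proof -
   have "mfrac X x (s *[X@@x] c) e = mfrac X x (s' *[X@@x] c) e"
    using s(3) merom_of_mult[OF x s(1) cc(1) r(2)] merom_of_mult[OF x s(2) cc(1) r(2)] by simp
   hence "e *[X@@x] (c *[X@@x] s) = e *[X@@x] (c *[X@@x] s')"
    using mfrac_eq_iff[OF x _ r(2) _ r(2), of "s *[X@@x] c" "s' *[X@@x] c"] s cc by(simp add: O.m_ac)
   hence "c *[X@@x] s = c *[X@@x] s'"
    by(rule nzd_cancel[OF O.is_cring RS_nzd[OF r(2)], rotated -1]) (use s cc in auto)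
   thus "s = s'"
    by(rule nzd_cancel[OF O.is_cring RS_nzd[OF r(1)], rotated -1]) (use s in auto)
  qed
  show "merom_of X x s *[MS X x] ?m +[MS X x] merom_of X x s' *[MS X x] ?m
   = merom_of X x (s +[X@@x] s') *[MS X x] ?m"
   if s: "s : carrier X@@x" "s' : carrier X@@x" for s s'
   using s h mc ring_hom_add[OF merom_of_hom[OF x], of s s'] by(simp add: M.l_distr)
  show "merom_of X x s *[MS X x] (merom_of X x s' *[MS X x] ?m) = merom_of X x (s *[X@@x] s') *[MS X x] ?m"
   if s: "s : carrier X@@x" "s' : carrier X@@x" for s s'
   using s h mc ring_hom_mult[OF merom_of_hom[OF x], of s s'] by(simp add: M.m_assoc)
  show "merom_of X x 1[X@@x] *[MS X x] ?m = ?m"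
   using mc ring_hom_one[OF merom_of_hom[OF x]] by simp
 qed
qed

end

section \<open>Points of the group schemes\<close>

abbreviation (input) "dsecs X V \<equiv> {%s. div_class X s (m s) |m. m : sections (merom X) V & (ALL s:V. m s : Units (MS X s))}"
abbreviation (input) "isecs X W \<equiv> {%y. s (fst y) |s U. opn X U & fst ` W <= U & s : sections X U}"
abbreviation (input) "psum S T a b l n \<equiv> %t. tensor_class (base_at S a t) (struct_at T a t) (L_at S a t) (\<Sum>i<n. frag_of (b i t, l i a$t))"
abbreviation (input) "psecs S T a V \<equiv> {psum S T a b l n |(n :: nat) b l W.
 openin (Pi_topology S) W & pt a ` V <= W & (ALL i<n. b i : sections T V & l i : L_sections S W)}"

lemma Pi_space_simps [simp]: "spc (Pi_space S) = Pi_topology S" "(Pi_space S)@@z = S@@(fst z)"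
 unfolding Pi_space_def inverse_image_def by simp_all

lemma locally_givenE:
 assumes "s : locally_given X E B W" "x : W"
 obtains V ta where "openin X V" "x : V" "V <= W" "ta : B V" "ALL y:V. s y = ta y"
 using locally_givenD[OF assms] that by(elim exE conjE)

context ringed
begin

lemma mfrac_sections:
 assumes U: "opn X U" and c: "!!y. y : U ==> lsec X y c" "!!y. y : U ==> regs X y e"
 shows "(\<lambda>y\<in>U. mq X y c e) : sections (merom X) U"
proof (rule sheaf.restrict_sections[OF merom_sheaf])
 show "lsec (merom X) y (%y. mq X y c e)" if "y : U" for y
  by(rule lsec_meromI[OF c(1)[OF that] c(2)[OF that]]) simp
qed (use U in simp)

lemma Pi_open:
 assumes c: "regs X x c" and e: "regs X x e"
 obtains U where "opn X U" "x : U" "openin (Pi_topology X) ((%y. (y, dc X y c e)) ` U)"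
  "ALL y:U. regs X y c & regs X y e"
proof -
 have x: "x : points X" by(rule lsec_points[OF regs_lsec[OF c]])
 have "evn X x (%y. regs X y c & regs X y e)" by(intro eventually_conj regs_near c e)
 then obtain U where U: "opn X U" "x : U" "ALL y:U. regs X y c & regs X y e" using x by(rule nearE)
 have UX: "y : points X" if "y : U" for y using openin_subset[OF U(1)] that by blast
 let ?m = "\<lambda>y\<in>U. mq X y c e"
 have m: "?m : sections (merom X) U" by(rule mfrac_sections[OF U(1)]) (use U(3) regs_lsec in auto)
 have mu: "?m y : Units (MS X y)" if "y : U" for y
  using mfrac_Units_iff[OF UX[OF that], of "c y" "e y"] regs_RS[of y] regs_carrier[of y] U(3) that by simp
 have "(\<lambda>y\<in>U. dc X y c e) : div_sections X U" unfolding div_sections_def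
 proof (rule locally_givenI)
  fix y assume y: "y : U"
  show "EX V ta. opn X V & y : V & V <= U & ta : dsecs X V &
   (ALL y:V. (\<lambda>y\<in>U. dc X y c e) y = ta y & (\<lambda>y\<in>U. dc X y c e) y : carrier (div_stalk X y))"
  proof (intro exI[of _ U] exI[of _ "%s. div_class X s (?m s)"] conjI ballI)
   show "(%s. div_class X s (?m s)) : dsecs X U"
    using m mu by blast
   fix z assume z: "z : U"
   thus "(\<lambda>y\<in>U. dc X y c e) z = div_class X z (?m z)" by simp
   show "(\<lambda>y\<in>U. dc X y c e) z : carrier (div_stalk X z)"
    using dcls_carrier[OF UX[OF z]] regs_RS[of z] U(3) z by simp
  qed (use U y in auto)
 qed simp
 hence "openin (Pi_topology X) ((%y. (y, (\<lambda>y\<in>U. dc X y c e) y)) ` U)"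
  unfolding Pi_topology_def using U(1) by(intro topology_generated_by_Basis) blast
 moreover have "(%y. (y, (\<lambda>y\<in>U. dc X y c e) y)) ` U = (%y. (y, dc X y c e)) ` U" by(rule image_cong) auto
 ultimately have "openin (Pi_topology X) ((%y. (y, dc X y c e)) ` U)" by simp
 thus thesis using that[OF U(1,2) _ U(3)] by simp
qed

lemma div_sections_chart:
 assumes U: "opn X U" and d: "d : div_sections X U" and x: "x : U"
 obtains c e where "regs X x c" "regs X x e" "evn X x (%y. d y = dc X y c e)"
proof -
 obtain V ta where V1: "opn X V" "x : V" "V <= U"
  and ta: "ta : dsecs X V"
  and V2: "ALL y:V. d y = ta y"
  by(rule locally_givenE[OF d[unfolded div_sections_def] x])
 note V = V1(1,2) V2
 from ta obtain m where m: "ta = (%s. div_class X s (m s))" "m : sections (merom X) V" "ALL s:V. m s : Units (MS X s)"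
  by blast
 have xX: "x : points X" using V openin_subset by blast
 have "lsec (merom X) x m" by(rule sheaf.sections_lsec[OF merom_sheaf _ m(2) V(2)]) (use V in simp)
 then obtain a e where ae: "lsec X x a" "regs X x e" "evn X x (%y. m y = mq X y a e)"
  by(rule lsec_meromE)
 have "mq X x a e : Units (MS X x)" 
  using bspec[OF m(3) V(2)] unfolding near_self[OF ae(3) xX] .
 hence "a x : RS X x" using mfrac_Units_iff[OF xX lsec_carrier[OF ae(1)] regs_RS[OF ae(2)]] by simp
 \<comment> \<open>A section with the same germ as the numerator \<open>a\<close> at
   \<open>x\<close> that is regular in a whole neighbourhood.\<close>
 then obtain c where c: "regs X x c" "c x = a x" by(rule reg_stalkE)
 have "evn X x (%y. c y = a y)" by(rule lsec_eq[OF regs_lsec[OF c(1)] ae(1) c(2)])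
 moreover have "evn X x (%y. y : V)" by(rule near_open[OF V(1,2)])
 ultimately have "evn X x (%y. d y = dc X y c e)"
  using ae(3) by eventually_elim (use V(3) m(1) in simp)
 thus thesis using that c(1) ae(2) by blast
qed

lemma points_Pi: "topspace (Pi_topology X) = {(x, de). x : points X & de : carrier (div_stalk X x)}"
proof (intro equalityI subsetI)
 fix z assume "z : topspace (Pi_topology X)"
 then obtain U d x where U: "opn X U" "d : div_sections X U" "x : U" "z = (x, d x)"
  unfolding Pi_topology_def topology_generated_by_topspace by blast
 have "d x : carrier (div_stalk X x)" using PiE_mem[OF locally_given_PiE[OF U(2)[unfolded div_sections_def]] U(3)] .
 thus "z : {(x, de). x : points X & de : carrier (div_stalk X x)}" using U openin_subset[OF U(1)] by auto
next
 fix z assume "z : {(x, de). x : points X & de : carrier (div_stalk X x)}"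
 then obtain x de where z: "z = (x, de)" "x : points X" "de : carrier (div_stalk X x)" by blast
 obtain c e where ce: "regs X x c" "regs X x e" "de = dc X x c e" using z(2,3) by(rule div_carrierE)
 obtain U where U: "opn X U" "x : U" "openin (Pi_topology X) ((%y. (y, dc X y c e)) ` U)"
  "ALL y:U. regs X y c & regs X y e" by(rule Pi_open[OF ce(1,2)])
 thus "z : topspace (Pi_topology X)" using openin_subset[OF U(3)] z(1) ce(3) by blast
qed

end

section \<open>Local charts of the points of the group schemes\<close>

locale gm = S: ringed S + T: ringed T for S :: "('a, 'r) ringed_space" and T :: "('b, 'k) ringed_space" +
 fixes f assumes f: "lrs_hom T S f"
begin

abbreviation ten where
 "ten t de v m == tensor_class S@@(f$t) (alg_module (cm f t) T@@t) (L_stalk S (f$t, de)) (frag_of (v, m))"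

lemma f_points: "t : points T ==> f$t : points S" by(rule lrs_homD(8)[OF f])
lemma f_hom: "t : points T ==> cm f t : ring_hom S@@(f$t) T@@t" by(rule lrs_homD(4)[OF f])
lemma f_closed: "t : points T ==> r : carrier S@@(f$t) ==> cm f t r : carrier T@@t"
 by(rule ring_hom_closed[OF f_hom])
lemma f_near: "t : points T ==> evn S f$t P ==> evn T t (%t. P f$t)"
 by(rule near_pullback[OF lrs_homD(1)[OF f]])

lemma L_rank1:
 assumes "t : points T" "c : RS S f$t" "e : RS S f$t"
 shows "rank_one S@@(f$t) T@@t (cm f t) (L_stalk S (f$t, dcls S f$t c e)) (mfrac S f$t c e)"
 by(rule S.L_rank_one[OF f_points assms(2,3) T.stalk_cring f_hom]) (rule assms)+

text \<open>One triple serves a whole neighbourhood of \<open>t\<close>. It is far from unique: a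
  unit of \<open>S\<close> may be moved between \<open>c/e\<close> and \<open>v\<close>.\<close>

definition gchart where
 "gchart a al t v c e <-> lsec T t v & v t : Units T@@t & regs S f$t c & regs S f$t e &
  evn T t (%t. a$t = (f$t, dc S f$t c e) &
   al t = ten t (dc S f$t c e) (v t) (mq S f$t c e))"

lemma Pi_pointD:
 assumes "a : Pi_points S T f"
 shows "cm a = cm f" "pt a : extensional (points T)" "continuous_map (spc T) (Pi_topology S) (pt a)"
  "!!t. t : points T ==> fst a$t = f$t"
  "!!t. t : points T ==> snd a$t : carrier (div_stalk S f$t)"
proof -
 have a: "lrs_hom T (Pi_space S) a" "mor_comp T S (Pi_proj S) a = f" using assms unfolding Pi_points_def by auto
 show "continuous_map (spc T) (Pi_topology S) (pt a)" "pt a : extensional (points T)"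
  using lrs_homD(1,2)[OF a(1)] by simp_all
 have P: "a$t : topspace (Pi_topology S)" if "t : points T" for t using lrs_homD(8)[OF a(1) that] by simp
 show 1: "fst a$t = f$t" if "t : points T" for t
  using that P[OF that] unfolding a(2)[symmetric] mor_comp_def Pi_proj_def by simp
 show "snd a$t : carrier (div_stalk S f$t)" if "t : points T" for t
  using P[OF that] 1[OF that] unfolding S.points_Pi by auto
 show "cm a = cm f"
 proof (rule extensionalityI[OF lrs_homD(3)[OF a(1)] lrs_homD(3)[OF f]])
  fix t assume t: "t : points T"
  show "cm a t = cm f t"
  proof (rule extensionalityI)
   show "cm a t : extensional (carrier S@@(f$t))" using lrs_homD(5)[OF a(1) t] 1[OF t] by simp
   show "cm f t : extensional (carrier S@@(f$t))" by(rule lrs_homD(5)[OF f t])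
   fix r assume r: "r : carrier S@@(f$t)"
   have "cm (mor_comp T S (Pi_proj S) a) t r = cm a t r"
    using t r P[OF t] 1[OF t] unfolding mor_comp_def Pi_proj_def by simp
   thus "cm a t r = cm f t r" using a(2) by simp
  qed
 qed
qed

text \<open>For continuity, the preimage of a basic open set given by another divisor
  \<open>d\<close> has to be open: two divisors that agree at a point agree near it.\<close>

lemma Pi_pointI:
 assumes A: "A : extensional (points T)"
  and ch: "!!t. t : points T ==> EX c e. regs S f$t c & regs S f$t e &
   evn T t (%t. A t = (f$t, dc S f$t c e))"
 shows "(|pt = A, cm = cm f|) : Pi_points S T f"
proof -
 let ?a = "(|pt = A, cm = cm f|)"
 have A1: "A t : topspace (Pi_topology S) & fst (A t) = f$t" if t: "t : points T" for t
 proof -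
  obtain c e where ce: "regs S f$t c" "regs S f$t e"
   "evn T t (%t. A t = (f$t, dc S f$t c e))" using ch[OF t] by blast
  show ?thesis using near_self[OF ce(3) t] f_points[OF t] S.dcls_carrier[OF f_points[OF t]] S.regs_RS ce
   unfolding S.points_Pi by simp
 qed
 have cont: "continuous_map (spc T) (Pi_topology S) A" unfolding Pi_topology_def
 proof (rule continuous_on_generated_topo)
  show "A ` points T <= \<Union> {(%s. (s, d s)) ` U |U d. opn S U & d : div_sections S U}"
   using A1 unfolding Pi_topology_def topology_generated_by_topspace by blast
  fix B assume "B : {(%s. (s, d s)) ` U |U d. opn S U & d : div_sections S U}"
  then obtain U d where B: "B = (%s. (s, d s)) ` U" "opn S U" "d : div_sections S U" by blast
  show "opn T (A -` B Int points T)"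
  proof (rule open_of_near)
   fix t assume "t : A -` B Int points T"
   hence t: "t : points T" "A t : B" by auto
   obtain c e where ce: "regs S f$t c" "regs S f$t e"
    "evn T t (%t. A t = (f$t, dc S f$t c e))" using ch[OF t(1)] by blast
   have s: "f$t : U" "d f$t = dc S f$t c e"
    using near_self[OF ce(3) t(1)] t(2) B(1) by auto
   obtain c' e' where ce': "regs S f$t c'" "regs S f$t e'"
    "evn S f$t (%y. d y = dc S y c' e')" using S.div_sections_chart[OF B(2,3) s(1)] by blast
   have "dc S f$t c e = dc S f$t c' e'"
    using near_self[OF ce'(3) f_points[OF t(1)]] s(2) by simp
   hence "evn S f$t (%y. dc S y c e = dc S y c' e')"
    by(rule S.dcls_near[OF ce(1,2) ce'(1,2)])
   with ce'(3) near_open[OF B(2) s(1)] have "evn S f$t (%y. y : U & d y = dc S y c e)"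
    by eventually_elim simp
   hence "evn T t (%t. f$t : U & d f$t = dc S f$t c e)"
    by(rule f_near[OF t(1)])
   with ce(3) near_points[of T t] have "evn T t (%t. t : A -` B Int points T)"
    by eventually_elim (auto simp: B(1))
   thus "t : points T & evn T t (%t. t : A -` B Int points T)" using t by blast
  qed
 qed
 have hom: "lrs_hom T (Pi_space S) ?a" unfolding lrs_hom_def Pi_space_simps morphism.select_convs
 proof (intro conjI ballI allI impI)
  fix t assume t: "t : points T"
  note F = lrs_homD(4,5,6)[OF f t] A1[OF t, THEN conjunct2]
  show "cm f t : ring_hom S@@(fst (A t)) T@@t" "cm f t : extensional (carrier S@@(fst (A t)))"
   "cm f t ` max_ideal S@@(fst (A t)) <= max_ideal T@@t" using F by simp_all
 next
  fix V s assume "openin (Pi_topology S) V & s : sections (Pi_space S) V"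
  hence V: "openin (Pi_topology S) V" and s: "s : sections (Pi_space S) V" by auto
  show "(\<lambda>x\<in>{x : points T. A x : V}. cm f x (s (A x))) : sections T {x : points T. A x : V}"
  proof (rule T.restrict_sections[OF openin_continuous_map_preimage[OF cont V]])
   fix x assume x: "x : {x : points T. A x : V}"
   have AV: "A x : V" using x by simp
   obtain V' ta where V1: "openin (Pi_topology S) V'" "A x : V'" "V' <= V"
    and ta: "ta : isecs S V'"
    and V2: "ALL y:V'. s y = ta y"
    by(rule locally_givenE[OF s[unfolded Pi_space_def inverse_image_def ringed_space.select_convs] AV])
   note V' = V1(1,2) V2
   from ta obtain si U where si: "ta = (%y. si (fst y))" "opn S U" "fst ` V' <= U" "si : sections S U" by blast
   have fx: "fst (A x) = f$x" "x : points T" using A1 x by auto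
   have "f$x : U" using si(3) V'(2) fx by force
   hence l: "lsec T x (%x. cm f x (si f$x))" by(intro lsec_pullback[OF f fx(2)] S.sections_lsec[OF si(2,4)])
   have "opn T {x : points T. A x : V'}" by(rule openin_continuous_map_preimage[OF cont V'(1)])
   hence "evn T x (%x. x : {x : points T. A x : V'})" by(rule near_open) (use V' fx in auto)
   hence "evn T x (%x. cm f x (si f$x) = cm f x (s (A x)))"
   proof eventually_elim
    case (elim y)
    hence "s (A y) = si (fst (A y))" using V'(3) si(1) by simp
    thus ?case using A1[of y] elim by simp
   qed
   thus "lsec T x (%x. cm f x (s (A x)))" by(rule T.lsec_cong[OF l])
  qed
 qed (use cont A lrs_homD(3)[OF f] in simp_all)
 have "mor_comp T S (Pi_proj S) ?a = f"
 proof (rule morphism.equality)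
  show "pt (mor_comp T S (Pi_proj S) ?a) = pt f"
   using A1 lrs_homD(2)[OF f] unfolding mor_comp_def Pi_proj_def by(auto intro!: extensionalityI[of _ "points T"])
  show "cm (mor_comp T S (Pi_proj S) ?a) = cm f"
  proof (rule extensionalityI[of _ "points T"])
   fix t assume t: "t : points T"
   have e: "(Pi_proj S)$(A t) = f$t" using A1[OF t] unfolding Pi_proj_def by simp
   have "cm (mor_comp T S (Pi_proj S) ?a) t = (\<lambda>r\<in>carrier S@@(f$t). cm f t r)"
    using t A1[OF t] e unfolding mor_comp_def by(auto simp: Pi_proj_def)
   thus "cm (mor_comp T S (Pi_proj S) ?a) t = cm f t"
    using extensional_restrict[OF lrs_homD(5)[OF f t]] by simp
  qed (use lrs_homD(3)[OF f] in \<open>simp_all add: mor_comp_def\<close>)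
 qed simp
 thus ?thesis using hom unfolding Pi_points_def by blast
qed

lemma ten_inj:
 assumes "t : points T" "c : RS S f$t" "e : RS S f$t" "v : carrier T@@t" "w : carrier T@@t"
  and "ten t (dcls S f$t c e) v (mfrac S f$t c e) = ten t (dcls S f$t c e) w (mfrac S f$t c e)"
 shows "v = w"
 using rank_one.cl_inj[OF L_rank1[OF assms(1-3)] assms(6,4,5)] .

lemma ten_smult:
 assumes t: "t : points T" and ce: "c : RS S f$t" "e : RS S f$t" and v: "v : carrier T@@t" and r: "r : carrier S@@(f$t)"
 shows "ten t (dcls S f$t c e) v (mfrac S f$t (r *[S@@(f$t)] c) e)
  = ten t (dcls S f$t c e) (v *[T@@t] cm f t r) (mfrac S f$t c e)"
proof -
 interpret rank_one "S@@(f$t)" "T@@t" "cm f t" "L_stalk S (f$t, dcls S f$t c e)" "mfrac S f$t c e"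
  by(rule L_rank1[OF t ce])
 show ?thesis using cl_smult[OF v r] S.merom_of_mult[OF f_points[OF t] r S.RS_carrier[OF f_points[OF t] ce(1)] ce(2)]
  unfolding S.L_stalk_simps by simp
qed

lemma ten_scale:
 assumes t: "t : points T" and ce: "c : RS S f$t" "e : RS S f$t"
  and v: "v : carrier T@@t" "b : carrier T@@t"
 shows "tensor_map S@@(f$t) (alg_module (cm f t) T@@t) (L_stalk S (f$t, dcls S f$t c e))
   (%x. b *[T@@t] x) id (ten t (dcls S f$t c e) v (mfrac S f$t c e))
  = ten t (dcls S f$t c e) (b *[T@@t] v) (mfrac S f$t c e)"
proof -
 interpret rank_one "S@@(f$t)" "T@@t" "cm f t" "L_stalk S (f$t, dcls S f$t c e)" "mfrac S f$t c e"
  by(rule L_rank1[OF t ce])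
 show ?thesis
  using tensor_map_pair[OF tensor_pair_axioms, of "%x. b *[T@@t] x" id "%r. r" v "mfrac S f$t c e"] v e_N
  by(simp add: B.r_distr B.m_lcomm)
qed

text \<open>The sections required by the sheafified pullback are tensors with the single term
  \<open>v \<otimes> c/e\<close>, and such a section generates because \<open>v\<close> is a
  unit.\<close>

lemma chart_carrier:
 assumes A: "A : extensional (points T)" and al: "al : extensional (points T)"
  and ch: "!!t. t : points T ==> EX v c e. gchart (|pt = A, cm = cm f|) al t v c e"
 shows "((|pt = A, cm = cm f|), al) : carrier (Gm_lft S T f)"
proof -
 let ?a = "(|pt = A, cm = cm f|)"
 have "?a : Pi_points S T f"
 proof (rule Pi_pointI[OF A])
  fix t assume "t : points T"
  then obtain v c e where "gchart ?a al t v c e" using ch by blast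
  thus "EX c e. regs S f$t c & regs S f$t e &
   evn T t (%t. A t = (f$t, dc S f$t c e))"
   unfolding gchart_def by(auto elim!: eventually_mono)
 qed
 moreover have "al : pullL_generators S T ?a" unfolding pullL_generators_def
 proof (intro CollectI conjI ballI)
  show "al : pullL_sections S T ?a (points T)" unfolding pullL_sections_def
  proof (rule locally_givenI[OF al])
   fix t assume t: "t : points T"
   then obtain v c e where g: "gchart ?a al t v c e" using ch by blast
   hence v: "lsec T t v" and ce: "regs S f$t c" "regs S f$t e" unfolding gchart_def by auto
   obtain U where U0: "opn S U" "f$t : U" "openin (Pi_topology S) ((%y. (y, dc S y c e)) ` U)"
    "ALL y:U. regs S y c & regs S y e" by(rule S.Pi_open[OF ce])
   note U = U0(1-3) U0(4)[THEN bspec, THEN conjunct1] U0(4)[THEN bspec, THEN conjunct2]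
   let ?W = "(%y. (y, dc S y c e)) ` U"
   let ?Q = "%t. ?a$t = (f$t, dc S f$t c e) &
     al t = ten t (dc S f$t c e) (v t) (mq S f$t c e)"
   have "evn T t (%t. ?Q t & lsec T t v & f$t : U)"
    by(intro eventually_conj lsec_near[OF v] f_near[OF t] near_open[OF U(1,2)] g[unfolded gchart_def, THEN conjunct2, THEN conjunct2, THEN conjunct2, THEN conjunct2])
   then obtain V where V: "opn T V" "t : V" "ALL t:V. ?Q t & lsec T t v & f$t : U" using t by(rule nearE)
   have VT: "V <= points T" by(rule openin_subset[OF V(1)])
   define b where "b = (%_::nat. restrict v V)"
   define l where "l = (%_::nat. \<lambda>z\<in>?W. mq S (fst z) c e)"
   have bs: "b i : sections T V" for i unfolding b_def by(rule T.restrict_sections[OF V(1)]) (use V in blast)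
   have US: "y : points S" if "y : U" for y using openin_subset[OF U(1)] that by blast
   have lW: "l i z = mq S (fst z) c e" if "z : ?W" for i z unfolding l_def using that by simp
   have ls: "l i : L_sections S ?W" for i unfolding L_sections_def
   proof (intro CollectI conjI ballI)
    show "l i : sections (inverse_image (Pi_topology S) fst (merom S)) ?W"
     unfolding inverse_image_def ringed_space.select_convs
    proof (rule locally_givenI)
     let ?m = "\<lambda>y\<in>U. mq S y c e"
     have m: "?m : sections (merom S) U"
      by(rule S.mfrac_sections[OF U(1) S.regs_lsec[OF U(4)] U(5)])
     fix z assume z: "z : ?W"
     show "EX V ta. openin (Pi_topology S) V & z : V & V <= ?W &
       ta : isecs (merom S) V &
       (ALL y:V. l i y = ta y & l i y : carrier (merom S)@@(fst y))"
     proof (intro exI[of _ ?W] exI[of _ "%y. ?m (fst y)"] conjI ballI)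
      have "opn (merom S) U" using U(1) by simp
      moreover have "fst ` ?W <= U" by auto
      ultimately show "(%y. ?m (fst y)) : isecs (merom S) ?W"
       using m by blast
      fix y assume y: "y : ?W"
      hence yU: "fst y : U" by auto
      show "l i y = ?m (fst y)" using lW[OF y] yU by simp
      show "l i y : carrier (merom S)@@(fst y)" unfolding lW[OF y]
       using S.mfrac_carrier[OF US[OF yU] S.regs_carrier[OF U(4)[OF yU]] S.regs_RS[OF U(5)[OF yU]]] by simp
     qed (use U(3) z in auto)
    qed (simp add: l_def)
    fix z assume z: "z : ?W"
    then obtain y where y: "y : U" "z = (y, dc S y c e)" by blast
    have "rank_one S@@y S@@y id (L_stalk S (y, dc S y c e)) (mq S y c e)"
     by(rule S.L_rank_one[OF US[OF y(1)] S.regs_RS[OF U(4)[OF y(1)]] S.regs_RS[OF U(5)[OF y(1)]] S.stalk_cring[OF US[OF y(1)]]])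
      (simp add: ring_hom_def)
    thus "l i z : carrier (L_stalk S z)" unfolding lW[OF z] unfolding y(2) fst_conv by(rule rank_one.e_N)
   qed
   show "EX V ta. opn T V & t : V & V <= points T &
    ta : psecs S T ?a V &
    (ALL y:V. al y = ta y & al y : pullL_stalk S T ?a y)"
   proof (intro exI[of _ V] exI[of _ "psum S T ?a b l 1"] conjI ballI)
    have "pt ?a ` V <= ?W"
    proof
     fix z assume "z : pt ?a ` V"
     then obtain y where "y : V" "z = (f$y, dc S f$y c e)" "f$y : U" using V(3) by auto
     thus "z : ?W" by blast
    qed
    thus "(psum S T ?a b l 1) :
     psecs S T ?a V"
     using U(3) bs ls by blast
    fix y assume y: "y : V"
    hence Q: "?Q y" "lsec T y v" "f$y : U" "y : points T" using V(3) VT by auto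
    have "?a$y : ?W" using Q(1,3) by simp
    thus "al y = tensor_class (base_at S ?a y) (struct_at T ?a y) (L_at S ?a y) (\<Sum>i<1. frag_of (b i y, l i ?a$y))"
     using Q y by(simp add: lW b_def)
    interpret R: rank_one "S@@(f$y)" "T@@y" "cm f y" "L_stalk S (f$y, dc S f$y c e)"
     "mq S f$y c e"
     by(rule L_rank1[OF Q(4) S.regs_RS[OF U(4)[OF Q(3)]] S.regs_RS[OF U(5)[OF Q(3)]]])
    show "al y : pullL_stalk S T ?a y" unfolding pullL_stalk_def
     using Q R.pair_carrier[OF _ R.e_N, of "v y"] T.lsec_carrier[OF Q(2)] by simp
   qed (use V VT in auto)
  qed
  fix t z assume t: "t : points T" and z: "z : pullL_stalk S T ?a t"
  then obtain v c e where g: "gchart ?a al t v c e" using ch by blast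
  hence v: "v t : Units T@@t" and ce: "regs S f$t c" "regs S f$t e" unfolding gchart_def by auto
  have at: "A t = (f$t, dc S f$t c e)"
   "al t = ten t (dc S f$t c e) (v t) (mq S f$t c e)"
   using near_self[OF g[unfolded gchart_def, THEN conjunct2, THEN conjunct2, THEN conjunct2, THEN conjunct2] t] by simp_all
  note cr = S.regs_RS[OF ce(1)] S.regs_RS[OF ce(2)]
  interpret R: rank_one "S@@(f$t)" "T@@t" "cm f t" "L_stalk S (f$t, dc S f$t c e)"
     "mq S f$t c e" by(rule L_rank1[OF t cr])
  have "z : tensor_carrier S@@(f$t) (alg_module (cm f t) T@@t) (L_stalk S (f$t, dc S f$t c e))"
   using z unfolding pullL_stalk_def by(simp add: at)
  then obtain w where w: "w : carrier T@@t" "z = R.cl (frag_of (w, mq S f$t c e))"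
   by(rule R.carrier_cl)
  let ?b = "w *[T@@t] inv[T@@t] v t"
  have b: "?b : carrier T@@t" "?b *[T@@t] v t = w" using w v by(simp_all add: R.B.m_assoc R.B.Units_closed)
  show "EX c:carrier T@@t. z = tensor_map (base_at S ?a t) (struct_at T ?a t) (L_at S ?a t) (%x. c *[T@@t] x) id (al t)"
   by(rule bexI[OF _ b(1)]) (use ten_scale[OF t cr R.B.Units_closed[OF v] b(1)] b(2) w(2) in \<open>simp add: at\<close>)
 qed
 ultimately show ?thesis unfolding Gm_lft_def by simp
qed

text \<open>Converse of \<open>chart_carrier\<close>. A section of the pullback is locally a finite
  sum of tensors; their second factors are all multiples of one local lift \<open>c/e\<close>, so
  the sum collapses to a single tensor by induction on the number of terms.\<close>

lemma carrier_chart: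
 assumes aal: "(a, al) : carrier (Gm_lft S T f)" and t: "t : points T"
 obtains v c e where "gchart a al t v c e"
proof -
 have a: "a : Pi_points S T f" and al: "al : pullL_generators S T a" using aal unfolding Gm_lft_def by auto
 note aD = Pi_pointD[OF a]
 have ft: "f$t : points S" by(rule f_points[OF t])
 obtain c e where ce: "regs S f$t c" "regs S f$t e" "snd a$t = dc S f$t c e"
  using ft aD(5)[OF t] by(rule S.div_carrierE)
 obtain U where U0: "opn S U" "f$t : U" "openin (Pi_topology S) ((%y. (y, dc S y c e)) ` U)"
   "ALL y:U. regs S y c & regs S y e" by(rule S.Pi_open[OF ce(1,2)])
  note U = U0(1-3) U0(4)[THEN bspec, THEN conjunct1] U0(4)[THEN bspec, THEN conjunct2]
 have at: "a$t = (f$t, dc S f$t c e)" using aD(4)[OF t] ce(3) by(simp add: prod_eq_iff)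
 have "opn T {t : points T. a$t : (%y. (y, dc S y c e)) ` U}"
  by(rule openin_continuous_map_preimage[OF aD(3) U(3)])
 hence "evn T t (%t. t : {t : points T. a$t : (%y. (y, dc S y c e)) ` U})"
  by(rule near_open) (use t at U(2) in auto)
 hence ev: "evn T t (%t. t : points T & f$t : U & a$t = (f$t, dc S f$t c e))"
 proof eventually_elim
  case (elim t)
  then obtain y where y: "y : U" "a$t = (y, dc S y c e)" "t : points T" by blast
  hence "y = f$t" using aD(4)[of t] by simp
  thus ?case using y by simp
 qed
 have als: "al : pullL_sections S T a (points T)" using al unfolding pullL_generators_def by simp
 obtain V ta where V1: "opn T V" "t : V" "V <= points T"
  and ta: "ta : psecs S T a V"
  and V2: "ALL y:V. al y = ta y"
  by(rule locally_givenE[OF als[unfolded pullL_sections_def] t])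
 note V = V1 V2
 from ta obtain n :: nat and b l W where W: "openin (Pi_topology S) W" "pt a ` V <= W"
  and bl: "ALL i<n. b i : sections T V & l i : L_sections S W"
  and tae: "ta = (psum S T a b l n)" by blast
 let ?cl = "%t. tensor_class S@@(f$t) (alg_module (cm f t) T@@t) (L_stalk S (f$t, dc S f$t c e))"
 let ?m = "%y. mq S y c e"
 have sums: "EX v. lsec T t v & evn T t (%t. ?cl t (\<Sum>i<k. frag_of (b i t, l i a$t)) = ?cl t (frag_of (v t, ?m f$t)))"
  if "k <= n" for k
  using that
 proof (induction k)
  case 0
  have "evn T t (%t. ?cl t (\<Sum>i<0. frag_of (b i t, l i a$t)) = ?cl t (frag_of (0[T@@t], ?m f$t)))"
   using ev
  proof eventually_elim
   case (elim t)
   hence t: "t : points T" "f$t : U" by auto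
   show ?case using rank_one.cl_zero[OF L_rank1[OF t(1) S.regs_RS[OF U(4)[OF t(2)]] S.regs_RS[OF U(5)[OF t(2)]]]] by simp
  qed
  thus ?case using T.lsec_zero[OF t] by blast
 next
  case (Suc k)
  then obtain v where v: "lsec T t v" "evn T t (%t. ?cl t (\<Sum>i<k. frag_of (b i t, l i a$t)) = ?cl t (frag_of (v t, ?m f$t)))"
   by auto
  have bk: "b k : sections T V" and lk: "l k : L_sections S W" using bl Suc.prems by auto
  have blk: "lsec T t (b k)" by(rule T.sections_lsec[OF V(1) bk V(2)])
  have atW: "a$t : W" using W(2) V(2) by blast
  have lks: "l k : sections (inverse_image (Pi_topology S) fst (merom S)) W" using lk unfolding L_sections_def by simp
  obtain W' ta' where W1: "openin (Pi_topology S) W'" "a$t : W'" "W' <= W"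
   and ta': "ta' : isecs (merom S) W'"
   and W2: "ALL y:W'. l k y = ta' y"
   by(rule locally_givenE[OF lks[unfolded inverse_image_def ringed_space.select_convs] atW])
  note W' = W1(1,2) W2
  from ta' obtain si U' where si: "ta' = (%y. si (fst y))" "opn (merom S) U'" "fst ` W' <= U'" "si : sections (merom S) U'" by blast
  have ftU': "f$t : U'" using si(3) W'(2) at by force
  have sil: "lsec (merom S) f$t si" by(rule sheaf.sections_lsec[OF S.merom_sheaf si(2,4) ftU'])
  have "opn T {t : points T. a$t : W'}" by(rule openin_continuous_map_preimage[OF aD(3) W'(1)])
  hence "evn T t (%t. t : {t : points T. a$t : W'})" by(rule near_open) (use t W' in auto)
  hence lev: "evn T t (%t. l k a$t = si f$t)"
   by eventually_elim (use W'(3) si(1) aD(4) in simp)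
  have "l k a$t : carrier (L_stalk S a$t)" using lk atW unfolding L_sections_def by blast
  then obtain r where r: "r : carrier S@@(f$t)" "l k a$t = r .[L_stalk S a$t] ?m f$t"
   using rank_one.gen[OF L_rank1[OF t S.regs_RS[OF ce(1)] S.regs_RS[OF ce(2)]]] unfolding at by blast
  obtain r' where r': "lsec S f$t r'" "r' f$t = r" using S.lsec_exists[OF ft r(1)] by blast
  have "lsec (merom S) f$t (%y. mfrac S y (r' y *[S@@y] c y) (e y))"
   by(rule S.lsec_meromI[OF S.lsec_mult[OF r'(1) S.regs_lsec[OF ce(1)]] ce(2)]) simp
  \<comment> \<open>The coefficient of \<open>l k\<close> is known at one point only; equality of
    meromorphic germs spreads it to a neighbourhood on \<open>S\<close>, and from there it is pulled
    back to \<open>T\<close>.\<close>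
  hence "evn S f$t (%y. si y = mfrac S y (r' y *[S@@y] c y) (e y))"
   using near_self[OF lev t] r r' S.merom_of_mult[OF ft r(1) S.regs_carrier[OF ce(1)] S.regs_RS[OF ce(2)]]
   by(intro S.merom_near_eq[OF sil]) (simp_all add: at S.L_stalk_simps)
  moreover have "evn S f$t (%y. lsec S y r')" by(rule lsec_near[OF r'(1)])
  ultimately have "evn S f$t (%y. si y = mfrac S y (r' y *[S@@y] c y) (e y) & lsec S y r')"
   by(rule eventually_conj)
  hence rev: "evn T t (%t. si f$t = mfrac S f$t (r' f$t *[S@@(f$t)] c f$t) (e f$t) & lsec S f$t r')"
   by(rule f_near[OF t])
  let ?v = "%t. v t +[T@@t] b k t *[T@@t] cm f t (r' f$t)"
  have "lsec T t ?v" by(rule T.lsec_add[OF v(1) T.lsec_mult[OF blk lsec_pullback[OF f t r'(1)]]])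
  moreover have "evn T t (%t. ?cl t (\<Sum>i<Suc k. frag_of (b i t, l i a$t)) = ?cl t (frag_of (?v t, ?m f$t)))"
   using ev v(2) lev rev lsec_near[OF v(1)] lsec_near[OF blk]
  proof eventually_elim
   case (elim t)
   hence t: "t : points T" "f$t : U" by auto
   note cr = S.regs_RS[OF U(4)[OF t(2)]] S.regs_RS[OF U(5)[OF t(2)]]
   note R = L_rank1[OF t(1) cr]
   have rc: "r' f$t : carrier S@@(f$t)" using elim(4) S.lsec_carrier by blast
   have "l k a$t = r' f$t .[L_stalk S (f$t, dc S f$t c e)] ?m f$t"
    using elim(3,4) S.merom_of_mult[OF f_points[OF t(1)] rc S.RS_carrier[OF f_points[OF t(1)] cr(1)] cr(2)]
    unfolding S.L_stalk_simps by simp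
   thus ?case
    using rank_one.cl_add[OF R elim(2) T.lsec_carrier[OF elim(5)] T.lsec_carrier[OF elim(6)] rc] by simp
  qed
  ultimately show ?case by blast
 qed
 obtain v where v: "lsec T t v" "evn T t (%t. ?cl t (\<Sum>i<n. frag_of (b i t, l i a$t)) = ?cl t (frag_of (v t, ?m f$t)))"
  using sums[of n] by blast
 have "evn T t (%t. t : V)" by(rule near_open[OF V(1,2)])
 with ev v(2) have main: "evn T t (%t. a$t = (f$t, dc S f$t c e) &
   al t = ?cl t (frag_of (v t, ?m f$t)))"
 proof eventually_elim
  case (elim t)
  hence "al t = ta t" using V(4) by blast
  thus ?case using elim unfolding tae by(simp add: aD(1))
 qed
 \<comment> \<open>The tensor \<open>1 \<otimes> c/e\<close> is a multiple of the generator;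
   comparing coordinates gives an inverse of \<open>v t\<close>.\<close>
 have "v t : Units T@@t"
 proof -
  note cr = S.regs_RS[OF ce(1)] S.regs_RS[OF ce(2)]
  interpret R: rank_one "S@@(f$t)" "T@@t" "cm f t" "L_stalk S (f$t, dc S f$t c e)"
     "?m f$t" by(rule L_rank1[OF t cr])
  have vc: "v t : carrier T@@t" by(rule T.lsec_carrier[OF v(1)])
  have "?cl t (frag_of (1[T@@t], ?m f$t)) : pullL_stalk S T a t"
   unfolding pullL_stalk_def using R.pair_carrier[OF _ R.e_N, of "1[T@@t]"] by(simp add: at aD(1))
  then obtain b where b: "b : carrier T@@t" "?cl t (frag_of (1[T@@t], ?m f$t)) =
    tensor_map (base_at S a t) (struct_at T a t) (L_at S a t) (%x. b *[T@@t] x) id (al t)"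
   using al t unfolding pullL_generators_def by blast
  hence "?cl t (frag_of (1[T@@t], ?m f$t)) = ?cl t (frag_of (b *[T@@t] v t, ?m f$t))"
   using ten_scale[OF t cr vc b(1)] near_self[OF main t] by(simp add: aD(1))
  hence "1[T@@t] = b *[T@@t] v t" by(rule R.cl_inj) (use b vc in auto)
  thus ?thesis using b(1) vc R.B.m_comm[OF b(1) vc] unfolding Units_def by auto
 qed
 thus thesis using that[of v c e] v(1) ce main unfolding gchart_def by blast
qed

lemma ten_mult:
 assumes t: "t : points T" and r: "c : RS S f$t" "e : RS S f$t" "c' : RS S f$t" "e' : RS S f$t"
  and v: "v : carrier T@@t" "v' : carrier T@@t"
  and d: "de = dcls S f$t c e *[div_stalk S f$t] dcls S f$t c' e'"
 shows "tensor_mult S@@(f$t) (alg_module (cm f t) T@@t) (L_stalk S (f$t, de))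
   (ten t (dcls S f$t c e) v (mfrac S f$t c e)) (ten t (dcls S f$t c' e') v' (mfrac S f$t c' e'))
  = ten t de (v *[T@@t] v') (mfrac S f$t (c *[S@@(f$t)] c') (e *[S@@(f$t)] e'))"
proof -
 note s = f_points[OF t]
 note p = S.RS_mult[OF s r(1,3)] S.RS_mult[OF s r(2,4)]
 note cc = S.RS_carrier[OF s r(1)] S.RS_carrier[OF s r(2)] S.RS_carrier[OF s r(3)] S.RS_carrier[OF s r(4)]
 have de: "de = dcls S f$t (c *[S@@(f$t)] c') (e *[S@@(f$t)] e')" unfolding d by(rule S.dcls_mult[OF s r])
 interpret R1: rank_one "S@@(f$t)" "T@@t" "cm f t" "L_stalk S (f$t, dcls S f$t c e)" "mfrac S f$t c e" by(rule L_rank1[OF t r(1,2)])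
 interpret R2: rank_one "S@@(f$t)" "T@@t" "cm f t" "L_stalk S (f$t, dcls S f$t c' e')" "mfrac S f$t c' e'" by(rule L_rank1[OF t r(3,4)])
 interpret R3: rank_one "S@@(f$t)" "T@@t" "cm f t" "L_stalk S (f$t, de)" "mfrac S f$t (c *[S@@(f$t)] c') (e *[S@@(f$t)] e')"
  unfolding de by(rule L_rank1[OF t p])
 interpret M: cring "MS S f$t" by(rule S.cring_merom[OF s])
 have h: "merom_of S f$t x : carrier (MS S f$t)" if "x : carrier S@@(f$t)" for x
  by(rule ring_hom_closed[OF S.merom_of_hom[OF s] that])
 have m: "mfrac S f$t c e : carrier (MS S f$t)" "mfrac S f$t c' e' : carrier (MS S f$t)"
  by(rule S.mfrac_carrier[OF s cc(1) r(2)], rule S.mfrac_carrier[OF s cc(3) r(4)])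
 have mm: "mfrac S f$t c e *[MS S f$t] mfrac S f$t c' e' = mfrac S f$t (c *[S@@(f$t)] c') (e *[S@@(f$t)] e')"
  by(rule S.mfrac_mult[OF s cc(1) r(2) cc(3) r(4)])
 have in1: "n : carrier (MS S f$t)" if "n : carrier (L_stalk S (f$t, dcls S f$t c e))" for n
  using R1.gen[OF that] h m unfolding S.L_stalk_simps by auto
 have in2: "n : carrier (MS S f$t)" if "n : carrier (L_stalk S (f$t, dcls S f$t c' e'))" for n
  using R2.gen[OF that] h m unfolding S.L_stalk_simps by auto
 have prod: "n *[MS S f$t] n' : carrier (L_stalk S (f$t, de))"
  if n: "n : carrier (L_stalk S (f$t, dcls S f$t c e))" "n' : carrier (L_stalk S (f$t, dcls S f$t c' e'))" for n n'
 proof -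
  obtain x where x: "x : carrier S@@(f$t)" "n = x .[L_stalk S (f$t, dcls S f$t c e)] mfrac S f$t c e" using R1.gen[OF n(1)] by blast
  obtain y where y: "y : carrier S@@(f$t)" "n' = y .[L_stalk S (f$t, dcls S f$t c' e')] mfrac S f$t c' e'" using R2.gen[OF n(2)] by blast
  have "n *[MS S f$t] n' = (x *[S@@(f$t)] y) .[L_stalk S (f$t, de)] mfrac S f$t (c *[S@@(f$t)] c') (e *[S@@(f$t)] e')"
   unfolding x(2) y(2) S.L_stalk_simps mm[symmetric]
   using x(1) y(1) h m ring_hom_mult[OF S.merom_of_hom[OF s] x(1) y(1)] by(simp add: M.m_ac)
  thus ?thesis using R3.closed[of "x *[S@@(f$t)] y"] x(1) y(1) by simp
 qed
 have "tensor_mult S@@(f$t) (alg_module (cm f t) T@@t) (L_stalk S (f$t, de)) (R1.cl (frag_of (v, mfrac S f$t c e))) (R2.cl (frag_of (v', mfrac S f$t c' e')))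
  = R3.cl (frag_of (v *[alg_module (cm f t) T@@t] v', mfrac S f$t c e *[L_stalk S (f$t, de)] mfrac S f$t c' e'))"
  by(rule tensor_mult_pair[OF R1.tensor_pair_axioms R2.tensor_pair_axioms R3.tensor_pair_axioms])
   (use v R1.e_N R2.e_N prod in1 in2 h in \<open>auto simp: S.L_stalk_simps(1-3) M.l_distr M.r_distr M.m_ac R1.B.l_distr R1.B.r_distr R1.B.m_ac f_closed[OF t]\<close>)
 thus ?thesis by(simp add: S.L_stalk_simps(2) mm)
qed

end

section \<open>The multiplicative group\<close>

context ringed
begin

lemma Gm_carrier_iff: "u : carrier (Gm X) <-> u : sections X (points X) & (ALL x:points X. u x : Units X@@x)"
proof
 assume "u : carrier (Gm X)"
 then obtain w where u: "u : sections X (points X)" and w: "w : sections X (points X)"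
  and e: "(\<lambda>x\<in>points X. u x *[X@@x] w x) = (\<lambda>x\<in>points X. 1[X@@x])"
  unfolding Gm_def units_of_carrier Units_def section_ring_simps by blast
 have "u x : Units X@@x" if x: "x : points X" for x
 proof -
  interpret cring "X@@x" by(rule stalk_cring[OF x])
  have 1: "u x *[X@@x] w x = 1[X@@x]" using fun_cong[OF e, of x] x by simp
  have 2: "u x : carrier X@@x" "w x : carrier X@@x"
   using lsec_carrier[OF sections_lsec[OF openin_topspace u x]] lsec_carrier[OF sections_lsec[OF openin_topspace w x]] by auto
  show ?thesis by(rule unit_factor[OF _ 2]) (use 1 in simp)
 qed
 thus "u : sections X (points X) & (ALL x:points X. u x : Units X@@x)" using u by blast
next
 assume u: "u : sections X (points X) & (ALL x:points X. u x : Units X@@x)"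
 let ?w = "\<lambda>x\<in>points X. inv[X@@x] u x"
 have w: "?w : sections X (points X)"
 proof (rule restrict_sections[OF openin_topspace])
  fix x assume x: "x : points X"
  show "lsec X x (%x. inv[X@@x] u x)"
   by(rule lsec_unit_near(2)[OF sections_lsec[OF openin_topspace conjunct1[OF u] x] bspec[OF conjunct2[OF u] x]])
 qed
 have uw: "u x *[X@@x] ?w x = 1[X@@x] & ?w x *[X@@x] u x = 1[X@@x]" if x: "x : points X" for x
 proof -
  interpret cring "X@@x" by(rule stalk_cring[OF x])
  show ?thesis using bspec[OF conjunct2[OF u] x] x by simp
 qed
 have "(\<lambda>x\<in>points X. u x *[X@@x] ?w x) = (\<lambda>x\<in>points X. 1[X@@x])"
  by(rule restrict_ext) (rule conjunct1[OF uw])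
 moreover have "(\<lambda>x\<in>points X. ?w x *[X@@x] u x) = (\<lambda>x\<in>points X. 1[X@@x])"
  by(rule restrict_ext) (rule conjunct2[OF uw])
 ultimately have "EX w:sections X (points X). (\<lambda>x\<in>points X. w x *[X@@x] u x) = (\<lambda>x\<in>points X. 1[X@@x]) &
   (\<lambda>x\<in>points X. u x *[X@@x] w x) = (\<lambda>x\<in>points X. 1[X@@x])"
  by(intro bexI[OF _ w] conjI)
 thus "u : carrier (Gm X)" using conjunct1[OF u] unfolding Gm_def units_of_carrier Units_def section_ring_simps
  by(intro CollectI conjI)
qed

end

lemma Gm_mult [simp]: "x *[Gm X] y = (\<lambda>t\<in>points X. x t *[X@@t] y t)"
 unfolding Gm_def by(simp add: units_of_mult)

lemma (in localized) loc_map_hom: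
 assumes fi: "fi : ring_hom R R'" and loc': "localized R' S'" and sub: "fi ` S <= S'"
 shows "loc_map R' S' fi : ring_hom L (localization R' S')"
proof -
 interpret R': localized R' S' by(rule loc')
 note lm = loc_map_fr[OF fi loc' sub]
 have c: "fi r : carrier R'" if "r : carrier R" for r by(rule ring_hom_closed[OF fi that])
 have s: "fi r : S'" if "r : S" for r using sub that by blast
 show ?thesis
 proof (rule ring_hom_memI)
  fix x y assume "x : carrier L" "y : carrier L"
  then obtain a b a' b' where ab: "a : carrier R" "b : S" "x = fr a b" "a' : carrier R" "b' : S" "y = fr a' b'" by(metis carrierE)
  show "loc_map R' S' fi x : carrier R'.L" using ab lm c s by auto
  show "loc_map R' S' fi (x *[L] y) = loc_map R' S' fi x *[R'.L] loc_map R' S' fi y"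
   using ab c s by(simp add: lm mult_fr mult_S R'.mult_fr ring_hom_mult[OF fi])
  show "loc_map R' S' fi (x +[L] y) = loc_map R' S' fi x +[R'.L] loc_map R' S' fi y"
   using ab c s by(simp add: lm add_fr mult_S R'.add_fr ring_hom_mult[OF fi] ring_hom_add[OF fi])
 next
  show "loc_map R' S' fi 1[L] = 1[R'.L]" unfolding one_fr R'.one_fr by(simp add: lm ring_hom_one[OF fi])
 qed
qed

context gm
begin

abbreviation D1 where "D1 t == dcls S f$t 1[S@@(f$t)] 1[S@@(f$t)]"
abbreviation M1 where "M1 t == mfrac S f$t 1[S@@(f$t)] 1[S@@(f$t)]"

lemma one_reg: "t : points T ==> 1[S@@(f$t)] : RS S f$t"
 by(rule S.RS_one[OF f_points])

lemma Gm_incl_ten: "Gm_incl S T f u = ((|pt = (\<lambda>t\<in>points T. (f$t, D1 t)), cm = cm f|), \<lambda>t\<in>points T. ten t (D1 t) (u t) (M1 t))"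
proof -
 have "(\<lambda>t\<in>points T. (f$t, 1[div_stalk S f$t])) = (\<lambda>t\<in>points T. (f$t, D1 t))"
  by(rule restrict_ext) (simp add: S.dcls_one f_points)
 hence z: "Pi_zero S T f = (|pt = (\<lambda>t\<in>points T. (f$t, D1 t)), cm = cm f|)" unfolding Pi_zero_def by simp
 show ?thesis unfolding Gm_incl_def z Let_def
  by(simp, rule restrict_ext) (simp add: S.mfrac_one f_points)
qed

lemma Gm_incl_carrier:
 assumes u: "u : carrier (Gm T)" shows "Gm_incl S T f u : carrier (Gm_lft S T f)"
 unfolding Gm_incl_ten
proof (rule chart_carrier)
 fix t assume t: "t : points T"
 have "gchart (|pt = (\<lambda>t\<in>points T. (f$t, D1 t)), cm = cm f|) (\<lambda>t\<in>points T. ten t (D1 t) (u t) (M1 t)) t u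
   (%s. 1[S@@s]) (%s. 1[S@@s])"
  unfolding gchart_def
 proof (intro conjI S.regs_one[OF f_points[OF t]])
  show "lsec T t u" "u t : Units T@@t" using u t T.sections_lsec[OF openin_topspace] unfolding T.Gm_carrier_iff by auto
 qed (rule eventually_mono[OF near_points], simp)
 thus "EX v c e. gchart (|pt = (\<lambda>t\<in>points T. (f$t, D1 t)), cm = cm f|) (\<lambda>t\<in>points T. ten t (D1 t) (u t) (M1 t)) t v c e" by blast
qed simp_all

lemma ten_one_inj:
 assumes "t : points T" "v : carrier T@@t" "w : carrier T@@t" "ten t (D1 t) v (M1 t) = ten t (D1 t) w (M1 t)"
 shows "v = w"
 using assms(4) by(rule ten_inj[OF assms(1) one_reg[OF assms(1)] one_reg[OF assms(1)] assms(2,3)])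

lemma Gm_incl_inj:
 assumes "u : extensional (points T)" "u' : extensional (points T)"
  and "!!t. t : points T ==> u t : carrier T@@t" "!!t. t : points T ==> u' t : carrier T@@t"
  and e: "Gm_incl S T f u = Gm_incl S T f u'"
 shows "u = u'"
proof (rule extensionalityI[OF assms(1,2)])
 fix t assume t: "t : points T"
 have "ten t (D1 t) (u t) (M1 t) = ten t (D1 t) (u' t) (M1 t)"
  using fun_cong[OF arg_cong[OF e, of snd], of t] t unfolding Gm_incl_ten by simp
 thus "u t = u' t" by(rule ten_one_inj[OF t assms(3)[OF t] assms(4)[OF t]])
qed

text \<open>\<open>c/e\<close> then comes from a unit of the local ring of \<open>S\<close> and can
  be moved across the tensor sign into \<open>v\<close>, while the divisor becomes trivial.\<close>

lemma ten_trivial: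
 assumes t: "t : points T" and triv: "RS S f$t <= Units S@@(f$t)"
  and ce: "c : RS S f$t" "e : RS S f$t" and v: "v : carrier T@@t"
 shows "dcls S f$t c e = D1 t"
  and "ten t (D1 t) v (mfrac S f$t c e) = ten t (D1 t) (v *[T@@t] cm f t (c *[S@@(f$t)] inv[S@@(f$t)] e)) (M1 t)"
proof -
 note s = f_points[OF t]
 interpret O: cring "S@@(f$t)" by(rule S.stalk_cring[OF s])
 show "dcls S f$t c e = D1 t" using S.dcls_trivial[OF s triv S.dcls_carrier[OF s ce]] S.dcls_one[OF s] by simp
 have u: "c : carrier S@@(f$t)" "e : Units S@@(f$t)" "e : carrier S@@(f$t)"
  using ce triv O.Units_closed by auto
 let ?r = "c *[S@@(f$t)] inv[S@@(f$t)] e"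
 have r: "?r : carrier S@@(f$t)" using u by simp
 have "mfrac S f$t c e = mfrac S f$t (?r *[S@@(f$t)] 1[S@@(f$t)]) 1[S@@(f$t)]"
  using S.mfrac_eq_iff[OF s u(1) ce(2) _ one_reg[OF t], of "?r *[S@@(f$t)] 1[S@@(f$t)]"] u r by(simp add: O.m_assoc)
 thus "ten t (D1 t) v (mfrac S f$t c e) = ten t (D1 t) (v *[T@@t] cm f t ?r) (M1 t)"
  using ten_smult[OF t one_reg[OF t] one_reg[OF t] v r] by simp
qed

lemma D1_mult: "t : points T ==> D1 t *[div_stalk S f$t] D1 t = D1 t"
proof -
 assume t: "t : points T"
 interpret group "div_stalk S f$t" by(rule S.div_group[OF f_points[OF t]])
 show ?thesis using S.dcls_one[OF f_points[OF t]] by(metis l_one one_closed)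
qed

lemma Gm_incl_mult:
 assumes u: "!!t. t : points T ==> u t : carrier T@@t" "!!t. t : points T ==> u' t : carrier T@@t"
 shows "Gm_incl S T f u *[Gm_lft S T f] Gm_incl S T f u' = Gm_incl S T f (\<lambda>t\<in>points T. u t *[T@@t] u' t)"
proof -
 let ?z = "(|pt = (\<lambda>t\<in>points T. (f$t, D1 t)), cm = cm f|)"
 have z: "Pi_add S T f ?z ?z = ?z" unfolding Pi_add_def by(simp, rule restrict_ext) (simp add: D1_mult)
 have "(\<lambda>t\<in>points T. tensor_mult (base_at S ?z t) (struct_at T ?z t) (L_at S ?z t)
   ((\<lambda>t\<in>points T. ten t (D1 t) (u t) (M1 t)) t) ((\<lambda>t\<in>points T. ten t (D1 t) (u' t) (M1 t)) t))
  = (\<lambda>t\<in>points T. ten t (D1 t) ((\<lambda>t\<in>points T. u t *[T@@t] u' t) t) (M1 t))"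
 proof (rule restrict_ext)
  fix t assume t: "t : points T"
  interpret O: cring "S@@(f$t)" by(rule S.stalk_cring[OF f_points[OF t]])
  note o = one_reg[OF t]
  show "tensor_mult (base_at S ?z t) (struct_at T ?z t) (L_at S ?z t)
   ((\<lambda>t\<in>points T. ten t (D1 t) (u t) (M1 t)) t) ((\<lambda>t\<in>points T. ten t (D1 t) (u' t) (M1 t)) t)
   = ten t (D1 t) ((\<lambda>t\<in>points T. u t *[T@@t] u' t) t) (M1 t)"
   using ten_mult[OF t o o o o u(1)[OF t] u(2)[OF t] D1_mult[OF t, symmetric]] t by simp
 qed
 thus ?thesis unfolding Gm_incl_ten unfolding Gm_lft_def by(simp add: Let_def z)
qed

lemma Gm_incl_iso:
 assumes triv: "!!t. t : points T ==> RS S f$t <= Units S@@(f$t)"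
 shows "Gm_incl S T f : iso (Gm T) (Gm_lft S T f)"
proof -
 have c: "u : extensional (points T) & (ALL t:points T. u t : carrier T@@t)" if "u : carrier (Gm T)" for u
  using that T.sections_sub[OF openin_topspace] unfolding T.Gm_carrier_iff by(auto simp: PiE_def)
 have hom: "Gm_incl S T f : hom (Gm T) (Gm_lft S T f)"
  using Gm_incl_mult c by(intro homI Gm_incl_carrier) auto
 have inj: "inj_on (Gm_incl S T f) (carrier (Gm T))"
  using Gm_incl_inj c by(intro inj_onI) blast
 have "u : Gm_incl S T f ` carrier (Gm T)" if u: "u : carrier (Gm_lft S T f)" for u
 proof -
  obtain a al where aal: "u = (a, al)" "(a, al) : carrier (Gm_lft S T f)" using u by(cases u) auto
  have "a : Pi_points S T f" and al: "al : extensional (points T)"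
   using aal(2) locally_given_PiE[of al] unfolding Gm_lft_def pullL_generators_def pullL_sections_def by(auto simp: PiE_def)
  note aD = Pi_pointD[OF this(1)]
  \<comment> \<open>Chosen pointwise, but unique by \<open>ten_one_inj\<close>; hence it agrees near
    \<open>t\<close> with the coordinate read off from a chart and is a section.\<close>
  define w where "w = (\<lambda>t\<in>points T. SOME w. w : carrier T@@t & al t = ten t (D1 t) w (M1 t))"
  have loc: "lsec T t w & w t : Units T@@t & al t = ten t (D1 t) (w t) (M1 t) & a$t = (f$t, D1 t)" if t: "t : points T" for t
  proof -
   obtain v c e where g: "gchart a al t v c e" using carrier_chart[OF aal(2) t] by blast
   note G = g[unfolded gchart_def]
   have v: "lsec T t v" "v t : Units T@@t" and ce: "regs S f$t c" "regs S f$t e" using G by auto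
   let ?r = "%s. c s *[S@@s] inv[S@@s] e s"
   let ?x = "%t. v t *[T@@t] cm f t (?r f$t)"
   have eu: "e f$t : Units S@@(f$t)" "c f$t : Units S@@(f$t)"
    using triv[OF t] S.regs_RS ce by auto
   have r: "lsec S f$t ?r"
    by(rule S.lsec_mult[OF S.regs_lsec[OF ce(1)] S.lsec_unit_near(2)[OF S.regs_lsec[OF ce(2)] eu(1)]])
   have x: "lsec T t ?x" by(rule T.lsec_mult[OF v(1) lsec_pullback[OF f t r]])
   have ru: "?r f$t : Units S@@(f$t)"
   proof -
    interpret O: cring "S@@(f$t)" by(rule S.stalk_cring[OF f_points[OF t]])
    show ?thesis using eu by simp
   qed
   have xu: "?x t : Units T@@t"
   proof -
    interpret B: cring "T@@t" by(rule T.stalk_cring[OF t])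
    show ?thesis using v(2) ring_hom_Units[OF f_hom[OF t] S.stalk_cring[OF f_points[OF t]] B.is_cring ru] by simp
   qed
   have ev0: "evn T t (%t. w t = ?x t & al t = ten t (D1 t) (w t) (M1 t) & a$t = (f$t, D1 t))"
    using G[THEN conjunct2, THEN conjunct2, THEN conjunct2, THEN conjunct2] near_points[of T t] lsec_near[OF v(1)] lsec_near[OF x]
     f_near[OF t S.regs_near[OF ce(1)]] f_near[OF t S.regs_near[OF ce(2)]]
   proof eventually_elim
    case (elim t)
    note k = ten_trivial[OF elim(2) triv[OF elim(2)] S.regs_RS[OF elim(5)] S.regs_RS[OF elim(6)] T.lsec_carrier[OF elim(3)]]
    have 1: "?x t : carrier T@@t & al t = ten t (D1 t) (?x t) (M1 t)" using elim(1) k T.lsec_carrier[OF elim(4)] by simp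
    have 2: "w t : carrier T@@t & al t = ten t (D1 t) (w t) (M1 t)"
     using someI[of "%w. w : carrier T@@t & al t = ten t (D1 t) w (M1 t)", OF 1] elim(2) unfolding w_def by simp
    have 3: "w t = ?x t"
     by(rule ten_one_inj[OF elim(2) conjunct1[OF 2] conjunct1[OF 1] trans[OF sym[OF conjunct2[OF 2]] conjunct2[OF 1]]])
    have "a$t = (f$t, D1 t)" using conjunct1[OF elim(1)] unfolding k(1) .
    thus ?case by(intro conjI 3 conjunct2[OF 2])
   qed
   hence ev: "evn T t (%t. ?x t = w t)"
    and at: "w t = ?x t & al t = ten t (D1 t) (w t) (M1 t) & a$t = (f$t, D1 t)"
    subgoal by(rule eventually_mono) simp
    using near_self[OF ev0 t] by simp
   show ?thesis using T.lsec_cong[OF x ev] xu at by simp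
  qed
  have "w : carrier (Gm T)"
   unfolding T.Gm_carrier_iff T.sections_iff[OF openin_topspace] using loc by(auto simp: w_def)
  moreover have "Gm_incl S T f w = (a, al)"
  proof -
   have "pt a = (\<lambda>t\<in>points T. (f$t, D1 t))" by(rule extensionalityI[OF aD(2)]) (use loc in auto)
   moreover have "al = (\<lambda>t\<in>points T. ten t (D1 t) (w t) (M1 t))" by(rule extensionalityI[OF al]) (use loc in auto)
   ultimately show ?thesis unfolding Gm_incl_ten using aD(1) by(auto intro!: morphism.equality)
  qed
  ultimately show ?thesis using aal(1) by force
 qed
 moreover have "Gm_incl S T f ` carrier (Gm T) <= carrier (Gm_lft S T f)" using Gm_incl_carrier by blast
 ultimately have "bij_betw (Gm_incl S T f) (carrier (Gm T)) (carrier (Gm_lft S T f))"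
  using inj unfolding bij_betw_def by blast
 thus ?thesis using hom unfolding iso_def by blast
qed

end

lemma (in gm) div_map_dcls:
 assumes t: "t : points T" and sub: "cm f t ` RS S f$t <= RS T t"
  and ce: "c : RS S f$t" "e : RS S f$t"
 shows "div_map T f t (dcls S f$t c e) = dcls T t (cm f t c) (cm f t e)"
proof -
 note s = f_points[OF t]
 note l = S.reg_localized[OF s]
 interpret A: cring "S@@(f$t)" by(rule S.stalk_cring[OF s])
 have c: "c : carrier S@@(f$t)" by(rule S.RS_carrier[OF s ce(1)])
 have fc: "cm f t r : RS T t" if "r : RS S f$t" for r using sub that by blast
 have "div_class T t (merom_map T f t m) = dcls T t (cm f t c) (cm f t e)" if m: "m : dcls S f$t c e" for m
 proof -
  obtain w where w: "w : Units S@@(f$t)" "m = merom_of S f$t w *[MS S f$t] mfrac S f$t c e"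
   using m unfolding S.in_div_class_iff by blast
  have wc: "w : carrier S@@(f$t)" using w(1) by(rule A.Units_closed)
  have wr: "w *[S@@(f$t)] c : RS S f$t" by(rule S.RS_mult[OF s S.RS_unit[OF s w(1)] ce(1)])
  have m: "m = mfrac S f$t (w *[S@@(f$t)] c) e" unfolding w(2) by(rule S.merom_of_mult[OF s wc c ce(2)])
  have mm: "merom_map T f t m = mfrac T t (cm f t w *[T@@t] cm f t c) (cm f t e)"
   unfolding merom_map_def m ring_hom_mult[OF f_hom[OF t] wc c, symmetric]
   by(rule localized.loc_map_fr[OF l f_hom[OF t] T.reg_localized[OF t] sub _ ce(2)]) (use wc c in simp)
  have wu: "cm f t w : Units T@@t" by(rule ring_hom_Units[OF f_hom[OF t] A.is_cring T.stalk_cring[OF t] w(1)])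
  interpret B: cring "T@@t" by(rule T.stalk_cring[OF t])
  show ?thesis unfolding mm
   by(rule T.dcls_eq_iff[OF t T.RS_mult[OF t T.RS_unit[OF t wu] fc[OF ce(1)]] fc[OF ce(2)] fc[OF ce(1)] fc[OF ce(2)], THEN iffD2],
     rule bexI[OF _ wu]) (use f_closed[OF t] wc c S.RS_carrier[OF s ce(2)] in \<open>simp add: B.m_assoc\<close>)
 qed
 moreover have "mfrac S f$t c e : dcls S f$t c e"
  using S.div_class_self[OF s] S.mfrac_Units_iff[OF s c ce(2)] ce(1) by blast
 ultimately show ?thesis unfolding div_map_def by blast
qed

section \<open>The total spectrum of meromorphic functions\<close>

locale weak_ass_scheme = ringed S for S :: "('a, 'r) ringed_space" +
 assumes scheme: "scheme S"
  and WA: "WeakAss S = Max_points S"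
  and lf: "locally_finite_subset (spc S) (Max_points S)"
begin

abbreviation E where "E == eta S"
abbreviation p where "p == eta_proj S"
abbreviation A where "A s == S@@s"
abbreviation M where "M s == MS S s"

lemma chart:
 assumes "s : points S"
 obtains V and R :: "('a => 'r) ring" and rh where "s : V" "affine_chart S R V rh"
 by(rule scheme_affine_chart[OF scheme assms])

lemma local: "s : points S ==> local_ring (A s)"
 using scheme unfolding scheme_def locally_ringed_def by blast

lemma Max_points_S: "s : Max_points S ==> s : points S"
 unfolding Max_points_def by blast

lemma Max_unit: assumes s: "s : Max_points S" and r: "nzd (A s) r" shows "r : Units (A s)"
proof -
 obtain V and R :: "('a => 'r) ring" and rh where V: "s : V" "affine_chart S R V rh"
  using chart[OF Max_points_S[OF s]] by blast
 show ?thesis by(rule affine_chart.Max_points_nzd[OF V(2,1) s r])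
qed

lemma Max_reg: "s : Max_points S ==> RS S s <= Units (A s)"
 using Max_unit RS_nzd by blast

text \<open>At a generic point this is the maximal ideal of \<open>M s\<close>, which is then a
  local ring isomorphic to the local ring of \<open>S\<close>.\<close>

definition gen_prime :: "'a => ('r \<times> 'r) set set" where
 "gen_prime s = carrier (M s) - Units (M s)"

lemma merom_of_iso: assumes s: "s : Max_points S" shows "merom_of S s : ring_iso (A s) (M s)"
 unfolding merom_stalk_def merom_of_def
 by(rule localized.fr_one_iso[OF reg_localized[OF Max_points_S[OF s]] Max_reg[OF s]])

lemma M_local: assumes s: "s : Max_points S" shows "local_ring (M s)"
proof (rule local_ring_of_ring_iso[OF local[OF Max_points_S[OF s]] merom_of_iso[OF s]])
 note s' = Max_points_S[OF s]
 show "0[M s] = merom_of S s 0[A s]"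
  using ring_hom_zero'[OF merom_of_hom[OF s'] stalk_cring[OF s'] cring_merom[OF s']] by simp
qed

lemma merom_of_gen_prime:
 assumes s: "s : Max_points S" and r: "r : carrier (A s)"
 shows "merom_of S s r : gen_prime s <-> r : max_ideal (A s)"
proof -
 note s' = Max_points_S[OF s]
 have "merom_of S s r : Units (M s) <-> r : Units (A s)"
  using ring_iso_Units[OF merom_of_iso[OF s] stalk_cring[OF s'] cring_merom[OF s'] r]
   ring_hom_Units[OF merom_of_hom[OF s'] stalk_cring[OF s'] cring_merom[OF s'], of r] by blast
 thus ?thesis unfolding gen_prime_def local_ring_nonunits(1)[OF local[OF s']]
  using r ring_hom_closed[OF merom_of_hom[OF s'] r] by blast
qed

lemma gen_prime_spec: assumes s: "s : Max_points S" shows "gen_prime s : spec_primes S (merom S) (merom_of S) s"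
proof -
 note s' = Max_points_S[OF s]
 have "max_ideal (A s) <= carrier (A s)" unfolding local_ring_nonunits(1)[OF local[OF s']] by blast
 hence "{r : carrier (A s). merom_of S s r : gen_prime s} = max_ideal (A s)"
  using merom_of_gen_prime[OF s] by blast
 moreover have "primeideal (gen_prime s) (M s)" unfolding gen_prime_def by(rule local_ringD(3)[OF M_local[OF s]])
 ultimately show ?thesis unfolding spec_primes_def by simp
qed

text \<open>A prime of \<open>M\<^sub>s\<close> over the closed point of \<open>A\<^sub>s\<close> makes all regular germs at \<open>s\<close>
  invertible; by prime avoidance \<open>s\<close> is then one of the finitely many generic points near \<open>s\<close>.\<close>

lemma Max_point_of_reg_units:
 assumes s: "s : points S" and u: "RS S s <= Units (A s)"
 shows "s : Max_points S"
proof -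
 obtain V and R :: "('a => 'r) ring" and rh where V: "s : V" "affine_chart S R V rh" using chart[OF s] by blast
 interpret C: affine_chart S R V rh by(rule V(2))
 obtain W where W: "opn S W" "s : W" "W <= V" "finite (W Int Max_points S)" "ALL z:W. True"
  using lf eventually_True V(1) by(rule C.locally_finite_Max)
 have "s : W Int Max_points S"
 proof (rule C.in_Max_points_of_units[OF W(4) _ V(1)])
  show "W Int Max_points S <= V Int Max_points S" using W(3) by blast
  fix a assume a: "a : carrier R" "!!i. i : W Int Max_points S ==> rh i a : Units (A i)"
  have "regs S s (%y. rh y a)"
   by(rule C.regs_criterion[OF WA V(1) C.rh_lsec[OF a(1) V(1)]])
    (rule eventually_mono[OF near_open[OF W(1,2)]], use a(2) in blast)
  thus "rh s a : Units (A s)" using u regs_RS[of s "%y. rh y a"] by blast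
 qed
 thus ?thesis by blast
qed

text \<open>Regular germs become units in the stalk of \<open>M\<close> and so cannot lie in the
  prime \<open>q\<close>. As \<open>q\<close> lies over the maximal ideal, they are units already in
  the local ring of \<open>S\<close>, and this happens only at generic points.\<close>

lemma spec_primes_Max:
 assumes s: "s : points S" and q: "q : spec_primes S (merom S) (merom_of S) s"
 shows "s : Max_points S" "q = gen_prime s"
proof -
 have qp: "primeideal q (M s)" and qm: "{r : carrier (A s). merom_of S s r : q} = max_ideal (A s)"
  using q unfolding spec_primes_def by simp_all
 note Oc = stalk_cring[OF s] and Mc = cring_merom[OF s]
 interpret Mc: cring "M s" by(rule Mc)
 have nu: "m ~: q" if "m : Units (M s)" for m
 proof
  assume "m : q"
  hence "inv[M s] m *[M s] m : q" using ideal.I_l_closed[OF primeideal.axioms(1)[OF qp]] that by blast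
  thus False using that ideal.one_imp_carrier[OF primeideal.axioms(1)[OF qp]] primeideal.I_notcarr[OF qp] by simp
 qed
 have "r : Units (A s)" if r: "r : RS S s" for r
 proof (rule ccontr)
  have rc: "r : carrier (A s)" by(rule RS_carrier[OF s r])
  assume "r ~: Units (A s)"
  hence "merom_of S s r : q" using rc qm local_ring_nonunits(1)[OF local[OF s]] by blast
  moreover have "merom_of S s r : Units (M s)"
   using mfrac_Units_iff[OF s rc RS_one[OF s]] r unfolding merom_of_def by simp
  ultimately show False using nu by blast
 qed
 thus sM: "s : Max_points S" by(intro Max_point_of_reg_units[OF s]) blast
 show "q = gen_prime s"
 proof (intro equalityI subsetI)
  fix m assume m: "m : q"
  thus "m : gen_prime s" unfolding gen_prime_def using nu ideal.Icarr[OF primeideal.axioms(1)[OF qp]] by blast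
 next
  fix m assume m: "m : gen_prime s"
  hence "m : carrier (M s)" unfolding gen_prime_def by blast
  then obtain r where r: "r : carrier (A s)" "m = merom_of S s r"
   using merom_of_iso[OF sM] unfolding ring_iso_def bij_betw_def by auto
  thus "m : q" using m merom_of_gen_prime[OF sM r(1)] qm by blast
 qed
qed

abbreviation ept where "ept s == (s, gen_prime s)"

lemma one_notin_gen_prime: assumes "s : Max_points S" shows "1[M s] ~: gen_prime s"
proof -
 interpret cring "M s" by(rule cring_merom[OF Max_points_S[OF assms]])
 show ?thesis unfolding gen_prime_def by simp
qed

lemma spc_E: "spc E = prime_topology (merom S) (spec_primes S (merom S) (merom_of S))"
 unfolding rel_Spec_def localize_at_def by simp

lemma basic_one:
 assumes U: "opn S U"
 shows "opn E (ept ` (U Int Max_points S))"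
proof -
 let ?Q = "spec_primes S (merom S) (merom_of S)"
 let ?g = "\<lambda>y\<in>U. mfrac S y 1[A y] 1[A y]"
 have US: "y : points S" if "y : U" for y using openin_subset[OF U] that by blast
 have g: "?g : sections (merom S) U" by(rule mfrac_sections[OF U]) (use US lsec_one regs_one in auto)
 have "basic_open (merom S) ?Q U ?g = ept ` (U Int Max_points S)"
 proof (intro equalityI subsetI)
  fix z assume "z : basic_open (merom S) ?Q U ?g"
  then obtain x q where z: "z = (x, q)" "x : U" "q : ?Q x" unfolding basic_open_def by blast
  thus "z : ept ` (U Int Max_points S)" using spec_primes_Max[OF US[OF z(2)] z(3)] by blast
 next
  fix z assume "z : ept ` (U Int Max_points S)"
  then obtain x where z: "z = ept x" "x : U" "x : Max_points S" by blast
  thus "z : basic_open (merom S) ?Q U ?g"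
   unfolding basic_open_def using gen_prime_spec[OF z(3)] one_notin_gen_prime[OF z(3)] mfrac_one[OF US[OF z(2)]] by simp
 qed
 thus ?thesis unfolding spc_E prime_topology_def using g U
  by(intro topology_generated_by_Basis) (metis (mono_tags, lifting) CollectI merom_simps(1))
qed

lemma points_E: "points E = ept ` Max_points S"
proof
 show "points E <= ept ` Max_points S"
 proof
  fix z assume "z : points E"
  then obtain U g where "z : basic_open (merom S) (spec_primes S (merom S) (merom_of S)) U g" "opn S U"
   unfolding spc_E prime_topology_def topology_generated_by_topspace merom_simps by blast
  then obtain x q where z: "z = (x, q)" "x : U" "q : spec_primes S (merom S) (merom_of S) x" "x : points S"
   unfolding basic_open_def using openin_subset[of "spc S" U] by blast
  thus "z : ept ` Max_points S" using spec_primes_Max[OF z(4,3)] by blast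
 qed
 have "points S Int Max_points S = Max_points S" using Max_points_S by blast
 thus "ept ` Max_points S <= points E" using openin_subset[OF basic_one[OF openin_topspace]] by simp
qed

text \<open>This makes \<open>\<eta>\<close> discrete.\<close>

lemma Max_isolated:
 assumes s: "s : Max_points S"
 shows "evn S s (%y. y : Max_points S --> y = s)"
proof -
 obtain V and R :: "('a => 'r) ring" and rh where V: "s : V" "affine_chart S R V rh" using chart[OF Max_points_S[OF s]] by blast
 interpret C: affine_chart S R V rh by(rule V(2))
 obtain W where W: "opn S W" "s : W" "W <= V" "finite (W Int Max_points S)" "ALL z:W. True"
  using lf eventually_True V(1) by(rule C.locally_finite_Max)
 have "~ C.pr j <= C.pr s" if "j : W Int Max_points S - {s}" for j
  using C.Max_points_minimal[OF V(1) s, of j] that W(3) by blast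
 then obtain h where h: "h : carrier R" "rh s h : Units (A s)" "ALL j:W Int Max_points S - {s}. rh j h = 0[A j]"
  using C.unit_vanishing_at[of "W Int Max_points S - {s}" s] W(3,4) V(1) by blast
 show ?thesis using C.unit_near[OF V(1) h(1,2)] near_open[OF W(1,2)]
 proof eventually_elim
  case (elim y)
  show ?case
  proof (rule impI, rule ccontr)
   assume y: "y : Max_points S" "y ~= s"
   hence "rh y h = 0[A y]" using h(3) elim by blast
   thus False using elim(1) local_ringD(3)[OF local[OF Max_points_S[OF y(1)]]]
     additive_subgroup.zero_closed[OF ideal.axioms(1)[OF primeideal.axioms(1)]] by(metis DiffE)
  qed
 qed
qed

lemma openin_E: "opn E W <-> W <= points E"
proof
 assume W: "W <= points E"
 have "opn E {z}" if z: "z : points E" for z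
 proof -
  obtain s where s: "s : Max_points S" "z = ept s" using z points_E by blast
  obtain U where U: "opn S U" "s : U" "ALL y:U. y : Max_points S --> y = s"
   using Max_isolated[OF s(1)] Max_points_S[OF s(1)] by(rule nearE)
  have "U Int Max_points S = {s}" using U(2,3) s(1) by blast
  thus ?thesis using basic_one[OF U(1)] s(2) by simp
 qed
 hence "opn E (\<Union>z\<in>W. {z})" using W by(intro openin_Union) auto
 thus "opn E W" by simp
qed (rule openin_subset)

lemma stalk_E: "E@@(s, q) = localization (M s) (carrier (M s) - q)"
 unfolding rel_Spec_def localize_at_def prime_stalk_def by simp

lemma gen_compl: assumes s: "s : Max_points S" shows "carrier (M s) - gen_prime s = Units (M s)"
proof -
 interpret cring "M s" by(rule cring_merom[OF Max_points_S[OF s]])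
 show ?thesis unfolding gen_prime_def using Units_closed by blast
qed

lemma loc_E: assumes s: "s : Max_points S" shows "localized (M s) (carrier (M s) - gen_prime s)"
 using gen_prime_spec[OF s] unfolding spec_primes_def by(auto intro: localized_compl_prime)

text \<open>Points of \<eta> are open, so only the value at a single point has to be realized as a
  fraction of sections of \<open>M\<close>; neighbouring values impose no compatibility.\<close>

lemma E_section:
 assumes W: "W <= points E" and si: "si : (\<Pi>\<^sub>E z\<in>W. carrier E@@z)"
 shows "si : sections E W"
proof -
 let ?Q = "spec_primes S (merom S) (merom_of S)"
 have sec: "sections E W = locally_given (spc E) (%z. carrier (prime_stalk (merom S) z))
    (%V. locfracs (merom S) ?Q V) W"
  unfolding spc_E unfolding rel_Spec_def localize_at_def by simp
 have st: "prime_stalk (merom S) z = E@@z" for z unfolding rel_Spec_def localize_at_def by simp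
 show ?thesis unfolding sec st
 proof (rule locally_givenI)
  show "si : extensional W" using si by(simp add: PiE_def)
  fix z assume z: "z : W"
  obtain s where s: "s : Max_points S" "z = ept s" using z W points_E by blast
  note s' = Max_points_S[OF s(1)]
  interpret l: localized "M s" "carrier (M s) - gen_prime s" by(rule loc_E[OF s(1)])
  have siz: "si z : carrier E@@z" using PiE_mem[OF si z] .
  then obtain a0 g0 where ag: "a0 : carrier (M s)" "g0 : carrier (M s) - gen_prime s" "si z = l.fr a0 g0"
   unfolding s(2) stalk_E by(rule l.carrierE)
  obtain a where a: "lsec (merom S) s a" "a s = a0" using sheaf.lsec_exists[OF merom_sheaf, of s a0] s' ag(1) by auto
  obtain g where g: "lsec (merom S) s g" "g s = g0" using sheaf.lsec_exists[OF merom_sheaf, of s g0] s' ag(2) by auto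
  have "evn S s (%y. lsec (merom S) y a & lsec (merom S) y g)"
   using lsec_near[OF a(1)] lsec_near[OF g(1)] by(simp add: eventually_conj)
  then obtain U where U: "opn S U" "s : U" "ALL y:U. lsec (merom S) y a & lsec (merom S) y g" using s' by(rule nearE)
  have U': "opn (merom S) U" using U(1) by simp
  have r: "restrict a U : sections (merom S) U" "restrict g U : sections (merom S) U"
   by(rule sheaf.restrict_sections[OF merom_sheaf U'], use U(3) in blast)+
  have b: "{z} <= basic_open (merom S) ?Q U (restrict g U)"
   unfolding basic_open_def using s(2) U(2) gen_prime_spec[OF s(1)] g(2) ag(2) by simp
  show "EX V ta. opn E V & z : V & V <= W &
   ta : locfracs (merom S) ?Q V &
   (ALL y:V. si y = ta y & si y : carrier E@@y)"
  proof (intro exI[of _ "{z}"] exI[of _ "locfrac (merom S) (restrict a U) (restrict g U)"] conjI ballI)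
   show "(locfrac (merom S) (restrict a U) (restrict g U))
    : locfracs (merom S) ?Q {z}"
    using r b U' by blast
   show "opn E {z}" unfolding openin_E using z W by blast
  qed (use z ag(3) a(2) g(2) s(2) U(2) siz in auto)
 qed
qed

lemma E_sections: assumes W: "W <= points E" shows "sections E W = (\<Pi>\<^sub>E z\<in>W. carrier E@@z)"
proof (intro equalityI subsetI)
 fix si assume "si : sections E W"
 thus "si : (\<Pi>\<^sub>E z\<in>W. carrier E@@z)"
  unfolding rel_Spec_def localize_at_def ringed_space.select_convs by(rule locally_given_PiE)
qed (rule E_section[OF W])

lemma p_pt: "s : Max_points S ==> p$(ept s) = s"
 unfolding rel_Spec_proj_def using points_E by simp

lemma p_cm: "s : Max_points S ==> cm p (ept s) = (\<lambda>r\<in>carrier (A s). fraction (M s) (carrier (M s) - gen_prime s) (merom_of S s r) 1[M s])"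
 unfolding rel_Spec_proj_def using points_E by simp

text \<open>At a generic point, inverting the regular germs and then localizing at the maximal ideal
  inverts only units, so \<eta> has the same local ring as \<open>S\<close> there.\<close>

lemma p_iso: assumes s: "s : Max_points S" shows "cm p (ept s) : ring_iso (A s) E@@(ept s)"
proof -
 interpret l: localized "M s" "carrier (M s) - gen_prime s" by(rule loc_E[OF s])
 have "(%m. l.fr m 1[M s]) \<circ> merom_of S s : ring_iso (A s) l.L"
  by(rule ring_iso_set_trans[OF merom_of_iso[OF s] l.fr_one_iso]) (use gen_compl[OF s] in simp)
 thus ?thesis unfolding stalk_E
  by(rule ring.ring_iso_restrict[OF cring.axioms(1)[OF stalk_cring[OF Max_points_S[OF s]]]]) (simp add: p_cm[OF s])
qed

lemma p_hom: "s : Max_points S ==> cm p (ept s) : ring_hom (A s) E@@(ept s)"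
 using p_iso unfolding ring_iso_def by blast

lemma E_local: assumes s: "s : Max_points S" shows "local_ring E@@(ept s)"
proof (rule local_ring_of_ring_iso[OF local[OF Max_points_S[OF s]] p_iso[OF s]])
 interpret l: localized "M s" "carrier (M s) - gen_prime s" by(rule loc_E[OF s])
 show "0[E@@(ept s)] = cm p (ept s) 0[A s]"
  using ring_hom_zero'[OF p_hom[OF s] stalk_cring[OF Max_points_S[OF s]]] l.cring_L unfolding stalk_E by simp
qed

lemma E_cring: "s : Max_points S ==> cring E@@(ept s)"
 using local_ringD(1)[OF E_local] .

lemma E_ringed: "ringed E"
proof (rule ringedI)
 have cr: "cring E@@z" if "z : points E" for z using that E_cring unfolding points_E by blast
 have sub: "U <= points E" if "opn E U" for U using that unfolding openin_E .
 show "is_ringed_space E" unfolding is_ringed_space_def sheaf_on_def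
 proof (intro conjI allI impI ballI; (elim conjE)?)
  fix U V s assume "opn E U" "opn E V" "V <= U" "s : sections E U"
  thus "restrict s V : sections E V" using E_sections[OF sub] by auto
 next
  fix U s assume "opn E U" "s : (\<Pi>\<^sub>E x\<in>U. carrier E@@x)"
  thus "s : sections E U" using E_sections[OF sub] by blast
 next
  fix x e assume x: "x : points E" "e : carrier E@@x"
  have "(\<lambda>y\<in>{x}. e) : sections E {x}" using x E_sections[of "{x}"] by auto
  thus "EX U s. opn E U & x : U & s : sections E U & s x = e"
   using x openin_E by(intro exI[of _ "{x}"] exI[of _ "\<lambda>y\<in>{x}. e"]) auto
 next
  fix U s t x assume "opn E U" "x : U" "s x = t x"
  thus "EX V. opn E V & x : V & V <= U & (ALL y:V. s y = t y)"
   using openin_E by(intro exI[of _ "{x}"]) auto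
 next
  fix U assume U: "opn E U"
  show "sections E U <= (\<Pi>\<^sub>E x\<in>U. carrier E@@x)" by(rule equalityD1[OF E_sections[OF sub[OF U]]])
  have c: "cring E@@x" if "x : U" for x using cr sub[OF U] that by blast
  show "(\<lambda>x\<in>U. 1[E@@x]) : sections E U" unfolding E_sections[OF sub[OF U]]
   unfolding restrict_PiE_iff by(rule ballI, rule cring.cring_simprules(6)[OF c])
  fix s assume s: "s : sections E U"
  have sc: "s x : carrier E@@x" if "x : U" for x using PiE_mem[OF s[unfolded E_sections[OF sub[OF U]]] that] .
  show "(\<lambda>x\<in>U. -[E@@x] s x) : sections E U" unfolding E_sections[OF sub[OF U]]
   unfolding restrict_PiE_iff by(rule ballI, rule cring.cring_simprules(3)[OF c sc])
  fix t assume t: "t : sections E U"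
  have tc: "t x : carrier E@@x" if "x : U" for x using PiE_mem[OF t[unfolded E_sections[OF sub[OF U]]] that] .
  show "(\<lambda>x\<in>U. s x +[E@@x] t x) : sections E U"
   unfolding E_sections[OF sub[OF U]] restrict_PiE_iff by(rule ballI, rule cring.cring_simprules(1)[OF c sc tc])
  show "(\<lambda>x\<in>U. s x *[E@@x] t x) : sections E U"
   unfolding E_sections[OF sub[OF U]] restrict_PiE_iff by(rule ballI, rule cring.cring_simprules(5)[OF c sc tc])
 qed (use cr in auto)
qed

lemma p_lrs: "lrs_hom E S p" unfolding lrs_hom_def
proof (intro conjI ballI allI impI)
 have pp: "p$z : points S" if "z : points E" for z using that p_pt Max_points_S unfolding points_E by auto
 show "continuous_map (spc E) (spc S) (pt p)" unfolding continuous_map_def openin_E using pp by auto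
 show "pt p : extensional (points E)" "cm p : extensional (points E)" unfolding rel_Spec_proj_def by simp_all
 fix z assume "z : points E"
 then obtain s where s: "s : Max_points S" "z = ept s" unfolding points_E by blast
 show "cm p z : ring_hom (A p$z) E@@z" using p_hom s p_pt by simp
 show "cm p z : extensional (carrier (A p$z))" using p_cm[OF s(1)] s p_pt by simp
 show "cm p z ` max_ideal (A p$z) <= max_ideal E@@z"
  unfolding s(2) p_pt[OF s(1)] local_ring_nonunits(1)[OF E_local[OF s(1)]] local_ring_nonunits(1)[OF local[OF Max_points_S[OF s(1)]]]
  using ring_iso_Units[OF p_iso[OF s(1)] stalk_cring[OF Max_points_S[OF s(1)]] E_cring[OF s(1)]] ring_hom_closed[OF p_hom[OF s(1)]] by blast
next
 fix V s assume V: "opn S V & s : sections S V"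
 have "cm p z (s p$z) : carrier E@@z" if z: "z : points E" "p$z : V" for z
 proof -
  obtain x where x: "x : Max_points S" "z = ept x" using z(1) unfolding points_E by blast
  have "s x : carrier (A x)" using lsec_carrier[OF sections_lsec, of V s x] V z(2) x p_pt by simp
  thus ?thesis using ring_hom_closed[OF p_hom[OF x(1)]] x p_pt by simp
 qed
 thus "(\<lambda>z\<in>{z : points E. p$z : V}. cm p z (s p$z)) : sections E {z : points E. p$z : V}"
  by(subst E_sections) auto
qed

lemma E_reg: assumes z: "z : points E" shows "RS E z <= Units E@@z"
proof
 interpret E: ringed E by(rule E_ringed)
 obtain s where s: "s : Max_points S" "z = ept s" using z unfolding points_E by blast
 note Oc = stalk_cring[OF Max_points_S[OF s(1)]] and Ec = E_cring[OF s(1)] and h = p_hom[OF s(1)]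
 interpret Oc: cring "A s" by(rule Oc)
 interpret Ec: cring "E@@(ept s)" by(rule Ec)
 fix x assume "x : RS E z"
 hence x: "nzd E@@(ept s) x" using E.RS_nzd s(2) by simp
 obtain r where r: "r : carrier (A s)" "x = cm p (ept s) r"
  using x p_iso[OF s(1)] unfolding ring_iso_def bij_betw_def nonzerodivisor_def by blast
 have inj: "inj_on (cm p (ept s)) (carrier (A s))" using p_iso[OF s(1)] unfolding ring_iso_def bij_betw_def by blast
 have "nzd (A s) r" unfolding nonzerodivisor_def
 proof (intro conjI r ballI impI)
  fix y assume y: "y : carrier (A s)" "r *[A s] y = 0[A s]"
  have "x *[E@@(ept s)] cm p (ept s) y = 0[E@@(ept s)]"
   using ring_hom_mult[OF h r(1) y(1)] y(2) r(2) ring_hom_zero'[OF h Oc Ec] by simp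
  hence "cm p (ept s) y = cm p (ept s) 0[A s]"
   using x ring_hom_closed[OF h y(1)] ring_hom_zero'[OF h Oc Ec] unfolding nonzerodivisor_def by simp
  thus "y = 0[A s]" by(rule inj_onD[OF inj]) (use y in auto)
 qed
 hence "r : Units (A s)" by(rule Max_unit[OF s(1)])
 thus "x : Units E@@z" using ring_hom_Units[OF h Oc Ec] r(2) s(2) by simp
qed

end

lemma lrs_hom_comp:
 assumes Z: "ringed Z" and l: "!!z. z : points Z ==> local_ring Z@@z"
  and g: "lrs_hom Y Z g" and f: "lrs_hom X Y f"
 shows "lrs_hom X Z (mor_comp X Z g f)"
proof -
 interpret Z: ringed Z by(rule Z)
 have e: "(mor_comp X Z g f)$x = g$(f$x)" 
  "cm (mor_comp X Z g f) x = (\<lambda>r\<in>carrier (Z@@g$(f$x)). cm f x (cm g f$x r))" if "x : points X" for x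
  using that unfolding mor_comp_def by simp_all
 show ?thesis unfolding lrs_hom_def
 proof (intro conjI ballI allI impI)
  show "continuous_map (spc X) (spc Z) (pt (mor_comp X Z g f))"
   by(rule continuous_map_eq[OF continuous_map_compose[OF lrs_homD(1)[OF f] lrs_homD(1)[OF g]]]) (simp add: e)
  show "pt (mor_comp X Z g f) : extensional (points X)" "cm (mor_comp X Z g f) : extensional (points X)" unfolding mor_comp_def by simp_all
  fix x assume x: "x : points X"
  note y = lrs_homD(8)[OF f x]
  note z = lrs_homD(8)[OF g y]
  have h: "cm f x \<circ> cm g f$x : ring_hom (Z@@g$(f$x)) X@@x"
   by(rule ring_hom_trans[OF lrs_homD(4)[OF g y] lrs_homD(4)[OF f x]])
  show "cm (mor_comp X Z g f) x : ring_hom (Z@@(mor_comp X Z g f)$x) X@@x"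
   unfolding e[OF x] by(rule ring.ring_hom_restrict[OF cring.axioms(1)[OF Z.stalk_cring[OF z]] h]) simp
  show "cm (mor_comp X Z g f) x : extensional (carrier (Z@@(mor_comp X Z g f)$x))" unfolding e[OF x] by simp
  have "max_ideal (Z@@g$(f$x)) <= carrier (Z@@g$(f$x))"
   unfolding local_ring_nonunits(1)[OF l[OF z]] by blast
  thus "cm (mor_comp X Z g f) x ` max_ideal (Z@@(mor_comp X Z g f)$x) <= max_ideal X@@x"
   unfolding e[OF x] using lrs_homD(6)[OF g y] lrs_homD(6)[OF f x] by auto
 next
  fix V s assume V0: "opn Z V & s : sections Z V"
  note V = conjunct1[OF V0] conjunct2[OF V0]
  let ?W = "{y : points Y. g$y : V}" and ?U = "{x : points X. (mor_comp X Z g f)$x : V}"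
  have W: "opn Y ?W" by(rule openin_continuous_map_preimage[OF lrs_homD(1)[OF g] V(1)])
  have U: "{x : points X. f$x : ?W} = ?U" using lrs_homD(8)[OF f] e(1) by auto
  have "(\<lambda>x\<in>?U. cm (mor_comp X Z g f) x (s (mor_comp X Z g f)$x))
   = (\<lambda>x\<in>?U. cm f x ((\<lambda>y\<in>?W. cm g y (s g$y)) f$x))"
  proof (rule restrict_ext)
   fix x assume x: "x : ?U"
   hence v: "g$(f$x) : V" using e(1)[of x] by simp
   hence "s g$(f$x) : carrier (Z@@g$(f$x))"
    by(rule Z.lsec_carrier[OF Z.sections_lsec[OF V]])
   thus "cm (mor_comp X Z g f) x (s (mor_comp X Z g f)$x) = cm f x ((\<lambda>y\<in>?W. cm g y (s g$y)) f$x)"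
    using v x e lrs_homD(8)[OF f] by simp
  qed
  thus "(\<lambda>x\<in>?U. cm (mor_comp X Z g f) x (s (mor_comp X Z g f)$x)) : sections X ?U"
   using lrs_homD(7)[OF f W lrs_homD(7)[OF g V]] unfolding U by simp
 qed
qed

section \<open>Comparison of the group schemes over the total spectrum\<close>

lemma mor_comp_assoc:
 assumes h: "lrs_hom X Y h" and g: "lrs_hom Y Z g" and p: "lrs_hom Z W p"
 shows "mor_comp X W (mor_comp Y W p g) h = mor_comp X W p (mor_comp X Z g h)"
proof (rule morphism.equality)
 show "pt (mor_comp X W (mor_comp Y W p g) h) = pt (mor_comp X W p (mor_comp X Z g h))"
  unfolding mor_comp_def morphism.select_convs by(rule restrict_ext) (simp add: lrs_homD(8)[OF h])
 show "cm (mor_comp X W (mor_comp Y W p g) h) = cm (mor_comp X W p (mor_comp X Z g h))"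
  unfolding mor_comp_def morphism.select_convs
 proof (rule restrict_ext)
  fix x assume x: "x : points X"
  note y = lrs_homD(8)[OF h x]
  note z = lrs_homD(8)[OF g y]
  show "(\<lambda>r\<in>carrier W@@((\<lambda>x\<in>points Y. p$(g$x)) h$x).
    cm h x ((\<lambda>x\<in>points Y. \<lambda>r\<in>carrier (W@@p$(g$x)). cm g x (cm p g$x r)) h$x r)) =
   (\<lambda>r\<in>carrier (W@@p$((\<lambda>x\<in>points X. g$(h$x)) x)).
    (\<lambda>x\<in>points X. \<lambda>r\<in>carrier (Z@@g$(h$x)). cm h x (cm g h$x r)) x
     (cm p ((\<lambda>x\<in>points X. g$(h$x)) x) r))"
   using x y ring_hom_closed[OF lrs_homD(4)[OF p z]] by(auto intro!: restrict_ext)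
 qed
qed simp

lemma (in ringed) Gm_group: "group (Gm X)"
 unfolding Gm_def by(rule monoid.units_group[OF cring.axioms(2)[OF section_ring_cring[OF openin_topspace], THEN comm_monoid.axioms(1)]])

text \<open>Whatever is needed of the multiplications of \<open>B\<close> and \<open>C\<close> is
  carried over from the group \<open>A\<close> along \<open>i\<close> and \<open>j\<close>.\<close>

lemma iso_of_triangle:
 assumes A: "group A" and i: "i : iso A B" and j: "j : iso A C" and k: "!!u. u : carrier A ==> k (i u) = j u"
 shows "k : iso B C"
proof -
 interpret A: group A by(rule A)
 have i': "i : hom A B" "bij_betw i (carrier A) (carrier B)" and j': "j : hom A C" "bij_betw j (carrier A) (carrier C)"
  using i j unfolding iso_def by auto
 have pre: "EX u:carrier A. y = i u" if "y : carrier B" for y using that i'(2) unfolding bij_betw_def by blast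
 have hom: "k : hom B C"
 proof (rule homI)
  fix y assume "y : carrier B"
  then obtain u where u: "u : carrier A" "y = i u" using pre by blast
  thus "k y : carrier C" using k hom_in_carrier[OF j'(1)] by simp
  fix y' assume "y' : carrier B"
  then obtain u' where u': "u' : carrier A" "y' = i u'" using pre by blast
  have "k (y *[B] y') = k (i (u *[A] u'))" using hom_mult[OF i'(1) u(1) u'(1)] u(2) u'(2) by simp
  also have "... = j (u *[A] u')" using k[OF A.m_closed[OF u(1) u'(1)]] .
  finally show "k (y *[B] y') = k y *[C] k y'" using hom_mult[OF j'(1) u(1) u'(1)] k u u' by simp
 qed
 have "bij_betw (k \<circ> i) (carrier A) (carrier C)"
  using j'(2) bij_betw_cong[of "carrier A" "k \<circ> i" j] k by simp
 hence "bij_betw k (carrier B) (carrier C)" using bij_betw_comp_iff[OF i'(2)] by blast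
 thus ?thesis using hom unfolding iso_def by blast
qed

lemma (in gm) Gm_incl_pull:
 assumes T': "ringed T'" and h: "lrs_hom T' T h" and f': "lrs_hom T' S (mor_comp T' S f h)"
  and u: "!!t. t : points T ==> u t : carrier T@@t"
 shows "Gm_lft_pull S T' h (Gm_incl S T f u) = Gm_incl S T' (mor_comp T' S f h) (Gm_pull T' h u)"
proof -
 let ?f' = "mor_comp T' S f h"
 interpret T': ringed T' by(rule T')
 interpret G': gm S T' ?f' by unfold_locales (rule f')
 let ?a = "(|pt = (\<lambda>t\<in>points T. (f$t, D1 t)), cm = cm f|)" and ?a' = "(|pt = (\<lambda>t\<in>points T'. (?f'$t, G'.D1 t)), cm = cm ?f'|)"
 have pf: "?f'$t = f$(h$t)" if "t : points T'" for t unfolding mor_comp_def using that by simp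
 have cf: "cm ?f' t = (\<lambda>r\<in>carrier (S@@f$(h$t)). cm h t (cm f h$t r))" if "t : points T'" for t
  unfolding mor_comp_def using that by simp
 have a': "mor_comp T' (Pi_space S) ?a h = ?a'"
 proof (rule morphism.equality)
  show "pt (mor_comp T' (Pi_space S) ?a h) = pt ?a'"
   unfolding mor_comp_def morphism.select_convs by(rule restrict_ext) (simp add: lrs_homD(8)[OF h])
  show "cm (mor_comp T' (Pi_space S) ?a h) = cm ?a'"
   unfolding mor_comp_def morphism.select_convs by(rule restrict_ext) (simp add: lrs_homD(8)[OF h])
 qed simp
 have "tensor_map (base_at S ?a' t) (struct_at T' ?a' t) (L_at S ?a' t) (cm h t) id ((\<lambda>t\<in>points T. ten t (D1 t) (u t) (M1 t)) h$t)
   = G'.ten t (G'.D1 t) (Gm_pull T' h u t) (G'.M1 t)" if t: "t : points T'" for t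
 proof -
  note y = lrs_homD(8)[OF h t]
  note hh = lrs_homD(4)[OF h t]
  interpret R: rank_one "S@@f$(h$t)" "T@@(h$t)" "cm f h$t" "L_stalk S (f$(h$t), D1 h$t)" "M1 h$t"
   by(rule L_rank1[OF y one_reg[OF y] one_reg[OF y]])
  interpret R': rank_one "S@@f$(h$t)" "T'@@t" "cm ?f' t" "L_stalk S (f$(h$t), D1 h$t)" "M1 h$t"
   using G'.L_rank1[OF t G'.one_reg[OF t] G'.one_reg[OF t]] unfolding pf[OF t] .
  have "tensor_map (S@@f$(h$t)) (alg_module (cm ?f' t) T'@@t) (L_stalk S (f$(h$t), D1 h$t)) (cm h t) id
    (R.cl (frag_of (u h$t, M1 h$t))) = R'.cl (frag_of (cm h t (u h$t), id (M1 h$t)))"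
   by(rule R.tensor_map_pair[OF R'.tensor_pair_axioms, where rh = "%r. r"])
    (simp_all add: u[OF y] R.e_N ring_hom_closed[OF hh] ring_hom_add[OF hh] ring_hom_mult[OF hh] cf[OF t])
  thus ?thesis using t y pf[OF t] unfolding Gm_pull_def by simp
 qed
 hence "(\<lambda>t\<in>points T'. tensor_map (base_at S ?a' t) (struct_at T' ?a' t) (L_at S ?a' t) (cm h t) id ((\<lambda>t\<in>points T. ten t (D1 t) (u t) (M1 t)) h$t))
  = (\<lambda>t\<in>points T'. G'.ten t (G'.D1 t) (Gm_pull T' h u t) (G'.M1 t))" by(rule restrict_ext)
 thus ?thesis unfolding Gm_incl_ten G'.Gm_incl_ten Gm_lft_pull_def by(simp only: case_prod_conv a' Let_def)
qed

context weak_ass_scheme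
begin

lemma p_reg: "s : Max_points S ==> cm p (ept s) ` RS S s <= RS E (ept s)"
 using ringed.RS_unit[OF E_ringed, of "ept s"] ring_hom_Units[OF p_hom[of s] stalk_cring[OF Max_points_S[of s]] E_cring[of s]] Max_reg[of s]
 unfolding points_E by blast

lemma merom_map_mfrac:
 assumes s: "s : Max_points S" and c: "c : carrier (A s)" and e: "e : RS S s"
 shows "merom_map E p (ept s) (mfrac S s c e) = mfrac E (ept s) (cm p (ept s) c) (cm p (ept s) e)"
  and "merom_map E p (ept s) : ring_hom (M s) (MS E (ept s))"
proof -
 interpret E: ringed E by(rule E_ringed)
 have z: "ept s : points E" using s unfolding points_E by blast
 note l = reg_localized[OF Max_points_S[OF s]] and r = p_hom[OF s] E.reg_localized[OF z] p_reg[OF s]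
 show "merom_map E p (ept s) (mfrac S s c e) = mfrac E (ept s) (cm p (ept s) c) (cm p (ept s) e)"
  unfolding merom_map_def by(rule localized.loc_map_fr[OF l r c e])
 show "merom_map E p (ept s) : ring_hom (M s) (MS E (ept s))"
  unfolding merom_map_def merom_stalk_def by(rule localized.loc_map_hom[OF l r])
qed

lemma div_map_one:
 assumes s: "s : Max_points S"
 shows "div_map E p (ept s) (dcls S s 1[A s] 1[A s]) = dcls E (ept s) 1[E@@(ept s)] 1[E@@(ept s)]"
proof -
 interpret P: gm S E p by(intro gm.intro gm_axioms.intro ringed_axioms E_ringed p_lrs)
 have z: "ept s : points E" using s unfolding points_E by blast
 note o = RS_one[OF Max_points_S[OF s]]
 show ?thesis using P.div_map_dcls[OF z, unfolded p_pt[OF s], OF p_reg[OF s] o o] ring_hom_one[OF p_hom[OF s]] by simp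
qed

end

locale eta_point = weak_ass_scheme S + X: ringed X for S :: "('a, 'r) ringed_space" and X :: "('b, 'k) ringed_space" +
 fixes g assumes g: "lrs_hom X (eta S) g"
begin

abbreviation f where "f == mor_comp X S p g"

lemma f_lrs: "lrs_hom X S f" by(rule lrs_hom_comp[OF ringed_axioms local p_lrs g])

sublocale G: gm S X f by unfold_locales (rule f_lrs)
sublocale H: gm "eta S" X g
 using E_ringed X.ringed_axioms g unfolding gm_def gm_axioms_def by blast

lemma pt_f: assumes x: "x : points X" shows "f$x : Max_points S" "g$x = ept f$x"
proof -
 obtain s where s: "s : Max_points S" "g$x = ept s" using lrs_homD(8)[OF g x] unfolding points_E by blast
 hence "f$x = s" using p_pt x unfolding mor_comp_def by simp
 thus "f$x : Max_points S" "g$x = ept f$x" using s by simp_all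
qed

lemma G_triv: "x : points X ==> RS S f$x <= Units (A f$x)"
 by(rule Max_reg[OF pt_f(1)])

lemma H_triv: "x : points X ==> RS E g$x <= Units E@@(g$x)"
 by(rule E_reg[OF lrs_homD(8)[OF g]])

text \<open>The identity on the local ring of \<open>X\<close> and the map induced on meromorphic
  functions combine to a map of tensor products semilinear along the stalk map of \<open>p\<close>;
  on trivial divisors it preserves the coordinate \<open>v\<close>.\<close>

lemma compare_ten:
 assumes x: "x : points X" and v: "v : carrier X@@x"
 shows "tensor_map E@@(g$x) (alg_module (cm g x) X@@x) (L_stalk E (g$x, H.D1 x)) id (merom_map E p g$x) (G.ten x (G.D1 x) v (G.M1 x))
  = H.ten x (H.D1 x) v (H.M1 x)"
proof -
 let ?s = "f$x"
 note s = pt_f(1)[OF x]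
 note s' = Max_points_S[OF s]
 note z = pt_f(2)[OF x]
 note o = RS_one[OF s']
 interpret A: cring "A ?s" by(rule stalk_cring[OF s'])
 have pf: "p$(g$x) = ?s" unfolding z by(rule p_pt[OF s])
 have "cm f x = (\<lambda>r\<in>carrier (A p$(g$x)). cm g x (cm p g$x r))" unfolding mor_comp_def using x by simp
 hence cf: "cm f x r = cm g x (cm p g$x r)" if "r : carrier (A ?s)" for r
  using that by(simp only: pf restrict_apply')
 interpret R: rank_one "A ?s" "X@@x" "cm f x" "L_stalk S (?s, G.D1 x)" "G.M1 x" by(rule G.L_rank1[OF x o o])
 interpret R': rank_one "E@@(g$x)" "X@@x" "cm g x" "L_stalk E (g$x, H.D1 x)" "H.M1 x"
  by(rule H.L_rank1[OF x H.one_reg[OF x] H.one_reg[OF x]])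
 note mm = merom_map_mfrac[OF s, folded z]
 note ph = p_hom[OF s, folded z]
 note mh = mm(2)[OF A.one_closed o]
 have mo: "merom_map E p g$x (merom_of S ?s r) = merom_of E g$x (cm p g$x r)" if "r : carrier (A ?s)" for r
  unfolding merom_of_def[of S ?s r] merom_of_def[of E "g$x"] using mm(1)[OF that o] ring_hom_one[OF ph] by simp
 have M1: "merom_map E p g$x (G.M1 x) = H.M1 x" using mm(1)[OF A.one_closed o] ring_hom_one[OF ph] by simp
 have hc: "merom_of S ?s r : carrier (M ?s)" if "r : carrier (A ?s)" for r by(rule ring_hom_closed[OF merom_of_hom[OF s'] that])
 have M1c: "G.M1 x : carrier (M ?s)" by(rule mfrac_carrier[OF s' A.one_closed o])
 interpret Mc: cring "M ?s" by(rule cring_merom[OF s'])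
 have nc: "n : carrier (M ?s)" if "n : carrier (L_stalk S (?s, G.D1 x))" for n
  using R.gen[OF that] hc M1c unfolding L_stalk_simps by auto
 have tgt: "merom_map E p g$x n : carrier (L_stalk E (g$x, H.D1 x))" if n: "n : carrier (L_stalk S (?s, G.D1 x))" for n
 proof -
  obtain r where r: "r : carrier (A ?s)" "n = r .[L_stalk S (?s, G.D1 x)] G.M1 x" using R.gen[OF n] by blast
  have "merom_map E p g$x n = cm p g$x r .[L_stalk E (g$x, H.D1 x)] H.M1 x"
   unfolding r(2) L_stalk_simps H.S.L_stalk_simps using ring_hom_mult[OF mh hc[OF r(1)] M1c] mo[OF r(1)] M1 by simp
  thus ?thesis using R'.closed[OF ring_hom_closed[OF ph r(1)]] by simp
 qed
 have "tensor_map E@@(g$x) (alg_module (cm g x) X@@x) (L_stalk E (g$x, H.D1 x)) id (merom_map E p g$x) (R.cl (frag_of (v, G.M1 x)))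
  = R'.cl (frag_of (id v, merom_map E p g$x (G.M1 x)))"
  by(rule R.tensor_map_pair[OF R'.tensor_pair_axioms, where rh = "cm p g$x"])
   (simp_all add: v R.e_N tgt nc hc mo cf ring_hom_closed[OF ph] ring_hom_add[OF mh] ring_hom_mult[OF mh] L_stalk_simps(1,3) H.S.L_stalk_simps(1,3))
 thus ?thesis unfolding M1 by simp
qed

lemma compare_incl:
 assumes u: "!!x. x : points X ==> u x : carrier X@@x"
 shows "Gm_lft_compare E p X g (Gm_incl S X f u) = Gm_incl E X g u"
proof -
 let ?a = "(|pt = (\<lambda>x\<in>points X. (f$x, G.D1 x)), cm = cm f|)" and ?a' = "(|pt = (\<lambda>x\<in>points X. (g$x, H.D1 x)), cm = cm g|)"
 have "(\<lambda>x\<in>points X. (g$x, div_map E p g$x (snd ?a$x))) = (\<lambda>x\<in>points X. (g$x, H.D1 x))"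
 proof (rule restrict_ext)
  fix x assume x: "x : points X"
  show "(g$x, div_map E p g$x (snd ?a$x)) = (g$x, H.D1 x)" using div_map_one[OF pt_f(1)[OF x]] x pt_f(2)[OF x] by simp
 qed
 hence a': "(|pt = (\<lambda>x\<in>points X. (g$x, div_map E p g$x (snd ?a$x))), cm = cm g|) = ?a'" by(simp only:)
 have "(\<lambda>x\<in>points X. tensor_map (base_at E ?a' x) (struct_at X ?a' x) (L_at E ?a' x) id (merom_map E p g$x)
   ((\<lambda>x\<in>points X. G.ten x (G.D1 x) (u x) (G.M1 x)) x)) = (\<lambda>x\<in>points X. H.ten x (H.D1 x) (u x) (H.M1 x))"
  by(rule restrict_ext) (use compare_ten[OF _ u] in simp)
 thus ?thesis unfolding G.Gm_incl_ten H.Gm_incl_ten Gm_lft_compare_def by(simp only: case_prod_conv a' Let_def)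
qed

lemma Gm_carrier_stalk: "u : carrier (Gm X) ==> x : points X ==> u x : carrier X@@x"
 using X.Gm_carrier_iff X.lsec_carrier[OF X.sections_lsec[OF openin_topspace]] by blast

text \<open>Every point of \<open>X\<close> lies over a generic point of \<open>S\<close>, so the
  multiplicative group maps isomorphically to the group attached to \<open>S\<close> as well as to
  the one attached to \<eta>; the comparison closes the triangle.\<close>

lemma compare_iso: "Gm_lft_compare E p X g : iso (Gm_lft S X f) (Gm_lft E X g)"
 by(rule iso_of_triangle[OF X.Gm_group G.Gm_incl_iso[OF G_triv] H.Gm_incl_iso[OF H_triv]])
  (assumption, assumption, rule compare_incl, rule Gm_carrier_stalk)

lemma Gm_pull_stalk:
 assumes h: "lrs_hom X' X h" and u: "u : carrier (Gm X)" and x: "x : points X'"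
 shows "Gm_pull X' h u x : carrier X'@@x"
 unfolding Gm_pull_def using x ring_hom_closed[OF lrs_homD(4)[OF h x] Gm_carrier_stalk[OF u lrs_homD(8)[OF h x]]] by simp

lemma incl_pull:
 assumes X': "ringed X'" and h: "lrs_hom X' X h" and u: "u : carrier (Gm X)"
 shows "Gm_incl E X' (mor_comp X' E g h) (Gm_pull X' h u) = Gm_lft_pull E X' h (Gm_incl E X g u)"
proof -
 have l: "local_ring E@@z" if "z : points E" for z using that E_local unfolding points_E by blast
 show ?thesis
  by(rule H.Gm_incl_pull[OF X' h lrs_hom_comp[OF E_ringed l g h], symmetric]) (auto intro: Gm_carrier_stalk[OF u])
qed

text \<open>Every element of the group comes from a unit, and for a unit both ways around the square
  give the inclusion of its pullback.\<close>

lemma compare_pull: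
 assumes X': "ringed X'" and h: "lrs_hom X' X h" and u: "u : carrier (Gm_lft S X f)"
 shows "Gm_lft_compare E p X' (mor_comp X' E g h) (Gm_lft_pull S X' h u) = Gm_lft_pull E X' h (Gm_lft_compare E p X g u)"
proof -
 obtain w where w: "w : carrier (Gm X)" "u = Gm_incl S X f w"
  using u G.Gm_incl_iso[OF G_triv] unfolding iso_def bij_betw_def by blast
 have l: "local_ring E@@z" if "z : points E" for z using that E_local unfolding points_E by blast
 interpret X': eta_point S X' "mor_comp X' E g h"
  by(intro eta_point.intro eta_point_axioms.intro weak_ass_scheme_axioms X' lrs_hom_comp[OF E_ringed l g h])
 have "Gm_lft_pull S X' h u = Gm_incl S X' X'.f (Gm_pull X' h w)"
  unfolding w(2) mor_comp_assoc[OF h g p_lrs, symmetric]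
  by(rule G.Gm_incl_pull[OF X' h lrs_hom_comp[OF ringed_axioms local f_lrs h]]) (assumption, rule Gm_carrier_stalk[OF w(1)])
 thus ?thesis
  using X'.compare_incl[OF Gm_pull_stalk[OF h w(1)]] incl_pull[OF X' h w(1)] compare_incl[OF Gm_carrier_stalk[OF w(1)]] w(2) by simp
qed

end

section \<open>The base change to the total spectrum of meromorphic functions\<close>

lemma rank_one_of_iso:
 assumes A: "cring A" and B: "cring B" and fi: "fi : ring_hom A B" and C: "cring C" and ps: "ps : ring_iso A C"
 shows "rank_one A B fi (alg_module ps C) 1[C]"
proof -
 interpret A: cring A by(rule A)
 interpret B: cring B by(rule B)
 interpret C: cring C by(rule C)
 have h: "ps : ring_hom A C" and b: "bij_betw ps (carrier A) (carrier C)" using ps unfolding ring_iso_def by auto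
 note hc = ring_hom_closed[OF h]
 show ?thesis
 proof
  fix n assume "n : carrier (alg_module ps C)"
  then obtain r where "r : carrier A" "n = ps r" using b unfolding bij_betw_def by auto
  thus "EX r:carrier A. n = r .[alg_module ps C] 1[C]" using hc by(intro bexI[of _ r]) simp_all
 next
  fix r r' assume "r : carrier A" "r' : carrier A" "r .[alg_module ps C] 1[C] = r' .[alg_module ps C] 1[C]"
  thus "r = r'" using hc bij_betw_imp_inj_on[OF b] by(auto dest: inj_onD)
 qed (use fi hc ring_hom_add[OF h] ring_hom_mult[OF h] ring_hom_one[OF h] in \<open>simp_all add: C.m_assoc\<close>)
qed

text \<open>\<open>C\<close> is free on \<open>1\<close> over \<open>A\<close>, so
  \<open>B \<otimes> C\<close> is \<open>B\<close>. This is applied with \<open>A\<close> the local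
  ring of \<open>S\<close> at a generic point and \<open>C\<close> that of \<eta>.\<close>

lemma tensor_ring_iso:
 assumes A: "cring A" and B: "cring B" and fi: "fi : ring_hom A B" and C: "cring C" and ps: "ps : ring_iso A C"
 defines "ka == %v. tensor_class A (alg_module fi B) (alg_module ps C) (frag_of (v, 1[C]))"
 shows "ka : ring_iso B (tensor_ring A (alg_module fi B) (alg_module ps C))"
  and "0[tensor_ring A (alg_module fi B) (alg_module ps C)] = ka 0[B]"
  and "!!r. r : carrier A ==> tensor_class A (alg_module fi B) (alg_module ps C) (frag_of (1[B], ps r)) = ka (fi r)"
proof -
 interpret R: rank_one A B fi "alg_module ps C" "1[C]" by(rule rank_one_of_iso[OF A B fi C ps])
 interpret C: cring C by(rule C)
 have h: "ps : ring_hom A C" using ps unfolding ring_iso_def by blast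
 note hc = ring_hom_closed[OF h]
 let ?F = "tensor_ring A (alg_module fi B) (alg_module ps C)"
 have F: "carrier ?F = tensor_carrier A (alg_module fi B) (alg_module ps C)"
  "x *[?F] y = tensor_mult A (alg_module fi B) (alg_module ps C) x y"
  "x +[?F] y = (\<Union>x\<in>x. \<Union>y\<in>y. R.cl (x + y))" "1[?F] = R.cl (frag_of (1[B], 1[C]))" "0[?F] = R.cl 0" for x y
  unfolding tensor_ring_def by simp_all
 have add: "(\<Union>x\<in>R.cl a. \<Union>y\<in>R.cl b. R.cl (x + y)) = R.cl (a + b)" for a b
 proof -
  have "R.cl (x + y) = R.cl (a + b)" if "x : R.cl a" "y : R.cl b" for x y
  proof (rule R.cl_eqI)
   have "(x - a) + (y - b) : R.K" using that by(intro R.K_add) (simp_all only: R.in_cl_iff)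
   thus "x + y - (a + b) : R.K" by(simp add: algebra_simps)
  qed
  thus ?thesis using R.cl_self[of a] R.cl_self[of b] by blast
 qed
 show "0[?F] = ka 0[B]" unfolding F ka_def by(rule R.cl_zero)
 show "tensor_class A (alg_module fi B) (alg_module ps C) (frag_of (1[B], ps r)) = ka (fi r)" if "r : carrier A" for r
  unfolding ka_def using R.cl_smult[OF R.B.one_closed that] hc[OF that] R.fi_closed[OF that] by simp
 show "ka : ring_iso B ?F"
 proof (rule ring_iso_memI)
  have kc: "ka v : tensor_carrier A (alg_module fi B) (alg_module ps C)" if "v : carrier B" for v
   unfolding ka_def by(rule R.pair_carrier) (use that in simp_all)
  show "ka v : carrier ?F" if "v : carrier B" for v unfolding F by(rule kc[OF that])
  fix v w assume vw: "v : carrier B" "w : carrier B"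
  show "ka (v *[B] w) = ka v *[?F] ka w"
  proof -
   have "tensor_mult A (alg_module fi B) (alg_module ps C) (R.cl (frag_of (v, 1[C]))) (R.cl (frag_of (w, 1[C])))
    = R.cl (frag_of (v *[alg_module fi B] w, 1[C] *[alg_module ps C] 1[C]))"
    by(rule tensor_mult_pair[OF R.tensor_pair_axioms R.tensor_pair_axioms R.tensor_pair_axioms])
     (simp_all add: vw hc C.l_distr C.r_distr C.m_ac R.B.l_distr R.B.r_distr R.B.m_ac)
   thus ?thesis unfolding F ka_def by simp
  qed
  show "ka (v +[B] w) = ka v +[?F] ka w"
   unfolding F ka_def add using R.cl_add[OF refl vw R.A.one_closed] vw ring_hom_one[OF h] ring_hom_one[OF fi] by simp
 next
  show "ka 1[B] = 1[?F]" unfolding F ka_def ..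
  show "bij_betw ka (carrier B) (carrier ?F)" unfolding F bij_betw_def
  proof (intro conjI equalityI subsetI inj_onI)
   show "v = w" if "v : carrier B" "w : carrier B" "ka v = ka w" for v w
    using that(3,1,2) unfolding ka_def by(rule R.cl_inj)
   fix X assume "X : tensor_carrier A (alg_module fi B) (alg_module ps C)"
   then obtain v where "v : carrier B" "X = R.cl (frag_of (v, 1[C]))" by(rule R.carrier_cl)
   thus "X : ka ` carrier B" unfolding ka_def by blast
  next
   fix X assume "X : ka ` carrier B"
   thus "X : tensor_carrier A (alg_module fi B) (alg_module ps C)" using R.pair_carrier[of _ "1[C]"] unfolding ka_def by auto
  qed
 qed
qed

section \<open>The fibre product of \<open>T\<close> with \<eta>: points and stalks\<close>

locale eta_fibre = weak_ass_scheme S + gm S T f for S :: "('a, 'r) ringed_space" and T :: "('b, 'k) ringed_space" and f +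
 assumes T_scheme: "scheme T"
begin

abbreviation Fp where "Fp == ringed_fibre_product T E S f p"
abbreviation Q where "Q == fibre_primes T E S f p"
abbreviation Te where "Te == fibre_product T E S f p"
abbreviation q1 where "q1 == fibre_proj1 T E S f p"
abbreviation q2 where "q2 == fibre_proj2 T E S f p"
abbreviation B where "B t == T@@t"

text \<open>The underlying set of the fibre product, as a subset of \<open>T\<close>. Since
  \<open>p\<close> is an isomorphism on local rings, there is exactly one point over each
  \<open>t\<close> in \<open>Z\<close>, and its local ring is that of \<open>T\<close>;
  \<open>ka\<close> and \<open>qt\<close> make this explicit on the tensor product before it is
  localized.\<close>

definition Z where "Z = {t : points T. f$t : Max_points S}"
abbreviation zt where "zt t == ept f$t"
abbreviation F where "F t == fibre_stalk T E S f p (t, zt t)"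
definition ka where "ka t v = fibre_tensor_class T E S f p (t, zt t) (frag_of (v, 1[E@@(zt t)]))"
definition qt where "qt t = ka t ` max_ideal (B t)"
abbreviation wpt where "wpt t == ((t, zt t), qt t)"

lemma T_local: "t : points T ==> local_ring (B t)"
 using T_scheme unfolding scheme_def locally_ringed_def by blast

lemma ZD: "t : Z ==> t : points T" "t : Z ==> f$t : Max_points S" "t : Z ==> f$t : points S"
 unfolding Z_def using Max_points_S by auto

lemma zt_E: "t : Z ==> zt t : points E" using ZD unfolding points_E by blast

lemma F_eq: "F t = tensor_ring (A f$t) (alg_module (cm f t) (B t)) (alg_module (cm p (zt t)) E@@(zt t))"
 unfolding fibre_stalk_def by simp

lemma ka_eq: "ka t v = tensor_class (A f$t) (alg_module (cm f t) (B t)) (alg_module (cm p (zt t)) E@@(zt t)) (frag_of (v, 1[E@@(zt t)]))"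
 unfolding ka_def fibre_tensor_class_def by simp

lemma
 assumes t: "t : Z"
 shows ka_iso: "ka t : ring_iso (B t) (F t)" and F_cring: "cring (F t)"
  and ka_second: "!!r. r : carrier (A f$t) ==>
   fibre_tensor_class T E S f p (t, zt t) (frag_of (1[B t], cm p (zt t) r)) = ka t (cm f t r)"
proof -
 note a = stalk_cring[OF ZD(3)[OF t]] T.stalk_cring[OF ZD(1)[OF t]] f_hom[OF ZD(1)[OF t]] E_cring[OF ZD(2)[OF t]] p_iso[OF ZD(2)[OF t]]
 have ka: "ka t = (%v. tensor_class (A f$t) (alg_module (cm f t) (B t)) (alg_module (cm p (zt t)) E@@(zt t)) (frag_of (v, 1[E@@(zt t)])))"
  by(rule ext) (rule ka_eq)
 show 1: "ka t : ring_iso (B t) (F t)" unfolding F_eq ka by(rule tensor_ring_iso(1)[OF a])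
 show "cring (F t)" by(rule cring_of_ring_iso[OF a(2) 1]) (unfold F_eq ka, rule tensor_ring_iso(2)[OF a])
 show "fibre_tensor_class T E S f p (t, zt t) (frag_of (1[B t], cm p (zt t) r)) = ka t (cm f t r)" if "r : carrier (A f$t)" for r
  unfolding ka using tensor_ring_iso(3)[OF a that] unfolding fibre_tensor_class_def by simp
qed

lemma ka_hom: "t : Z ==> ka t : ring_hom (B t) (F t)" using ka_iso unfolding ring_iso_def by blast
lemma ka_bij: "t : Z ==> bij_betw (ka t) (carrier (B t)) (carrier (F t))" using ka_iso unfolding ring_iso_def by blast
lemma ka_closed: "t : Z ==> v : carrier (B t) ==> ka t v : carrier (F t)" by(rule ring_hom_closed[OF ka_hom])

lemma max_B: "t : points T ==> max_ideal (B t) = carrier (B t) - Units (B t)"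
 by(rule local_ring_nonunits(1)[OF T_local])

lemma ka_qt: assumes t: "t : Z" and v: "v : carrier (B t)" shows "ka t v : qt t <-> v ~: Units (B t)"
 unfolding qt_def max_B[OF ZD(1)[OF t]] using v bij_betw_imp_inj_on[OF ka_bij[OF t]] by(auto dest: inj_onD)

lemma qt_compl: assumes t: "t : Z" shows "carrier (F t) - qt t = Units (F t)"
proof -
 note B = T.stalk_cring[OF ZD(1)[OF t]] and F = F_cring[OF t]
 have u: "ka t v : Units (F t) <-> v : Units (B t)" if "v : carrier (B t)" for v
  using ring_iso_Units[OF ka_iso[OF t] B F that] ring_hom_Units[OF ka_hom[OF t] B F, of v] by blast
 show ?thesis
 proof (intro equalityI subsetI)
  fix x assume x: "x : carrier (F t) - qt t"
  then obtain v where v: "v : carrier (B t)" "x = ka t v" using ka_bij[OF t] unfolding bij_betw_def by blast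
  thus "x : Units (F t)" using x u ka_qt[OF t v(1)] by blast
 next
  fix x assume x: "x : Units (F t)"
  hence "x : carrier (F t)" using monoid.Units_closed[OF ring.is_monoid[OF cring.axioms(1)[OF F]]] by blast
  then obtain v where v: "v : carrier (B t)" "x = ka t v" using ka_bij[OF t] unfolding bij_betw_def by blast
  thus "x : carrier (F t) - qt t" using x u ka_qt[OF t v(1)] \<open>x : carrier (F t)\<close> by blast
 qed
qed

lemma F_local: assumes t: "t : Z" shows "local_ring (F t)"
 by(rule local_ring_of_ring_iso[OF T_local[OF ZD(1)[OF t]] ka_iso[OF t]])
  (rule ring_hom_zero'[OF ka_hom[OF t] T.stalk_cring[OF ZD(1)[OF t]] F_cring[OF t], symmetric])

lemma qt_eq: assumes t: "t : Z" shows "qt t = carrier (F t) - Units (F t)"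
proof -
 have "qt t <= carrier (F t)" unfolding qt_def max_B[OF ZD(1)[OF t]] using ka_closed[OF t] by blast
 thus ?thesis using qt_compl[OF t] by blast
qed

lemma qt_prime: "t : Z ==> primeideal (qt t) (F t)"
 unfolding qt_eq by(rule local_ringD(3)[OF F_local])

text \<open>\<open>ka t\<close> is an isomorphism onto the tensor product, so lying over the maximal
  ideal of \<open>B t\<close> already determines the prime. That this prime also lies over the
  maximal ideal of \<eta> follows because \<open>f\<close> is local.\<close>

lemma Q_iff: assumes t: "t : Z" shows "q : Q (t, zt t) <-> q = qt t"
proof
 assume "q : Q (t, zt t)"
 hence q: "primeideal q (F t)" "{r : carrier (B t). ka t r : q} = max_ideal (B t)"
  unfolding fibre_primes_def ka_def by auto
 have "q <= ka t ` carrier (B t)"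
  using ka_bij[OF t] ideal.Icarr[OF primeideal.axioms(1)[OF q(1)]] unfolding bij_betw_def by blast
 thus "q = qt t" unfolding qt_def q(2)[symmetric] by blast
next
 assume q: "q = qt t"
 have 1: "{r : carrier (B t). ka t r : qt t} = max_ideal (B t)" unfolding max_B[OF ZD(1)[OF t]] using ka_qt[OF t] by blast
 have u: "cm f t r : Units (B t) <-> r : Units (A f$t)" if "r : carrier (A f$t)" for r
  by(rule lrs_hom_units[OF f ZD(1)[OF t] T_local[OF ZD(1)[OF t]] local[OF ZD(3)[OF t]] that])
 note s = ZD(2)[OF t]
 have u': "cm p (zt t) r : Units E@@(zt t) <-> r : Units (A f$t)" if "r : carrier (A f$t)" for r
  using ring_iso_Units[OF p_iso[OF s] stalk_cring[OF ZD(3)[OF t]] E_cring[OF s] that]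
   ring_hom_Units[OF p_hom[OF s] stalk_cring[OF ZD(3)[OF t]] E_cring[OF s], of r] by blast
 have im: "carrier E@@(zt t) = cm p (zt t) ` carrier (A f$t)" using p_iso[OF s] unfolding ring_iso_def bij_betw_def by auto
 have "{r : carrier E@@(zt t). fibre_tensor_class T E S f p (t, zt t) (frag_of (1[B t], r)) : qt t} = max_ideal E@@(zt t)"
  unfolding local_ring_nonunits(1)[OF E_local[OF s]] im
  using ka_second[OF t] u u' ka_qt[OF t f_closed[OF ZD(1)[OF t]]] by auto
 thus "q : Q (t, zt t)" unfolding q fibre_primes_def using 1 qt_prime[OF t] by(simp add: ka_def)
qed

lemma Fp_simps: "spc Fp = fibre_topology T E f p" "stalk Fp = fibre_stalk T E S f p"
 unfolding ringed_fibre_product_def by simp_all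

lemma points_Fp: "points Fp = (%t. (t, zt t)) ` Z"
proof -
 have "points Fp = {(t, z). t : points T & z : points E & f$t = p$z}" unfolding Fp_simps fibre_topology_def by auto
 also have "... = (%t. (t, zt t)) ` Z"
 proof (intro equalityI subsetI)
  fix w assume "w : {(t, z). t : points T & z : points E & f$t = p$z}"
  then obtain t s where "w = (t, ept s)" "t : points T" "s : Max_points S" "f$t = s" using p_pt unfolding points_E by auto
  thus "w : (%t. (t, zt t)) ` Z" unfolding Z_def by auto
 next
  fix w assume "w : (%t. (t, zt t)) ` Z"
  thus "w : {(t, z). t : points T & z : points E & f$t = p$z}" using ZD p_pt zt_E by auto
 qed
 finally show ?thesis .
qed

lemma near_zt: assumes t: "t : Z" shows "evn T t (%t'. t' : Z --> zt t' = zt t)"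
 using f_near[OF ZD(1)[OF t] Max_isolated[OF ZD(2)[OF t]]] by eventually_elim (simp add: Z_def)

lemma Fp_near:
 assumes t: "t : Z" and U: "opn Fp U" "(t, zt t) : U"
 shows "evn T t (%t'. t' : Z --> (t', zt t') : U)"
proof -
 obtain W where W: "openin (prod_topology (spc T) (spc E)) W" "U = W Int {(x, y). f$x = p$y}"
  using U(1) unfolding Fp_simps fibre_topology_def openin_subtopology by blast
 then obtain V V' where V: "opn T V" "t : V" "zt t : V'" "V \<times> V' <= W"
  using U(2) unfolding openin_prod_topology_alt by blast
 show ?thesis using near_zt[OF t] near_open[OF V(1,2)]
 proof eventually_elim
  case (elim t')
  show ?case
  proof
   assume t': "t' : Z"
   hence "(t', zt t') : W" using elim V by auto
   moreover have "f$t' = p$(zt t')" using p_pt[OF ZD(2)[OF t']] by simp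
   ultimately show "(t', zt t') : U" unfolding W(2) by simp
  qed
 qed
qed

lemma Fp_open: assumes V: "opn T V" shows "opn Fp ((%t. (t, zt t)) ` (V Int Z))"
proof -
 have VT: "V <= points T" by(rule openin_subset[OF V])
 have "openin (prod_topology (spc T) (spc E)) (V \<times> points E)" by(simp add: openin_prod_Times_iff V)
 hence "opn Fp ((V \<times> points E) Int {(x, y). f$x = p$y})"
  unfolding Fp_simps fibre_topology_def openin_subtopology by blast
 moreover have "(V \<times> points E) Int {(x, y). f$x = p$y} = (%t. (t, zt t)) ` (V Int Z)"
 proof (intro equalityI subsetI)
  fix w assume "w : (V \<times> points E) Int {(x, y). f$x = p$y}"
  then obtain t s where "w = (t, ept s)" "t : V" "s : Max_points S" "f$t = s" using p_pt unfolding points_E by auto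
  thus "w : (%t. (t, zt t)) ` (V Int Z)" unfolding Z_def using VT by auto
 next
  fix w assume "w : (%t. (t, zt t)) ` (V Int Z)"
  thus "w : (V \<times> points E) Int {(x, y). f$x = p$y}" using ZD p_pt zt_E by auto
 qed
 ultimately show ?thesis by simp
qed

abbreviation (input) "fsum b c n == %z. fibre_tensor_class T E S f p z (\<Sum>i<n. frag_of (b i (fst z), c i (snd z)))"
abbreviation (input) "fsecs V == {fsum b c n |(n :: nat) b c U U'.
 opn T U & opn E U' & V <= U \<times> U' & (ALL i<n. b i : sections T U & c i : sections E U')}"

lemma sections_Fp: "sections Fp = locally_given (spc Fp) (%z. carrier Fp@@z)
    (%V. fsecs V)"
 unfolding ringed_fibre_product_def by simp

lemma Fp_section:
 assumes V: "opn T V" and v: "v : sections T V"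
 shows "(\<lambda>z\<in>(%t. (t, zt t)) ` (V Int Z). ka (fst z) (v (fst z))) : sections Fp ((%t. (t, zt t)) ` (V Int Z))" (is "?s : sections Fp ?W")
 unfolding sections_Fp
proof (rule locally_givenI)
 interpret E: ringed E by(rule E_ringed)
 let ?o = "\<lambda>z\<in>points E. 1[E@@z]"
 fix z assume z: "z : ?W"
 show "EX V ta. opn Fp V & z : V & V <= ?W &
    ta : fsecs V &
    (ALL y:V. ?s y = ta y & ?s y : carrier Fp@@y)"
 proof (intro exI[of _ ?W] exI[of _ "fsum (%i::nat. v) (%i::nat. ?o) 1"] conjI ballI)
  show "opn Fp ?W" by(rule Fp_open[OF V])
  have "?W <= V \<times> points E" using zt_E by auto
  moreover have "ALL i<1::nat. (%i::nat. v) i : sections T V & (%i::nat. ?o) i : sections E (points E)"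
   using v E.sections_one[OF openin_topspace] by simp
  ultimately show "(fsum (%i::nat. v) (%i::nat. ?o) 1)
   : fsecs ?W"
   using V openin_topspace[of "spc E"]
   by - (intro CollectI exI[of _ "1::nat"] exI[of _ "%i::nat. v"] exI[of _ "%i::nat. ?o"] exI[of _ V] exI[of _ "points E"] conjI refl, assumption+)
  fix y assume y: "y : ?W"
  then obtain t where t: "t : V" "t : Z" "y = (t, zt t)" by blast
  have sy: "?s y = ka (fst y) (v (fst y))" by(rule restrict_apply'[OF y])
  show "?s y = fibre_tensor_class T E S f p y (\<Sum>i<1. frag_of ((%i::nat. v) i (fst y), (%i::nat. ?o) i (snd y)))"
   unfolding sy unfolding t(3) using zt_E[OF t(2)] by(simp add: ka_def)
  show "?s y : carrier Fp@@y"
   unfolding sy unfolding t(3) fst_conv Fp_simps by(rule ka_closed[OF t(2) T.lsec_carrier[OF T.sections_lsec[OF V v t(1)]]])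
 qed (use z in simp_all)
qed simp

text \<open>A section is locally a sum of tensors \<open>b \<otimes> c\<close>. As \<eta> is
  discrete, \<open>c\<close> is near \<open>t0\<close> evaluated at a single point, where it comes
  from some \<open>r\<close> on \<open>S\<close>, and the term becomes \<open>b f(r)\<close>:
  sections are restrictions to \<open>Z\<close> of sections of \<open>T\<close>.\<close>

lemma Fp_section_near:
 assumes t0: "t0 : Z" and U: "opn Fp U" "(t0, zt t0) : U" and s: "s : sections Fp U"
 obtains v where "lsec T t0 v" "evn T t0 (%t. t : Z --> (t, zt t) : U & s (t, zt t) = ka t (v t))"
proof -
 interpret E: ringed E by(rule E_ringed)
 note t0T = ZD(1)[OF t0] and s0 = ZD(2)[OF t0] and s0S = ZD(3)[OF t0]
 obtain V ta where V: "opn Fp V" "(t0, zt t0) : V" "V <= U"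
  and ta: "ta : fsecs V"
  and sV: "ALL y:V. s y = ta y" by(rule locally_givenE[OF s[unfolded sections_Fp] U(2)])
 from ta obtain n :: nat and b c U1 U2 where bc: "opn T U1" "opn E U2" "V <= U1 \<times> U2"
  "ALL i<n. b i : sections T U1 & c i : sections E U2"
  and tae: "ta = (fsum b c n)" by blast
 let ?cl = "%t. tensor_class (A f$t) (alg_module (cm f t) (B t)) (alg_module (cm p (zt t)) E@@(zt t))"
 have tU: "t0 : U1" "zt t0 : U2" using bc(3) V(2) by auto
 have sums: "EX v. lsec T t0 v & evn T t0 (%t. t : Z --> ?cl t (\<Sum>i<k. frag_of (b i t, c i (zt t))) = ka t (v t))" if "k <= n" for k
  using that
 proof (induction k)
  case 0
  have "?cl t 0 = ka t 0[B t]" if t: "t : Z" for t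
   unfolding ka_eq by(rule rank_one.cl_zero[OF rank_one_of_iso[OF stalk_cring[OF ZD(3)[OF t]] T.stalk_cring[OF ZD(1)[OF t]] f_hom[OF ZD(1)[OF t]] E_cring[OF ZD(2)[OF t]] p_iso[OF ZD(2)[OF t]]]])
  hence "evn T t0 (%t. t : Z --> ?cl t (\<Sum>i<0. frag_of (b i t, c i (zt t))) = ka t 0[B t])" by simp
  thus ?case using T.lsec_zero[OF t0T] by blast
 next
  case (Suc k)
  then obtain v where v: "lsec T t0 v" "evn T t0 (%t. t : Z --> ?cl t (\<Sum>i<k. frag_of (b i t, c i (zt t))) = ka t (v t))" by auto
  have bk: "b k : sections T U1" and ck: "c k : sections E U2" using bc(4) Suc.prems by auto
  have blk: "lsec T t0 (b k)" by(rule T.sections_lsec[OF bc(1) bk tU(1)])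
  have "c k (zt t0) : carrier E@@(zt t0)" by(rule E.lsec_carrier[OF E.sections_lsec[OF bc(2) ck tU(2)]])
  then obtain r where r: "r : carrier (A f$t0)" "c k (zt t0) = cm p (zt t0) r"
   using p_iso[OF s0] unfolding ring_iso_def bij_betw_def by blast
  obtain r' where r': "lsec S f$t0 r'" "r' f$t0 = r" using lsec_exists[OF s0S r(1)] by blast
  let ?v = "%t. v t +[B t] b k t *[B t] cm f t (r' f$t)"
  have "lsec T t0 ?v" by(rule T.lsec_add[OF v(1) T.lsec_mult[OF blk lsec_pullback[OF f t0T r'(1)]]])
  moreover have "evn T t0 (%t. t : Z --> ?cl t (\<Sum>i<Suc k. frag_of (b i t, c i (zt t))) = ka t (?v t))"
   using v(2) near_zt[OF t0] lsec_near[OF v(1)] lsec_near[OF blk]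
  proof eventually_elim
   case (elim t)
   show ?case
   proof
    assume t: "t : Z"
    have st: "zt t = zt t0" "f$t = f$t0" using elim(2) t by auto
    have R: "rank_one (A f$t) (B t) (cm f t) (alg_module (cm p (zt t)) E@@(zt t)) 1[E@@(zt t)]"
     by(rule rank_one_of_iso[OF stalk_cring[OF ZD(3)[OF t]] T.stalk_cring[OF ZD(1)[OF t]] f_hom[OF ZD(1)[OF t]] E_cring[OF ZD(2)[OF t]] p_iso[OF ZD(2)[OF t]]])
    have rc: "r : carrier (A f$t)" using r(1) st(2) by simp
    interpret e: cring "E@@(zt t)" by(rule E_cring[OF ZD(2)[OF t]])
    have "c k (zt t) = cm p (zt t) r" unfolding st(1) by(rule r(2))
    hence ck': "c k (zt t) = r .[alg_module (cm p (zt t)) E@@(zt t)] 1[E@@(zt t)]"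
     by(simp only: alg_module_simps e.r_one[OF ring_hom_closed[OF p_hom[OF ZD(2)[OF t]] rc]])
    have "?cl t ((\<Sum>i<k. frag_of (b i t, c i (zt t))) + frag_of (b k t, c k (zt t))) = ka t (v t +[B t] b k t *[B t] cm f t r)"
     unfolding ck' ka_eq
     by(rule rank_one.cl_add[OF R _ T.lsec_carrier[OF elim(3)] T.lsec_carrier[OF elim(4)] rc]) (use elim(1) t in \<open>simp add: ka_eq\<close>)
    thus "?cl t (\<Sum>i<Suc k. frag_of (b i t, c i (zt t))) = ka t (?v t)" using r'(2) st(2) by simp
   qed
  qed
  ultimately show ?case by blast
 qed
 obtain v where v: "lsec T t0 v" "evn T t0 (%t. t : Z --> ?cl t (\<Sum>i<n. frag_of (b i t, c i (zt t))) = ka t (v t))" using sums[of n] by blast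
 have "evn T t0 (%t. t : Z --> (t, zt t) : U & s (t, zt t) = ka t (v t))"
  using v(2) Fp_near[OF t0 V(1,2)]
 proof eventually_elim
  case (elim t)
  show ?case
  proof
   assume t: "t : Z"
   hence tV: "(t, zt t) : V" using elim(2) by blast
   hence "s (t, zt t) = ta (t, zt t)" using sV by blast
   thus "(t, zt t) : U & s (t, zt t) = ka t (v t)" using tV V(3) elim(1) t unfolding tae fibre_tensor_class_def by auto
  qed
 qed
 with v(1) show thesis by(rule that)
qed

end

lemma lsec_locally_givenE:
 assumes "sections X = locally_given (spc X) E B" "lsec X x s"
 obtains V ta where "opn X V" "x : V" "ta : B V" "ALL y:V. s y = ta y"
proof (rule lsec_locally_givenD[OF assms])
 fix V ta assume a: "opn X V" "x : V" "ta : B V" "!!y. y : V ==> s y = ta y"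
 show thesis by(rule that[OF a(1-3) ballI[OF a(4)]])
qed

section \<open>The fibre product of \<open>T\<close> with \<eta>: topology and structure
  sheaf\<close>

context eta_fibre
begin

abbreviation io where "io t == cm q1 (wpt t)"
abbreviation ev :: "'b => ('b => bool) => bool" where "ev t0 P == evn T t0 (%t. t : Z --> P t)"

lemma Te_simps: "spc Te = prime_topology Fp Q" "stalk Te = prime_stalk Fp"
 unfolding fibre_product_def localize_at_def by simp_all

lemma qt_one: "t : Z ==> ka t 1[B t] ~: qt t"
 using ka_qt[of t "1[B t]"] T.stalk_cring[OF ZD(1)] by(simp add: cring.cring_simprules(6) monoid.Units_one_closed[OF ring.is_monoid[OF cring.axioms(1)]])

lemma basic_open_one:
 assumes V: "opn T V"
 shows "wpt ` (V Int Z) = basic_open Fp Q ((%t. (t, zt t)) ` (V Int Z)) (\<lambda>z\<in>(%t. (t, zt t)) ` (V Int Z). ka (fst z) ((\<lambda>t\<in>V. 1[B t]) (fst z)))" (is "_ = basic_open Fp Q ?W ?g")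
proof (intro equalityI subsetI)
 fix w assume "w : wpt ` (V Int Z)"
 then obtain t where t: "t : V" "t : Z" "w = wpt t" by blast
 hence z: "(t, zt t) : ?W" by blast
 have "?g (t, zt t) ~: qt t" unfolding restrict_apply'[OF z] fst_conv using qt_one[OF t(2)] t(1) by simp
 thus "w : basic_open Fp Q ?W ?g" unfolding basic_open_def t(3) using z Q_iff[OF t(2)] by blast
next
 fix w assume "w : basic_open Fp Q ?W ?g"
 then obtain t q where t: "t : V" "t : Z" "w = ((t, zt t), q)" "q : Q (t, zt t)" unfolding basic_open_def by blast
 thus "w : wpt ` (V Int Z)" using Q_iff[OF t(2)] by blast
qed

lemma Te_open: assumes V: "opn T V" shows "opn Te (wpt ` (V Int Z))"
 unfolding Te_simps prime_topology_def basic_open_one[OF V]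
 by(rule topology_generated_by_Basis, rule CollectI, intro exI conjI, rule refl, rule Fp_open[OF V], rule Fp_section[OF V T.sections_one[OF V]])

lemma points_Te: "points Te = wpt ` Z"
proof (intro equalityI subsetI)
 fix w assume "w : points Te"
 then obtain U g where U: "w : basic_open Fp Q U g" "opn Fp U"
  unfolding Te_simps prime_topology_def topology_generated_by_topspace by blast
 obtain z q where z: "w = (z, q)" "z : U" "q : Q z" using U(1) unfolding basic_open_def by blast
 have "z : points Fp" using openin_subset[OF U(2)] z(2) by blast
 then obtain t where t: "t : Z" "z = (t, zt t)" unfolding points_Fp by blast
 thus "w : wpt ` Z" using z Q_iff[OF t(1)] by blast
next
 have "points T Int Z = Z" using ZD(1) by blast
 thus "w : points Te" if "w : wpt ` Z" for w using that openin_subset[OF Te_open[OF openin_topspace]] by auto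
qed

lemma wpt_Te: "t : Z ==> wpt t : points Te" unfolding points_Te by blast

text \<open>The topology is induced from \<open>T\<close>: in terms of a section \<open>v\<close> of
  \<open>T\<close>, avoiding the prime \<open>qt\<close> means that \<open>v\<close> is a unit,
  which is an open condition on \<open>T\<close>.\<close>

lemma Te_open_near:
 assumes V: "opn Te V" and t0: "t0 : Z" "wpt t0 : V"
 shows "ev t0 (%t. wpt t : V)"
proof -
 have "generate_topology_on {basic_open Fp Q U g |U g. opn Fp U & g : sections Fp U} V"
  using V unfolding Te_simps prime_topology_def by(rule openin_topology_generated_by)
 thus ?thesis using t0(2)
 proof (induction rule: generate_topology_on.induct)
  case (Int a b)
  hence "ev t0 (%t. wpt t : a)" "ev t0 (%t. wpt t : b)" by auto
  thus ?case by eventually_elim blast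
 next
  case (UN K)
  then obtain k where k: "k : K" "wpt t0 : k" by blast
  hence "ev t0 (%t. wpt t : k)" using UN by blast
  thus ?case by eventually_elim (use k in blast)
 next
  case (Basis s)
  then obtain U g where U: "s = basic_open Fp Q U g" "opn Fp U" "g : sections Fp U" by blast
  have tU: "(t0, zt t0) : U" "g (t0, zt t0) ~: qt t0" using Basis(2) unfolding U(1) basic_open_def by auto
  obtain v where v: "lsec T t0 v" "ev t0 (%t. (t, zt t) : U & g (t, zt t) = ka t (v t))" by(rule Fp_section_near[OF t0(1) U(2) tU(1) U(3)])
  have u: "v t0 : Units (B t0)"
   using near_self[OF v(2) ZD(1)[OF t0(1)]] t0(1) tU(2) ka_qt[OF t0(1) T.lsec_carrier[OF v(1)]] by simp
  show ?case using v(2) T.lsec_unit_near(1)[OF v(1) u] lsec_near[OF v(1)]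
  proof eventually_elim
   case (elim t)
   thus "t : Z --> wpt t : s"
    using ka_qt[of t "v t"] T.lsec_carrier[of t v] Q_iff[of t] unfolding U(1) basic_open_def by auto
  qed
 qed simp
qed

lemma near_Te:
 assumes t0: "t0 : Z"
 shows "evn Te (wpt t0) P <-> ev t0 (%t. P (wpt t))"
proof
 assume "evn Te (wpt t0) P"
 then obtain V where V: "opn Te V" "wpt t0 : V" "ALL y:V. P y" using wpt_Te[OF t0] by(rule nearE)
 show "ev t0 (%t. P (wpt t))" using Te_open_near[OF V(1) t0 V(2)] by eventually_elim (use V(3) in blast)
next
 assume "ev t0 (%t. P (wpt t))"
 then obtain V where V: "opn T V" "t0 : V" "ALL t:V. t : Z --> P (wpt t)" using ZD(1)[OF t0] by(rule nearE)
 show "evn Te (wpt t0) P"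
 proof (rule nearI[OF Te_open[OF V(1)]])
  show "wpt t0 : wpt ` (V Int Z)" using V(2) t0 by blast
  fix y assume "y : wpt ` (V Int Z)"
  thus "P y" using V(3) by blast
 qed
qed

abbreviation Lf where "Lf t == fraction (F t) (carrier (F t) - qt t)"

lemma stalk_Te: "Te@@(wpt t) = localization (F t) (carrier (F t) - qt t)"
 unfolding Te_simps prime_stalk_def Fp_simps by simp

lemma F_loc: "t : Z ==> localized (F t) (carrier (F t) - qt t)"
 by(rule localized_compl_prime[OF qt_prime])

lemma io_eq: assumes t: "t : Z" shows "io t = (\<lambda>r\<in>carrier (B t). Lf t (ka t r) 1[F t])"
 unfolding fibre_proj1_def fibre_frac_def morphism.select_convs restrict_apply'[OF wpt_Te[OF t]] by(simp add: ka_def)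

lemma io_iso: assumes t: "t : Z" shows "io t : ring_iso (B t) Te@@(wpt t)"
proof -
 interpret l: localized "F t" "carrier (F t) - qt t" by(rule F_loc[OF t])
 have "(%m. l.fr m 1[F t]) \<circ> ka t : ring_iso (B t) l.L"
  by(rule ring_iso_set_trans[OF ka_iso[OF t] l.fr_one_iso]) (use qt_compl[OF t] in simp)
 thus ?thesis unfolding stalk_Te
  by(rule ring.ring_iso_restrict[OF cring.axioms(1)[OF T.stalk_cring[OF ZD(1)[OF t]]]]) (simp add: io_eq[OF t])
qed

lemma io_hom: "t : Z ==> io t : ring_hom (B t) Te@@(wpt t)" using io_iso unfolding ring_iso_def by blast

lemma io_inj: "t : Z ==> io t v = io t w ==> v : carrier (B t) ==> w : carrier (B t) ==> v = w"
 using io_iso[of t] unfolding ring_iso_def bij_betw_def by(auto dest: inj_onD)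

lemma io_surj: assumes "t : Z" "x : carrier Te@@(wpt t)" obtains v where "v : carrier (B t)" "x = io t v"
 using io_iso[OF assms(1)] assms(2) unfolding ring_iso_def bij_betw_def by blast

lemma Te_cring: assumes t: "t : Z" shows "cring Te@@(wpt t)"
 unfolding stalk_Te by(rule localized.cring_L[OF F_loc[OF t]])

lemma io_closed: "t : Z ==> v : carrier (B t) ==> io t v : carrier Te@@(wpt t)" by(rule ring_hom_closed[OF io_hom])

lemma io_Units: "t : Z ==> v : carrier (B t) ==> io t v : Units Te@@(wpt t) <-> v : Units (B t)"
 using ring_iso_Units[OF io_iso T.stalk_cring[OF ZD(1)] Te_cring] ring_hom_Units[OF io_hom T.stalk_cring[OF ZD(1)] Te_cring] by blast

lemma Te_local: assumes t: "t : Z" shows "local_ring Te@@(wpt t)"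
 by(rule local_ring_of_ring_iso[OF T_local[OF ZD(1)[OF t]] io_iso[OF t]])
  (rule ring_hom_zero'[OF io_hom[OF t] T.stalk_cring[OF ZD(1)[OF t]] Te_cring[OF t], symmetric])

lemma q2_cm: assumes t: "t : Z" and r: "r : carrier (A f$t)" shows "cm q2 (wpt t) (cm p (zt t) r) = io t (cm f t r)"
proof -
 have c: "cm p (zt t) r : carrier E@@(zt t)" by(rule ring_hom_closed[OF p_hom[OF ZD(2)[OF t]] r])
 have "cm q2 (wpt t) (cm p (zt t) r) = Lf t (fibre_tensor_class T E S f p (t, zt t) (frag_of (1[B t], cm p (zt t) r))) 1[F t]"
  unfolding fibre_proj2_def fibre_frac_def morphism.select_convs restrict_apply'[OF wpt_Te[OF t]] using c by simp
 thus ?thesis unfolding ka_second[OF t r] io_eq[OF t] using f_closed[OF ZD(1)[OF t] r] by simp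
qed

lemma sections_Te: "sections Te = locally_given (spc Te) (%z. carrier Te@@z)
    (%V. locfracs Fp Q V)"
 unfolding fibre_product_def localize_at_def by simp

text \<open>A fraction of sections of the tensor product has as denominator a section of
  \<open>T\<close> that is a unit near \<open>t0\<close>, so it is given by a section of
  \<open>T\<close>. With its converse \<open>lsec_TeI\<close> this identifies the structure sheaf
  with the inverse image of that of \<open>T\<close> on \<open>Z\<close>.\<close>

lemma lsec_TeD:
 assumes t0: "t0 : Z" and x: "lsec Te (wpt t0) x"
 obtains v where "lsec T t0 v" "ev t0 (%t. x (wpt t) = io t (v t))"
proof -
 obtain V ta where V: "opn Te V" "wpt t0 : V"
  and ta: "ta : locfracs Fp Q V"
  and xV: "ALL y:V. x y = ta y" by(rule lsec_locally_givenE[OF sections_Te x])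
 from ta obtain a g U where U: "opn Fp U" "a : sections Fp U" "g : sections Fp U" "V <= basic_open Fp Q U g"
  and tae: "ta = (locfrac Fp a g)" by blast
 have tU: "(t0, zt t0) : U" "g (t0, zt t0) ~: qt t0" using V(2) U(4) unfolding basic_open_def by auto
 obtain va where va: "lsec T t0 va" "ev t0 (%t. (t, zt t) : U & a (t, zt t) = ka t (va t))" by(rule Fp_section_near[OF t0 U(1) tU(1) U(2)])
 obtain vg where vg: "lsec T t0 vg" "ev t0 (%t. (t, zt t) : U & g (t, zt t) = ka t (vg t))" by(rule Fp_section_near[OF t0 U(1) tU(1) U(3)])
 have u: "vg t0 : Units (B t0)"
  using near_self[OF vg(2) ZD(1)[OF t0]] t0 tU(2) ka_qt[OF t0 T.lsec_carrier[OF vg(1)]] by simp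
 let ?v = "%t. va t *[B t] inv[B t] vg t"
 have "lsec T t0 ?v" by(rule T.lsec_mult[OF va(1) T.lsec_unit_near(2)[OF vg(1) u]])
 moreover have "ev t0 (%t. x (wpt t) = io t (?v t))"
  using va(2) vg(2) T.lsec_unit_near(1)[OF vg(1) u] lsec_near[OF va(1)] Te_open_near[OF V(1) t0 V(2)]
 proof eventually_elim
  case (elim t)
  show ?case
  proof
   assume t: "t : Z"
   interpret l: localized "F t" "carrier (F t) - qt t" by(rule F_loc[OF t])
   interpret b: cring "B t" by(rule T.stalk_cring[OF ZD(1)[OF t]])
   have c: "va t : carrier (B t)" "vg t : carrier (B t)" using T.lsec_carrier[OF elim(4)] b.Units_closed[OF elim(3)] .
   have v: "?v t : carrier (B t)" "?v t *[B t] vg t = va t" using c elim(3) by(simp_all add: b.m_assoc)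
   have "x (wpt t) = ta (wpt t)" using xV elim(5) t by blast
   also have "... = l.fr (ka t (va t)) (ka t (vg t))" unfolding tae Fp_simps using elim(1,2) t by simp
   also have "... = l.fr (ka t (?v t)) 1[F t]"
    using ring_hom_mult[OF ka_hom[OF t] v(1) c(2)] ka_closed[OF t] c v ka_qt[OF t c(2)] elim(3) l.one_S
    by(intro l.fr_eqI) simp_all
   finally show "x (wpt t) = io t (?v t)" unfolding io_eq[OF t] using v(1) by simp
  qed
 qed
 ultimately show thesis by(rule that)
qed

lemma lsec_TeI:
 assumes t0: "t0 : Z" and v: "lsec T t0 v" and x: "ev t0 (%t. x (wpt t) = io t (v t))"
 shows "lsec Te (wpt t0) x"
proof -
 have "evn T t0 (%t. (t : Z --> x (wpt t) = io t (v t)) & lsec T t v)" by(rule eventually_conj[OF x lsec_near[OF v]])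
 then obtain V where V: "opn T V" "t0 : V" "ALL t:V. (t : Z --> x (wpt t) = io t (v t)) & lsec T t v" using ZD(1)[OF t0] by(rule nearE)
 have vs: "restrict v V : sections T V" by(rule T.restrict_sections[OF V(1)]) (use V(3) in blast)
 let ?W = "(%t. (t, zt t)) ` (V Int Z)"
 let ?a = "\<lambda>z\<in>?W. ka (fst z) (restrict v V (fst z))" and ?g = "\<lambda>z\<in>?W. ka (fst z) ((\<lambda>t\<in>V. 1[B t]) (fst z))"
 have xv: "x y = (locfrac Fp ?a ?g) y & x y : carrier Te@@y"
  if y: "y : wpt ` (V Int Z)" for y
 proof -
  obtain t where t: "t : V" "t : Z" "y = wpt t" using y by blast
  have w: "(t, zt t) : ?W" using t by blast
  have vc: "v t : carrier (B t)" using V(3) t(1) T.lsec_carrier by blast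
  have e: "x (wpt t) = io t (v t)" using V(3) t by blast
  show ?thesis unfolding t(3) e case_prod_conv restrict_apply'[OF w] fst_conv restrict_apply'[OF t(1)] io_eq[OF t(2)] ring_hom_one[OF ka_hom[OF t(2)]] Fp_simps
   using vc io_closed[OF t(2) vc] unfolding io_eq[OF t(2)] by simp
 qed
 show ?thesis
 proof (rule lsec_locally_givenI[OF sections_Te Te_open[OF V(1)]])
  show "wpt t0 : wpt ` (V Int Z)" using V(2) t0 by blast
  show "(locfrac Fp ?a ?g) : locfracs Fp Q (wpt ` (V Int Z))"
   by(rule CollectI, rule exI[of _ ?a], rule exI[of _ ?g], rule exI[of _ ?W], intro conjI refl Fp_open[OF V(1)] Fp_section[OF V(1) vs]
    Fp_section[OF V(1) T.sections_one[OF V(1)]] equalityD1[OF basic_open_one[OF V(1)]])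
  show "x y = (locfrac Fp ?a ?g) y" if "y : wpt ` (V Int Z)" for y
   by(rule conjunct1[OF xv[OF that]])
  show "x y : carrier Te@@y" if "y : wpt ` (V Int Z)" for y by(rule conjunct2[OF xv[OF that]])
 qed
qed

lemma Te_sheaf: "sheaf Te (%z. carrier Te@@z)"
proof (rule sheaf_locally_given[OF sections_Te])
 fix V W ta assume WV: "W <= V" and ta: "ta : locfracs Fp Q V"
 from ta obtain a g U where U: "ta = (locfrac Fp a g)"
  "opn Fp U" "a : sections Fp U" "g : sections Fp U" "V <= basic_open Fp Q U g" by blast
 have "ta : locfracs Fp Q W"
  by(rule CollectI, rule exI[of _ a], rule exI[of _ g], rule exI[of _ U], intro conjI U(1-4) subset_trans[OF WV U(5)])
 thus "EX ta':locfracs Fp Q W. ALL y:W. ta' y = ta y"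
  by(rule bexI[rotated]) simp
next
 fix w e assume "w : points Te" and e: "e : carrier Te@@w"
 then obtain t where t: "t : Z" "w = wpt t" unfolding points_Te by blast
 obtain r where r: "r : carrier (B t)" "e = io t r" using io_surj[OF t(1)] e t(2) by blast
 obtain v where v: "lsec T t v" "v t = r" by(rule T.lsec_exists[OF ZD(1)[OF t(1)] r(1)])
 have "lsec Te w (%w. cm q1 w (v (fst (fst w))))" unfolding t(2) by(rule lsec_TeI[OF t(1) v(1)]) simp
 thus "EX s. lsec Te w s & s w = e" using t(2) r(2) v(2) by(intro exI[of _ "%w. cm q1 w (v (fst (fst w)))"]) simp
next
 fix w x y assume x: "lsec Te w x" and y: "lsec Te w y" and e: "x w = y w"
 then obtain t where t: "t : Z" "w = wpt t" using lsec_points[OF x] unfolding points_Te by blast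
 obtain v where v: "lsec T t v" "ev t (%t. x (wpt t) = io t (v t))" by(rule lsec_TeD[OF t(1) x[unfolded t(2)]])
 obtain u where u: "lsec T t u" "ev t (%t. y (wpt t) = io t (u t))" by(rule lsec_TeD[OF t(1) y[unfolded t(2)]])
 have "io t (v t) = io t (u t)"
  using near_self[OF v(2) ZD(1)[OF t(1)]] near_self[OF u(2) ZD(1)[OF t(1)]] t e by simp
 hence "v t = u t" by(rule io_inj[OF t(1) _ T.lsec_carrier[OF v(1)] T.lsec_carrier[OF u(1)]])
 hence "evn T t (%t. v t = u t)" by(rule T.lsec_eq[OF v(1) u(1)])
 hence "ev t (%t. x (wpt t) = y (wpt t))" using v(2) u(2) by eventually_elim simp
 thus "evn Te w (%w. x w = y w)" unfolding t(2) near_Te[OF t(1)] .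
qed

lemma Te_ringed: "ringed Te"
proof (rule ringedI)
 interpret X: sheaf Te "%z. carrier Te@@z" by(rule Te_sheaf)
 have w: "EX t:Z. w = wpt t" if "w : points Te" for w using that unfolding points_Te by blast
 \<comment> \<open>Each ring operation is computed on representing sections of \<open>T\<close> and
   transferred along \<open>io\<close>.\<close>
 have op: "lsec Te w (%w. h w (x w) (y w))"
  if x: "lsec Te w x" "lsec Te w y" and l: "!!t u v. lsec T t u ==> lsec T t v ==> lsec T t (%t. k t (u t) (v t))"
   and hk: "!!t u v. t : Z ==> u : carrier (B t) ==> v : carrier (B t) ==> io t (k t u v) = h (wpt t) (io t u) (io t v)" for w x y h k
 proof -
  obtain t where t: "t : Z" "w = wpt t" using w[OF lsec_points[OF x(1)]] by blast
  obtain u where u: "lsec T t u" "ev t (%t. x (wpt t) = io t (u t))" by(rule lsec_TeD[OF t(1) x(1)[unfolded t(2)]])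
  obtain v where v: "lsec T t v" "ev t (%t. y (wpt t) = io t (v t))" by(rule lsec_TeD[OF t(1) x(2)[unfolded t(2)]])
  have "ev t (%t. h (wpt t) (x (wpt t)) (y (wpt t)) = io t (k t (u t) (v t)))"
   using u(2) v(2) lsec_near[OF u(1)] lsec_near[OF v(1)]
   by eventually_elim (use hk T.lsec_carrier in simp)
  thus ?thesis unfolding t(2) by(rule lsec_TeI[OF t(1) l[OF u(1) v(1)]])
 qed

 show "is_ringed_space Te" unfolding is_ringed_space_def
 proof (intro conjI ballI allI impI X.sheaf)
  show "cring Te@@w" if "w : points Te" for w using w[OF that] Te_cring by blast
  fix U assume U: "opn Te U"
  show "(\<lambda>x\<in>U. 1[Te@@x]) : sections Te U"
  proof (rule X.restrict_sections[OF U])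
   fix x assume "x : U"
   then obtain t where t: "t : Z" "x = wpt t" using w openin_subset[OF U] by blast
   have "ev t (%t. 1[Te@@(wpt t)] = io t 1[B t])" using ring_hom_one[OF io_hom] by(intro always_eventually) simp
   thus "lsec Te x (%x. 1[Te@@x])" unfolding t(2) by(rule lsec_TeI[OF t(1) T.lsec_one[OF ZD(1)[OF t(1)]]])
  qed
  fix x assume x: "x : sections Te U"
  note lx = X.sections_lsec[OF U x]
  show "(\<lambda>z\<in>U. -[Te@@z] x z) : sections Te U"
  proof (rule X.restrict_sections[OF U])
   fix z assume z: "z : U"
   show "lsec Te z (%z. -[Te@@z] x z)"
   proof (rule op[of z x x "%t a b. -[B t] a" "%z a b. -[Te@@z] a", OF lx[OF z] lx[OF z]])
    show "lsec T t (%t. -[B t] u t)" if "lsec T t u" for t u by(rule T.lsec_neg[OF that])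
    show "io t (-[B t] u) = -[Te@@(wpt t)] io t u" if "t : Z" "u : carrier (B t)" for t u
     by(rule ring_hom_cring.hom_a_inv[OF ring_hom_cring.intro[OF T.stalk_cring[OF ZD(1)[OF that(1)]] Te_cring[OF that(1)] ring_hom_cring_axioms.intro[OF io_hom[OF that(1)]]] that(2)])
   qed
  qed
  fix y assume y: "y : sections Te U"
  note ly = X.sections_lsec[OF U y]
  show "(\<lambda>z\<in>U. x z +[Te@@z] y z) : sections Te U"
   by(rule X.restrict_sections[OF U], rule op[of _ x y "%t. ring.add (B t)" "%z. ring.add Te@@z", OF lx ly])
    (assumption, assumption, rule T.lsec_add, assumption, assumption, rule ring_hom_add[OF io_hom])
  show "(\<lambda>z\<in>U. x z *[Te@@z] y z) : sections Te U"
   by(rule X.restrict_sections[OF U], rule op[of _ x y "%t. Group.monoid.mult (B t)" "%z. Group.monoid.mult Te@@z", OF lx ly])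
    (assumption, assumption, rule T.lsec_mult, assumption, assumption, rule ring_hom_mult[OF io_hom])
 qed
qed

lemma q2_lrs: "lrs_hom Te E q2"
proof -
 interpret X: ringed Te by(rule Te_ringed)
 interpret E: ringed E by(rule E_ringed)
 have pt2: "q2$(wpt t) = zt t" if "t : Z" for t unfolding fibre_proj2_def using wpt_Te[OF that] by simp
 have E_im: "EX a:carrier (A f$t). r = cm p (zt t) a" if "t : Z" "r : carrier E@@(zt t)" for t r
  using p_iso[OF ZD(2)[OF that(1)]] that(2) unfolding ring_iso_def bij_betw_def by blast
 have near2: "evn Te (wpt t) (%w. q2$w = zt t)" if "t : Z" for t
  unfolding near_Te[OF that] using near_zt[OF that]
 proof eventually_elim
  case (elim t')
  show ?case
  proof
   assume t': "t' : Z"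
   thus "q2$(wpt t') = zt t" unfolding pt2[OF t'] using elim by blast
  qed
 qed
 have op: "opn Te {w : points Te. q2$w : V}" for V
 proof (rule open_of_near)
  fix w assume w: "w : {w : points Te. q2$w : V}"
  then obtain t where t: "t : Z" "w = wpt t" unfolding points_Te by blast
  have "evn Te w (%y. y : {w : points Te. q2$w : V})"
   using near2[OF t(1), folded t(2)] near_points[of Te w] by eventually_elim (use w t pt2 in simp)
  thus "w : points Te & evn Te w (%y. y : {w : points Te. q2$w : V})" using w by blast
 qed
 show ?thesis unfolding lrs_hom_def
 proof (intro conjI ballI allI impI)
  show "continuous_map (spc Te) (spc E) (pt q2)" unfolding continuous_map_def using op pt2 zt_E by(auto simp: points_Te)
  show "pt q2 : extensional (points Te)" "cm q2 : extensional (points Te)" unfolding fibre_proj2_def by simp_all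
  fix w assume "w : points Te"
  then obtain t where t: "t : Z" "w = wpt t" unfolding points_Te by blast
  note h = p_hom[OF ZD(2)[OF t(1)]] and fh = f_hom[OF ZD(1)[OF t(1)]] and q = q2_cm[OF t(1)]
  interpret a: cring "A f$t" by(rule stalk_cring[OF ZD(3)[OF t(1)]])
  have e: "cm q2 (wpt t) (cm p (zt t) r) = io t (cm f t r)" "cm f t r : carrier (B t)" if "r : carrier (A f$t)" for r
   using q[OF that] f_closed[OF ZD(1)[OF t(1)] that] .
  show "cm q2 w : ring_hom E@@(q2$w) Te@@w" unfolding t(2) pt2[OF t(1)]
  proof (rule ring_hom_memI)
   fix x y assume x: "x : carrier E@@(zt t)" and y: "y : carrier E@@(zt t)"
   obtain a b where ab: "a : carrier (A f$t)" "x = cm p (zt t) a" "b : carrier (A f$t)" "y = cm p (zt t) b"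
    using E_im[OF t(1) x] E_im[OF t(1) y] by blast
   show "cm q2 (wpt t) x : carrier Te@@(wpt t)" unfolding ab(2) e(1)[OF ab(1)] by(rule io_closed[OF t(1) e(2)[OF ab(1)]])
   show "cm q2 (wpt t) (x *[E@@(zt t)] y) = cm q2 (wpt t) x *[Te@@(wpt t)] cm q2 (wpt t) y"
    unfolding ab(2,4) ring_hom_mult[OF h ab(1,3), symmetric] e(1)[OF ab(1)] e(1)[OF ab(3)] e(1)[OF a.m_closed[OF ab(1,3)]]
     ring_hom_mult[OF fh ab(1,3)] by(rule ring_hom_mult[OF io_hom[OF t(1)] e(2)[OF ab(1)] e(2)[OF ab(3)]])
   show "cm q2 (wpt t) (x +[E@@(zt t)] y) = cm q2 (wpt t) x +[Te@@(wpt t)] cm q2 (wpt t) y"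
    unfolding ab(2,4) ring_hom_add[OF h ab(1,3), symmetric] e(1)[OF ab(1)] e(1)[OF ab(3)] e(1)[OF a.a_closed[OF ab(1,3)]]
     ring_hom_add[OF fh ab(1,3)] by(rule ring_hom_add[OF io_hom[OF t(1)] e(2)[OF ab(1)] e(2)[OF ab(3)]])
  next
   show "cm q2 (wpt t) 1[E@@(zt t)] = 1[Te@@(wpt t)]"
    unfolding ring_hom_one[OF h, symmetric] e(1)[OF a.one_closed] ring_hom_one[OF fh] by(rule ring_hom_one[OF io_hom[OF t(1)]])
  qed
  show "cm q2 w : extensional (carrier E@@(q2$w))"
   unfolding t(2) pt2[OF t(1)] unfolding fibre_proj2_def morphism.select_convs restrict_apply'[OF wpt_Te[OF t(1)]] by simp
  show "cm q2 w ` max_ideal E@@(q2$w) <= max_ideal Te@@w"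
  proof
   fix y assume "y : cm q2 w ` max_ideal E@@(q2$w)"
   then obtain x where x: "x : carrier E@@(zt t)" "x ~: Units E@@(zt t)" "y = cm q2 (wpt t) x"
    unfolding t(2) pt2[OF t(1)] local_ring_nonunits(1)[OF E_local[OF ZD(2)[OF t(1)]]] by blast
   obtain a where a: "a : carrier (A f$t)" "x = cm p (zt t) a" using E_im[OF t(1) x(1)] by blast
   have "a ~: Units (A f$t)"
    using x(2) a(2) ring_hom_Units[OF h a.is_cring E_cring[OF ZD(2)[OF t(1)]]] by blast
   hence "cm f t a ~: Units (B t)"
    using lrs_hom_units[OF f ZD(1)[OF t(1)] T_local[OF ZD(1)[OF t(1)]] local[OF ZD(3)[OF t(1)]] a(1)] by blast
   thus "y : max_ideal Te@@w"
    unfolding t(2) local_ring_nonunits(1)[OF Te_local[OF t(1)]] x(3) a(2) e(1)[OF a(1)]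
    using io_Units[OF t(1) e(2)[OF a(1)]] io_closed[OF t(1) e(2)[OF a(1)]] by blast
  qed
 next
  fix V s assume V: "opn E V & s : sections E V"
  show "(\<lambda>w\<in>{w : points Te. q2$w : V}. cm q2 w (s q2$w)) : sections Te {w : points Te. q2$w : V}"
  proof (rule X.restrict_sections[OF op])
   fix w assume w: "w : {w : points Te. q2$w : V}"
   then obtain t where t: "t : Z" "w = wpt t" unfolding points_Te by blast
   have "zt t : V" using w t pt2 by simp
   hence "s (zt t) : carrier E@@(zt t)" by(rule E.lsec_carrier[OF E.sections_lsec[OF conjunct1[OF V] conjunct2[OF V]]])
   then obtain a where a: "a : carrier (A f$t)" "s (zt t) = cm p (zt t) a" using E_im[OF t(1)] by blast
   obtain b where b: "lsec S f$t b" "b f$t = a" using lsec_exists[OF ZD(3)[OF t(1)] a(1)] by blast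
   have "ev t (%t. cm q2 (wpt t) (s q2$(wpt t)) = io t (cm f t (b f$t)))"
    using near_zt[OF t(1)]
   proof eventually_elim
    case (elim t')
    show ?case
    proof
     assume t': "t' : Z"
     hence z: "zt t' = zt t" "f$t' = f$t" using elim by auto
     have a': "a : carrier (A f$t')" using a(1) unfolding z(2) .
     have "s q2$(wpt t') = cm p (zt t') a" unfolding pt2[OF t'] unfolding z(1) by(rule a(2))
     moreover have "b f$t' = a" unfolding z(2) by(rule b(2))
     ultimately show "cm q2 (wpt t') (s q2$(wpt t')) = io t' (cm f t' (b f$t'))" using q2_cm[OF t' a'] by(simp only:)
    qed
   qed
   thus "lsec Te w (%w. cm q2 w (s q2$w))" unfolding t(2)
    by(rule lsec_TeI[OF t(1) lsec_pullback[OF f ZD(1)[OF t(1)] b(1)]])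
  qed
 qed
qed

sublocale X: eta_point S Te q2
 by(intro eta_point.intro eta_point_axioms.intro weak_ass_scheme_axioms Te_ringed q2_lrs)

end

section \<open>Units on the generic fibre and the explicit base change map\<close>

context eta_fibre
begin

lemma q_simps:
 assumes t: "t : Z"
 shows "q1$(wpt t) = t" "q2$(wpt t) = zt t" "pt X.f (wpt t) = f$t"
  and "!!r. r : carrier (A f$t) ==> cm X.f (wpt t) r = io t (cm f t r)"
proof -
 note w = wpt_Te[OF t]
 show "q1$(wpt t) = t" unfolding fibre_proj1_def using w by simp
 show 2: "q2$(wpt t) = zt t" unfolding fibre_proj2_def using w by simp
 have p2: "p$(q2$(wpt t)) = f$t" unfolding 2 by(rule p_pt[OF ZD(2)[OF t]])
 show "pt X.f (wpt t) = f$t" unfolding mor_comp_def morphism.select_convs restrict_apply'[OF w] by(rule p2)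
 fix r assume r: "r : carrier (A f$t)"
 show "cm X.f (wpt t) r = io t (cm f t r)"
  unfolding mor_comp_def morphism.select_convs restrict_apply'[OF w] p2 restrict_apply'[OF r] unfolding 2 by(rule q2_cm[OF t r])
qed

definition eta_family where "eta_family y = (\<lambda>w\<in>points Te. cm q1 w (y (fst (fst w))))"

text \<open>Units of the fibre product, freed from its nested types. Nothing is said about points of
  \<open>T\<close> outside \<open>Z\<close>; extending across them is the surjectivity
  problem.\<close>

definition zsec where "zsec y <-> (ALL t:Z. y t : Units (B t) & (EX v. lsec T t v & ev t (%t'. y t' = v t')))"

lemma eta_family_at: "t : Z ==> eta_family y (wpt t) = io t (y t)"
 unfolding eta_family_def restrict_apply'[OF wpt_Te] by simp

lemma zsecD: assumes "zsec y" "t : Z" shows "y t : Units (B t)" "y t : carrier (B t)" "EX v. lsec T t v & ev t (%t'. y t' = v t')"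
 using assms monoid.Units_closed[OF ring.is_monoid[OF cring.axioms(1)[OF T.stalk_cring[OF ZD(1)[OF assms(2)]]]]] unfolding zsec_def by auto

lemma Gm_TeI: assumes y: "zsec y" shows "eta_family y : carrier (Gm Te)"
 unfolding X.X.Gm_carrier_iff X.X.sections_iff[OF openin_topspace]
proof (intro conjI ballI)
 show "eta_family y : extensional (points Te)" unfolding eta_family_def by simp
 fix w assume "w : points Te"
 then obtain t where t: "t : Z" "w = wpt t" unfolding points_Te by blast
 obtain v where v: "lsec T t v" "ev t (%t'. y t' = v t')" using zsecD(3)[OF y t(1)] by blast
 have "ev t (%t. eta_family y (wpt t) = io t (v t))" using v(2) by eventually_elim (simp add: eta_family_at)
 thus "lsec Te w (eta_family y)" unfolding t(2) by(rule lsec_TeI[OF t(1) v(1)])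
 show "eta_family y w : Units Te@@w" unfolding t(2) eta_family_at[OF t(1)]
  using io_Units[OF t(1) zsecD(2)[OF y t(1)]] zsecD(1)[OF y t(1)] by blast
qed

lemma Gm_TeE:
 assumes x: "x : carrier (Gm Te)"
 obtains y where "zsec y" "x = eta_family y"
proof -
 have xs: "x : extensional (points Te)" "!!w. w : points Te ==> lsec Te w x" "!!w. w : points Te ==> x w : Units Te@@w"
  using x unfolding X.X.Gm_carrier_iff X.X.sections_iff[OF openin_topspace] by auto
 define y where "y t = inv_into (carrier (B t)) (io t) (x (wpt t))" for t
 have xc: "x (wpt t) : carrier Te@@(wpt t)" if "t : Z" for t by(rule X.X.lsec_carrier[OF xs(2)[OF wpt_Te[OF that]]])
 have y: "y t : carrier (B t)" "io t (y t) = x (wpt t)" if tz: "t : Z" for t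
 proof -
  obtain v where "v : carrier (B t)" "x (wpt t) = io t v" by(rule io_surj[OF tz xc[OF tz]])
  hence "x (wpt t) : io t ` carrier (B t)" by blast
  thus "y t : carrier (B t)" "io t (y t) = x (wpt t)" unfolding y_def by(rule inv_into_into, rule f_inv_into_f)
 qed
 have "zsec y" unfolding zsec_def
 proof (intro ballI conjI)
  fix t assume t: "t : Z"
  show "y t : Units (B t)" using io_Units[OF t y(1)[OF t]] y(2)[OF t] xs(3)[OF wpt_Te[OF t]] by simp
  obtain v where v: "lsec T t v" "ev t (%t. x (wpt t) = io t (v t))" by(rule lsec_TeD[OF t xs(2)[OF wpt_Te[OF t]]])
  have "ev t (%t'. y t' = v t')" using v(2) lsec_near[OF v(1)]
  proof eventually_elim
   case (elim t')
   show ?case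
   proof
    assume t': "t' : Z"
    show "y t' = v t'" by(rule io_inj[OF t' _ y(1)[OF t'] T.lsec_carrier[OF elim(2)]]) (use y(2)[OF t'] elim(1) t' in simp)
   qed
  qed
  thus "EX v. lsec T t v & ev t (%t'. y t' = v t')" using v(1) by blast
 qed
 moreover have "x = eta_family y"
 proof (rule extensionalityI[OF xs(1)])
  show "eta_family y : extensional (points Te)" unfolding eta_family_def by simp
  fix w assume "w : points Te"
  then obtain t where t: "t : Z" "w = wpt t" unfolding points_Te by blast
  show "x w = eta_family y w" unfolding t(2) eta_family_at[OF t(1)] y(2)[OF t(1)] ..
 qed
 ultimately show thesis by(rule that)
qed

text \<open>Over a generic point of \<open>S\<close> all divisors vanish; \<open>gval al t\<close> is the element of the local
  ring at \<open>t\<close> to which a section of the pullback of \<open>L\<close> then corresponds.\<close>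

definition gval where "gval al t = (SOME y. y : carrier (B t) & al t = ten t (D1 t) y (M1 t))"

lemma gval_eq:
 assumes t: "t : Z" and ce: "c : RS S f$t" "e : RS S f$t" and v: "v : carrier (B t)"
  and al: "al t = ten t (dcls S f$t c e) v (mfrac S f$t c e)"
 shows "gval al t = v *[B t] cm f t (c *[A f$t] inv[A f$t] e)" "al t = ten t (D1 t) (gval al t) (M1 t)"
  "dcls S f$t c e = D1 t"
proof -
 note k = ten_trivial[OF ZD(1)[OF t] Max_reg[OF ZD(2)[OF t]] ce v]
 interpret a: cring "A f$t" by(rule stalk_cring[OF ZD(3)[OF t]])
 interpret b: cring "B t" by(rule T.stalk_cring[OF ZD(1)[OF t]])
 let ?y = "v *[B t] cm f t (c *[A f$t] inv[A f$t] e)"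
 have u: "e : Units (A f$t)" "c : carrier (A f$t)" using Max_reg[OF ZD(2)[OF t]] ce RS_carrier[OF ZD(3)[OF t]] by auto
 have y: "?y : carrier (B t) & al t = ten t (D1 t) ?y (M1 t)"
  using k(2) v f_closed[OF ZD(1)[OF t]] u unfolding al k(1) by simp
 have g: "gval al t : carrier (B t) & al t = ten t (D1 t) (gval al t) (M1 t)"     unfolding gval_def by(rule someI[of "%y. y : carrier (B t) & al t = ten t (D1 t) y (M1 t)", OF y])
 show "gval al t = ?y"
  by(rule ten_one_inj[OF ZD(1)[OF t] conjunct1[OF g] conjunct1[OF y] trans[OF sym[OF conjunct2[OF g]] conjunct2[OF y]]])
 show "al t = ten t (D1 t) (gval al t) (M1 t)" by(rule conjunct2[OF g])
 show "dcls S f$t c e = D1 t" by(rule k(1))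
qed

lemma gchartD:
 assumes "gchart a al t v c e"
 shows "lsec T t v" "v t : Units (B t)" "regs S f$t c" "regs S f$t e"
  "evn T t (%t. a$t = (f$t, dc S f$t c e) &
   al t = ten t (dc S f$t c e) (v t) (mq S f$t c e))"
 using assms unfolding gchart_def by auto

text \<open>The first form avoids inverses of \<open>e\<close>, which are guaranteed only over
  generic points; triples are compared in this form later.\<close>

lemma gchart_gval:
 assumes t: "t : points T" and g: "gchart a al t v c e"
 shows "ev t (%t. gval al t *[B t] cm f t (e f$t) = v t *[B t] cm f t (c f$t))" 
  and "ev t (%t. gval al t = v t *[B t] cm f t (c f$t *[A f$t] inv[A f$t] e f$t) &
   al t = ten t (D1 t) (gval al t) (M1 t) & a$t = (f$t, D1 t))"
proof -
 note G = gchartD[OF g]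
 show 2: "ev t (%t. gval al t = v t *[B t] cm f t (c f$t *[A f$t] inv[A f$t] e f$t) &
   al t = ten t (D1 t) (gval al t) (M1 t) & a$t = (f$t, D1 t))"
  using G(5) lsec_near[OF G(1)] f_near[OF t regs_near[OF G(3)]] f_near[OF t regs_near[OF G(4)]]
 proof eventually_elim
  case (elim t)
  show ?case
  proof
   assume t: "t : Z"
   note k = gval_eq[of t "c f$t" "e f$t" "v t" al, OF t regs_RS[OF elim(3)] regs_RS[OF elim(4)] T.lsec_carrier[OF elim(2)] conjunct2[OF elim(1)]]
   show "gval al t = v t *[B t] cm f t (c f$t *[A f$t] inv[A f$t] e f$t) &
    al t = ten t (D1 t) (gval al t) (M1 t) & a$t = (f$t, D1 t)"
    using k elim(1) by simp
  qed
 qed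
 show "ev t (%t. gval al t *[B t] cm f t (e f$t) = v t *[B t] cm f t (c f$t))"
  using 2 lsec_near[OF G(1)] f_near[OF t regs_near[OF G(3)]] f_near[OF t regs_near[OF G(4)]]
 proof eventually_elim
  case (elim t)
  show ?case
  proof
   assume t: "t : Z"
   interpret a: cring "A f$t" by(rule stalk_cring[OF ZD(3)[OF t]])
   interpret b: cring "B t" by(rule T.stalk_cring[OF ZD(1)[OF t]])
   have u: "e f$t : Units (A f$t)" using Max_reg[OF ZD(2)[OF t]] regs_RS[OF elim(4)] by blast
   have cc: "c f$t : carrier (A f$t)" by(rule regs_carrier[OF elim(3)])
   have r: "c f$t *[A f$t] inv[A f$t] e f$t : carrier (A f$t)" using u cc by simp
   have "c f$t *[A f$t] inv[A f$t] e f$t *[A f$t] e f$t = c f$t"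
    using u cc a.Units_closed[OF u] by(simp add: a.m_assoc)
   hence "cm f t (c f$t) = cm f t (c f$t *[A f$t] inv[A f$t] e f$t) *[B t] cm f t (e f$t)"
    using ring_hom_mult[OF f_hom[OF ZD(1)[OF t]] r a.Units_closed[OF u]] by simp
   thus "gval al t *[B t] cm f t (e f$t) = v t *[B t] cm f t (c f$t)"
    using elim(1) t f_closed[OF ZD(1)[OF t] r] f_closed[OF ZD(1)[OF t] a.Units_closed[OF u]] T.lsec_carrier[OF elim(2)] by(simp add: b.m_assoc)
  qed
 qed
qed

lemma gval_zsec: assumes aal: "(a, al) : carrier (Gm_lft S T f)" shows "zsec (gval al)"
 unfolding zsec_def
proof (intro ballI conjI)
 fix t assume t: "t : Z"
 note tT = ZD(1)[OF t]
 obtain v c e where g: "gchart a al t v c e" by(rule carrier_chart[OF aal tT])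
 note G = gchartD[OF g]
 interpret a: cring "A f$t" by(rule stalk_cring[OF ZD(3)[OF t]])
 interpret b: cring "B t" by(rule T.stalk_cring[OF tT])
 have u: "e f$t : Units (A f$t)" "c f$t : Units (A f$t)"
  using Max_reg[OF ZD(2)[OF t]] regs_RS[OF G(3)] regs_RS[OF G(4)] by auto
 let ?y = "%t. v t *[B t] cm f t (c f$t *[A f$t] inv[A f$t] e f$t)"
 have e: "ev t (%t. gval al t = ?y t)" using gchart_gval(2)[OF tT g] by eventually_elim simp
 have "lsec T t ?y"
  by(rule T.lsec_mult[OF G(1) lsec_pullback[OF f tT, of "%s. c s *[A s] inv[A s] e s"]])
   (rule lsec_mult[OF regs_lsec[OF G(3)] lsec_unit_near(2)[OF regs_lsec[OF G(4)] u(1)]])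
 thus "EX v. lsec T t v & ev t (%t'. gval al t' = v t')" using e by(intro exI[of _ ?y] conjI)
 have "cm f t (c f$t *[A f$t] inv[A f$t] e f$t) : Units (B t)"
  by(rule ring_hom_Units[OF f_hom[OF tT] a.is_cring b.is_cring]) (use u in simp)
 thus "gval al t : Units (B t)" using near_self[OF e tT] t G(2) by simp
qed

lemma pull_q1:
 assumes aal: "(a, al) : carrier (Gm_lft S T f)"
 shows "Gm_lft_pull S Te q1 (a, al) = Gm_incl S Te X.f (eta_family (gval al))"
proof -
 have a: "a : Pi_points S T f" using aal unfolding Gm_lft_def by simp
 note aD = Pi_pointD[OF a]
 have at: "a$t = (f$t, D1 t)" "al t = ten t (D1 t) (gval al t) (M1 t)" if t: "t : Z" for t
 proof -
  obtain v c e where g: "gchart a al t v c e" by(rule carrier_chart[OF aal ZD(1)[OF t]])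
  show "a$t = (f$t, D1 t)" "al t = ten t (D1 t) (gval al t) (M1 t)" using near_self[OF gchart_gval(2)[OF ZD(1)[OF t] g] ZD(1)[OF t]] t by auto
 qed
 let ?a' = "(|pt = (\<lambda>w\<in>points Te. (pt X.f w, X.G.D1 w)), cm = cm X.f|)"
 have w: "EX t:Z. w = wpt t" if "w : points Te" for w using that unfolding points_Te by blast
 have cf: "cm X.f (wpt t) = (\<lambda>r\<in>carrier (A f$t). io t (cm f t r))" if t: "t : Z" for t
 proof (rule extensionalityI[of _ "carrier (A f$t)"])
  show "cm X.f (wpt t) : extensional (carrier (A f$t))" using lrs_homD(5)[OF X.f_lrs wpt_Te[OF t]] unfolding q_simps(3)[OF t] .
  show "cm X.f (wpt t) r = (\<lambda>r\<in>carrier (A f$t). io t (cm f t r)) r" if "r : carrier (A f$t)" for r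
   unfolding q_simps(4)[OF t that] restrict_apply'[OF that] ..
 qed simp
 have a': "mor_comp Te (Pi_space S) a q1 = ?a'"
 proof (rule morphism.equality)
  show "pt (mor_comp Te (Pi_space S) a q1) = pt ?a'"
   unfolding mor_comp_def[of Te "Pi_space S" a q1] morphism.select_convs
  proof (rule restrict_ext)
   fix w assume "w : points Te"
   then obtain t where t: "t : Z" "w = wpt t" using w by blast
   show "a$(q1$w) = (pt X.f w, X.G.D1 w)" unfolding t(2) q_simps(1,3)[OF t(1)] by(rule at(1)[OF t(1)])
  qed
  show "cm (mor_comp Te (Pi_space S) a q1) = cm ?a'"
  proof (rule extensionalityI[of _ "points Te"])
   fix w assume wT: "w : points Te"
   then obtain t where t: "t : Z" "w = wpt t" using w by blast
   show "cm (mor_comp Te (Pi_space S) a q1) w = cm ?a' w"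
    unfolding mor_comp_def[of Te "Pi_space S" a q1] morphism.select_convs restrict_apply'[OF wT] Pi_space_simps
    unfolding t(2) q_simps(1)[OF t(1)] at(1)[OF t(1)] fst_conv aD(1) cf[OF t(1)] ..
  qed (use lrs_homD(3)[OF X.f_lrs] in \<open>simp_all add: mor_comp_def\<close>)
 qed simp
 have "tensor_map (base_at S ?a' w) (struct_at Te ?a' w) (L_at S ?a' w) (cm q1 w) id (al q1$w)
   = X.G.ten w (X.G.D1 w) (eta_family (gval al) w) (X.G.M1 w)" if wT: "w : points Te" for w
 proof -
  obtain t where t: "t : Z" "w = wpt t" using w[OF wT] by blast
  note tT = ZD(1)[OF t(1)]
  interpret R: rank_one "A f$t" "B t" "cm f t" "L_stalk S (f$t, D1 t)" "M1 t"
   by(rule L_rank1[OF tT one_reg[OF tT] one_reg[OF tT]])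
  interpret R': rank_one "A f$t" "Te@@(wpt t)" "cm X.f (wpt t)" "L_stalk S (f$t, D1 t)" "M1 t"
   using X.G.L_rank1[OF wpt_Te[OF t(1)] X.G.one_reg[OF wpt_Te[OF t(1)]] X.G.one_reg[OF wpt_Te[OF t(1)]]] unfolding q_simps(3)[OF t(1)] .
  have "tensor_map (A f$t) (alg_module (cm X.f (wpt t)) Te@@(wpt t)) (L_stalk S (f$t, D1 t)) (io t) id
    (R.cl (frag_of (gval al t, M1 t))) = R'.cl (frag_of (io t (gval al t), id (M1 t)))"
   by(rule R.tensor_map_pair[OF R'.tensor_pair_axioms, where rh = "%r. r"])
    (simp_all add: zsecD(2)[OF gval_zsec[OF aal] t(1)] R.e_N io_closed[OF t(1)] ring_hom_add[OF io_hom[OF t(1)]] ring_hom_mult[OF io_hom[OF t(1)]] q_simps(4)[OF t(1)])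
  hence "tensor_map (A f$t) (alg_module (cm X.f (wpt t)) Te@@(wpt t)) (L_stalk S (f$t, D1 t)) (io t) id (al t)
   = R'.cl (frag_of (io t (gval al t), M1 t))" using at(2)[OF t(1)] by simp
  thus ?thesis
   unfolding t(2) morphism.select_convs restrict_apply'[OF wpt_Te[OF t(1)]] Pi_space_simps fst_conv q_simps(1,3)[OF t(1)] eta_family_at[OF t(1)] .
 qed
 hence "(\<lambda>w\<in>points Te. tensor_map (base_at S ?a' w) (struct_at Te ?a' w) (L_at S ?a' w) (cm q1 w) id (al q1$w))
  = (\<lambda>w\<in>points Te. X.G.ten w (X.G.D1 w) (eta_family (gval al) w) (X.G.M1 w))" by(rule restrict_ext)
 thus ?thesis unfolding X.G.Gm_incl_ten Gm_lft_pull_def by(simp only: case_prod_conv a' Let_def)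
qed

text \<open>The pulled back point is the inclusion of a unit, so the comparison map leads back into
  the range of the inclusion that \<open>eta_base_change\<close> inverts. From here on the map is a
  matter of families on \<open>Z\<close>.\<close>

lemma eta_base_change_eq:
 assumes aal: "(a, al) : carrier (Gm_lft S T f)"
 shows "eta_base_change S T f (a, al) = eta_family (gval al)"
proof -
 note y = Gm_TeI[OF gval_zsec[OF aal]]
 have "inj_on (Gm_incl E Te q2) (carrier (Gm Te))"
  using X.H.Gm_incl_iso[OF X.H_triv] unfolding iso_def bij_betw_def by blast
 hence "inv_into (carrier (Gm Te)) (Gm_incl E Te q2) (Gm_incl E Te q2 (eta_family (gval al))) = eta_family (gval al)"
  using y by(rule inv_into_f_f)
 moreover have "Gm_lft_compare E p Te q2 (Gm_incl S Te X.f (eta_family (gval al))) = Gm_incl E Te q2 (eta_family (gval al))"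
  by(rule X.compare_incl) (rule X.Gm_carrier_stalk[OF y])
 ultimately show ?thesis unfolding eta_base_change_def Let_def pull_q1[OF aal] by simp
qed

end

section \<open>Flatness\<close>

context tensor_pair
begin

lemma balanced_eq:
 assumes G: "comm_group G" and c: "!!m n. m : carrier M ==> n : carrier N ==> p m n : carrier G"
  and pM: "!!m m' n. m : carrier M ==> m' : carrier M ==> n : carrier N ==> p (m +[M] m') n = p m n *[G] p m' n"
  and pN: "!!m n n'. m : carrier M ==> n : carrier N ==> n' : carrier N ==> p m (n +[N] n') = p m n *[G] p m n'"
  and pA: "!!r m n. r : carrier A ==> m : carrier M ==> n : carrier N ==> p (r .[M] m) n = p m (r .[N] n)"
  and mn: "m : carrier M" "n : carrier N" "m' : carrier M" "n' : carrier N" and e: "cl (frag_of (m, n)) = cl (frag_of (m', n'))"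
 shows "p m n = p m' n'"
proof -
 interpret G: comm_group G by(rule G)
 have "(%(m, n). p m n) ` (carrier M \<times> carrier N) <= carrier G" using c by auto
 then obtain h where h: "h : hom F G" "!!z. z : carrier M \<times> carrier N ==> h (frag_of z) = (%(m, n). p m n) z"
  using comm_group.free_Abelian_group_universal[OF G] by blast
 interpret h: group_hom F G h by(intro group_hom.intro group_hom_axioms.intro F_group h(1) G.is_group)
 have hp: "h (frag_of (m, n)) = p m n" if "m : carrier M" "n : carrier N" for m n using h(2) that by simp
 have "frag_of (m, n) - frag_of (m', n') : K" using e cl_eq_iff by blast
 hence "h (frag_of (m, n) - frag_of (m', n')) = 1[G]"
  by(rule K_balanced[OF G h(1) hp pM pN pA, rotated -1])
 moreover have "frag_of (m, n) - frag_of (m', n') = frag_of (m, n) *[F] inv[F] frag_of (m', n')" using mn by simp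
 ultimately have "p m n *[G] inv[G] p m' n' = 1[G]"
  using h.hom_mult[of "frag_of (m, n)" "inv[F] frag_of (m', n')"] h.hom_inv[of "frag_of (m', n')"] h.G.inv_closed[of "frag_of (m', n')"]
   pair_F[OF mn(1,2)] pair_F[OF mn(3,4)] hp[OF mn(1,2)] hp[OF mn(3,4)] by metis
 thus ?thesis using c mn by(metis G.inv_closed G.inv_equality G.inv_inv)
qed

end

lemma alg_module_module:
 assumes A: "cring A" and B: "cring B" and fi: "fi : ring_hom A B" and I: "ideal I B"
 shows "module A ((alg_module fi B)(|carrier := I|))"
proof -
 interpret A: cring A by(rule A)
 interpret B: cring B by(rule B)
 interpret I: ideal I B by(rule I)
 note Ic = I.Icarr
 have neg: "EX y:I. x +[B] y = 0[B]" if "x : I" for x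
  by(rule bexI[of _ "-[B] x"]) (rule B.r_neg[OF Ic[OF that]], rule I.a_inv_closed[OF that])
 show ?thesis
 proof (rule moduleI[OF A])
  show "abelian_group ((alg_module fi B)(|carrier := I|))"
   by(rule abelian_groupI) (use Ic neg in \<open>auto simp: B.a_ac\<close>)
 qed (use Ic ring_hom_closed[OF fi] I.I_l_closed in \<open>simp_all add: ring_hom_add[OF fi] ring_hom_mult[OF fi] ring_hom_one[OF fi] B.l_distr B.r_distr B.m_assoc\<close>)
qed

lemma module_tensor_pair:
 assumes "module A M" "module A N" shows "tensor_pair A M N"
proof -
 interpret M: module A M by(rule assms)
 interpret N: module A N by(rule assms)
 show ?thesis by unfold_locales simp_all
qed

text \<open>The only way in which exactness is used: for an injective linear map \<open>j\<close>
  into \<open>A\<close>, a tensor \<open>m \<otimes> b\<close> is determined by the element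
  \<open>fi (j m) b\<close> of \<open>B\<close>, because its image in \<open>A \<otimes> B\<close>
  is.\<close>

lemma flat_class_eq:
 fixes A :: "'r ring" and N' :: "('r, 'r) module"
 assumes A: "cring A" and B: "cring B" and fi: "fi : ring_hom A B" and fl: "flat_module A (alg_module fi B)" and N': "module A N'"
  and j: "j : carrier N' \<rightarrow> carrier A" "inj_on j (carrier N')" "!!x y. x : carrier N' ==> y : carrier N' ==> j (x +[N'] y) = j x +[A] j y"
   "!!r x. r : carrier A ==> x : carrier N' ==> j (r .[N'] x) = r *[A] j x"
  and m: "m : carrier N'" "m' : carrier N'" and b: "b : carrier B" "b' : carrier B" and e: "fi (j m) *[B] b = fi (j m') *[B] b'"
 shows "tensor_class A N' (alg_module fi B) (frag_of (m, b)) = tensor_class A N' (alg_module fi B) (frag_of (m', b'))"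
proof -
 interpret A: cring A by(rule A)
 interpret B: cring B by(rule B)
 let ?M = "alg_module fi B" and ?N = "(alg_module (%r. r) A)(|carrier := carrier A|)"
 have M: "module A ?M" using fl unfolding flat_module_def by blast
 have N: "module A ?N" by(rule alg_module_module[OF A A _ A.oneideal]) (simp add: ring_hom_def)
 interpret P': tensor_pair A N' ?M by(rule module_tensor_pair[OF N' M])
 interpret P: tensor_pair A ?N ?M by(rule module_tensor_pair[OF N M])
 have inj: "inj_on (tensor_map A ?N ?M j id) (tensor_carrier A N' ?M)"
  by(rule fl[unfolded flat_module_def, THEN conjunct2, rule_format]) (use N N' j in auto)
 have tm: "tensor_map A ?N ?M j id (P'.cl (frag_of (m, b))) = P.cl (frag_of (1[A], fi (j m) *[B] b))" if m: "m : carrier N'" and b: "b : carrier B" for m b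
 proof -
  have jm: "j m : carrier A" using j(1) m by blast
  have "tensor_map A ?N ?M j id (P'.cl (frag_of (m, b))) = P.cl (frag_of (j m, id b))"
   by(rule P'.tensor_map_pair[OF P.tensor_pair_axioms, where rh = "%r. r"]) (use m b j in auto)
  also have "... = P.cl (frag_of (1[A], fi (j m) *[B] b))"
   using P.cl_eqI[OF P.K_rel_A[of "j m" "1[A]" b]] jm b by simp
  finally show ?thesis .
 qed
 show ?thesis
  by(rule inj_onD[OF inj]) (use m b in \<open>simp_all add: tm e P'.pair_carrier\<close>)
qed

text \<open>The injective map is multiplication by \<open>x\<close> on \<open>A\<close>. It
  identifies \<open>1 \<otimes> y\<close> with \<open>1 \<otimes> 0\<close>, and the balanced
  product map then gives \<open>y = 0\<close>.\<close>

lemma flat_nzd: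
 fixes A :: "'r ring"
 assumes A: "cring A" and B: "cring B" and fi: "fi : ring_hom A B" and fl: "flat_module A (alg_module fi B)" and x: "nzd A x"
 shows "nzd B (fi x)"
proof -
 interpret A: cring A by(rule A)
 interpret B: cring B by(rule B)
 let ?N = "(alg_module (%r. r) A)(|carrier := carrier A|)"
 have N: "module A ?N" by(rule alg_module_module[OF A A _ A.oneideal]) (simp add: ring_hom_def)
 have M: "module A (alg_module fi B)" using fl unfolding flat_module_def by blast
 have xc: "x : carrier A" using x unfolding nonzerodivisor_def by blast
 note h = ring_hom_closed[OF fi]
 show ?thesis unfolding nonzerodivisor_def
 proof (intro conjI h xc ballI impI)
  fix y assume y: "y : carrier B" "fi x *[B] y = 0[B]"
  have e: "tensor_class A ?N (alg_module fi B) (frag_of (1[A], y)) = tensor_class A ?N (alg_module fi B) (frag_of (1[A], 0[B]))"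
  proof (rule flat_class_eq[OF A B fi fl N, of "%y. x *[A] y"])
   show "inj_on (%y. x *[A] y) (carrier ?N)" by(rule inj_onI) (use nzd_cancel[OF A x] in simp)
  qed (use xc y h in \<open>simp_all add: A.r_distr A.m_ac\<close>)
  have "fi 1[A] *[B] y = fi 1[A] *[B] 0[B]"
   by(rule tensor_pair.balanced_eq[OF module_tensor_pair[OF N M] B.a_comm_group, where p = "%m n. fi m *[B] n", rotated -1, OF e])
    (use y h in \<open>simp_all add: ring_hom_add[OF fi] ring_hom_mult[OF fi] B.l_distr B.r_distr B.m_ac\<close>)
  thus "y = 0[B]" using y(1) by(simp add: ring_hom_one[OF fi])
 qed
qed

text \<open>The ideal \<open>(a, b)\<close> has the functional \<open>r a + s b \<mapsto> r\<close> with values in the residue field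
  unless \<open>a \<in> b A\<close>; tensoring it with \<open>B\<close> separates \<open>a \<otimes> 1\<close> from \<open>b \<otimes> u\<close>.\<close>

lemma flat_local_divides:
 fixes A :: "'r ring"
 assumes A: "local_ring A" and B: "local_ring B" and fi: "fi : ring_hom A B" and fl: "flat_module A (alg_module fi B)"
  and loc: "!!r. r : carrier A ==> fi r : Units B ==> r : Units A"
  and ab: "a : carrier A" "b : carrier A" and u: "u : carrier B" and e: "fi a = fi b *[B] u"
 shows "EX c:carrier A. a = b *[A] c"
proof (rule ccontr)
 assume no: "~ ?thesis"
 note Ac = local_ringD(1)[OF A] and Bc = local_ringD(1)[OF B]
 interpret A: cring A by(rule Ac)
 interpret B: cring B by(rule Bc)
 note h = ring_hom_closed[OF fi]
 define J where "J = carrier B - Units B"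
 interpret J: primeideal J B unfolding J_def by(rule local_ringD(3)[OF B])
 let ?Q = "B Quot J"
 have Q: "cring ?Q" by(rule J.quotient_is_cring[OF Bc])
 interpret Q: cring ?Q by(rule Q)
 define I where "I = {r *[A] a +[A] s *[A] b |r s. r : carrier A & s : carrier A}"
 have Isum: "(r *[A] a +[A] s *[A] b) +[A] (r' *[A] a +[A] s' *[A] b) = (r +[A] r') *[A] a +[A] (s +[A] s') *[A] b"
  and Imult: "r' *[A] (r *[A] a +[A] s *[A] b) = (r' *[A] r) *[A] a +[A] (r' *[A] s) *[A] b"
  if "r : carrier A" "s : carrier A" "r' : carrier A" "s' : carrier A" for r s r' s'
  using that ab by(simp_all add: A.l_distr A.r_distr A.m_assoc A.a_ac)
 have "PIdl\<^bsub>A\<^esub> a <+>\<^bsub>A\<^esub> PIdl\<^bsub>A\<^esub> b = I" unfolding I_def cgenideal_def set_add_def' by blast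
 hence I: "ideal I A" using A.add_ideals[OF A.cgenideal_ideal[OF ab(1)] A.cgenideal_ideal[OF ab(2)]] by simp
 let ?N = "(alg_module (%r. r) A)(|carrier := I|)"
 have N: "module A ?N" by(rule alg_module_module[OF Ac Ac _ I]) (simp add: ring_hom_def)
 have M: "module A (alg_module fi B)" using fl unfolding flat_module_def by blast
 \<comment> \<open>If two representations of an element of the ideal had first coefficients
   differing by a unit, \<open>a\<close> could be solved for as a multiple of \<open>b\<close>. So
   the first coefficient is well defined modulo the maximal ideal of \<open>B\<close>.\<close>
 have nu: "fi (r -[A] r') : J" if r: "r : carrier A" "s : carrier A" "r' : carrier A" "s' : carrier A"
  and e: "r *[A] a +[A] s *[A] b = r' *[A] a +[A] s' *[A] b" for r s r' s'
 proof (rule ccontr)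
  assume "fi (r -[A] r') ~: J"
  hence du: "r -[A] r' : Units A" using loc[of "r -[A] r'"] h[of "r -[A] r'"] r unfolding J_def by simp
  let ?d = "r -[A] r'"
  have "?d *[A] a = (r *[A] a +[A] s *[A] b) -[A] s *[A] b -[A] r' *[A] a"
   using r(1-3) ab by algebra
  also have "... = (s' -[A] s) *[A] b" unfolding e using r ab by algebra
  finally have d: "?d *[A] a = (s' -[A] s) *[A] b" .
  have "a = inv[A] ?d *[A] (?d *[A] a)" using du ab(1) A.Units_closed[OF du] by(simp add: A.m_assoc[symmetric])
  also have "... = b *[A] (inv[A] ?d *[A] (s' -[A] s))" unfolding d using du r ab by(simp add: A.m_ac)
  finally show False using no du r by blast
 qed
 \<comment> \<open>An arbitrary choice of first coefficient; only its image in the residue field of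
   \<open>B\<close> is used.\<close>
 define c where "c m = (SOME r. r : carrier A & (EX s:carrier A. m = r *[A] a +[A] s *[A] b))" for m
 have c: "c m : carrier A & (EX s:carrier A. m = c m *[A] a +[A] s *[A] b)" if "m : I" for m
  unfolding c_def by(rule someI_ex) (use that in \<open>auto simp: I_def\<close>)
 have coset: "J +>\<^bsub>B\<^esub> (fi (c m) *[B] n) = J +>\<^bsub>B\<^esub> (fi r *[B] n)"
  if m: "m = r *[A] a +[A] s *[A] b" and r: "r : carrier A" "s : carrier A" and n: "n : carrier B" for m r s n
 proof -
  have mI: "m : I" unfolding I_def m using r by blast
  obtain s' where s': "s' : carrier A" "m = c m *[A] a +[A] s' *[A] b" "c m : carrier A" using c[OF mI] by blast
  have "fi (c m -[A] r) : J" by(rule nu[OF s'(3,1) r]) (use s'(2) m in simp)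
  hence "fi (c m -[A] r) *[B] n : J" using n by(rule J.I_r_closed)
  moreover have "fi (c m) = fi (c m -[A] r) +[B] fi r"
   using ring_hom_add[OF fi, of "c m -[A] r" r] s'(3) r(1) by(simp add: a_minus_def A.a_assoc A.l_neg)
  ultimately have "fi (c m) *[B] n -[B] fi r *[B] n : J"
   using n h s'(3) r(1) by(simp add: B.l_distr a_minus_def B.a_assoc B.r_neg)
  thus ?thesis using B.quotient_eq_iff_same_a_r_cos[OF J.ideal_axioms] n h s'(3) r(1) by simp
 qed
 have add: "(J +>\<^bsub>B\<^esub> x) +[?Q] (J +>\<^bsub>B\<^esub> y) = J +>\<^bsub>B\<^esub> (x +[B] y)" if "x : carrier B" "y : carrier B" for x y
  using J.a_rcos_sum[OF that] unfolding FactRing_def by simp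
 \<comment> \<open>Both tensors map to the same element of \<open>B\<close>, so flatness makes them
   equal already over the ideal.\<close>
 have cl: "tensor_class A ?N (alg_module fi B) (frag_of (a, 1[B])) = tensor_class A ?N (alg_module fi B) (frag_of (b, u))"
 proof (rule flat_class_eq[OF Ac Bc fi fl N, of "%x. x"])
  have "a = 1[A] *[A] a +[A] 0[A] *[A] b" "b = 0[A] *[A] a +[A] 1[A] *[A] b" using ab by simp_all
  thus "a : carrier ?N" "b : carrier ?N" unfolding I_def by auto
 qed (use ideal.Icarr[OF I] u e h ab in auto)
 let ?p = "%m n. J +>\<^bsub>B\<^esub> (fi (c m) *[B] n)"
 have aI: "a = 1[A] *[A] a +[A] 0[A] *[A] b" and bI: "b = 0[A] *[A] a +[A] 1[A] *[A] b" using ab by simp_all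
 have abI: "a : I" "b : I" unfolding I_def using aI bI A.one_closed A.zero_closed by blast+
 have "?p a 1[B] = ?p b u"
 proof (rule tensor_pair.balanced_eq[OF module_tensor_pair[OF N M] Q.a_comm_group, where p = ?p, rotated -1, OF cl])
  show "?p m n : carrier (add_monoid ?Q)" if "m : carrier ?N" "n : carrier (alg_module fi B)" for m n
   using that c[of m] h unfolding FactRing_def A_RCOSETS_def' by auto
  show "?p m (n +[alg_module fi B] n') = ?p m n *[add_monoid ?Q] ?p m n'"
   if "m : carrier ?N" "n : carrier (alg_module fi B)" "n' : carrier (alg_module fi B)" for m n n'
   using that c[of m] h add by(simp add: B.r_distr)
  show "?p (m +[?N] m') n = ?p m n *[add_monoid ?Q] ?p m' n"
   if m: "m : carrier ?N" "m' : carrier ?N" "n : carrier (alg_module fi B)" for m m' n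
  proof -
   obtain s s' where s: "s : carrier A" "m = c m *[A] a +[A] s *[A] b" "c m : carrier A"
    and s': "s' : carrier A" "m' = c m' *[A] a +[A] s' *[A] b" "c m' : carrier A" using c[of m] c[of m'] m by auto
   have "m +[A] m' = (c m +[A] c m') *[A] a +[A] (s +[A] s') *[A] b" using Isum[OF s(3,1) s'(3,1)] s(2) s'(2) by simp
   hence "?p (m +[A] m') n = J +>\<^bsub>B\<^esub> (fi (c m +[A] c m') *[B] n)" by(rule coset) (use s s' m in simp_all)
   thus ?thesis using add[of "fi (c m) *[B] n" "fi (c m') *[B] n"] s(3) s'(3) h m by(simp add: ring_hom_add[OF fi] B.l_distr)
  qed
  show "?p (r .[?N] m) n = ?p m (r .[alg_module fi B] n)"
   if r: "r : carrier A" "m : carrier ?N" "n : carrier (alg_module fi B)" for r m n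
  proof -
   obtain s where s: "s : carrier A" "m = c m *[A] a +[A] s *[A] b" "c m : carrier A" using c[of m] r by auto
   have "r *[A] m = (r *[A] c m) *[A] a +[A] (r *[A] s) *[A] b" using Imult[OF s(3,1) r(1) r(1)] s(2) by simp
   hence "?p (r *[A] m) n = J +>\<^bsub>B\<^esub> (fi (r *[A] c m) *[B] n)" by(rule coset) (use s r in simp_all)
   thus ?thesis using s(3) h r by(simp add: ring_hom_mult[OF fi] B.m_ac)
  qed
 qed (use abI u in simp_all)
 moreover have "?p a 1[B] = J +>\<^bsub>B\<^esub> (fi 1[A] *[B] 1[B])" by(rule coset[OF aI]) simp_all
 moreover have "?p b u = J +>\<^bsub>B\<^esub> (fi 0[A] *[B] u)" by(rule coset[OF bI]) (use u in simp_all)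
 ultimately have "J +>\<^bsub>B\<^esub> 1[B] = J +>\<^bsub>B\<^esub> 0[B]"
  using u by(simp add: ring_hom_one[OF fi] ring_hom_zero'[OF fi Ac Bc])
 hence "1[B] : J" using B.quotient_eq_iff_same_a_r_cos[OF J.ideal_axioms, of "1[B]" "0[B]"] by(simp add: a_minus_def)
 thus False unfolding J_def by simp
qed

section \<open>Flat and convex base change\<close>

locale eta_convex = eta_fibre S T f for S :: "('a, 'r) ringed_space" and T :: "('b, 'k) ringed_space" and f +
 assumes flat: "flat_morphism T S f" and convex: "convex_morphism T S f"
begin

abbreviation fs where "fs c t == cm f t (c f$t)"

lemma fs_reg: assumes t: "t : points T" and c: "nzd (A f$t) r" shows "nzd (B t) (cm f t r)"
 using flat t unfolding flat_morphism_def
 by(intro flat_nzd[OF stalk_cring[OF f_points[OF t]] T.stalk_cring[OF t] f_hom[OF t] _ c]) blast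

lemma fs_regs: assumes t: "t : points T" and c: "regs S f$t c" shows "regs T t (fs c)"
 unfolding regs_def
proof (intro conjI lsec_pullback[OF f t regs_lsec[OF c]])
 show "evn T t (%t. nzd (B t) (fs c t))"
  using near_points[of T t] f_near[OF t regs_near[OF c]] by eventually_elim (rule fs_reg[OF _ regs_nzd])
qed

text \<open>Near any point of \<open>T\<close>, the set \<open>Z\<close> is cut out by the
  invertibility of a multiplicative set \<open>Sg\<close>, each member of which is near
  \<open>t0\<close> a unit times the pullback of a regular section of \<open>S\<close>. It supplies
  the denominators for density as well as for extension.\<close>

lemma Z_chart:
 assumes t0: "t0 : points T"
 obtains V and R :: "('b => 'k) ring" and rh Sg where "t0 : V" "affine_chart T R V rh" "mult_subset R Sg"
  "ALL y:V. (ALL w:Sg. rh y w : Units (B y)) --> y : Z" "ev t0 (%y. y : V & (ALL w:Sg. rh y w : Units (B y)))"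
  "ALL w:Sg. EX a ga. regs S f$t0 a & lsec T t0 ga & ga t0 : Units (B t0) & evn T t0 (%y. rh y w = ga y *[B y] fs a y)"
proof -
 note s0 = f_points[OF t0]
 obtain V and R :: "('b => 'k) ring" and rh where C: "t0 : V" "affine_chart T R V rh" using scheme_affine_chart[OF T_scheme t0] by blast
 obtain V' and R' :: "('a => 'r) ring" and rh' where D: "f$t0 : V'" "affine_chart S R' V' rh'" using chart[OF s0] by blast
 interpret C: affine_chart T R V rh by(rule C(2))
 interpret D: affine_chart S R' V' rh' by(rule D(2))
 obtain W where W: "opn S W" "f$t0 : W" "W <= V'" "finite (W Int Max_points S)" "ALL z:W. True"
  using lf eventually_True D(1) by(rule D.locally_finite_Max)
 define N where "N = W Int Max_points S"
 obtain g where g: "g : carrier R" "rh t0 g : Units (B t0)" "!!y. y : V ==> rh y g : Units (B y) ==> f$y : W"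
  by(rule C.basisE[OF f_near[OF t0 near_open[OF W(1,2)]] C(1)]) blast
 define Ug where "Ug = {a : carrier R'. ALL i:N. rh' i a : Units (A i)}"
 let ?fa = "%a. fs (%s. rh' s a)"
 \<comment> \<open>Pullbacks of elements of \<open>Ug\<close> live only on the basic open set of
   \<open>g\<close>, which is mapped into \<open>W\<close>; a power of \<open>g\<close> turns them
   into germs of elements of \<open>R\<close>.\<close>
 define Sg where "Sg = {b : carrier R. EX a:Ug. EX k::nat. ALL y:V. rh y g : Units (B y) --> rh y b = rh y g ^[B y] k *[B y] ?fa a y}"
 have SgI: "b : Sg" if "b : carrier R" "a : Ug" "!!y. y : V ==> rh y g : Units (B y) ==> rh y b = rh y g ^[B y] k *[B y] ?fa a y" for a b and k :: nat
  unfolding Sg_def using that by auto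
 have NV: "i : V'" if "i : N" for i using that W(3) unfolding N_def by blast
 have UgR: "a : carrier R'" if "a : Ug" for a using that unfolding Ug_def by simp
 have fy: "f$y : V'" "y : points T" if "y : V" "rh y g : Units (B y)" for y using g(3)[OF that] W(3) C.V_points[OF that(1)] by auto
 have fac: "?fa a y : carrier (B y)" if "a : carrier R'" "y : V" "rh y g : Units (B y)" for a y
  by(rule f_closed[OF fy(2)[OF that(2,3)] D.rh_closed[OF fy(1)[OF that(2,3)] that(1)]])
 have one_Ug: "1[R'] : Ug" unfolding Ug_def using NV D.rh_one D.stalk_V by(auto simp: cring.cring_simprules(6) monoid.Units_one_closed[OF ring.is_monoid[OF cring.axioms(1)]])
 have fa_one: "?fa 1[R'] y = 1[B y]" if "y : V" "rh y g : Units (B y)" for y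
  using D.rh_one[OF fy(1)[OF that]] ring_hom_one[OF f_hom[OF fy(2)[OF that]]] by simp
 have mult: "mult_subset R Sg" unfolding mult_subset_def
 proof (intro conjI ballI)
  show "Sg <= carrier R" unfolding Sg_def by blast
  show "1[R] : Sg"
  proof (rule SgI[OF C.R.one_closed one_Ug, of 0])
   fix y assume y: "y : V" "rh y g : Units (B y)"
   interpret b: cring "B y" by(rule C.stalk_V[OF y(1)])
   show "rh y 1[R] = rh y g ^[B y] (0::nat) *[B y] ?fa 1[R'] y" using C.rh_one[OF y(1)] fa_one[OF y] by simp
  qed
  fix b b' assume "b : Sg" "b' : Sg"
  then obtain a k a' k' where b: "b : carrier R" "a : Ug" "ALL y:V. rh y g : Units (B y) --> rh y b = rh y g ^[B y] (k::nat) *[B y] ?fa a y"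
   and b': "b' : carrier R" "a' : Ug" "ALL y:V. rh y g : Units (B y) --> rh y b' = rh y g ^[B y] (k'::nat) *[B y] ?fa a' y"
   unfolding Sg_def by blast
  show "b *[R] b' : Sg"
  proof (rule SgI[of _ "a *[R'] a'" "k + k'"])
   show "a *[R'] a' : Ug" unfolding Ug_def using UgR[OF b(2)] UgR[OF b'(2)] b(2) b'(2) D.unit_mult_iff[OF NV] unfolding Ug_def by simp
   fix y assume y: "y : V" "rh y g : Units (B y)"
   interpret b: cring "B y" by(rule C.stalk_V[OF y(1)])
   have m: "?fa (a *[R'] a') y = ?fa a y *[B y] ?fa a' y"
    using D.rh_mult[OF fy(1)[OF y] UgR[OF b(2)] UgR[OF b'(2)]]
     ring_hom_mult[OF f_hom[OF fy(2)[OF y]] D.rh_closed[OF fy(1)[OF y] UgR[OF b(2)]] D.rh_closed[OF fy(1)[OF y] UgR[OF b'(2)]]] by simp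
   show "rh y (b *[R] b') = rh y g ^[B y] (k + k') *[B y] ?fa (a *[R'] a') y"
    unfolding m C.rh_mult[OF y(1) b(1) b'(1)] using b(3) b'(3) y g(1) fac[OF UgR[OF b(2)] y] fac[OF UgR[OF b'(2)] y]
    by(simp add: b.nat_pow_mult[symmetric] b.m_ac)
  qed (use b b' in simp)
 qed
 have Z1: "y : Z" if y: "y : V" and u: "ALL w:Sg. rh y w : Units (B y)" for y
 proof -
  have "g : Sg"
  proof (rule SgI[OF g(1) one_Ug, of 1])
   fix y assume y: "y : V" "rh y g : Units (B y)"
   interpret b: cring "B y" by(rule C.stalk_V[OF y(1)])
   show "rh y g = rh y g ^[B y] (1::nat) *[B y] ?fa 1[R'] y" using C.rh_closed[OF y(1) g(1)] fa_one[OF y] by simp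
  qed
  hence gu: "rh y g : Units (B y)" using u by blast
  note yT = fy(2)[OF y gu] and yV' = fy(1)[OF y gu]
  have "f$y : N"
  proof (rule D.in_Max_points_of_units[OF _ _ yV'])
   show "finite N" "N <= V' Int Max_points S" using W(3,4) unfolding N_def by auto
   fix a assume a: "a : carrier R'" "!!i. i : N ==> rh' i a : Units (A i)"
   hence aU: "a : Ug" unfolding Ug_def by blast
   have one: "mult_subset R {1[R]}" unfolding mult_subset_def by simp
   note G = C.R.denoms_mult_subset[OF one g(1)]
   define Y where "Y = {z : V. ALL w:C.R.denoms {1[R]} g. rh z w : Units (B z)}"
   have Y: "z : Y <-> z : V & rh z g : Units (B z)" for z
    unfolding Y_def using C.denoms_unit_iff[OF one g(1), of z] C.rh_one[of z] monoid.Units_one_closed[OF ring.is_monoid[OF cring.axioms(1)[OF C.stalk_V[of z]]]] by auto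
   have "EX ta. lsec T z ta & evn T z (%z'. z' : Y --> ?fa a z' = ta z')"
    if z: "z : Y" for z
   proof -
    have z': "z : V" "rh z g : Units (B z)" using z Y by auto
    have "lsec T z (?fa a)" by(rule lsec_pullback[OF f fy(2)[OF z'] D.rh_lsec[OF a(1) fy(1)[OF z']]])
    thus ?thesis by(intro exI[of _ "?fa a"] conjI) simp_all
   qed
   \<comment> \<open>The pullback of \<open>a\<close> is a section over the basic open set of
     \<open>g\<close>, hence a fraction whose denominator is a power of \<open>g\<close> and whose
     numerator belongs to \<open>Sg\<close>. So at a point where \<open>Sg\<close> is invertible all
     of \<open>Ug\<close> is, which places \<open>f$y\<close> among the generic points
     \<open>N\<close>.\<close>
   then obtain b w where bw: "b : carrier R" "w : C.R.denoms {1[R]} g" "ALL z:Y. rh z w *[B z] ?fa a z = rh z b"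
    by(rule C.section_is_fraction[OF G Y_def]) blast+
   obtain k :: nat where k: "w = g ^[R] k" using bw(2) g(1) unfolding C.R.denoms_def by auto
   have e: "rh z b = rh z g ^[B z] k *[B z] ?fa a z" if "z : V" "rh z g : Units (B z)" for z
    using bspec[OF bw(3), of z] Y that C.rh_pow[OF that(1) g(1)] k by simp
   hence "b : Sg" by(rule SgI[OF bw(1) aU])
   hence bu: "rh y b : Units (B y)" using u by blast
   interpret b: cring "B y" by(rule C.stalk_V[OF y])
   have "?fa a y : Units (B y)"
    by(rule b.unit_of_unit_mult[OF _ fac[OF a(1) y gu]]) (use bu e[OF y gu] C.unit_pow[OF y g(1) gu] C.rh_pow[OF y g(1)] in auto)
   thus "rh' f$y a : Units (A f$y)"
    using lrs_hom_units[OF f yT T_local[OF yT] local[OF f_points[OF yT]] D.rh_closed[OF yV' a(1)]] by blast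
  qed
  thus "y : Z" using yT unfolding N_def Z_def by blast
 qed
 have near_g: "evn T t0 (%y. y : V & rh y g : Units (B y))"
  by(rule eventually_conj[OF C.near_V[OF C(1)] C.unit_near[OF C(1) g(1,2)]])
 have Z2: "ev t0 (%y. y : V & (ALL w:Sg. rh y w : Units (B y)))"
  using near_g
 proof eventually_elim
  case (elim y)
  hence y: "y : V" "rh y g : Units (B y)" by auto
  interpret b: cring "B y" by(rule C.stalk_V[OF y(1)])
  show ?case
  proof (intro impI conjI ballI y)
   fix w assume yZ: "y : Z" and "w : Sg"
   then obtain a and k :: nat where a: "a : Ug" "rh y w = rh y g ^[B y] k *[B y] ?fa a y" using y unfolding Sg_def by blast
   have "f$y : N" using g(3)[OF y] ZD(2)[OF yZ] unfolding N_def by blast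
   hence "rh' f$y a : Units (A f$y)" using a(1) unfolding Ug_def by blast
   hence "?fa a y : Units (B y)" by(rule ring_hom_Units[OF f_hom[OF fy(2)[OF y]] D.stalk_V[OF fy(1)[OF y]] b.is_cring])
   thus "rh y w : Units (B y)" unfolding a(2) using C.unit_pow[OF y(1) g(1) y(2), of k] C.rh_pow[OF y(1) g(1)] by simp
  qed
 qed
 have Z3: "EX a ga. regs S f$t0 a & lsec T t0 ga & ga t0 : Units (B t0) & evn T t0 (%y. rh y w = ga y *[B y] fs a y)"
  if w: "w : Sg" for w
 proof -
  obtain a and k :: nat where a: "a : Ug" "ALL y:V. rh y g : Units (B y) --> rh y w = rh y g ^[B y] k *[B y] ?fa a y"
   using w unfolding Sg_def by blast
  have "evn S f$t0 (%s. s : Max_points S --> rh' s a : Units (A s))"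
   using near_open[OF W(1,2)] by eventually_elim (use a(1) in \<open>auto simp: Ug_def N_def\<close>)
  hence "regs S f$t0 (%s. rh' s a)" by(rule D.regs_criterion[OF WA D(1) D.rh_lsec[OF UgR[OF a(1)] D(1)]])
  moreover have "lsec T t0 (%y. rh y g ^[B y] k)" by(rule T.lsec_pow[OF C.rh_lsec[OF g(1) C(1)]])
  moreover have "rh t0 g ^[B t0] k : Units (B t0)" using C.unit_pow[OF C(1) g(1,2)] C.rh_pow[OF C(1) g(1)] by simp
  moreover have "evn T t0 (%y. rh y w = rh y g ^[B y] k *[B y] ?fa a y)"
   using near_g by eventually_elim (use a(2) in blast)
  ultimately show ?thesis by(intro exI conjI)
 qed
 show thesis using that[OF C mult _ Z2] Z1 Z3 by blast
qed

lemma Z_chart_regs: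
 assumes t0: "t0 : points T" and a: "regs S f$t0 a" "lsec T t0 ga" "ga t0 : Units (B t0)" "evn T t0 (%y. w y = ga y *[B y] fs a y)"
 shows "regs T t0 w"
 by(rule T.regs_cong[OF T.regs_mult[OF T.regs_unit[OF a(2,3)] fs_regs[OF t0 a(1)]]]) (rule eventually_mono[OF a(4)], simp)

text \<open>Write \<open>x = a/b\<close>. On the locus of \<open>Sg\<close> in a basic neighbourhood
  given by \<open>h\<close> the numerator \<open>a\<close> vanishes, so \<open>w h^n a = 0\<close>
  with \<open>w\<close> in \<open>Sg\<close>. At \<open>t0\<close> the factor \<open>h\<close> is a
  unit and \<open>w\<close> a nonzerodivisor, being a unit times the pullback of a regular
  section.\<close>

lemma dense_zero:
 assumes t0: "t0 : points T" and x: "lsec T t0 x" and van: "ev t0 (%t. x t = 0[B t])"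
 shows "x t0 = 0[B t0]"
proof -
 obtain V and R :: "('b => 'k) ring" and rh Sg where C: "t0 : V" "affine_chart T R V rh" "mult_subset R Sg"
  "ALL y:V. (ALL w:Sg. rh y w : Units (B y)) --> y : Z" "ev t0 (%y. y : V & (ALL w:Sg. rh y w : Units (B y)))"
  "ALL w:Sg. EX a ga. regs S f$t0 a & lsec T t0 ga & ga t0 : Units (B t0) & evn T t0 (%y. rh y w = ga y *[B y] fs a y)"
  by(rule Z_chart[OF t0])
 interpret C: affine_chart T R V rh by(rule C(2))
 interpret b0: cring "B t0" by(rule T.stalk_cring[OF t0])
 obtain a b where ab: "a : carrier R" "b : carrier R" "rh t0 b : Units (B t0)"
  "!!y. y : V ==> rh y b : Units (B y) ==> rh y b *[B y] x y = rh y a" by(rule C.lsec_frac[OF x C(1)]) blast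
 have "evn T t0 (%y. rh y b : Units (B y) & (y : Z --> x y = 0[B y]))" by(rule eventually_conj[OF C.unit_near[OF C(1) ab(2,3)] van])
 then obtain h where h: "h : carrier R" "rh t0 h : Units (B t0)"
  "!!y. y : V ==> rh y h : Units (B y) ==> rh y b : Units (B y) & (y : Z --> x y = 0[B y])" using C(1) by(rule C.basisE) blast
 obtain w and n :: nat where w: "w : Sg" "w *[R] h ^[R] n *[R] a = 0[R]"
 proof (rule C.killed_of_vanishing[OF C(3) ab(1) h(1)])
  fix y assume y: "y : V" "!!w. w : Sg ==> rh y w : Units (B y)" "rh y h : Units (B y)"
  interpret b: cring "B y" by(rule C.stalk_V[OF y(1)])
  have "x y = 0[B y]" using C(4) y h(3)[OF y(1,3)] by blast
  thus "rh y a = 0[B y]" using ab(4)[OF y(1)] h(3)[OF y(1,3)] b.Units_closed by force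
 qed
 obtain a' ga where a': "regs S f$t0 a'" "lsec T t0 ga" "ga t0 : Units (B t0)" "evn T t0 (%y. rh y w = ga y *[B y] fs a' y)"
  using C(6) w(1) by blast
 have nz: "nzd (B t0) (rh t0 w)" by(rule T.regs_nzd[OF Z_chart_regs[OF t0 a']])
 have wR: "w : carrier R" by(rule mult_subsetD(4)[OF C(3) w(1)])
 note xc = T.lsec_carrier[OF x]
 have bc: "rh t0 b : carrier (B t0)" by(rule b0.Units_closed[OF ab(3)])
 have hn: "rh t0 (h ^[R] n) *[B t0] rh t0 b : Units (B t0)" using C.unit_pow[OF C(1) h(1,2)] ab(3) by simp
 have "rh t0 w *[B t0] (rh t0 (h ^[R] n) *[B t0] rh t0 b *[B t0] x t0) = rh t0 (w *[R] h ^[R] n *[R] a)"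
  using C.rh_mult[OF C(1)] wR h(1) ab(1) ab(4)[OF C(1) ab(3)] xc bc C.rh_closed[OF C(1)] by(simp add: b0.m_assoc)
 hence "rh t0 (h ^[R] n) *[B t0] rh t0 b *[B t0] x t0 = 0[B t0]"
  using nz xc b0.Units_closed[OF hn] unfolding w(2) C.rh_zero[OF C(1)] nonzerodivisor_def by simp
 thus ?thesis using nzd_unit[OF b0.is_cring hn] xc unfolding nonzerodivisor_def by blast
qed

lemma dense_eq:
 assumes t0: "t0 : points T" and x: "lsec T t0 x" "lsec T t0 y" and e: "ev t0 (%t. x t = y t)"
 shows "x t0 = y t0"
proof -
 interpret b0: cring "B t0" by(rule T.stalk_cring[OF t0])
 have "x t0 +[B t0] (-[B t0] y t0) = 0[B t0]"
 proof (rule dense_zero[OF t0 T.lsec_add[OF x(1) T.lsec_neg[OF x(2)]]])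
  show "ev t0 (%t. x t +[B t] (-[B t] y t) = 0[B t])" using e lsec_near[OF x(2)]
  proof eventually_elim
   case (elim t)
   interpret b: abelian_group "B t" using T.stalk_cring[OF lsec_points[OF elim(2)]] by(rule cring.axioms(1)[THEN ring.is_abelian_group])
   show ?case using elim(1) b.r_neg[OF T.lsec_carrier[OF elim(2)]] by simp
  qed
 qed
 thus ?thesis using T.lsec_carrier[OF x(1)] T.lsec_carrier[OF x(2)] by(metis b0.a_comm b0.add.inv_closed b0.minus_equality b0.minus_minus)
qed

end

text \<open>The product of two charts is a chart for the product. This makes the formula for the
  base change map applicable to products.\<close>

lemma (in gm) Gm_lft_mult_closed:
 assumes "(a, al) : carrier (Gm_lft S T f)" "(b, be) : carrier (Gm_lft S T f)"
 shows "(a, al) *[Gm_lft S T f] (b, be) : carrier (Gm_lft S T f)"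
proof -
 let ?A = "\<lambda>t\<in>points T. (f$t, snd a$t *[div_stalk S f$t] snd b$t)"
 let ?c = "(|pt = ?A, cm = cm f|)"
 let ?ga = "\<lambda>t\<in>points T. tensor_mult (base_at S ?c t) (struct_at T ?c t) (L_at S ?c t) (al t) (be t)"
 have "(?c, ?ga) : carrier (Gm_lft S T f)"
 proof (rule chart_carrier)
  fix t assume t: "t : points T"
  obtain v c e where g: "gchart a al t v c e" by(rule carrier_chart[OF assms(1) t])
  obtain v' c' e' where g': "gchart b be t v' c' e'" by(rule carrier_chart[OF assms(2) t])
  note G = g[unfolded gchart_def] g'[unfolded gchart_def]
  let ?v = "%t. v t *[T@@t] v' t" and ?p = "%s. c s *[S@@s] c' s" and ?q = "%s. e s *[S@@s] e' s"
  have r: "regs S f$t c" "regs S f$t e" "regs S f$t c'" "regs S f$t e'" "lsec T t v" "lsec T t v'" using G by auto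
  have "gchart ?c ?ga t ?v ?p ?q" unfolding gchart_def
  proof (intro conjI T.lsec_mult S.regs_mult r)
   interpret cring "T@@t" by(rule T.stalk_cring[OF t])
   show "?v t : Units T@@t" using G by simp
   show "evn T t (%t. ?c$t = (f$t, dc S f$t ?p ?q) &
    ?ga t = ten t (dc S f$t ?p ?q) (?v t) (mq S f$t ?p ?q))"
    using G[THEN conjunct2, THEN conjunct2, THEN conjunct2, THEN conjunct2] near_points[of T t] lsec_near[OF r(5)] lsec_near[OF r(6)]
     f_near[OF t S.regs_near[OF r(1)]] f_near[OF t S.regs_near[OF r(2)]] f_near[OF t S.regs_near[OF r(3)]] f_near[OF t S.regs_near[OF r(4)]]
   proof eventually_elim
    case (elim t)
    note rs = S.regs_RS[OF elim(6)] S.regs_RS[OF elim(7)] S.regs_RS[OF elim(8)] S.regs_RS[OF elim(9)]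
    note d = S.dcls_mult[OF f_points[OF elim(3)] rs]
    show ?case using elim(1,2,3) ten_mult[OF elim(3) rs T.lsec_carrier[OF elim(4)] T.lsec_carrier[OF elim(5)] refl] d by simp
   qed
  qed
  thus "EX v c e. gchart ?c ?ga t v c e" by blast
 qed simp_all
 thus ?thesis unfolding Gm_lft_def Pi_add_def by(simp add: Let_def)
qed

section \<open>Bijectivity of the base change map\<close>

context eta_convex
begin

text \<open>A triple near \<open>t\<close>, which may lie outside \<open>Z\<close>, such that the
  family \<open>x\<close> equals \<open>v c/e\<close> on \<open>Z\<close>. Unlike
  \<open>gchart\<close> it refers to no point of the group scheme, so it can be used to build
  one.\<close>

definition compat where
 "compat x t v c e <-> lsec T t v & v t : Units (B t) & regs S f$t c & regs S f$t e &
  ev t (%t. x t *[B t] fs e t = v t *[B t] fs c t)"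

lemma compat_near:
 assumes t: "t : points T" and c: "compat x t v c e"
 shows "evn T t (%t. compat x t v c e)"
proof -
 have C: "lsec T t v" "v t : Units (B t)" "regs S f$t c" "regs S f$t e"
  "ev t (%t. x t *[B t] fs e t = v t *[B t] fs c t)" using c unfolding compat_def by auto
 show ?thesis
  using lsec_near[OF C(1)] T.lsec_unit_near(1)[OF C(1,2)] f_near[OF t regs_near[OF C(3)]] f_near[OF t regs_near[OF C(4)]] near_near[OF C(5)]
  by eventually_elim (simp add: compat_def)
qed

lemma compat_gchart: "t : points T ==> gchart a al t v c e ==> compat (gval al) t v c e"
 unfolding compat_def using gchart_gval(1)[of t a al v c e] gchartD[of a al t v c e] by blast

lemma fs_mult: "t : points T ==> r : carrier (A f$t) ==> s : carrier (A f$t) ==> cm f t (r *[A f$t] s) = cm f t r *[B t] cm f t s"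
 by(rule ring_hom_mult[OF f_hom])

lemma local_divides:
 assumes t: "t : points T" and ab: "a : carrier (A f$t)" "b : carrier (A f$t)" and u: "u : carrier (B t)"
  and e: "cm f t a = cm f t b *[B t] u"
 shows "EX c:carrier (A f$t). a = b *[A f$t] c"
proof (rule flat_local_divides[OF local[OF f_points[OF t]] T_local[OF t] f_hom[OF t] _ _ ab u e])
 show "flat_module (A f$t) (alg_module (cm f t) (B t))" using flat t unfolding flat_morphism_def by blast
 show "r : Units (A f$t)" if "r : carrier (A f$t)" "cm f t r : Units (B t)" for r
  using lrs_hom_units[OF f t T_local[OF t] local[OF f_points[OF t]] that(1)] that(2) by blast
qed

text \<open>By density \<open>v c e' = v' c' e\<close> holds at \<open>t\<close> itself. Hence
  \<open>c e'\<close> and \<open>c' e\<close> divide each other after pullback and therefore on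
  \<open>S\<close>; they differ by a unit \<open>k\<close> of \<open>S\<close>, and moving
  \<open>k\<close> across the tensor sign turns one tensor into the other.\<close>

lemma compat_unique:
 assumes t: "t : points T" and c: "compat x t v c e" and c': "compat x t v' c' e'" and x: "!!t. t : Z ==> x t : carrier (B t)"
 shows "dc S f$t c e = dc S f$t c' e'"
  "ten t (dc S f$t c e) (v t) (mq S f$t c e)
   = ten t (dc S f$t c' e') (v' t) (mq S f$t c' e')"
proof -
 let ?s = "f$t"
 note s = f_points[OF t]
 have C: "lsec T t v" "v t : Units (B t)" "regs S ?s c" "regs S ?s e" "ev t (%t. x t *[B t] fs e t = v t *[B t] fs c t)"
  and C': "lsec T t v'" "v' t : Units (B t)" "regs S ?s c'" "regs S ?s e'" "ev t (%t. x t *[B t] fs e' t = v' t *[B t] fs c' t)"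
  using c c' unfolding compat_def by auto
 interpret a: cring "A ?s" by(rule stalk_cring[OF s])
 interpret b: cring "B t" by(rule T.stalk_cring[OF t])
 note L = T.regs_lsec[OF fs_regs[OF t]]
 have eq: "v t *[B t] (fs c t *[B t] fs e' t) = v' t *[B t] (fs c' t *[B t] fs e t)"
 proof (rule dense_eq[OF t T.lsec_mult[OF C(1) T.lsec_mult[OF L[OF C(3)] L[OF C'(4)]]] T.lsec_mult[OF C'(1) T.lsec_mult[OF L[OF C'(3)] L[OF C(4)]]]])
  show "ev t (%t. v t *[B t] (fs c t *[B t] fs e' t) = v' t *[B t] (fs c' t *[B t] fs e t))"
   using C(5) C'(5) lsec_near[OF C(1)] lsec_near[OF C'(1)] lsec_near[OF L[OF C(3)]] lsec_near[OF L[OF C(4)]] lsec_near[OF L[OF C'(3)]] lsec_near[OF L[OF C'(4)]]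
  proof eventually_elim
   case (elim t)
   show ?case
   proof
    assume tZ: "t : Z"
    interpret z: cring "B t" by(rule T.stalk_cring[OF ZD(1)[OF tZ]])
    note cc = elim(3-8)[THEN T.lsec_carrier] x[OF tZ]
    have "v t *[B t] (fs c t *[B t] fs e' t) = (v t *[B t] fs c t) *[B t] fs e' t" using cc by(simp add: z.m_assoc)
    also have "... = (x t *[B t] fs e t) *[B t] fs e' t" using elim(1) tZ by simp
    also have "... = (x t *[B t] fs e' t) *[B t] fs e t" using cc by(simp add: z.m_ac)
    also have "... = v' t *[B t] (fs c' t *[B t] fs e t)" using elim(2) tZ cc by(simp add: z.m_assoc)
    finally show "v t *[B t] (fs c t *[B t] fs e' t) = v' t *[B t] (fs c' t *[B t] fs e t)" .
   qed
  qed
 qed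
 let ?c = "c ?s" and ?e = "e ?s" and ?c' = "c' ?s" and ?e' = "e' ?s"
 note rs = regs_RS[OF C(3)] regs_RS[OF C(4)] regs_RS[OF C'(3)] regs_RS[OF C'(4)]
 note cs = rs[THEN RS_carrier[OF s]]
 note fc = cs[THEN f_closed[OF t]]
 note vc = b.Units_closed[OF C(2)] b.Units_closed[OF C'(2)]
 have q: "?c *[A ?s] ?e' : carrier (A ?s)" "?c' *[A ?s] ?e : carrier (A ?s)" using cs by simp_all
 have eq': "v t *[B t] cm f t (?c *[A ?s] ?e') = v' t *[B t] cm f t (?c' *[A ?s] ?e)" using eq fs_mult[OF t] cs by simp
 have d: "EX k:carrier (A ?s). p = p' *[A ?s] k"
  if p: "p : carrier (A ?s)" "p' : carrier (A ?s)" and w: "w : Units (B t)" "w' : Units (B t)" and e: "w *[B t] cm f t p = w' *[B t] cm f t p'" for p p' w w'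
 proof (rule local_divides[OF t p])
  note wc = b.Units_closed[OF w(1)] b.Units_closed[OF w(2)]
  show "inv[B t] w *[B t] w' : carrier (B t)" using w wc by simp
  have "cm f t p = inv[B t] w *[B t] (w *[B t] cm f t p)" using w(1) wc f_closed[OF t p(1)] by(simp add: b.m_assoc[symmetric])
  thus "cm f t p = cm f t p' *[B t] (inv[B t] w *[B t] w')" unfolding e using w(1) wc f_closed[OF t p(2)] by(simp add: b.m_ac)
 qed
 obtain k where k: "k : carrier (A ?s)" "?c *[A ?s] ?e' = (?c' *[A ?s] ?e) *[A ?s] k" using d[OF q C(2) C'(2) eq'] by blast
 obtain k' where k': "k' : carrier (A ?s)" "?c' *[A ?s] ?e = (?c *[A ?s] ?e') *[A ?s] k'" using d[OF q(2,1) C'(2) C(2) eq'[symmetric]] by blast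
 have nz: "nzd (A ?s) (?c' *[A ?s] ?e)" by(rule RS_nzd[OF RS_mult[OF s rs(3,2)]])
 have "k *[A ?s] k' = 1[A ?s]"
  by(rule nzd_cancel[OF a.is_cring nz]) (use k k' q in \<open>simp_all add: a.m_assoc[symmetric]\<close>)
 hence ku: "k : Units (A ?s)" by(intro a.unit_factor[OF _ k(1) k'(1)]) simp
 show "dcls S ?s ?c ?e = dcls S ?s ?c' ?e'"
  unfolding dcls_eq_iff[OF s rs] by(rule bexI[OF _ ku]) (use k q(2) in \<open>simp add: a.m_comm\<close>)
 have "mfrac S ?s ?c ?e = mfrac S ?s (k *[A ?s] ?c') ?e'"
  using mfrac_eq_iff[OF s cs(1) rs(2) _ rs(4), of "k *[A ?s] ?c'"] k cs by(simp add: a.m_ac)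
 moreover have "v t *[B t] cm f t k = v' t"
 proof (rule nzd_cancel[OF b.is_cring fs_reg[OF t nz]])
  show "cm f t (?c' *[A ?s] ?e) *[B t] (v t *[B t] cm f t k) = cm f t (?c' *[A ?s] ?e) *[B t] v' t"
   using eq'[unfolded k(2) fs_mult[OF t q(2) k(1)]] vc f_closed[OF t q(2)] f_closed[OF t k(1)] by(simp add: b.m_ac)
 qed (use vc f_closed[OF t k(1)] in simp_all)
 ultimately show "ten t (dcls S ?s ?c ?e) (v t) (mfrac S ?s ?c ?e) = ten t (dcls S ?s ?c' ?e') (v' t) (mfrac S ?s ?c' ?e')"
  using ten_smult[OF t rs(3,4) vc(1) k(1)] \<open>dcls S ?s ?c ?e = dcls S ?s ?c' ?e'\<close> by simp
qed

lemma zsec_inv: assumes x: "zsec x" shows "zsec (%t. inv[B t] x t)"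
 unfolding zsec_def
proof (intro ballI conjI)
 fix t assume t: "t : Z"
 interpret b: cring "B t" by(rule T.stalk_cring[OF ZD(1)[OF t]])
 show "inv[B t] x t : Units (B t)" using zsecD(1)[OF x t] by simp
 obtain v where v: "lsec T t v" "ev t (%t'. x t' = v t')" using zsecD(3)[OF x t] by blast
 have vt: "v t : Units (B t)" using near_self[OF v(2) ZD(1)[OF t]] t zsecD(1)[OF x t] by simp
 have "ev t (%t'. inv[B t'] x t' = inv[B t'] v t')" using v(2) by eventually_elim simp
 thus "EX v. lsec T t v & ev t (%t'. inv[B t'] x t' = v t')" using T.lsec_unit_near(2)[OF v(1) vt] by blast
qed

text \<open>A unit on the generic fibre is, near \<open>t0\<close>, a fraction \<open>b1 / w1\<close> whose denominator comes from
  \<open>S\<close>; so is its inverse \<open>b2 / w2\<close>. Then \<open>0 \<le> [b1] \<le> [w1 w2]\<close> and convexity places \<open>[b1]\<close> in the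
  divisors of \<open>S\<close>.\<close>

lemma zsec_compat:
 assumes x: "zsec x" and t0: "t0 : points T"
 shows "EX v c e. compat x t0 v c e"
proof -
 obtain V and R :: "('b => 'k) ring" and rh Sg where C: "t0 : V" "affine_chart T R V rh" "mult_subset R Sg"
  "ALL y:V. (ALL w:Sg. rh y w : Units (B y)) --> y : Z" "ev t0 (%y. y : V & (ALL w:Sg. rh y w : Units (B y)))"
  "ALL w:Sg. EX a ga. regs S f$t0 a & lsec T t0 ga & ga t0 : Units (B t0) & evn T t0 (%y. rh y w = ga y *[B y] fs a y)"
  by(rule Z_chart[OF t0])
 interpret C: affine_chart T R V rh by(rule C(2))
 interpret b0: cring "B t0" by(rule T.stalk_cring[OF t0])
 note s = f_points[OF t0]
 define Y where "Y = {y : V. ALL w:Sg. rh y w : Units (B y)}"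
 have YZ: "y : Z" if "y : Y" for y using that C(4) unfolding Y_def by blast
 have nY: "ev t0 (%y. y : Y)" using C(5) by eventually_elim (simp add: Y_def)
 have frac: "EX b:carrier R. EX w:Sg. ALL y:Y. rh y w *[B y] x y = rh y b" if x: "zsec x" for x
 proof -
  have "EX ta. lsec T y ta & evn T y (%y'. y' : Y --> x y' = ta y')" if y: "y : Y" for y
  proof -
   obtain v where v: "lsec T y v" "ev y (%t'. x t' = v t')" using zsecD(3)[OF x YZ[OF y]] by blast
   have "evn T y (%y'. y' : Y --> x y' = v y')" using v(2) by eventually_elim (use YZ in blast)
   thus ?thesis using v(1) by blast
  qed
  thus ?thesis by(rule C.section_is_fraction[OF C(3) Y_def]) blast+
 qed
 obtain b1 w1 where 1: "b1 : carrier R" "w1 : Sg" "ALL y:Y. rh y w1 *[B y] x y = rh y b1" using frac[OF x] by blast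
 obtain b2 w2 where 2: "b2 : carrier R" "w2 : Sg" "ALL y:Y. rh y w2 *[B y] inv[B y] x y = rh y b2" using frac[OF zsec_inv[OF x]] by blast
 obtain a1 ga1 where a1: "regs S f$t0 a1" "lsec T t0 ga1" "ga1 t0 : Units (B t0)" "evn T t0 (%y. rh y w1 = ga1 y *[B y] fs a1 y)"
  using C(6) 1(2) by blast
 obtain a2 ga2 where a2: "regs S f$t0 a2" "lsec T t0 ga2" "ga2 t0 : Units (B t0)" "evn T t0 (%y. rh y w2 = ga2 y *[B y] fs a2 y)"
  using C(6) 2(2) by blast
 note wR = mult_subsetD(4)[OF C(3) 1(2)] mult_subsetD(4)[OF C(3) 2(2)]
 have lb: "lsec T t0 (%y. rh y b1)" "lsec T t0 (%y. rh y b2)" by(rule C.rh_lsec[OF 1(1) C(1)], rule C.rh_lsec[OF 2(1) C(1)])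
 have rw: "regs T t0 (%y. rh y w1)" "regs T t0 (%y. rh y w2)" by(rule Z_chart_regs[OF t0 a1], rule Z_chart_regs[OF t0 a2])
 have rww: "regs T t0 (%y. rh y w1 *[B y] rh y w2)" by(rule T.regs_mult[OF rw])
 have "ev t0 (%y. rh y w1 *[B y] rh y w2 = rh y b1 *[B y] rh y b2)" using nY
 proof eventually_elim
  case (elim y)
  show ?case
  proof
   assume yZ: "y : Z"
   hence y: "y : Y" "y : V" using elim unfolding Y_def by auto
   interpret b: cring "B y" by(rule C.stalk_V[OF y(2)])
   have w: "rh y w1 : carrier (B y)" "rh y w2 : carrier (B y)" using wR C.rh_closed[OF y(2)] by auto
   have "rh y b1 *[B y] rh y b2 = (rh y w1 *[B y] x y) *[B y] (rh y w2 *[B y] inv[B y] x y)" using 1(3) 2(3) y(1) by simp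
   also have "... = (rh y w1 *[B y] rh y w2) *[B y] (x y *[B y] inv[B y] x y)"
    using w zsecD(2)[OF x yZ] zsecD(2)[OF zsec_inv[OF x] yZ] by(simp add: b.m_ac)
   also have "... = rh y w1 *[B y] rh y w2" using w zsecD(1)[OF x yZ] by simp
   finally show "rh y w1 *[B y] rh y w2 = rh y b1 *[B y] rh y b2" by simp
  qed
 qed
 \<comment> \<open>\<open>x\<close> times its inverse is \<open>1\<close>, so
   \<open>b1 b2 = w1 w2\<close> on the generic fibre and by density at \<open>t0\<close>. Thus
   \<open>b1\<close> divides a regular germ and is itself regular, which is what gives it a
   divisor.\<close>
 hence bw: "rh t0 w1 *[B t0] rh t0 w2 = rh t0 b1 *[B t0] rh t0 b2" by(rule dense_eq[OF t0 T.regs_lsec[OF rww] T.lsec_mult[OF lb]])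
 have rbb: "regs T t0 (%y. rh y b1 *[B y] rh y b2)"
  by(rule T.regs_cong[OF rww T.lsec_eq[OF T.regs_lsec[OF rww] T.lsec_mult[OF lb] bw]])
 have rb1: "regs T t0 (%y. rh y b1)" by(rule T.regs_factor[OF rbb lb])
 have rb2: "regs T t0 (%y. rh y b2)"
 proof (rule T.regs_factor[OF _ lb(2,1)], rule T.regs_cong[OF rbb])
  show "evn T t0 (%y. rh y b1 *[B y] rh y b2 = rh y b2 *[B y] rh y b1)" using C.near_V[OF C(1)]
  proof eventually_elim
   case (elim y)
   show ?case by(rule comm_monoid.m_comm[OF cring.axioms(2)[OF C.stalk_V[OF elim]] C.rh_closed[OF elim 1(1)] C.rh_closed[OF elim 2(1)]])
  qed
 qed
 note B1 = T.regs_RS[OF rb1] and B2 = T.regs_RS[OF rb2] and o = T.RS_one[OF t0]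
 have sub: "cm f t0 ` RS S f$t0 <= RS T t0"
 proof
  fix y assume "y : cm f t0 ` RS S f$t0"
  then obtain b where b: "regs S f$t0 b" "y = fs b t0" using reg_stalkE by(elim imageE) metis
  thus "y : RS T t0" using T.regs_RS[OF fs_regs[OF t0 b(1)]] by simp
 qed
 let ?H = "div_map T f t0 ` carrier (div_stalk S f$t0)"
 interpret D: group "div_stalk T t0" by(rule T.div_group[OF t0])
 note fr = sub[THEN subsetD, OF imageI]
 have inH: "dcls T t0 (cm f t0 c) (cm f t0 e) : ?H" if "c : RS S f$t0" "e : RS S f$t0" for c e
  using imageI[OF dcls_carrier[OF s that], of "div_map T f t0"] unfolding div_map_dcls[OF t0 sub that] .
 \<comment> \<open>Adding the divisor of a regular germ goes up in the order; both inequalities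
   needed for convexity are of this kind.\<close>
 have le: "div_le T t0 de (de *[div_stalk T t0] dcls T t0 b 1[B t0])" if "de : carrier (div_stalk T t0)" "b : RS T t0" for de b
 proof -
  interpret D: comm_group "div_stalk T t0"
   unfolding div_stalk_def by(rule comm_group.abelian_FactGroup[OF T.div_normal(1)[OF t0] normal_imp_subgroup[OF T.div_normal(2)[OF t0]]])
  have bc: "dcls T t0 b 1[B t0] : carrier (div_stalk T t0)" by(rule T.dcls_carrier[OF t0 that(2) o])
  hence "de *[div_stalk T t0] dcls T t0 b 1[B t0] *[div_stalk T t0] inv[div_stalk T t0] de = dcls T t0 b 1[B t0]"
   using that(1) by(simp add: D.m_ac D.m_assoc[symmetric])
  thus ?thesis unfolding div_le_def merom_of_def using that(2) by simp
 qed
 have c1: "dcls T t0 1[B t0] 1[B t0] : carrier (div_stalk T t0)" "dcls T t0 (rh t0 b1) 1[B t0] : carrier (div_stalk T t0)"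
  using T.dcls_carrier[OF t0 o o] T.dcls_carrier[OF t0 B1 o] .
 have bc: "rh t0 b1 : carrier (B t0)" "rh t0 b2 : carrier (B t0)" using lb T.lsec_carrier by auto
 have l1: "div_le T t0 (dcls T t0 1[B t0] 1[B t0]) (dcls T t0 (rh t0 b1) 1[B t0])"
  using le[OF c1(1) B1] T.dcls_mult[OF t0 o o B1 o] bc by simp
 have l2: "div_le T t0 (dcls T t0 (rh t0 b1) 1[B t0]) (dcls T t0 (rh t0 w1 *[B t0] rh t0 w2) 1[B t0])"
  using le[OF c1(2) B2] T.dcls_mult[OF t0 B1 o B2 o] bc unfolding bw by simp
 note ra = regs_RS[OF a1(1)] regs_RS[OF a2(1)]
 note ac = ra[THEN RS_carrier[OF s]]
 interpret a: cring "A f$t0" by(rule stalk_cring[OF s])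
 have h1: "cm f t0 1[A f$t0] = 1[B t0]" by(rule ring_hom_one[OF f_hom[OF t0]])
 \<comment> \<open>The upper bound comes from a divisor of \<open>S\<close>, because
   \<open>w1 w2\<close> is the pullback of \<open>a1 a2\<close> up to the unit
   \<open>ga1 ga2\<close>.\<close>
 have "dcls T t0 (rh t0 w1 *[B t0] rh t0 w2) 1[B t0] = dcls T t0 (cm f t0 (a1 f$t0 *[A f$t0] a2 f$t0)) 1[B t0]"
 proof (rule T.dcls_eq_iff[OF t0 T.regs_RS[OF rww] o fr[OF RS_mult[OF s ra]] o, THEN iffD2], rule bexI)
  show "ga1 t0 *[B t0] ga2 t0 : Units (B t0)" using a1(3) a2(3) by simp
  show "rh t0 w1 *[B t0] rh t0 w2 *[B t0] 1[B t0] = ga1 t0 *[B t0] ga2 t0 *[B t0] (cm f t0 (a1 f$t0 *[A f$t0] a2 f$t0) *[B t0] 1[B t0])"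
   unfolding near_self[OF a1(4) t0] near_self[OF a2(4) t0] fs_mult[OF t0 ac]
   using ac[THEN f_closed[OF t0]] a1(3)[THEN b0.Units_closed] a2(3)[THEN b0.Units_closed] by(simp add: b0.m_ac)
 qed
 hence hw: "dcls T t0 (rh t0 w1 *[B t0] rh t0 w2) 1[B t0] : ?H"
  using inH[OF RS_mult[OF s ra] RS_one[OF s]] unfolding h1 by simp
 have ho: "dcls T t0 1[B t0] 1[B t0] : ?H" using inH[OF RS_one[OF s] RS_one[OF s]] unfolding h1 .
 have "convex_subgroup (div_stalk T t0) (div_le T t0) ?H" using convex t0 unfolding convex_morphism_def by blast
 hence "dcls T t0 (rh t0 b1) 1[B t0] : ?H" unfolding convex_subgroup_def using ho hw c1(2) l1 l2 by blast
 then obtain de where de: "de : carrier (div_stalk S f$t0)" "dcls T t0 (rh t0 b1) 1[B t0] = div_map T f t0 de" by blast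
 obtain c0 e0 where ce: "regs S f$t0 c0" "regs S f$t0 e0" "de = dc S f$t0 c0 e0" by(rule div_carrierE[OF s de(1)])
 note rce = regs_RS[OF ce(1)] regs_RS[OF ce(2)]
 have "dcls T t0 (rh t0 b1) 1[B t0] = dcls T t0 (fs c0 t0) (fs e0 t0)" using de(2) div_map_dcls[OF t0 sub rce] ce(3) by simp
 then obtain w where w: "w : Units (B t0)" "rh t0 b1 *[B t0] fs e0 t0 = w *[B t0] (fs c0 t0 *[B t0] 1[B t0])"
  using T.dcls_eq_iff[OF t0 B1 o fr[OF rce(1)] fr[OF rce(2)]] by blast
 obtain om where om: "lsec T t0 om" "om t0 = w" by(rule T.lsec_exists[OF t0 b0.Units_closed[OF w(1)]])
 have lce: "lsec T t0 (fs c0)" "lsec T t0 (fs e0)" "lsec T t0 (fs a1)" using T.regs_lsec[OF fs_regs[OF t0 ce(1)]] T.regs_lsec[OF fs_regs[OF t0 ce(2)]] T.regs_lsec[OF fs_regs[OF t0 a1(1)]] .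
 have we: "evn T t0 (%t. rh t b1 *[B t] fs e0 t = om t *[B t] fs c0 t)"
  by(rule T.lsec_eq[OF T.lsec_mult[OF lb(1) lce(2)] T.lsec_mult[OF om(1) lce(1)]]) (use w(2) om(2) T.lsec_carrier[OF lce(1)] in simp)
 \<comment> \<open>From \<open>x = b1 / (ga1 a1)\<close> and \<open>b1 = om c0 / e0\<close>: the
   units \<open>om\<close> and \<open>ga1\<close> of \<open>T\<close> go into \<open>v\<close>, the
   regular sections of \<open>S\<close> into numerator and denominator.\<close>
 let ?v = "%t. om t *[B t] inv[B t] ga1 t" and ?e = "%s. e0 s *[A s] a1 s"
 have "compat x t0 ?v c0 ?e" unfolding compat_def
 proof (intro conjI T.lsec_mult om(1) T.lsec_unit_near(2)[OF a1(2,3)] ce(1) regs_mult ce(2) a1(1))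
  show "om t0 *[B t0] inv[B t0] ga1 t0 : Units (B t0)" using w(1) om(2) a1(3) by simp
  show "ev t0 (%t. x t *[B t] fs ?e t = ?v t *[B t] fs c0 t)"
   using nY we a1(4) T.lsec_unit_near(1)[OF a1(2,3)] lsec_near[OF om(1)] f_near[OF t0 regs_near[OF ce(1)]] f_near[OF t0 regs_near[OF ce(2)]] f_near[OF t0 regs_near[OF a1(1)]]
  proof eventually_elim
   case (elim t)
   show ?case
   proof
    assume tZ: "t : Z"
    note tT = ZD(1)[OF tZ]
    have tY: "t : Y" using elim(1) tZ by blast
    interpret b: cring "B t" by(rule T.stalk_cring[OF tT])
    note rc = regs_carrier[OF elim(6)] regs_carrier[OF elim(7)] regs_carrier[OF elim(8)]
    note fc = rc[THEN f_closed[OF tT]] T.lsec_carrier[OF elim(5)] b.Units_closed[OF elim(4)] zsecD(2)[OF x tZ]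
    have iu: "inv[B t] ga1 t : carrier (B t)" using elim(4) by simp
    have "x t *[B t] fs ?e t = inv[B t] ga1 t *[B t] ga1 t *[B t] (x t *[B t] (fs e0 t *[B t] fs a1 t))"
     using fs_mult[OF tT rc(2,3)] elim(4) fc by simp
    also have "... = inv[B t] ga1 t *[B t] (((ga1 t *[B t] fs a1 t) *[B t] x t) *[B t] fs e0 t)" using fc iu by(simp add: b.m_ac)
    also have "... = inv[B t] ga1 t *[B t] (om t *[B t] fs c0 t)" using bspec[OF 1(3) tY] elim(2,3) by simp
    finally show "x t *[B t] fs ?e t = ?v t *[B t] fs c0 t" using fc iu by(simp add: b.m_ac)
   qed
  qed
 qed
 thus ?thesis by blast
qed

lemma gval_unique:
 assumes t: "t : Z" and y: "y : carrier (B t)" "al t = ten t (D1 t) y (M1 t)" shows "gval al t = y"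
proof -
 have g: "gval al t : carrier (B t) & al t = ten t (D1 t) (gval al t) (M1 t)"
  unfolding gval_def by(rule someI[of "%y. y : carrier (B t) & al t = ten t (D1 t) y (M1 t)", OF conjI[OF y]])
 show ?thesis by(rule ten_one_inj[OF ZD(1)[OF t] conjunct1[OF g] y(1) trans[OF sym[OF conjunct2[OF g]] y(2)]])
qed

lemma gval_at:
 assumes aal: "(a, al) : carrier (Gm_lft S T f)" and t: "t : Z"
 shows "al t = ten t (D1 t) (gval al t) (M1 t)" "a$t = (f$t, D1 t)"
proof -
 obtain v c e where g: "gchart a al t v c e" by(rule carrier_chart[OF aal ZD(1)[OF t]])
 show "al t = ten t (D1 t) (gval al t) (M1 t)" "a$t = (f$t, D1 t)" using near_self[OF gchart_gval(2)[OF ZD(1)[OF t] g] ZD(1)[OF t]] t by auto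
qed

lemma eta_family_eq_iff:
 assumes "!!t. t : Z ==> x t : carrier (B t)" "!!t. t : Z ==> y t : carrier (B t)"
 shows "eta_family x = eta_family y <-> (ALL t:Z. x t = y t)"
proof
 assume e: "eta_family x = eta_family y"
 show "ALL t:Z. x t = y t"
 proof
  fix t assume t: "t : Z"
  show "x t = y t" by(rule io_inj[OF t _ assms(1)[OF t] assms(2)[OF t]]) (use fun_cong[OF e, of "wpt t"] in \<open>simp only: eta_family_at[OF t]\<close>)
 qed
next
 assume e: "ALL t:Z. x t = y t"
 show "eta_family x = eta_family y" unfolding eta_family_def by(rule restrict_ext) (use e in \<open>auto simp: points_Te\<close>)
qed

text \<open>Uniqueness of compatible triples at every point of \<open>T\<close> gives injectivity
  and also the gluing of independently chosen triples in the proof of surjectivity.\<close>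

theorem eta_base_change_iso: "eta_base_change S T f : iso (Gm_lft S T f) (Gm Te)"
proof -
 have hom: "eta_base_change S T f : hom (Gm_lft S T f) (Gm Te)"
 proof (rule homI)
  fix u assume u: "u : carrier (Gm_lft S T f)"
  obtain a al where a: "u = (a, al)" by(cases u) auto
  note aal = u[unfolded a]
  show "eta_base_change S T f u : carrier (Gm Te)" unfolding a eta_base_change_eq[OF aal] by(rule Gm_TeI[OF gval_zsec[OF aal]])
  fix u' assume u': "u' : carrier (Gm_lft S T f)"
  obtain b be where b: "u' = (b, be)" by(cases u') auto
  note bbe = u'[unfolded b]
  obtain d de where d: "(a, al) *[Gm_lft S T f] (b, be) = (d, de)" by(cases "(a, al) *[Gm_lft S T f] (b, be)") auto
  note dde = Gm_lft_mult_closed[OF aal bbe, unfolded d]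
  have g: "gval de t = gval al t *[B t] gval be t" if t: "t : Z" for t
  proof (rule gval_unique[OF t])
   note tT = ZD(1)[OF t]
   interpret bt: cring "B t" by(rule T.stalk_cring[OF tT])
   interpret at: cring "A f$t" by(rule stalk_cring[OF ZD(3)[OF t]])
   note gc = zsecD(2)[OF gval_zsec[OF aal] t] zsecD(2)[OF gval_zsec[OF bbe] t]
   show "gval al t *[B t] gval be t : carrier (B t)" using gc by simp
   have "de t = tensor_mult (A f$t) (alg_module (cm f t) (B t)) (L_stalk S (f$t, D1 t)) (al t) (be t)"
    using d tT gval_at(2)[OF aal t] gval_at(2)[OF bbe t] D1_mult[OF tT] unfolding Gm_lft_def Pi_add_def by(auto simp: Let_def)
   thus "de t = ten t (D1 t) (gval al t *[B t] gval be t) (M1 t)"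
    using ten_mult[OF tT one_reg[OF tT] one_reg[OF tT] one_reg[OF tT] one_reg[OF tT] gc D1_mult[OF tT, symmetric]] gval_at(1)[OF aal t] gval_at(1)[OF bbe t] by simp
  qed
  have "(\<lambda>w\<in>points Te. eta_family (gval al) w *[Te@@w] eta_family (gval be) w) = eta_family (gval de)"
   unfolding eta_family_def[of "gval de"]
  proof (rule restrict_ext)
   fix w assume "w : points Te"
   then obtain t where t: "t : Z" "w = wpt t" unfolding points_Te by blast
   show "eta_family (gval al) w *[Te@@w] eta_family (gval be) w = cm q1 w (gval de (fst (fst w)))"
    unfolding t(2) eta_family_at[OF t(1)] fst_conv g[OF t(1)]
    by(rule ring_hom_mult[OF io_hom[OF t(1)] zsecD(2)[OF gval_zsec[OF aal] t(1)] zsecD(2)[OF gval_zsec[OF bbe] t(1)], symmetric])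
  qed
  thus "eta_base_change S T f (u *[Gm_lft S T f] u') = eta_base_change S T f u *[Gm Te] eta_base_change S T f u'"
   unfolding a b d eta_base_change_eq[OF aal] eta_base_change_eq[OF bbe] eta_base_change_eq[OF dde] Gm_mult ..
 qed
 have ext: "pt a : extensional (points T)" "al : extensional (points T)" "cm a = cm f" if "(a, al) : carrier (Gm_lft S T f)" for a al
  using that Pi_pointD(1,2)[of a] locally_given_PiE[of al] unfolding Gm_lft_def pullL_generators_def pullL_sections_def by(auto simp: PiE_def)
 have inj: "inj_on (eta_base_change S T f) (carrier (Gm_lft S T f))"
 proof (rule inj_onI)
  fix u u' assume u: "u : carrier (Gm_lft S T f)" "u' : carrier (Gm_lft S T f)" and e: "eta_base_change S T f u = eta_base_change S T f u'"
  obtain a al b be where a: "u = (a, al)" "u' = (b, be)" by(cases u, cases u') auto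
  note aal = u(1)[unfolded a] and bbe = u(2)[unfolded a]
  note z = gval_zsec[OF aal] gval_zsec[OF bbe]
  have eq: "ALL t:Z. gval al t = gval be t"
   by(rule eta_family_eq_iff[THEN iffD1, rotated 2, OF e[unfolded a eta_base_change_eq[OF aal] eta_base_change_eq[OF bbe]]])
    (rule zsecD(2)[OF z(1)], assumption, rule zsecD(2)[OF z(2)], assumption)
  have p: "a$t = b$t & al t = be t" if t: "t : points T" for t
  proof -
   obtain v c e where g: "gchart a al t v c e" by(rule carrier_chart[OF aal t])
   obtain v' c' e' where g': "gchart b be t v' c' e'" by(rule carrier_chart[OF bbe t])
   \<comment> \<open>The two families on \<open>Z\<close> agree, so the chart of the second point is
     compatible with the family of the first.\<close>
   have "compat (gval al) t v' c' e'"
    using compat_gchart[OF t g'] eq unfolding compat_def by(auto elim!: eventually_mono)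
   note k = compat_unique[OF t compat_gchart[OF t g] this zsecD(2)[OF z(1)]]
   show ?thesis using near_self[OF gchartD(5)[OF g] t] near_self[OF gchartD(5)[OF g'] t] k by simp
  qed
  have "pt a = pt b" by(rule extensionalityI[OF ext(1)[OF aal] ext(1)[OF bbe]]) (use p in blast)
  moreover have "al = be" by(rule extensionalityI[OF ext(2)[OF aal] ext(2)[OF bbe]]) (use p in blast)
  ultimately show "u = u'" unfolding a using ext(3)[OF aal] ext(3)[OF bbe] by simp
 qed
 have surj: "EX u:carrier (Gm_lft S T f). eta_base_change S T f u = w" if w: "w : carrier (Gm Te)" for w
 proof -
  obtain x where x: "zsec x" "w = eta_family x" by(rule Gm_TeE[OF w])
  note xc = zsecD(2)[OF x(1)]
  \<comment> \<open>A triple is chosen separately at each point; nothing relates the choices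
    yet.\<close>
  obtain v c e where ch: "!!t. t : points T ==> compat x t (v t) (c t) (e t)" using zsec_compat[OF x(1)] by metis
  let ?d = "%t. dc S f$t (c t) (e t)"
  define al where "al = (\<lambda>t\<in>points T. ten t (?d t) (v t t) (mq S f$t (c t) (e t)))"
  let ?a = "(|pt = (\<lambda>t\<in>points T. (f$t, ?d t)), cm = cm f|)"
  have gc: "gchart ?a al t (v t) (c t) (e t)" if t: "t : points T" for t
  proof -
   have k: "compat x t (v t) (c t) (e t)" by(rule ch[OF t])
   have "evn T t (%t'. ?a$t' = (f$t', dc S f$t' (c t) (e t)) &
    al t' = ten t' (dc S f$t' (c t) (e t)) (v t t') (mq S f$t' (c t) (e t)))"
    using compat_near[OF t k] near_points[of T t]
   proof eventually_elim
    case (elim t')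
    \<comment> \<open>The triple of \<open>t\<close> is also compatible at \<open>t'\<close>, so it
      gives the same divisor and the same tensor there as the triple chosen at
      \<open>t'\<close>.\<close>
    show ?case using compat_unique[OF elim(2) ch[OF elim(2)] elim(1) xc] elim(2) unfolding al_def by simp
   qed
   thus ?thesis using k unfolding gchart_def compat_def by blast
  qed
  have aal: "(?a, al) : carrier (Gm_lft S T f)"
   by(rule chart_carrier) (use gc in \<open>auto simp: al_def\<close>)
  have "gval al t = x t" if t: "t : Z" for t
  proof -
   note tT = ZD(1)[OF t]
   interpret b: cring "B t" by(rule T.stalk_cring[OF tT])
   note G = gchartD[OF gc[OF tT]]
   have k: "gval al t *[B t] cm f t (e t f$t) = v t t *[B t] cm f t (c t f$t)"
    using near_self[OF gchart_gval(1)[OF tT gc[OF tT]] tT] t by blast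
   have "ev t (%t'. x t' *[B t'] fs (e t) t' = v t t' *[B t'] fs (c t) t')" using ch[OF tT] unfolding compat_def by blast
   hence k': "x t *[B t] cm f t (e t f$t) = v t t *[B t] cm f t (c t f$t)" using near_self[OF _ tT] t by blast
   have ec: "cm f t (e t f$t) : carrier (B t)" by(rule f_closed[OF tT regs_carrier[OF G(4)]])
   show ?thesis
    by(rule nzd_cancel[OF b.is_cring fs_reg[OF tT regs_nzd[OF G(4)]] zsecD(2)[OF gval_zsec[OF aal] t] xc[OF t]])
     (use k k' ec xc[OF t] zsecD(2)[OF gval_zsec[OF aal] t] in \<open>simp add: b.m_comm\<close>)
  qed
  hence "ALL t:Z. gval al t = x t" by blast
  hence "eta_base_change S T f (?a, al) = w" unfolding eta_base_change_eq[OF aal] x(2)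
   by(rule eta_family_eq_iff[THEN iffD2, rotated 2]) (rule zsecD(2)[OF gval_zsec[OF aal]], assumption, rule xc, assumption)
  thus ?thesis using aal by blast
 qed
 have "eta_base_change S T f ` carrier (Gm_lft S T f) <= carrier (Gm Te)" using hom hom_in_carrier[OF hom] by blast
 hence "bij_betw (eta_base_change S T f) (carrier (Gm_lft S T f)) (carrier (Gm Te))"
  unfolding bij_betw_def using inj surj by blast
 thus ?thesis using hom unfolding iso_def by blast
qed

end

section \<open>Quasi-coherence of the sheaf of meromorphic functions\<close>

lemma lin_comb_finsum:
 fixes A :: "'r ring" and M :: "('r, 'm) module"
 assumes m: "module A M" and K: "finite K" "K <= G" "!!e. e : G - K ==> c e = 0[A]"
  and c: "!!e. e : G ==> c e : carrier A" and v: "!!e. e : G ==> v e : carrier M"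
 shows "lin_comb A M G v c = (\<Oplus>\<^bsub>M\<^esub>e\<in>K. c e .[M] v e)"
proof -
 interpret module A M by(rule m)
 show ?thesis unfolding lin_comb_def
  by(rule M.add.finprod_mono_neutral_cong_left[OF K(1)]) (use K c v in auto)
qed

lemma lin_comb_single:
 fixes A :: "'r ring" and M :: "('r, 'm) module"
 assumes m: "module A M" and "e : G" "u : carrier A" "!!e. e : G ==> v e : carrier M"
 shows "lin_comb A M G v (\<lambda>e'\<in>G. if e' = e then u else 0[A]) = u .[M] v e"
proof -
 interpret module A M by(rule m)
 have "lin_comb A M G v (\<lambda>e'\<in>G. if e' = e then u else 0[A]) = (\<Oplus>\<^bsub>M\<^esub>e'\<in>{e}. (\<lambda>e'\<in>G. if e' = e then u else 0[A]) e' .[M] v e')"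
  by(rule lin_comb_finsum[OF m]) (use assms in auto)
 thus ?thesis using assms M.finsum_insert[of "{}" e "%e'. (\<lambda>e'\<in>G. if e' = e then u else 0[A]) e' .[M] v e'"] by simp
qed

lemma fin_coeffs_single:
 assumes "u : carrier A" "0[A] : carrier A" shows "(\<lambda>e'\<in>G. if e' = e then u else 0[A]) : fin_coeffs A G"
proof -
 have "finite {e' : G. (\<lambda>e'\<in>G. if e' = e then u else 0[A]) e' ~= 0[A]}" by(rule finite_subset[of _ "{e}"]) auto
 thus ?thesis unfolding fin_coeffs_def using assms by auto
qed

lemma (in module) finsum_relations:
 assumes D: "finite D" and K: "finite K" and d: "!!r. r : D ==> d r : carrier R" and r: "!!r e. r : D ==> e : K ==> r' r e : carrier R"
  and v: "!!e. e : K ==> v e : carrier M" and z: "!!r. r : D ==> (\<Oplus>\<^bsub>M\<^esub>e\<in>K. r' r e .[M] v e) = 0[M]"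
 shows "(\<Oplus>\<^bsub>M\<^esub>e\<in>K. (\<Oplus>r\<in>D. d r *[R] r' r e) .[M] v e) = 0[M]"
 using D d r z
proof (induction D)
 case empty
 have "(\<Oplus>\<^bsub>M\<^esub>e\<in>K. (\<Oplus>r\<in>{}. d r *[R] r' r e) .[M] v e) = (\<Oplus>\<^bsub>M\<^esub>e\<in>K. 0[M])"
  by(rule M.finsum_cong') (use v in auto)
 thus ?case by simp
next
 case (insert x D)
 have c: "(\<Oplus>r\<in>D. d r *[R] r' r e) : carrier R" if "e : K" for e by(rule R.finsum_closed) (use insert.prems that in auto)
 have "(\<Oplus>\<^bsub>M\<^esub>e\<in>K. (\<Oplus>r\<in>insert x D. d r *[R] r' r e) .[M] v e)
  = (\<Oplus>\<^bsub>M\<^esub>e\<in>K. d x .[M] (r' x e .[M] v e) +[M] (\<Oplus>r\<in>D. d r *[R] r' r e) .[M] v e)"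
 proof (rule M.finsum_cong')
  fix e assume e: "e : K"
  have "(\<Oplus>r\<in>insert x D. d r *[R] r' r e) = d x *[R] r' x e +[R] (\<Oplus>r\<in>D. d r *[R] r' r e)"
   by(rule R.finsum_insert) (use insert e in auto)
  thus "(\<Oplus>r\<in>insert x D. d r *[R] r' r e) .[M] v e = d x .[M] (r' x e .[M] v e) +[M] (\<Oplus>r\<in>D. d r *[R] r' r e) .[M] v e"
   using c[OF e] v[OF e] insert.prems e by(simp add: smult_l_distr smult_assoc1)
 qed (use c v insert.prems in auto)
 also have "... = (\<Oplus>\<^bsub>M\<^esub>e\<in>K. d x .[M] (r' x e .[M] v e)) +[M] (\<Oplus>\<^bsub>M\<^esub>e\<in>K. (\<Oplus>r\<in>D. d r *[R] r' r e) .[M] v e)"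
  by(rule M.finsum_addf) (use c v insert.prems in auto)
 also have "(\<Oplus>\<^bsub>M\<^esub>e\<in>K. d x .[M] (r' x e .[M] v e)) = d x .[M] (\<Oplus>\<^bsub>M\<^esub>e\<in>K. r' x e .[M] v e)"
  by(rule finsum_smult_ldistr[symmetric, OF K]) (use v insert.prems in auto)
 also have "... = 0[M]" using insert.prems by(simp add: smult_r_null)
 also have "(\<Oplus>\<^bsub>M\<^esub>e\<in>K. (\<Oplus>r\<in>D. d r *[R] r' r e) .[M] v e) = 0[M]" using insert by simp
 finally show ?case by simp
qed

section \<open>Linear combinations of meromorphic sections\<close>

context ringed
begin

lemma merom_module: assumes x: "x : points X" shows "module X@@x (merom_module X x)"
proof -
 interpret M: cring "MS X x" by(rule cring_merom[OF x])
 have "(alg_module (merom_of X x) (MS X x))(|carrier := carrier (MS X x)|) = merom_module X x"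
  unfolding merom_module_def alg_module_def by simp
 thus ?thesis using alg_module_module[OF stalk_cring[OF x] cring_merom[OF x] merom_of_hom[OF x] M.oneideal] by simp
qed

lemma lsec_merom_comb:
 assumes m: "lsec (merom X) x m" and r: "lsec X x r" and n: "lsec (merom X) x n"
 shows "lsec (merom X) x (%y. r y .[merom_module X y] m y +[merom_module X y] n y)"
proof -
 obtain a b where ab: "lsec X x a" "regs X x b" "evn X x (%y. m y = mq X y a b)" by(rule lsec_meromE[OF m])
 obtain c d where cd: "lsec X x c" "regs X x d" "evn X x (%y. n y = mq X y c d)" by(rule lsec_meromE[OF n])
 have "evn X x (%y. r y .[merom_module X y] m y +[merom_module X y] n y =
   mfrac X y (r y *[X@@y] a y *[X@@y] d y +[X@@y] c y *[X@@y] b y) (b y *[X@@y] d y))"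
  using ab(3) cd(3) lsec_near[OF ab(1)] lsec_near[OF cd(1)] lsec_near[OF r] regs_near[OF ab(2)] regs_near[OF cd(2)]
 proof eventually_elim
  case (elim y)
  note y = lsec_points[OF elim(3)]
  interpret localized "X@@y" "RS X y" by(rule reg_localized[OF y])
  note c = elim(3-5)[THEN lsec_carrier] and s = elim(6,7)[THEN regs_RS]
  have "r y .[merom_module X y] m y = mfrac X y (r y *[X@@y] a y) (b y)"
   using merom_of_mult[OF y c(3,1) s(1)] elim(1) unfolding merom_module_def by simp
  thus ?case using add_fr[OF _ s(1) c(2) s(2), of "r y *[X@@y] a y"] c elim(2) unfolding merom_module_def merom_stalk_def by simp
 qed
 thus ?thesis by(rule lsec_meromI[OF lsec_add[OF lsec_mult[OF lsec_mult[OF r ab(1)] regs_lsec[OF cd(2)]] lsec_mult[OF cd(1) regs_lsec[OF ab(2)]]] regs_mult[OF ab(2) cd(2)]])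
qed

lemma merom_zero: "x : points X ==> b : RS X x ==> 0[merom_module X x] = mfrac X x 0[X@@x] b"
 using localized.zero_fr[OF reg_localized] mfrac_eq_iff[of x "0[X@@x]" "1[X@@x]" "0[X@@x]" b] RS_one[of x] RS_carrier[of x b] stalk_cring[of x]
 unfolding merom_module_def merom_stalk_def by(simp add: cring.cring_simprules)

lemma lsec_merom_sum:
 assumes x: "x : points X" and K: "finite K" and m: "!!e. e : K ==> lsec (merom X) x (m e)" and r: "!!e. e : K ==> lsec X x (r e)"
 shows "lsec (merom X) x (%y. \<Oplus>\<^bsub>merom_module X y\<^esub>e\<in>K. r e y .[merom_module X y] m e y)"
 using K m r
proof (induction K)
 case empty
 have "evn X x (%y. (\<Oplus>\<^bsub>merom_module X y\<^esub>e\<in>{}. r e y .[merom_module X y] m e y) = mfrac X y 0[X@@y] 1[X@@y])"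
  using near_points
 proof eventually_elim
  case (elim y)
  interpret module "X@@y" "merom_module X y" by(rule merom_module[OF elim])
  show ?case using merom_zero[OF elim RS_one[OF elim]] by simp
 qed
 thus ?case by(rule lsec_meromI[OF lsec_zero[OF x] regs_one[OF x]])
next
 case (insert e K)
 have l: "lsec (merom X) x (%y. r e y .[merom_module X y] m e y +[merom_module X y] (\<Oplus>\<^bsub>merom_module X y\<^esub>e\<in>K. r e y .[merom_module X y] m e y))"
  by(rule lsec_merom_comb) (use insert in simp_all)
 have "evn X x (%y. lsec (merom X) y (m e') & lsec X y (r e'))" if "e' : insert e K" for e'
  by(rule eventually_conj[OF lsec_near[OF insert.prems(1)[OF that], unfolded merom_simps] lsec_near[OF insert.prems(2)[OF that]]])
 hence "evn X x (%y. ALL e':insert e K. lsec (merom X) y (m e') & lsec X y (r e'))"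
  by(intro eventually_ball_finite ballI) (use insert.hyps(1) in simp_all)
 hence ev: "evn X x (%y. r e y .[merom_module X y] m e y +[merom_module X y] (\<Oplus>\<^bsub>merom_module X y\<^esub>e\<in>K. r e y .[merom_module X y] m e y)
  = (\<Oplus>\<^bsub>merom_module X y\<^esub>e\<in>insert e K. r e y .[merom_module X y] m e y))"
 proof eventually_elim
  case (elim y)
  have y: "y : points X" by(rule lsec_points[OF conjunct2[OF bspec[OF elim insertI1]]])
  interpret module "X@@y" "merom_module X y" by(rule merom_module[OF y])
  have c: "r e' y .[merom_module X y] m e' y : carrier (merom_module X y)" if "e' : insert e K" for e'
  proof (rule smult_closed)
   show "r e' y : carrier X@@y" by(rule lsec_carrier) (use bspec[OF elim that] in blast)
   show "m e' y : carrier (merom_module X y)"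
    using sheaf.lsec_carrier[OF merom_sheaf conjunct1[OF bspec[OF elim that]]] unfolding merom_module_def by simp
  qed
  show ?case by(rule M.finsum_insert[symmetric, OF insert.hyps(1,2)]) (use c in blast)+
 qed
 show ?case by(rule sheaf.lsec_cong[OF merom_sheaf l]) (use ev in \<open>simp only: merom_simps\<close>)
qed

end

section \<open>A presentation of the sheaf on a small affine neighbourhood\<close>

locale small_chart = weak_ass_scheme S + C: affine_chart S R V rh for S :: "('a, 'r) ringed_space" and R :: "'c ring" and V rh +
 fixes W
 assumes W: "opn S W" "W <= V" "finite (W Int Max_points S)"
begin

abbreviation "MM y == merom_module S y"

lemma W_points: "y : W ==> y : points S" using openin_subset[OF W(1)] by blast

lemma MM_carrier [simp]: "carrier (MM y) = carrier (M y)" unfolding merom_module_def by simp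

lemma regs_on_W:
 assumes b: "b : carrier R" "!!i. i : W Int Max_points S ==> rh i b : Units (A i)" and z: "z : W"
 shows "regs S z (%y. rh y b)"
proof (rule C.regs_criterion[OF WA _ C.rh_lsec[OF b(1)]])
 show "evn S z (%y. y : Max_points S --> rh y b : Units (A y))" using near_open[OF W(1) z] by eventually_elim (use b(2) in blast)
qed (use z W(2) in auto)

text \<open>Multiplication by \<open>h\<close> is harmless at \<open>y\<close> and erases whatever
  happens at the generic points of \<open>W\<close> that do not specialize to \<open>y\<close>. This
  is how statements near \<open>y\<close> are spread over all of \<open>W\<close>.\<close>

lemma cut:
 assumes y: "y : W"
 obtains h where "h : carrier R" "rh y h : Units (A y)" "ALL i:W Int Max_points S. ~ C.pr i <= C.pr y --> rh i h = 0[A i]"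
proof -
 define F where "F = {i : W Int Max_points S. ~ C.pr i <= C.pr y}"
 have F: "finite F" "F <= V Int Max_points S" "y : V" "!!i. i : F ==> ~ C.pr i <= C.pr y"
  using finite_subset[OF _ W(3), of F] W(2) y unfolding F_def by auto
 obtain h where "h : carrier R" "rh y h : Units (A y)" "ALL i:F. rh i h = 0[A i]" using C.unit_vanishing_at[OF F] by blast
 thus thesis using that unfolding F_def by blast
qed

text \<open>The numerator of a local fraction vanishes at all generic points specializing to
  \<open>z\<close> and is therefore zero at \<open>z\<close>.\<close>

lemma merom_zero_on_W:
 assumes z: "z : W" and s: "lsec (merom S) z si" and van: "!!i. i : W Int Max_points S ==> si i = 0[MM i]"
 shows "si z = 0[MM z]"
proof -
 have zV: "z : V" using z W(2) by blast
 obtain a b where ab: "lsec S z a" "regs S z b" "evn S z (%y. si y = mq S y a b)" by(rule lsec_meromE[OF s])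
 have ev: "evn S z (%y. si y = mq S y a b & lsec S y a & regs S y b & y : W)"
  by(intro eventually_conj ab(3) lsec_near[OF ab(1)] regs_near[OF ab(2)] near_open[OF W(1) z])
 have "a z = 0[A z]"
 proof (rule C.lsec_eq_zero[OF WA zV ab(1)])
  fix i assume i: "i : V" "C.pr i <= C.pr z" "i : Max_points S"
  have e: "si i = mq S i a b" "lsec S i a" "regs S i b" "i : W" using C.near_generization[OF ev zV i(1,2)] by auto
  interpret cring "A i" by(rule stalk_cring[OF W_points[OF e(4)]])
  note bi = regs_RS[OF e(3)]
  have "mq S i a b = mfrac S i 0[A i] (b i)" using van e i(3) merom_zero[OF W_points[OF e(4)] bi] by simp
  hence "a i *[A i] b i = 0[A i] *[A i] b i"
   using mfrac_eq_iff[OF W_points[OF e(4)] lsec_carrier[OF e(2)] bi zero_closed bi] by blast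
  thus "a i = 0[A i]"
   by(intro nzd_cancel[OF is_cring regs_nzd[OF e(3)] lsec_carrier[OF e(2)] zero_closed])
    (simp add: m_comm lsec_carrier[OF e(2)] regs_carrier[OF e(3)])
 qed
 thus ?thesis using near_self[OF ab(3) W_points[OF z]] merom_zero[OF W_points[OF z] regs_RS[OF ab(2)]] by simp
qed

text \<open>A fraction near \<open>y\<close> is the germ of one on all of \<open>W\<close>: multiply numerator and denominator by
  \<open>h\<close>, which kills the generic points not specializing to \<open>y\<close>, and add to the denominator an
  element that is invertible precisely there.\<close>

lemma merom_germ_global:
 assumes y: "y : W" and m: "m : carrier (M y)"
 shows "EX e:sections (merom S) W. e y = m"
proof -
 have yV: "y : V" and yS: "y : points S" using y W(2) W_points by auto
 interpret a: cring "A y" by(rule stalk_cring[OF yS])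
 obtain a b where ab: "lsec S y a" "regs S y b" "m = mq S y a b" by(rule merom_carrierE[OF yS m])
 obtain a1 s where a1: "a1 : carrier R" "s : carrier R" "rh y s : Units (A y)" "rh y s *[A y] a y = rh y a1"
  using C.frac[OF yV lsec_carrier[OF ab(1)]] by blast
 obtain b1 t where b1: "b1 : carrier R" "t : carrier R" "rh y t : Units (A y)" "rh y t *[A y] b y = rh y b1"
  using C.frac[OF yV regs_carrier[OF ab(2)]] by blast
 define b0 where "b0 = s *[R] b1"
 define a0 where "a0 = t *[R] a1"
 have R0: "b0 : carrier R" "a0 : carrier R" unfolding a0_def b0_def using a1 b1 by simp_all
 have st: "rh y s *[A y] rh y t : Units (A y)" using a1(3) b1(3) by simp
 have stb: "lsec S y (%z. rh z s *[A z] rh z t)" by(rule lsec_mult[OF C.rh_lsec[OF a1(2) yV] C.rh_lsec[OF b1(2) yV]])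
 have e0: "rh y b0 = rh y s *[A y] rh y t *[A y] b y" "rh y a0 = rh y s *[A y] rh y t *[A y] a y"
  unfolding a0_def b0_def C.rh_mult[OF yV a1(2) b1(1)] C.rh_mult[OF yV b1(2) a1(1)] a1(4)[symmetric] b1(4)[symmetric]
  using C.rh_closed[OF yV a1(2)] C.rh_closed[OF yV b1(2)] lsec_carrier[OF ab(1)] regs_carrier[OF ab(2)] by(simp_all add: a.m_ac)
 have rb0: "regs S y (%z. rh z b0)"
  by(rule regs_cong[OF regs_mult[OF regs_unit[OF stb st] ab(2)]])
   (rule lsec_eq[OF lsec_mult[OF stb regs_lsec[OF ab(2)]] C.rh_lsec[OF R0(1) yV] e0(1)[symmetric]])
 obtain h where h: "h : carrier R" "rh y h : Units (A y)" "ALL i:W Int Max_points S. ~ C.pr i <= C.pr y --> rh i h = 0[A i]" by(rule cut[OF y])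
 define F where "F = {i : W Int Max_points S. C.pr i <= C.pr y}"
 define F' where "F' = {i : W Int Max_points S. ~ C.pr i <= C.pr y}"
 have FF: "finite F" "F <= V Int Max_points S" "finite F'" "F' <= V Int Max_points S" "F Int F' = {}"
  using finite_subset[OF _ W(3), of F] finite_subset[OF _ W(3), of F'] W(2) unfolding F_def F'_def by auto
 obtain k where k: "k : carrier R" "!!i. i : F ==> rh i k = 0[A i]" "!!i. i : F' ==> rh i k : Units (A i)"
  by(rule C.separate_Max_points[OF FF]) blast
 \<comment> \<open>At generic points specializing to \<open>y\<close> the summand \<open>k\<close>
   vanishes and \<open>h b0\<close> is a unit; at the others \<open>h\<close> vanishes and
   \<open>k\<close> is a unit. So the denominator is a unit at all generic points of
   \<open>W\<close>, hence regular on \<open>W\<close>.\<close>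
 let ?b = "h *[R] b0 +[R] k" and ?a = "h *[R] a0"
 have bR: "?b : carrier R" "?a : carrier R" using h k R0 by simp_all
 have rho_b: "rh i ?b = rh i h *[A i] rh i b0 +[A i] rh i k" if "i : V" for i
  using that h k R0 C.rh_add C.rh_mult by simp
 have unit: "rh i ?b : Units (A i)" if i: "i : W Int Max_points S" for i
 proof -
  have iV: "i : V" using i W(2) by blast
  interpret ai: cring "A i" by(rule C.stalk_V[OF iV])
  show ?thesis
  proof (cases "C.pr i <= C.pr y")
   case True
   have "rh i h : Units (A i)" by(rule C.near_generization[OF C.unit_near[OF yV h(1,2)] yV iV True])
   moreover have "regs S i (%z. rh z b0)" by(rule C.near_generization[OF regs_near[OF rb0] yV iV True])
   hence "rh i b0 : Units (A i)" using Max_unit[of i] regs_nzd i by blast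
   ultimately show ?thesis unfolding rho_b[OF iV] using k(2)[of i] i True C.rh_closed[OF iV h(1)] C.rh_closed[OF iV R0(1)] unfolding F_def by simp
  next
   case False
   hence "rh i h = 0[A i]" "rh i k : Units (A i)" using h(3) i k(3) unfolding F'_def by auto
   thus ?thesis unfolding rho_b[OF iV] using C.rh_closed[OF iV R0(1)] ai.Units_closed[of "rh i k"] by simp
  qed
 qed
 \<comment> \<open>Vanishing at the generic points specializing to \<open>y\<close> implies
   vanishing at \<open>y\<close>, so adding \<open>k\<close> leaves the germ of the denominator at
   \<open>y\<close> unchanged.\<close>
 have k0: "rh y k = 0[A y]"
 proof (rule C.lsec_eq_zero[OF WA yV C.rh_lsec[OF k(1) yV]])
  fix i assume i: "i : V" "C.pr i <= C.pr y" "i : Max_points S"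
  have "i : W" by(rule C.near_generization[OF near_open[OF W(1) y] yV i(1,2)])
  thus "rh i k = 0[A i]" using i k(2) unfolding F_def by blast
 qed
 have zV: "z : V" if "z : W" for z using that W(2) by blast
 have "(\<lambda>z\<in>W. mfrac S z (rh z ?a) (rh z ?b)) : sections (merom S) W"
  by(rule mfrac_sections[OF W(1) C.rh_lsec[OF bR(2) zV] regs_on_W[OF bR(1) unit]])
 moreover have "mfrac S y (rh y ?a) (rh y ?b) = m"
 proof -
  have e: "rh y ?a = rh y h *[A y] rh y a0" "rh y ?b = rh y h *[A y] rh y b0"
   using C.rh_mult[OF yV h(1) R0(2)] rho_b[OF yV] k0 C.rh_closed[OF yV h(1)] C.rh_closed[OF yV R0(1)] by simp_all
  show ?thesis unfolding ab(3)
   by(rule mfrac_eq_iff[OF yS C.rh_closed[OF yV bR(2)] regs_RS[OF regs_on_W[OF bR(1) unit y]] lsec_carrier[OF ab(1)] regs_RS[OF ab(2)], THEN iffD2])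
    (use C.rh_closed[OF yV h(1)] C.rh_closed[OF yV a1(2)] C.rh_closed[OF yV b1(2)] lsec_carrier[OF ab(1)] regs_carrier[OF ab(2)] in \<open>simp_all add: e e0 a.m_ac\<close>)
 qed
 ultimately show ?thesis using y by(intro bexI[of _ "\<lambda>z\<in>W. mfrac S z (rh z ?a) (rh z ?b)"]) simp_all
qed

lemma common_denominator:
 assumes y: "y : V" and K: "finite K" "!!e. e : K ==> c e : carrier (A y)"
 shows "EX s:carrier R. rh y s : Units (A y) & (EX a. ALL e:K. a e : carrier R & rh y s *[A y] c e = rh y (a e))"
 using K
proof (induction K)
 case empty
 interpret cring "A y" by(rule C.stalk_V[OF y])
 show ?case using C.rh_one[OF y] by(intro bexI[of _ "1[R]"]) simp_all
next
 case (insert e K)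
 interpret cring "A y" by(rule C.stalk_V[OF y])
 obtain s a where s: "s : carrier R" "rh y s : Units (A y)" "!!e. e : K ==> a e : carrier R & rh y s *[A y] c e = rh y (a e)"
  using insert by(metis insertI2)
 obtain b t where t: "b : carrier R" "t : carrier R" "rh y t : Units (A y)" "rh y t *[A y] c e = rh y b"
  using C.frac[OF y insert.prems[of e]] by blast
 let ?a = "%x. if x = e then s *[R] b else t *[R] a x"
 have "?a x : carrier R & rh y (s *[R] t) *[A y] c x = rh y (?a x)" if x: "x : insert e K" for x
 proof -
  note m = C.rh_mult[OF y] C.rh_closed[OF y s(1)] C.rh_closed[OF y t(2)] insert.prems[OF x]
  show ?thesis
  proof (cases "x = e")
   case True
   thus ?thesis using s(1) t m by(simp add: t(4)[symmetric] m_assoc)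
  next
   case False
   hence "a x : carrier R" "rh y (a x) = rh y s *[A y] c x" using s(3) x by auto
   thus ?thesis using False s(1) t(2) m by(simp add: m_ac)
  qed
 qed
 moreover have "rh y (s *[R] t) : Units (A y)" using C.unit_mult_iff[OF y s(1) t(2)] s(2) t(3) by blast
 ultimately show ?case using s(1) t(2) by(intro bexI[of _ "s *[R] t"] conjI exI[of _ ?a] ballI) (blast, blast, blast, simp)
qed

abbreviation (input) "G == sections (merom S) W"
abbreviation (input) "z0 == \<lambda>z\<in>W. 0[A z]"

text \<open>All relations with finite support valid over the whole of \<open>W\<close> are taken, so
  that generation amounts to lifting a relation at a single point.\<close>

definition rel where
 "rel = {r : (\<Pi>\<^sub>E e\<in>G. sections S W). finite {e : G. r e ~= z0} & (ALL y:W. lin_comb (A y) (MM y) G (%e. e y) (%e. r e y) = 0[MM y])}"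

lemma MM: "y : W ==> module (A y) (MM y)"
 by(rule merom_module[OF W_points])

lemma G_lsec: "e : G ==> y : W ==> lsec (merom S) y e"
 by(rule sheaf.sections_lsec[OF merom_sheaf]) (simp_all add: W(1))

lemma G_carrier: "e : G ==> y : W ==> e y : carrier (MM y)"
 using sheaf.lsec_carrier[OF merom_sheaf G_lsec] by simp

lemma relD:
 assumes r: "r : rel"
 shows "finite {e : G. r e ~= z0}" "!!e y. e : G ==> y : W ==> r e y : carrier (A y)"
  "!!y. y : W ==> lin_comb (A y) (MM y) G (%e. e y) (%e. r e y) = 0[MM y]" "!!e. e : G ==> r e : sections S W"
proof -
 show 1: "r e : sections S W" if "e : G" for e using r that unfolding rel_def by blast
 show "r e y : carrier (A y)" if "e : G" "y : W" for e y by(rule lsec_carrier[OF sections_lsec[OF W(1) 1[OF that(1)] that(2)]])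
qed (use r in \<open>auto simp: rel_def\<close>)

text \<open>\<open>s\<close> clears the denominators of the finitely many coefficients, and
  \<open>h\<close> kills the combination at generic points not specializing to \<open>y\<close>. At
  the other generic points of \<open>W\<close> the relation holds because it holds near
  \<open>y\<close>; vanishing at all of them gives a relation over \<open>W\<close>.\<close>

lemma relation_lift:
 assumes y: "y : W" and c: "c : fin_coeffs (A y) G" and z: "lin_comb (A y) (MM y) G (%e. e y) c = 0[MM y]"
 shows "EX r:rel. EX u:Units (A y). ALL e:G. c e = u *[A y] r e y"
proof -
 have yV: "y : V" using y W(2) by blast
 interpret a: cring "A y" by(rule C.stalk_V[OF yV])
 interpret m: module "A y" "MM y" by(rule MM[OF y])
 define K where "K = {e : G. c e ~= 0[A y]}"
 have K: "finite K" "K <= G" and cc: "c e : carrier (A y)" if "e : G" for e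
  using c that unfolding fin_coeffs_def K_def by auto
 have K: "finite K" "K <= G" using c unfolding fin_coeffs_def K_def by auto
 obtain s a where s: "s : carrier R" "rh y s : Units (A y)" and a: "!!e. e : K ==> a e : carrier R" "!!e. e : K ==> rh y s *[A y] c e = rh y (a e)"
  using common_denominator[OF yV K(1), of c] cc K(2) by blast
 obtain h where h: "h : carrier R" "rh y h : Units (A y)" "ALL i:W Int Max_points S. ~ C.pr i <= C.pr y --> rh i h = 0[A i]" by(rule cut[OF y])
 let ?si = "%z. \<Oplus>\<^bsub>MM z\<^esub>e\<in>K. rh z (a e) .[MM z] e z" and ?ta = "%z. \<Oplus>\<^bsub>MM z\<^esub>e\<in>K. rh z (h *[R] a e) .[MM z] e z"
 have zV: "z : V" if "z : W" for z using that W(2) by blast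
 have ha: "h *[R] a e : carrier R" if "e : K" for e using h(1) a(1)[OF that] by simp
 have lK: "lsec (merom S) z e" if "z : W" "e : K" for z e by(rule G_lsec[OF _ that(1)]) (use that(2) K(2) in blast)
 have ec: "e z : carrier (MM z)" if "z : W" "e : K" for z e by(rule G_carrier[OF _ that(1)]) (use that(2) K(2) in blast)
 have si: "lsec (merom S) y ?si"
  by(rule lsec_merom_sum[OF W_points[OF y] K(1), where m = "%e. e"]) (rule lK[OF y], assumption, rule C.rh_lsec[OF a(1) yV])
 have ta: "lsec (merom S) z ?ta" if z: "z : W" for z
  by(rule lsec_merom_sum[OF W_points[OF z] K(1), where m = "%e. e"]) (rule lK[OF z], assumption, rule C.rh_lsec[OF ha zV[OF z]])
 have tasi: "?ta z = rh z h .[MM z] ?si z" if z: "z : W" for z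
 proof -
  interpret mz: module "A z" "MM z" by(rule MM[OF z])
  have ac: "rh z (a e) .[MM z] e z : carrier (MM z)" if "e : K" for e by(rule mz.smult_closed[OF C.rh_closed[OF zV[OF z] a(1)[OF that]] ec[OF z that]])
  have "?ta z = (\<Oplus>\<^bsub>MM z\<^esub>e\<in>K. rh z h .[MM z] (rh z (a e) .[MM z] e z))"
  proof (rule mz.M.finsum_cong')
   show "(%e. rh z h .[MM z] (rh z (a e) .[MM z] e z)) : K \<rightarrow> carrier (MM z)" by(rule Pi_I, rule mz.smult_closed[OF C.rh_closed[OF zV[OF z] h(1)] ac])
   show "rh z (h *[R] a e) .[MM z] e z = rh z h .[MM z] (rh z (a e) .[MM z] e z)" if "e : K" for e
    unfolding C.rh_mult[OF zV[OF z] h(1) a(1)[OF that]] by(rule mz.smult_assoc1[OF C.rh_closed[OF zV[OF z] h(1)] C.rh_closed[OF zV[OF z] a(1)[OF that]] ec[OF z that]])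
  qed simp
  also have "... = rh z h .[MM z] ?si z" by(rule mz.finsum_smult_ldistr[symmetric, OF K(1) C.rh_closed[OF zV[OF z] h(1)]]) (use ac in blast)
  finally show ?thesis .
 qed
 have cec: "c e .[MM y] e y : carrier (MM y)" if "e : K" for e
  by(rule m.smult_closed[OF cc ec[OF y that]]) (use K(2) that in blast)
 have "?si y = (\<Oplus>\<^bsub>MM y\<^esub>e\<in>K. rh y s .[MM y] (c e .[MM y] e y))"
 proof (rule m.M.finsum_cong')
  show "(%e. rh y s .[MM y] (c e .[MM y] e y)) : K \<rightarrow> carrier (MM y)"
   by(rule Pi_I, rule m.smult_closed[OF C.rh_closed[OF yV s(1)] cec])
  show "rh y (a e) .[MM y] e y = rh y s .[MM y] (c e .[MM y] e y)" if "e : K" for e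
   unfolding a(2)[OF that, symmetric] by(rule m.smult_assoc1[OF C.rh_closed[OF yV s(1)] _ ec[OF y that]]) (use cc K(2) that in blast)
 qed simp
 also have "... = rh y s .[MM y] (\<Oplus>\<^bsub>MM y\<^esub>e\<in>K. c e .[MM y] e y)"
  by(rule m.finsum_smult_ldistr[symmetric, OF K(1) C.rh_closed[OF yV s(1)]]) (rule Pi_I, rule cec)
 also have "(\<Oplus>\<^bsub>MM y\<^esub>e\<in>K. c e .[MM y] e y) = 0[MM y]" using z unfolding lin_comb_def K_def .
 also have "rh y s .[MM y] 0[MM y] = 0[MM y]" by(rule m.smult_r_null[OF C.rh_closed[OF yV s(1)]])
 finally have siy: "?si y = 0[MM y]" .
 let ?n = "%z. \<Oplus>\<^bsub>MM z\<^esub>e\<in>{}. rh z (a e) .[MM z] e z"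
 have n: "lsec (merom S) y ?n" by(rule lsec_merom_sum[OF W_points[OF y] finite.emptyI, where m = "%e. e"]) simp_all
 have "evn S y (%z. ?si z = ?n z)" by(rule merom_near_eq[OF si n]) (use siy in simp)
 hence near0: "evn S y (%z. ?si z = 0[MM z])" using near_open[OF W(1) y]
 proof eventually_elim
  case (elim z)
  interpret mz: module "A z" "MM z" by(rule MM[OF elim(2)])
  show ?case using elim(1) by simp
 qed
 have ta0: "?ta z = 0[MM z]" if z: "z : W" for z
 proof (rule merom_zero_on_W[OF z ta[OF z]])
  fix i assume i: "i : W Int Max_points S"
  hence iW: "i : W" by blast
  interpret mi: module "A i" "MM i" by(rule MM[OF iW])
  have sic: "?si i : carrier (MM i)" by(rule mi.M.finsum_closed, rule Pi_I, rule mi.smult_closed[OF C.rh_closed[OF zV[OF iW] a(1)] ec[OF iW]])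
  show "?ta i = 0[MM i]"
  proof (cases "C.pr i <= C.pr y")
   case True
   have "?si i = 0[MM i]" by(rule C.near_generization[OF near0 yV zV[OF iW] True])
   thus ?thesis unfolding tasi[OF iW] using mi.smult_r_null[OF C.rh_closed[OF zV[OF iW] h(1)]] by simp
  next
   case False
   hence "rh i h = 0[A i]" using h(3) i by blast
   thus ?thesis unfolding tasi[OF iW] using mi.smult_l_null[OF sic] by simp
  qed
 qed
 \<comment> \<open>Off the support of \<open>c\<close> the coefficient is the zero section itself,
   which keeps the support of the lifted relation finite.\<close>
 define r where "r = (\<lambda>e\<in>G. if e : K then (\<lambda>z\<in>W. rh z (h *[R] a e)) else z0)"
 have rK: "r e z = rh z (h *[R] a e)" if "e : K" "z : W" for e z using that K(2) unfolding r_def by auto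
 have r0: "r e = z0" if "e : G" "e ~: K" for e using that unfolding r_def by simp
 have rc: "r e z : carrier (A z)" if "e : G" "z : W" for e z
  using rK[of e z] r0[OF that(1)] C.rh_closed[OF zV[OF that(2)] ha, of e] that cring.cring_simprules(2)[OF stalk_cring[OF W_points[OF that(2)]]] by(cases "e : K") auto
 have "r : rel" unfolding rel_def
 proof (intro CollectI conjI ballI)
  have "r e : sections S W" if "e : G" for e
  proof (cases "e : K")
   case True
   have "r e = (\<lambda>z\<in>W. rh z (h *[R] a e))" using True that unfolding r_def by simp
   thus ?thesis using restrict_sections[OF W(1) C.rh_lsec[OF ha[OF True] zV]] by simp
  next
   case False
   thus ?thesis unfolding r0[OF that False] using restrict_sections[OF W(1) lsec_zero[OF W_points]] by simp
  qed
  thus "r : (\<Pi>\<^sub>E e\<in>G. sections S W)" unfolding r_def by auto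
  show "finite {e : G. r e ~= z0}" by(rule finite_subset[OF _ K(1)]) (use r0 in blast)
  fix z assume z: "z : W"
  interpret mz: module "A z" "MM z" by(rule MM[OF z])
  have "lin_comb (A z) (MM z) G (%e. e z) (%e. r e z) = (\<Oplus>\<^bsub>MM z\<^esub>e\<in>K. r e z .[MM z] e z)"
   by(rule lin_comb_finsum[OF MM[OF z] K]) (use r0 z rc G_carrier in auto)
  also have "... = ?ta z" by(rule mz.M.finsum_cong') (use rK z ec mz.smult_closed[OF C.rh_closed[OF zV[OF z] ha] ec[OF z]] in auto)
  finally show "lin_comb (A z) (MM z) G (%e. e z) (%e. r e z) = 0[MM z]" using ta0[OF z] by simp
 qed
 moreover have hs: "rh y h *[A y] rh y s : Units (A y)" using h(2) s(2) by simp
 have "c e = inv[A y] (rh y h *[A y] rh y s) *[A y] r e y" if e: "e : G" for e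
 proof (cases "e : K")
  case True
  have "r e y = rh y h *[A y] rh y s *[A y] c e"
   using rK[OF True y] C.rh_mult[OF yV h(1) a(1)[OF True]] a(2)[OF True] C.rh_closed[OF yV h(1)] C.rh_closed[OF yV s(1)] cc[OF e] by(simp add: a.m_assoc)
  thus ?thesis using hs cc[OF e] a.Units_closed[OF hs] by(simp add: a.m_assoc[symmetric])
 next
  case False
  thus ?thesis using e r0[OF e False] y hs unfolding K_def by simp
 qed
 ultimately show ?thesis using a.Units_inv_Units[OF hs] by blast
qed

text \<open>For the forward direction one lifted relation with a unit coefficient is enough; the
  converse is linearity of the combination in its coefficients.\<close>

lemma relations_generate:
 assumes y: "y : W" and c: "c : fin_coeffs (A y) G"
 shows "lin_comb (A y) (MM y) G (%e. e y) c = 0[MM y] <->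
  (EX d:fin_coeffs (A y) rel. ALL e:G. c e = (\<Oplus>\<^bsub>A y\<^esub>r\<in>{r : rel. d r ~= 0[A y]}. d r *[A y] r e y))"
proof
 interpret m: module "A y" "MM y" by(rule MM[OF y])
 {
  assume "lin_comb (A y) (MM y) G (%e. e y) c = 0[MM y]"
  then obtain r u where r: "r : rel" "u : Units (A y)" "ALL e:G. c e = u *[A y] r e y" using relation_lift[OF y c] by blast
  \<comment> \<open>That \<open>u\<close> is nonzero makes the support of \<open>?d\<close> exactly
    the singleton of \<open>r\<close>.\<close>
  have u: "u : carrier (A y)" "u ~= 0[A y]"
   by(rule m.R.Units_closed[OF r(2)], metis m.R.Units_r_inv m.R.Units_inv_closed m.R.l_null r(2) local_ringD(2)[OF local[OF W_points[OF y]]])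
  let ?d = "\<lambda>r'\<in>rel. if r' = r then u else 0[A y]"
  have D: "{r' : rel. ?d r' ~= 0[A y]} = {r}" using r(1) u(2) by auto
  have "c e = (\<Oplus>\<^bsub>A y\<^esub>r\<in>{r}. ?d r *[A y] r e y)" if e: "e : G" for e
   using r e u(1) relD(2)[OF r(1) e y] m.R.finsum_insert[of "{}" r "%r. ?d r *[A y] r e y"] by simp
  thus "EX d:fin_coeffs (A y) rel. ALL e:G. c e = (\<Oplus>\<^bsub>A y\<^esub>r\<in>{r : rel. d r ~= 0[A y]}. d r *[A y] r e y)"
   unfolding D[symmetric] by(intro bexI[OF _ fin_coeffs_single[OF u(1) m.R.zero_closed]] ballI)
 next
  assume "EX d:fin_coeffs (A y) rel. ALL e:G. c e = (\<Oplus>\<^bsub>A y\<^esub>r\<in>{r : rel. d r ~= 0[A y]}. d r *[A y] r e y)"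
  then obtain d where d: "d : fin_coeffs (A y) rel" "ALL e:G. c e = (\<Oplus>\<^bsub>A y\<^esub>r\<in>{r : rel. d r ~= 0[A y]}. d r *[A y] r e y)" by blast
  define D where "D = {r : rel. d r ~= 0[A y]}"
  define K where "K = {e : G. c e ~= 0[A y]} Un (\<Union>r\<in>D. {e : G. r e ~= z0})"
  have D: "finite D" "D <= rel" "!!r. r : D ==> d r : carrier (A y)" using d(1) unfolding fin_coeffs_def D_def by auto
  have K: "finite K" "K <= G" unfolding K_def using c D(1,2) relD(1) unfolding fin_coeffs_def by auto
  have cc: "c e : carrier (A y)" if "e : G" for e using c that unfolding fin_coeffs_def by auto
  have rc: "r e y : carrier (A y)" if "r : D" "e : G" for r e using relD(2)[of r e y] D(2) that y by blast
  have "lin_comb (A y) (MM y) G (%e. e y) c = (\<Oplus>\<^bsub>MM y\<^esub>e\<in>K. c e .[MM y] e y)"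
   by(rule lin_comb_finsum[OF MM[OF y] K]) (use cc y G_carrier in \<open>auto simp: K_def\<close>)
  also have "... = (\<Oplus>\<^bsub>MM y\<^esub>e\<in>K. (\<Oplus>\<^bsub>A y\<^esub>r\<in>D. d r *[A y] r e y) .[MM y] e y)"
   by(rule m.M.finsum_cong', rule refl, rule Pi_I, rule m.smult_closed, rule m.R.finsum_closed)
    (use D rc K(2) G_carrier y d(2) in \<open>auto simp: D_def\<close>)
  also have "... = 0[MM y]"
  proof (rule m.finsum_relations[OF D(1) K(1) D(3)])
   fix r assume r: "r : D"
   hence rr: "r : rel" using D(2) by blast
   have "lin_comb (A y) (MM y) G (%e. e y) (%e. r e y) = (\<Oplus>\<^bsub>MM y\<^esub>e\<in>K. r e y .[MM y] e y)"
   proof (rule lin_comb_finsum[OF MM[OF y] K])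
    fix e assume "e : G - K"
    hence "r e = z0" using r unfolding K_def by blast
    thus "r e y = 0[A y]" using y by simp
   qed (use rc r G_carrier y in auto)
   thus "(\<Oplus>\<^bsub>MM y\<^esub>e\<in>K. r e y .[MM y] e y) = 0[MM y]" using relD(3)[OF rr y] by simp
  qed (use rc K(2) G_carrier y in blast)+
  finally show "lin_comb (A y) (MM y) G (%e. e y) c = 0[MM y]" .
 }
qed

end

theorem (in weak_ass_scheme) quasi_coherent_merom: "quasi_coherent S (merom_module S) (sections (merom S))"
 unfolding quasi_coherent_def
proof (intro conjI ballI merom_module)
 show "sheaf_on (spc S) (%x. carrier (merom_module S x)) (sections (merom S))"
  using merom_sheaf unfolding sheaf_def merom_module_def by simp
 fix x assume x: "x : points S"
 obtain V and R :: "('a => 'r) ring" and rh where V: "x : V" "affine_chart S R V rh" using chart[OF x] by blast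
 interpret C: affine_chart S R V rh by(rule V(2))
 obtain W where W0: "opn S W" "x : W" "W <= V" "finite (W Int Max_points S)" "ALL z:W. True"
  using lf eventually_True V(1) by(rule C.locally_finite_Max)
 interpret small_chart S R V rh W by(unfold_locales) (fact W0)+
 show "EX U G R. opn S U & x : U & G <= sections (merom S) U &
    (ALL r:R. r : (\<Pi>\<^sub>E e\<in>G. sections S U) &
     (ALL y:U. EX V. opn S V & y : V & V <= U & finite {e : G. EX z:V. r e z ~= 0[A z]})) &
    (ALL y:U. (ALL m:carrier (merom_module S y). EX c:fin_coeffs (A y) G. lin_comb (A y) (merom_module S y) G (%e. e y) c = m) &
     (ALL c:fin_coeffs (A y) G. lin_comb (A y) (merom_module S y) G (%e. e y) c = 0[merom_module S y] <->
       (EX d:fin_coeffs (A y) R. ALL e:G. c e = (\<Oplus>\<^bsub>A y\<^esub>r\<in>{r : R. d r ~= 0[A y]}. d r *[A y] r e y))))"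
 proof (rule exI[of _ W], rule exI[of _ "sections (merom S) W"], rule exI[of _ rel], intro conjI ballI W0(1,2) relations_generate)
  fix r assume r: "r : rel"
  thus "r : (\<Pi>\<^sub>E e\<in>sections (merom S) W. sections S W)" unfolding rel_def by blast
  fix y assume y: "y : W"
  have "{e : sections (merom S) W. EX z:W. r e z ~= 0[A z]} <= {e : sections (merom S) W. r e ~= (\<lambda>z\<in>W. 0[A z])}" by auto
  hence "finite {e : sections (merom S) W. EX z:W. r e z ~= 0[A z]}" by(rule finite_subset[OF _ relD(1)[OF r]])
  thus "EX V. opn S V & y : V & V <= W & finite {e : sections (merom S) W. EX z:V. r e z ~= 0[A z]}"
   using W(1) y by(intro exI[of _ W]) simp
 next
  fix y m assume y: "y : W" and m: "m : carrier (merom_module S y)"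
  interpret m: module "A y" "merom_module S y" by(rule MM[OF y])
  obtain e where e: "e : sections (merom S) W" "e y = m" using merom_germ_global[OF y] m by auto
  have l: "lin_comb (A y) (merom_module S y) (sections (merom S) W) (%e. e y) (\<lambda>e'\<in>sections (merom S) W. if e' = e then 1[A y] else 0[A y])
    = 1[A y] .[MM y] e y"
   by(rule lin_comb_single[OF MM[OF y] e(1) m.R.one_closed]) (rule G_carrier[OF _ y])
  show "EX c:fin_coeffs (A y) (sections (merom S) W). lin_comb (A y) (merom_module S y) (sections (merom S) W) (%e. e y) c = m"
   by(rule bexI[OF _ fin_coeffs_single[OF m.R.one_closed m.R.zero_closed]])
    (use l m.smult_one[OF m] e(2) in simp)
 qed simp_all
qed

theorem mainTheorem5:
  fixes S :: "('a, 'r) ringed_space"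
  assumes "scheme S"
    and "WeakAss S = Max_points S"
    and "locally_finite_subset (spc S) (Max_points S)"
  shows "quasi_coherent S (merom_module S) (sections (merom S)) \<and>
    (\<forall>(X :: ('b, 'k) ringed_space) g. scheme X \<and> lrs_hom X (eta S) g \<longrightarrow>
       Gm_lft_compare (eta S) (eta_proj S) X g
         \<in> iso (Gm_lft S X (mor_comp X S (eta_proj S) g)) (Gm_lft (eta S) X g) \<and>
       Gm_incl (eta S) X g \<in> iso (Gm X) (Gm_lft (eta S) X g) \<and>
       (\<forall>(X' :: ('c, 'l) ringed_space) h. scheme X' \<and> lrs_hom X' X h \<longrightarrow>
          (\<forall>u \<in> carrier (Gm_lft S X (mor_comp X S (eta_proj S) g)).
             Gm_lft_compare (eta S) (eta_proj S) X' (mor_comp X' (eta S) g h) (Gm_lft_pull S X' h u)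
               = Gm_lft_pull (eta S) X' h (Gm_lft_compare (eta S) (eta_proj S) X g u)) \<and>
          (\<forall>u \<in> carrier (Gm X).
             Gm_incl (eta S) X' (mor_comp X' (eta S) g h) (Gm_pull X' h u)
               = Gm_lft_pull (eta S) X' h (Gm_incl (eta S) X g u)))) \<and>
    (\<forall>(T :: ('d, 'm) ringed_space) f.
       scheme T \<and> lrs_hom T S f \<and> flat_morphism T S f \<and> convex_morphism T S f \<longrightarrow>
       eta_base_change S T f
         \<in> iso (Gm_lft S T f) (Gm (fibre_product T (eta S) S f (eta_proj S))))"
proof -
 have S: "ringed S" using assms(1) unfolding scheme_def locally_ringed_def by(blast intro: ringedI)
 interpret weak_ass_scheme S
  by(intro weak_ass_scheme.intro weak_ass_scheme_axioms.intro S assms)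
 have ringed_scheme: "ringed X" if "scheme X" for X :: "('x, 'y) ringed_space"
  using that unfolding scheme_def locally_ringed_def by(blast intro: ringedI)
 show ?thesis
 proof (intro conjI allI impI ballI quasi_coherent_merom; (elim conjE)?)
  fix X :: "('b, 'k) ringed_space" and g
  assume X: "scheme X" and g: "lrs_hom X E g"
  interpret eta_point S X g
   by(intro eta_point.intro eta_point_axioms.intro weak_ass_scheme_axioms ringed_scheme X g)
  show "Gm_lft_compare E p X g : iso (Gm_lft S X (mor_comp X S p g)) (Gm_lft E X g)" by(rule compare_iso)
  show "Gm_incl E X g : iso (Gm X) (Gm_lft E X g)" by(rule H.Gm_incl_iso[OF H_triv])
  fix X' :: "('c, 'l) ringed_space" and h
  assume X': "scheme X'" and h: "lrs_hom X' X h"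
  show "Gm_lft_compare E p X' (mor_comp X' E g h) (Gm_lft_pull S X' h u) = Gm_lft_pull E X' h (Gm_lft_compare E p X g u)"
   if "u : carrier (Gm_lft S X (mor_comp X S p g))" for u
   by(rule compare_pull[OF ringed_scheme[OF X'] h that])
  show "Gm_incl E X' (mor_comp X' E g h) (Gm_pull X' h u) = Gm_lft_pull E X' h (Gm_incl E X g u)"
   if "u : carrier (Gm X)" for u
   by(rule incl_pull[OF ringed_scheme[OF X'] h that])
 next
  fix T :: "('d, 'm) ringed_space" and f
  assume T: "scheme T" and f: "lrs_hom T S f" and fl: "flat_morphism T S f" and cv: "convex_morphism T S f"
  interpret eta_convex S T f
   by(intro eta_convex.intro eta_convex_axioms.intro eta_fibre.intro eta_fibre_axioms.intro gm.intro gm_axioms.intro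
     weak_ass_scheme_axioms S ringed_scheme T f fl cv)
  show "eta_base_change S T f : iso (Gm_lft S T f) (Gm (fibre_product T E S f p))" by(rule eta_base_change_iso)
 qed
qed

end
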